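(* For each $i=1,2$, let $X_i$ be a (possibly closed) $4$-manifold, let $L_i$ be an $S^2$-link in $S^4$, and let $Z_i$ be a connected summand or a codimension-$0$ submanifold of $S^4(L_i)$. Suppose $H_2(Z_1)=H_2(Z_2)=0$. Then the following hold. (1) The genus functions of $X_1\# Z_1$ and $X_2\# Z_2$ are algebraically equivalent if and only if those of $X_1$ and $X_2$ are algebraically equivalent. (2) In the case where each $\partial X_i$ and $\partial Z_i$ are non-empty, the genus functions of the boundary sums $X_1\natural Z_1$ and $X_2\natural Z_2$ are algebraically equivalent if and only if those of $X_1$ and $X_2$ are algebraically equivalent.
   Context: Conventions: all manifolds, submanifolds and boundaries are compact, connected, oriented and smooth; homology has integer coefficients. An $S^2$-link in $S^4$ is a smooth submanifold of $S^4$ each of whose connected components is a $2$-sphere (the empty set is allowed). $S^4(L)$ denotes the closed $4$-manifold obtained from $S^4$ by surgery on $L$: for each component of $L$, remove the interior of its tubular neighborhood $S^2\times D^2$ and glue in $S^1\times D^3$ along the resulting boundary. The genus function of a $4$-manifold $X$ is the map $g_X:H_2(X)\to\mathbb{Z}$ sending $\alpha$ to the minimum genus of a smoothly embedded closed connected oriented surface in $X$ representing $\alpha$. The genus functions of $X$ and $Y$ are algebraically equivalent if there is an isomorphism $H_2(X)\to H_2(Y)$ preserving the genus functions and the intersection forms. *)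

theory Defs
  imports "HOL-Analysis.Analysis" "HOL-Homology.Homology"
begin

section \<open>Smooth maps between subsets of Euclidean spaces\<close>

text \<open>Manifolds are subsets of Euclidean spaces of arbitrary dimension (the convention of Milnor
  and of Guillemin and Pollack). Every compact smooth manifold with boundary is diffeomorphic to
  one of these, by Whitney's embedding theorem.\<close>

primrec Ck_on :: "nat \<Rightarrow> ('a::euclidean_space \<Rightarrow> 'b::euclidean_space) \<Rightarrow> 'a set \<Rightarrow> bool" where
  "Ck_on 0 f U \<longleftrightarrow> continuous_on U f"
| "Ck_on (Suc k) f U \<longleftrightarrow>
     f differentiable_on U \<and> (\<forall>v. Ck_on k (\<lambda>x. frechet_derivative f (at x) v) U)"

definition smooth_map :: "'a::euclidean_space set \<Rightarrow> ('a \<Rightarrow> 'b::euclidean_space) \<Rightarrow> bool" where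
  "smooth_map S f \<longleftrightarrow>
     (\<forall>x\<in>S. \<exists>U F. open U \<and> x \<in> U \<and> (\<forall>k. Ck_on k F U) \<and> (\<forall>y\<in>U \<inter> S. F y = f y))"

definition diffeo ::
    "'a::euclidean_space set \<Rightarrow> 'b::euclidean_space set \<Rightarrow> ('a \<Rightarrow> 'b) \<Rightarrow> bool" where
  "diffeo S T f \<longleftrightarrow> inj_on f S \<and> f ` S = T \<and> smooth_map S f \<and> smooth_map T (inv_into S f)"


section \<open>Manifolds with boundary\<close>

definition half_space :: "(real, 'n::{finite,one}) vec set" where
  "half_space = {x. 0 \<le> x $ 1}"

definition smooth_chart ::
    "'a::euclidean_space set \<Rightarrow> (real, 'n::{finite,one}) vec set \<Rightarrow> ((real, 'n) vec \<Rightarrow> 'a) \<Rightarrow> bool" where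
  "smooth_chart M V \<phi> \<longleftrightarrow>
     (open V \<or> openin (top_of_set half_space) V) \<and>
     openin (top_of_set M) (\<phi> ` V) \<and> diffeo V (\<phi> ` V) \<phi>"

definition smooth_manifold :: "'n::{finite,one} itself \<Rightarrow> 'a::euclidean_space set \<Rightarrow> bool" where
  "smooth_manifold _ M \<longleftrightarrow>
     (\<forall>p\<in>M. \<exists>V (\<phi> :: (real, 'n) vec \<Rightarrow> 'a). smooth_chart M V \<phi> \<and> p \<in> \<phi> ` V)"

definition mfd_boundary :: "'n::{finite,one} itself \<Rightarrow> 'a::euclidean_space set \<Rightarrow> 'a set" where
  "mfd_boundary _ M =
     {p\<in>M. \<not> (\<exists>V (\<phi> :: (real, 'n) vec \<Rightarrow> 'a). open V \<and> smooth_chart M V \<phi> \<and> p \<in> \<phi> ` V)}"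


section \<open>Oriented manifolds\<close>

text \<open>An ordered basis of the tangent space at a point is encoded as the injective linear map
  \<^term>\<open>A :: (real, 'n) vec \<Rightarrow> 'a\<close> that sends the standard basis to it; \<open>frames M p\<close> is the set of the
  positively oriented ones.\<close>

record ('a, 'n) omanifold =
  pts :: "'a set"
  frames :: "'a \<Rightarrow> ((real, 'n) vec \<Rightarrow> 'a) set"

text \<open>The requirement on \<^term>\<open>frames M\<close> says that the chart preserves orientation and also that the
  frames at a point form exactly one orientation class. Charts on pieces of the half-space
  can be made orientation preserving only in dimension at least 2; dimensions 2 and 4 are used.\<close>

definition oriented_chart ::
    "('a::euclidean_space, 'n::{finite,one}) omanifold \<Rightarrow> (real, 'n) vec set \<Rightarrow> ((real, 'n) vec \<Rightarrow> 'a) \<Rightarrow> bool"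
  where
  "oriented_chart M V \<phi> \<longleftrightarrow> smooth_chart (pts M) V \<phi> \<and>
     (\<forall>y\<in>V. \<exists>D. (\<phi> has_derivative D) (at y within V) \<and>
        frames M (\<phi> y) = {D \<circ> (\<lambda>v. B *v v) |B. 0 < det B})"

definition oriented_manifold :: "('a::euclidean_space, 'n::{finite,one}) omanifold \<Rightarrow> bool" where
  "oriented_manifold M \<longleftrightarrow> (\<forall>p\<in>pts M. \<exists>V \<phi>. oriented_chart M V \<phi> \<and> p \<in> \<phi> ` V)"

definition bdry :: "('a::euclidean_space, 'n::{finite,one}) omanifold \<Rightarrow> 'a set" where
  "bdry M = mfd_boundary TYPE('n) (pts M)"

definition opposite ::
    "('a::euclidean_space, 'n::{finite,one}) omanifold \<Rightarrow> ('a, 'n) omanifold" where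
  "opposite M = M\<lparr>frames := \<lambda>p. {A \<circ> (\<lambda>v. B *v v) |A B. A \<in> frames M p \<and> det B < 0}\<rparr>"

definition delete ::
    "('a, 'n) omanifold \<Rightarrow> 'a set \<Rightarrow> ('a, 'n) omanifold" where
  "delete M T = M\<lparr>pts := pts M - T\<rparr>"

text \<open>Smooth orientation preserving embeddings of codimension 0.\<close>

definition oriented_embedding ::
    "('a::euclidean_space, 'n::{finite,one}) omanifold \<Rightarrow> ('b::euclidean_space, 'n) omanifold
      \<Rightarrow> ('a \<Rightarrow> 'b) \<Rightarrow> bool" where
  "oriented_embedding M W f \<longleftrightarrow>
     f ` pts M \<subseteq> pts W \<and> diffeo (pts M) (f ` pts M) f \<and>
     (\<forall>V \<phi>. oriented_chart M V \<phi> \<longrightarrow>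
        (\<forall>y\<in>V. \<exists>D. ((f \<circ> \<phi>) has_derivative D) (at y within V) \<and> D \<in> frames W (f (\<phi> y))))"

definition open_oriented_embedding ::
    "('a::euclidean_space, 'n::{finite,one}) omanifold \<Rightarrow> ('b::euclidean_space, 'n) omanifold
      \<Rightarrow> ('a \<Rightarrow> 'b) \<Rightarrow> bool" where
  "open_oriented_embedding M W f \<longleftrightarrow>
     oriented_embedding M W f \<and> openin (top_of_set (pts W)) (f ` pts M)"

text \<open>A 4-manifold in the sense of the standing conventions: compact, connected and oriented, with
  connected (possibly empty) boundary.\<close>

definition four_manifold :: "('a::euclidean_space, 4) omanifold \<Rightarrow> bool" where
  "four_manifold X \<longleftrightarrow>
     oriented_manifold X \<and> compact (pts X) \<and> connected (pts X) \<and> pts X \<noteq> {} \<and> connected (bdry X)"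

definition closed_surface :: "('a::euclidean_space, 2) omanifold \<Rightarrow> bool" where
  "closed_surface F \<longleftrightarrow>
     oriented_manifold F \<and> compact (pts F) \<and> connected (pts F) \<and> pts F \<noteq> {} \<and> bdry F = {}"


section \<open>Connected sums and boundary sums\<close>

text \<open>Sums are determined up to orientation preserving diffeomorphism, so they are described by a
  relation: \<open>W\<close> is a sum of \<open>X\<close> and \<open>Z\<close>. This is the smooth gluing of Kervaire and Milnor, which needs
  no corners: take disc embeddings \<open>i\<close> into \<open>X\<close>, preserving orientation, and \<open>j\<close> into \<open>Z\<close>, reversing
  it, remove the centres, and identify \<open>i (t u)\<close> with \<open>j ((1 - t) u)\<close> for unit vectors \<open>u\<close> and
  \<open>0 < t < 1\<close>. For \<open>H = UNIV\<close> the discs lie in the interior and the result is the connected sum.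
  For \<open>H = half_space\<close> they are half-discs meeting the boundaries in 3-discs, and the
  result is the boundary sum (Kosinski).\<close>

definition disc_sum ::
    "(real^4) set \<Rightarrow> ('a::euclidean_space, 4) omanifold \<Rightarrow> ('b::euclidean_space, 4) omanifold
      \<Rightarrow> ('c::euclidean_space, 4) omanifold \<Rightarrow> bool" where
  "disc_sum H X Z W \<longleftrightarrow> oriented_manifold W \<and>
     (\<exists>U i U' j a b.
        openin (top_of_set H) U \<and> cball 0 1 \<inter> H \<subseteq> U \<and> oriented_chart X U i \<and>
        openin (top_of_set H) U' \<and> cball 0 1 \<inter> H \<subseteq> U' \<and> oriented_chart (opposite Z) U' j \<and>
        open_oriented_embedding (delete X {i 0}) W a \<and>
        open_oriented_embedding (delete Z {j 0}) W b \<and>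
        pts W = a ` (pts X - {i 0}) \<union> b ` (pts Z - {j 0}) \<and>
        (\<forall>x \<in> pts X - {i 0}. \<forall>z \<in> pts Z - {j 0}.
           a x = b z \<longleftrightarrow>
             (\<exists>u \<in> sphere 0 1 \<inter> H. \<exists>t \<in> {0<..<1}. x = i (t *\<^sub>R u) \<and> z = j ((1 - t) *\<^sub>R u))))"

definition connected_sum ::
    "('a::euclidean_space, 4) omanifold \<Rightarrow> ('b::euclidean_space, 4) omanifold
      \<Rightarrow> ('c::euclidean_space, 4) omanifold \<Rightarrow> bool" where
  "connected_sum X Z W \<longleftrightarrow> disc_sum UNIV X Z W"

definition boundary_sum ::
    "('a::euclidean_space, 4) omanifold \<Rightarrow> ('b::euclidean_space, 4) omanifold
      \<Rightarrow> ('c::euclidean_space, 4) omanifold \<Rightarrow> bool" where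
  "boundary_sum X Z W \<longleftrightarrow> disc_sum half_space X Z W"

text \<open>The complementary summand is taken in \<^typ>\<open>real^9\<close>, where every closed 4-manifold embeds.\<close>

definition connected_summand ::
    "('a::euclidean_space, 4) omanifold \<Rightarrow> ('b::euclidean_space, 4) omanifold \<Rightarrow> bool" where
  "connected_summand Z S \<longleftrightarrow>
     (\<exists>M :: (real^9, 4) omanifold. four_manifold M \<and> connected_sum Z M S)"

definition codim0_submanifold ::
    "('a::euclidean_space, 4) omanifold \<Rightarrow> ('b::euclidean_space, 4) omanifold \<Rightarrow> bool" where
  "codim0_submanifold Z S \<longleftrightarrow> (\<exists>e. oriented_embedding Z S e)"


section \<open>Surgery on sphere links in the 4-sphere\<close>

text \<open>The 4-sphere is oriented by the outward normal first convention.\<close>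

definition sphere4 :: "(real^5, 4) omanifold" where
  "sphere4 = \<lparr>pts = sphere 0 1,
     frames = \<lambda>p. {A. linear A \<and> (\<forall>v. A v \<bullet> p = 0) \<and>
       0 < det (matrix (\<lambda>v :: real^5. v $ 1 *\<^sub>R p + A (vector [v $ 2, v $ 3, v $ 4, v $ 5])))}\<rparr>"

definition S2_link :: "(real^5) set \<Rightarrow> bool" where
  "S2_link L \<longleftrightarrow> L \<subseteq> pts sphere4 \<and> compact L \<and> smooth_manifold TYPE(2) L \<and>
     (\<forall>C \<in> components L. \<exists>f :: real^5 \<Rightarrow> real^3. diffeo C (sphere 0 1) f)"

text \<open>\<open>S\<close> is a result of surgery on \<open>L\<close>. Again the gluing is along open sets (Milnor): with \<open>\<phi> C\<close>
  the tubular neighbourhood of the component \<open>C\<close>, a copy of the open solid \<open>D\<^sup>3 \<times> S\<^sup>1\<close> is glued to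
  the complement of \<open>L\<close> by identifying \<open>\<phi> C (u, t v)\<close> with \<open>(t u, v)\<close> for unit vectors \<open>u\<close>, \<open>v\<close> and
  \<open>0 < t < 1\<close>. The orientation of \<open>S\<close> is the one extending that of the complement of \<open>L\<close>.\<close>

definition surgery :: "(real^5) set \<Rightarrow> ('a::euclidean_space, 4) omanifold \<Rightarrow> bool" where
  "surgery L S \<longleftrightarrow> oriented_manifold S \<and>
     (\<exists>(\<phi> :: (real^5) set \<Rightarrow> (real^3) \<times> (real^2) \<Rightarrow> real^5) a
       (b :: (real^5) set \<Rightarrow> (real^3) \<times> (real^2) \<Rightarrow> 'a).
        (\<forall>C \<in> components L.
           diffeo (sphere 0 1 \<times> cball 0 1) (\<phi> C ` (sphere 0 1 \<times> cball 0 1)) (\<phi> C) \<and>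
           \<phi> C ` (sphere 0 1 \<times> cball 0 1) \<subseteq> pts sphere4 \<and>
           \<phi> C ` (sphere 0 1 \<times> {0}) = C) \<and>
        disjoint_family_on (\<lambda>C. \<phi> C ` (sphere 0 1 \<times> cball 0 1)) (components L) \<and>
        open_oriented_embedding (delete sphere4 L) S a \<and>
        (\<forall>C \<in> components L.
           diffeo (ball 0 1 \<times> sphere 0 1) (b C ` (ball 0 1 \<times> sphere 0 1)) (b C) \<and>
           openin (top_of_set (pts S)) (b C ` (ball 0 1 \<times> sphere 0 1))) \<and>
        disjoint_family_on (\<lambda>C. b C ` (ball 0 1 \<times> sphere 0 1)) (components L) \<and>
        pts S = a ` (pts sphere4 - L) \<union> (\<Union>C \<in> components L. b C ` (ball 0 1 \<times> sphere 0 1)) \<and>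
        (\<forall>C \<in> components L. \<forall>x \<in> pts sphere4 - L. \<forall>y \<in> ball 0 1. \<forall>v \<in> sphere 0 1.
           a x = b C (y, v) \<longleftrightarrow>
             (\<exists>u \<in> sphere 0 1. \<exists>t \<in> {0<..<1}. x = \<phi> C (u, t *\<^sub>R v) \<and> y = t *\<^sub>R u)))"


section \<open>Homology, genus function and intersection form\<close>

abbreviation H2 :: "('a::euclidean_space, 4) omanifold \<Rightarrow> 'a chain set monoid" where
  "H2 X \<equiv> homology_group 2 (top_of_set (pts X))"

text \<open>A singular cycle in \<open>F\<close> represents the fundamental class if at each point \<open>p\<close> it is homologous,
  relative to the complement of \<open>p\<close>, to a positively oriented affine 2-simplex around \<open>p\<close> in an
  oriented chart.\<close>

definition fundamental_cycle :: "('a::euclidean_space, 2) omanifold \<Rightarrow> 'a chain \<Rightarrow> bool" where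
  "fundamental_cycle F z \<longleftrightarrow> singular_relcycle 2 (top_of_set (pts F)) {} z \<and>
     (\<forall>p \<in> pts F. \<exists>V \<phi> a0 a1 a2. oriented_chart F V \<phi> \<and>
        convex hull {a0, a1, a2} \<subseteq> V \<and> p \<in> \<phi> ` interior (convex hull {a0, a1, a2}) \<and>
        0 < det (vector [a1 - a0, a2 - a0]) \<and>
        homologous_rel 2 (top_of_set (pts F)) (pts F - {p}) z
          (frag_of (restrict (\<lambda>x. \<phi> (x 0 *\<^sub>R a0 + x 1 *\<^sub>R a1 + x 2 *\<^sub>R a2)) (standard_simplex 2))))"

definition represents ::
    "('a::euclidean_space, 4) omanifold \<Rightarrow> ('a, 2) omanifold \<Rightarrow> 'a chain set \<Rightarrow> bool" where
  "represents X F \<alpha> \<longleftrightarrow> closed_surface F \<and> pts F \<subseteq> pts X \<and>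
     (\<exists>z. fundamental_cycle F z \<and> \<alpha> = homologous_rel_set 2 (top_of_set (pts X)) {} z)"

definition has_genus :: "('a::euclidean_space, 2) omanifold \<Rightarrow> nat \<Rightarrow> bool" where
  "has_genus F g \<longleftrightarrow> homology_group 1 (top_of_set (pts F)) \<cong> free_Abelian_group {..<2 * g}"

definition genus_function :: "('a::euclidean_space, 4) omanifold \<Rightarrow> 'a chain set \<Rightarrow> nat" where
  "genus_function X \<alpha> = (LEAST g. \<exists>F. represents X F \<alpha> \<and> has_genus F g)"

text \<open>The intersection form counts, with signs, the intersection points of transverse representing
  surfaces. A pair of frames of the two surfaces is juxtaposed to a frame of the 4-manifold.\<close>

definition juxtapose :: "(real^2 \<Rightarrow> 'a::euclidean_space) \<Rightarrow> (real^2 \<Rightarrow> 'a) \<Rightarrow> real^4 \<Rightarrow> 'a" where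
  "juxtapose A B v = A (vector [v $ 1, v $ 2]) + B (vector [v $ 3, v $ 4])"

definition transverse :: "('a::euclidean_space, 2) omanifold \<Rightarrow> ('a, 2) omanifold \<Rightarrow> bool" where
  "transverse F G \<longleftrightarrow>
     (\<forall>p \<in> pts F \<inter> pts G. \<forall>A \<in> frames F p. \<forall>B \<in> frames G p. inj (juxtapose A B))"

definition intersection_sign ::
    "('a::euclidean_space, 4) omanifold \<Rightarrow> ('a, 2) omanifold \<Rightarrow> ('a, 2) omanifold \<Rightarrow> 'a \<Rightarrow> int"
  where
  "intersection_sign X F G p =
     (if \<forall>A \<in> frames F p. \<forall>B \<in> frames G p. juxtapose A B \<in> frames X p then 1 else -1)"

definition intersection_form ::
    "('a::euclidean_space, 4) omanifold \<Rightarrow> 'a chain set \<Rightarrow> 'a chain set \<Rightarrow> int" where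
  "intersection_form X \<alpha> \<beta> =
     (THE n. \<exists>F G. represents X F \<alpha> \<and> represents X G \<beta> \<and> transverse F G \<and>
        n = (\<Sum>p \<in> pts F \<inter> pts G. intersection_sign X F G p))"

text \<open>Algebraic equivalence of the genus functions.\<close>

definition alg_equiv ::
    "('a::euclidean_space, 4) omanifold \<Rightarrow> ('b::euclidean_space, 4) omanifold \<Rightarrow> bool" where
  "alg_equiv X Y \<longleftrightarrow> (\<exists>h \<in> iso (H2 X) (H2 Y).
     (\<forall>\<alpha> \<in> carrier (H2 X). genus_function Y (h \<alpha>) = genus_function X \<alpha>) \<and>
     (\<forall>\<alpha> \<in> carrier (H2 X). \<forall>\<beta> \<in> carrier (H2 X).
        intersection_form Y (h \<alpha>) (h \<beta>) = intersection_form X \<alpha> \<beta>))"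

end

theory Submission
  imports Defs
begin

text \<open>Write \<open>W\<close> for the sum of \<open>X\<close> and \<open>Z\<close>; it suffices to show that \<open>X\<close> and \<open>W\<close> are algebraically
  equivalent. Since \<open>H2 Z = 0\<close>, Mayer-Vietoris shows that the punctured \<open>X\<close> has the second homology of
  both \<open>X\<close> and \<open>W\<close>. It remains to move surfaces, or pairs of surfaces, from \<open>X\<close> to \<open>W\<close> and back by
  orientation preserving embeddings of neighbourhoods that are compatible with this isomorphism.
  From \<open>X\<close> to \<open>W\<close> one pushes them off the centre of the disc. Conversely, the part of the surfaces
  in \<open>Z\<close> can be pushed off the core circles of the surgeries, hence has a neighbourhood in \<open>Z\<close>
  that embeds in \<open>real^4\<close>. Turned inside out, this neighbourhood embeds in the disc of \<open>X\<close>
  compatibly with the neck, so it replaces \<open>Z\<close> by a disc. No transversality or existence of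
  surfaces is needed, as all invariants are carried along by the embeddings.\<close>

text \<open>The neck shapes the proof. \<open>disc_sum\<close> glues along the exact inversion of
  \<open>t\<close> into \<open>1 - t\<close>, whereas an embedding of a piece of \<open>Z\<close>
  into \<open>real^4\<close> has no normal form near \<open>j 0\<close>. To put a disc in place of
  that piece without disturbing anything in \<open>X\<close>, the replacement has to be the standard
  inversion on a whole collar. This is arranged by extending a local inverse of the embedded disc to
  a globally defined diffeomorphism onto its image and following it by a radial map that is the
  standard inversion near 0, so neither uniqueness of disc embeddings nor isotopy extension is
  invoked. Since the complement of a point in \<open>real^4\<close> is connected, the orientation
  behaviour of the resulting map is decided at a single point of the neck.

  Connected sums and boundary sums are treated together, \<open>H\<close> being \<open>UNIV\<close>
  or \<open>half_space\<close>. General position is reached by explicit cut-off translations in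
  three of the four dimensions, parallel to the wall of the half-space or across a surgery tube;
  three dimensions suffice to avoid a set made of planar pieces. A derivative bound of 1/2 on each
  displacement makes the shifts diffeomorphisms.\<close>

section \<open>Calculus of the classes \<open>Ck_on\<close> and of smooth maps on open sets\<close>

lemma Ck_on_SucD:
  assumes "Ck_on (Suc k) f U" "open U" "x \<in> U"
  shows "(f has_derivative frechet_derivative f (at x)) (at x)"
proof -
  have "f differentiable (at x within U)"
    using assms unfolding Ck_on.simps differentiable_on_def by blast
  then show ?thesis
    unfolding at_within_open[OF assms(3,2)] by (simp add: frechet_derivative_works)
qed

lemma Ck_on_cong:
  assumes "open U" "\<And>x. x \<in> U \<Longrightarrow> f x = g x" "Ck_on k f U"
  shows "Ck_on k g U"
  using assms(2,3)
proof (induction k arbitrary: f g)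
  case 0
  then show ?case by (simp cong: continuous_on_cong)
next
  case (Suc k)
  have d: "(g has_derivative frechet_derivative f (at x)) (at x)" if "x \<in> U" for x
  proof (rule has_derivative_transform_within_open[OF _ assms(1) that])
    show "(f has_derivative frechet_derivative f (at x)) (at x)"
      using Suc.prems(2) assms(1) that by (rule Ck_on_SucD)
  qed (use Suc.prems in auto)
  then have "frechet_derivative f (at x) = frechet_derivative g (at x)" if "x \<in> U" for x
    using that frechet_derivative_at by blast
  then have "Ck_on k (\<lambda>x. frechet_derivative g (at x) v) U" for v
    using Suc.IH[of "\<lambda>x. frechet_derivative f (at x) v" "\<lambda>x. frechet_derivative g (at x) v"] Suc.prems by simp
  moreover have "g differentiable_on U"
    using d unfolding differentiable_on_def differentiable_def by (meson has_derivative_at_withinI)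
  ultimately show ?case by simp
qed

text \<open>Since \<open>frechet_derivative\<close> is a choice operator, inductions are easier with
  whatever formula the differentiation rules produce; uniqueness of derivatives on an open set
  converts it.\<close>

lemma Ck_on_SucI':
  assumes "open U" and d: "\<And>x. x \<in> U \<Longrightarrow> (f has_derivative f' x) (at x)"
    and "\<And>v. Ck_on k (\<lambda>x. f' x v) U"
  shows "Ck_on (Suc k) f U"
proof -
  have "f' x = frechet_derivative f (at x)" if "x \<in> U" for x
    using d[OF that] frechet_derivative_at by metis
  then have "Ck_on k (\<lambda>x. frechet_derivative f (at x) v) U" for v
    using Ck_on_cong[OF assms(1) _ assms(3)[of v], of "\<lambda>x. frechet_derivative f (at x) v"] by simp
  moreover have "f differentiable_on U"
    using d unfolding differentiable_on_def differentiable_def by (meson has_derivative_at_withinI)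
  ultimately show ?thesis by simp
qed

lemma Ck_on_continuous: "Ck_on k f U \<Longrightarrow> continuous_on U f"
  by (cases k) (auto intro: differentiable_imp_continuous_on)

lemma Ck_on_Suc_imp: "open U \<Longrightarrow> Ck_on (Suc k) f U \<Longrightarrow> Ck_on k f U"
proof (induction k arbitrary: f)
  case 0
  then show ?case by (auto intro: differentiable_imp_continuous_on)
next
  case (Suc k)
  from Suc.prems have "\<forall>v. Ck_on (Suc k) (\<lambda>x. frechet_derivative f (at x) v) U" "f differentiable_on U"
    unfolding Ck_on.simps(2)[of "Suc k"] by auto
  then show ?case using Suc.IH[OF Suc.prems(1)] unfolding Ck_on.simps(2)[of k f] by blast
qed

lemma Ck_on_subset: "open V \<Longrightarrow> V \<subseteq> U \<Longrightarrow> Ck_on k f U \<Longrightarrow> Ck_on k f V"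
proof (induction k arbitrary: f)
  case 0
  then show ?case using continuous_on_subset by auto
next
  case (Suc k)
  then show ?case using differentiable_on_subset[of f U V] by simp
qed

lemma Ck_on_const: "open U \<Longrightarrow> Ck_on k (\<lambda>x. c) U"
proof (induction k arbitrary: c)
  case (Suc k)
  then show ?case by (intro Ck_on_SucI'[where f' = "\<lambda>x v. 0"]) auto
qed auto

lemma Ck_on_bounded_linear: "open U \<Longrightarrow> bounded_linear f \<Longrightarrow> Ck_on k f U"
proof (cases k)
  case (Suc m)
  assume *: "open U" "bounded_linear f"
  show ?thesis unfolding Suc
    by (rule Ck_on_SucI'[where f' = "\<lambda>x. f"])
      (use * in \<open>auto simp: bounded_linear_imp_has_derivative Ck_on_const\<close>)
qed (simp add: linear_continuous_on)

lemma Ck_on_add: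
  "open U \<Longrightarrow> Ck_on k f U \<Longrightarrow> Ck_on k g U \<Longrightarrow> Ck_on k (\<lambda>x. f x + g x) U"
proof (induction k arbitrary: f g)
  case (Suc k)
  show ?case
  proof (rule Ck_on_SucI'[where f' = "\<lambda>x v. frechet_derivative f (at x) v + frechet_derivative g (at x) v"])
    show "((\<lambda>x. f x + g x) has_derivative
        (\<lambda>v. frechet_derivative f (at x) v + frechet_derivative g (at x) v)) (at x)" if "x \<in> U" for x
      using that Suc.prems by (intro has_derivative_add Ck_on_SucD)
  qed (use Suc in auto)
qed (simp add: continuous_on_add)

lemma Ck_on_sum:
  "open U \<Longrightarrow> (\<And>i. i \<in> I \<Longrightarrow> Ck_on k (f i) U) \<Longrightarrow> Ck_on k (\<lambda>x. \<Sum>i\<in>I. f i x) U"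
  by (induction I rule: infinite_finite_induct) (auto simp: Ck_on_const Ck_on_add)

lemma Ck_on_bilinear:
  assumes "bounded_bilinear h"
  shows "open U \<Longrightarrow> Ck_on k f U \<Longrightarrow> Ck_on k g U \<Longrightarrow> Ck_on k (\<lambda>x. h (f x) (g x)) U"
proof (induction k arbitrary: f g)
  case 0
  then show ?case by (simp add: bounded_bilinear.continuous_on[OF assms])
next
  case (Suc k)
  show ?case
  proof (rule Ck_on_SucI'[where f' = "\<lambda>x v. h (f x) (frechet_derivative g (at x) v) + h (frechet_derivative f (at x) v) (g x)"])
    show "open U" by fact
    show "((\<lambda>x. h (f x) (g x)) has_derivative
         (\<lambda>v. h (f x) (frechet_derivative g (at x) v) + h (frechet_derivative f (at x) v) (g x))) (at x)"
      if "x \<in> U" for x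
      using that Suc.prems by (intro bounded_bilinear.FDERIV[OF assms] Ck_on_SucD)
    have "Ck_on k f U" "Ck_on k g U"
      using Suc.prems Ck_on_Suc_imp by blast+
    then show "Ck_on k (\<lambda>x. h (f x) (frechet_derivative g (at x) v) + h (frechet_derivative f (at x) v) (g x)) U" for v
      using Suc.prems by (intro Ck_on_add Suc.IH) auto
  qed
qed

lemmas Ck_on_scaleR = Ck_on_bilinear[OF bounded_bilinear_scaleR]
lemmas Ck_on_mult = Ck_on_bilinear[OF bounded_bilinear_mult]
lemmas Ck_on_inner = Ck_on_bilinear[OF bounded_bilinear_inner]

lemma Ck_on_compose:
  assumes "open U" "open V"
  shows "Ck_on k f U \<Longrightarrow> Ck_on k g V \<Longrightarrow> f ` U \<subseteq> V \<Longrightarrow> Ck_on k (\<lambda>x. g (f x)) U"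
proof (induction k arbitrary: f g)
  case 0
  then show ?case using continuous_on_compose2[of V g U f] by simp
next
  case (Suc k)
  let ?f' = "\<lambda>x. frechet_derivative f (at x)" and ?g' = "\<lambda>x. frechet_derivative g (at x)"
  show ?case
  proof (rule Ck_on_SucI'[where f' = "\<lambda>x v. ?g' (f x) (?f' x v)"])
    show "open U" by fact
    have df: "(f has_derivative ?f' x) (at x)" if "x \<in> U" for x
      using Suc.prems that assms by (intro Ck_on_SucD)
    have dg: "(g has_derivative ?g' y) (at y)" if "y \<in> V" for y
      using Suc.prems that assms by (intro Ck_on_SucD)
    show "((\<lambda>x. g (f x)) has_derivative (\<lambda>v. ?g' (f x) (?f' x v))) (at x)" if "x \<in> U" for x
      using that Suc.prems(3) by (intro has_derivative_compose[OF df dg]) auto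
    \<comment> \<open>The direction \<open>?f' x v\<close> varies with \<open>x\<close>, whereas the
      induction hypothesis covers derivatives of \<open>g\<close> in fixed directions only.
      Expanding in the basis separates the two dependences.\<close>
    have eq: "(\<Sum>b\<in>Basis. (?f' x v \<bullet> b) *\<^sub>R ?g' (f x) b) = ?g' (f x) (?f' x v)" if "x \<in> U" for x v
    proof -
      have "linear (?g' (f x))"
        using dg[of "f x"] Suc.prems(3) that by (metis has_derivative_linear image_subset_iff)
      then have "?g' (f x) (\<Sum>b\<in>Basis. (?f' x v \<bullet> b) *\<^sub>R b) = (\<Sum>b\<in>Basis. (?f' x v \<bullet> b) *\<^sub>R ?g' (f x) b)"
        by (simp add: linear_sum linear_scale)
      then show ?thesis by (simp only: euclidean_representation)
    qed
    have f: "Ck_on k f U" using Suc.prems assms Ck_on_Suc_imp by blast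
    have "Ck_on k (\<lambda>x. \<Sum>b\<in>Basis. (?f' x v \<bullet> b) *\<^sub>R ?g' (f x) b) U" for v
      using Suc.prems assms f
      by (intro Ck_on_sum Ck_on_scaleR Ck_on_inner Ck_on_const Suc.IH) auto
    then show "Ck_on k (\<lambda>x. ?g' (f x) (?f' x v)) U" for v
      by (rule Ck_on_cong[OF assms(1), rotated]) (rule eq)
  qed
qed

lemma Ck_on_Union:
  assumes "\<And>V. V \<in> \<V> \<Longrightarrow> open V \<and> Ck_on k f V"
  shows "Ck_on k f (\<Union>\<V>)"
  using assms
proof (induction k arbitrary: f)
  case 0
  then show ?case by (auto intro: continuous_on_open_Union)
next
  case (Suc k)
  have "f differentiable_on \<Union>\<V>"
    using Suc.prems by (auto simp: differentiable_on_def)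
      (metis UnionI at_within_open open_Union)
  then show ?case using Suc by auto
qed

text \<open>Openness is built in, so that \<open>frechet_derivative\<close> is the true derivative
  at every point of \<open>U\<close>.\<close>

definition smooth_on :: "'a::euclidean_space set \<Rightarrow> ('a \<Rightarrow> 'b::euclidean_space) \<Rightarrow> bool" where
  "smooth_on U f \<longleftrightarrow> open U \<and> (\<forall>k. Ck_on k f U)"

lemma smooth_on_open: "smooth_on U f \<Longrightarrow> open U"
  by (simp add: smooth_on_def)

lemma smooth_on_has_derivative:
  "smooth_on U f \<Longrightarrow> x \<in> U \<Longrightarrow> (f has_derivative frechet_derivative f (at x)) (at x)"
  using Ck_on_SucD smooth_on_def by blast

lemma smooth_on_continuous_on: "smooth_on U f \<Longrightarrow> continuous_on U f"
  using Ck_on_continuous smooth_on_def by blast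

lemma smooth_on_cong:
  "smooth_on U f \<Longrightarrow> (\<And>x. x \<in> U \<Longrightarrow> f x = g x) \<Longrightarrow> smooth_on U g"
  unfolding smooth_on_def using Ck_on_cong by metis

lemma smooth_on_subset: "smooth_on U f \<Longrightarrow> open V \<Longrightarrow> V \<subseteq> U \<Longrightarrow> smooth_on V f"
  unfolding smooth_on_def using Ck_on_subset by metis

lemma smooth_on_compose:
  "smooth_on V g \<Longrightarrow> smooth_on U f \<Longrightarrow> f ` U \<subseteq> V \<Longrightarrow> smooth_on U (\<lambda>x. g (f x))"
  unfolding smooth_on_def using Ck_on_compose by metis

lemma smooth_on_const [intro]: "open U \<Longrightarrow> smooth_on U (\<lambda>x. c)"
  unfolding smooth_on_def using Ck_on_const by metis

lemma smooth_on_bounded_linear: "open U \<Longrightarrow> bounded_linear f \<Longrightarrow> smooth_on U f"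
  unfolding smooth_on_def using Ck_on_bounded_linear by metis

lemma smooth_on_linear: "open U \<Longrightarrow> linear f \<Longrightarrow> smooth_on U f"
  by (simp add: linear_conv_bounded_linear smooth_on_bounded_linear)

lemma smooth_on_id: "open U \<Longrightarrow> smooth_on U (\<lambda>x. x)"
  by (intro smooth_on_bounded_linear bounded_linear_ident)

lemma smooth_on_add: "smooth_on U f \<Longrightarrow> smooth_on U g \<Longrightarrow> smooth_on U (\<lambda>x. f x + g x)"
  unfolding smooth_on_def using Ck_on_add by metis

lemma smooth_on_sum:
  "open U \<Longrightarrow> (\<And>i. i \<in> I \<Longrightarrow> smooth_on U (f i)) \<Longrightarrow> smooth_on U (\<lambda>x. \<Sum>i\<in>I. f i x)"
  unfolding smooth_on_def using Ck_on_sum by metis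

lemma smooth_on_scaleR: "smooth_on U f \<Longrightarrow> smooth_on U g \<Longrightarrow> smooth_on U (\<lambda>x. f x *\<^sub>R g x)"
  unfolding smooth_on_def using Ck_on_scaleR by metis

lemma smooth_on_mult:
  fixes f g :: "'a::euclidean_space \<Rightarrow> real"
  shows "smooth_on U f \<Longrightarrow> smooth_on U g \<Longrightarrow> smooth_on U (\<lambda>x. f x * g x)"
  unfolding smooth_on_def using Ck_on_mult by metis

lemma smooth_on_inner: "smooth_on U f \<Longrightarrow> smooth_on U g \<Longrightarrow> smooth_on U (\<lambda>x. f x \<bullet> g x)"
  unfolding smooth_on_def using Ck_on_inner by metis

lemma smooth_on_minus: "smooth_on U f \<Longrightarrow> smooth_on U (\<lambda>x. - f x)"
  using smooth_on_scaleR[OF smooth_on_const[of U "-1"], of f] smooth_on_open[of U f] by simp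

lemma smooth_on_diff: "smooth_on U f \<Longrightarrow> smooth_on U g \<Longrightarrow> smooth_on U (\<lambda>x. f x - g x)"
  using smooth_on_add[of U f "\<lambda>x. - g x"] smooth_on_minus[of U g] by simp

lemma smooth_on_prod:
  fixes f :: "'i \<Rightarrow> 'a::euclidean_space \<Rightarrow> real"
  shows "open U \<Longrightarrow> (\<And>i. i \<in> I \<Longrightarrow> smooth_on U (f i)) \<Longrightarrow> smooth_on U (\<lambda>x. \<Prod>i\<in>I. f i x)"
  by (induction I rule: infinite_finite_induct) (auto intro: smooth_on_mult)

lemma smooth_on_linear_compose:
  "linear L \<Longrightarrow> smooth_on U f \<Longrightarrow> smooth_on U (\<lambda>x. L (f x))"
  by (rule smooth_on_compose[OF smooth_on_linear[of UNIV]]) auto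

lemma smooth_on_basis:
  fixes f :: "'a::euclidean_space \<Rightarrow> 'b::euclidean_space"
  assumes "open U" "\<And>b. b \<in> Basis \<Longrightarrow> smooth_on U (\<lambda>x. f x \<bullet> b)"
  shows "smooth_on U f"
proof -
  have "smooth_on U (\<lambda>x. \<Sum>b\<in>Basis. (f x \<bullet> b) *\<^sub>R b)"
    using assms by (intro smooth_on_sum smooth_on_scaleR) auto
  then show ?thesis by (simp add: euclidean_representation)
qed

lemma smooth_on_vec:
  fixes f :: "'a::euclidean_space \<Rightarrow> real^'n"
  assumes "open U" "\<And>i. smooth_on U (\<lambda>x. f x $ i)"
  shows "smooth_on U f"
  by (rule smooth_on_basis[OF assms(1)]) (use assms(2) in \<open>auto simp: Basis_vec_def inner_axis\<close>)

lemma smooth_on_Pair: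
  assumes "smooth_on U f" "smooth_on U g"
  shows "smooth_on U (\<lambda>x. (f x, g x))"
proof -
  have l1: "linear (\<lambda>y. (y, 0))" and l2: "linear (\<lambda>y. (0, y))" by (auto intro!: linearI)
  have "smooth_on U (\<lambda>x. (f x, 0) + (0, g x))"
    by (rule smooth_on_add[OF smooth_on_linear_compose[OF l1 assms(1)] smooth_on_linear_compose[OF l2 assms(2)]])
  then show ?thesis by simp
qed

lemma smooth_on_local:
  assumes "\<And>x. x \<in> U \<Longrightarrow> \<exists>V. x \<in> V \<and> V \<subseteq> U \<and> smooth_on V f"
  shows "smooth_on U f"
proof -
  define \<V> where "\<V> = {V. V \<subseteq> U \<and> smooth_on V f}"
  have "U = \<Union>\<V>" using assms by (auto simp: \<V>_def)
  moreover have "smooth_on (\<Union>\<V>) f"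
    using Ck_on_Union[of \<V> _ f] by (auto simp: \<V>_def smooth_on_def)
  ultimately show ?thesis by simp
qed

text \<open>The derivative in direction \<open>v\<close> is \<open>- v\<close> times the square of
  the function itself, so the induction on the order feeds on its own hypothesis.\<close>

lemma smooth_on_inverse: "smooth_on (- {0}) (inverse :: real \<Rightarrow> real)"
proof -
  have "Ck_on k (inverse :: real \<Rightarrow> real) (- {0})" for k
  proof (induction k)
    case 0
    then show ?case by (auto intro!: continuous_intros)
  next
    case (Suc k)
    show ?case
    proof (rule Ck_on_SucI'[where f' = "\<lambda>x v. - (inverse x * v * inverse x)"])
      show "((inverse :: real \<Rightarrow> real) has_derivative (\<lambda>v. - (inverse x * v * inverse x))) (at x)"
        if "x \<in> - {0}" for x :: real
        using that has_derivative_inverse'[of x UNIV] by auto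
      have "Ck_on k (\<lambda>x. (-v) * (inverse x * inverse x)) (-{0::real})" for v :: real
        by (intro Ck_on_mult Suc Ck_on_const) auto
      then show "Ck_on k (\<lambda>x. - (inverse x * v * inverse x)) (- {0::real})" for v :: real
        by (simp add: mult.assoc mult.left_commute[of _ v])
    qed auto
  qed
  then show ?thesis by (simp add: smooth_on_def open_Compl)
qed

lemma smooth_on_real_sqrt: "smooth_on {0<..} sqrt"
proof -
  have "Ck_on k sqrt {0<..}" for k
  proof (induction k)
    case 0
    then show ?case by (auto intro!: continuous_intros)
  next
    case (Suc k)
    show ?case
    proof (rule Ck_on_SucI'[where f' = "\<lambda>x v. v * (inverse (sqrt x) * (1/2))"])
      show "(sqrt has_derivative (\<lambda>v. v * (inverse (sqrt x) * (1/2)))) (at x)" if "x \<in> {0<..}" for x :: real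
      proof (rule has_derivative_eq_rhs)
        show "(sqrt has_derivative (*) (inverse (sqrt x) / 2)) (at x)"
          using DERIV_real_sqrt[of x] that by (simp add: has_field_derivative_def)
      qed (auto simp: fun_eq_iff)
      show "Ck_on k (\<lambda>x. v * (inverse (sqrt x) * (1/2))) {0<..}" for v
        using smooth_on_inverse by (intro Ck_on_mult Ck_on_const Ck_on_compose[OF _ _ Suc])
          (auto simp: smooth_on_def)
    qed auto
  qed
  then show ?thesis by (simp add: smooth_on_def)
qed

lemma smooth_on_norm: "smooth_on (-{0}) (norm :: 'a::euclidean_space \<Rightarrow> real)"
proof -
  have "smooth_on (-{0::'a}) (\<lambda>x. sqrt (x \<bullet> x))"
    by (intro smooth_on_compose[OF smooth_on_real_sqrt] smooth_on_inner smooth_on_id) auto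
  then show ?thesis by (simp add: norm_eq_sqrt_inner[abs_def])
qed

lemma smooth_on_divide:
  fixes f g :: "'a::euclidean_space \<Rightarrow> real"
  assumes "smooth_on U f" "smooth_on U g" "\<And>x. x \<in> U \<Longrightarrow> g x \<noteq> 0"
  shows "smooth_on U (\<lambda>x. f x / g x)"
proof -
  have "g ` U \<subseteq> - {0}" using assms(3) by auto
  then show ?thesis
    using smooth_on_mult[OF assms(1) smooth_on_compose[OF smooth_on_inverse assms(2)]]
    by (simp add: divide_inverse)
qed

lemma smooth_on_det:
  fixes A :: "'a::euclidean_space \<Rightarrow> real^'n^'n"
  assumes "open U" "\<And>i j. smooth_on U (\<lambda>x. A x $ i $ j)"
  shows "smooth_on U (\<lambda>x. det (A x))"
  unfolding det_def using assms
  by (intro smooth_on_sum smooth_on_mult smooth_on_prod) auto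

text \<open>Cramer's rule writes the solution as a quotient of determinants of smooth
  entries.\<close>

lemma smooth_on_inv_mult:
  fixes A :: "'a::euclidean_space \<Rightarrow> real^'n^'n"
  assumes "open U" "\<And>i j. smooth_on U (\<lambda>x. A x $ i $ j)" "\<And>x. x \<in> U \<Longrightarrow> det (A x) \<noteq> 0"
    "\<And>x. x \<in> U \<Longrightarrow> A x *v y x = v"
  shows "smooth_on U y"
proof -
  have "y x = (\<chi> k. det (\<chi> i j. if j = k then v $ i else A x $ i $ j) / det (A x))" if "x \<in> U" for x
    using cramer[OF assms(3)[OF that]] assms(4)[OF that] by blast
  moreover have "smooth_on U (\<lambda>x. (\<chi> k. det (\<chi> i j. if j = k then v $ i else A x $ i $ j) / det (A x)))"
  proof (rule smooth_on_vec[OF assms(1)])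
    fix k
    have "smooth_on U (\<lambda>x. det (\<chi> i j. if j = k then v $ i else A x $ i $ j) / det (A x))"
    proof (intro smooth_on_divide smooth_on_det assms)
      fix i j show "smooth_on U (\<lambda>x. (\<chi> i j. if j = k then v $ i else A x $ i $ j) $ i $ j)"
        using assms(1,2) by (cases "j = k") auto
    qed auto
    then show "smooth_on U (\<lambda>x. (\<chi> k. det (\<chi> i j. if j = k then v $ i else A x $ i $ j) / det (A x)) $ k)"
      by simp
  qed
  ultimately show ?thesis using smooth_on_cong by fastforce
qed

lemma linear_inj_on_vec_det:
  fixes D :: "real^'n \<Rightarrow> real^'n"
  assumes "linear D" "\<And>v. D v = 0 \<Longrightarrow> v = 0"
  shows "det (matrix D) \<noteq> 0"
  using assms det_nz_iff_inj linear_injective_0 by blast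

text \<open>Injectivity is assumed on all of \<open>U\<close>, so no local inversion has to be
  constructed: invariance of domain gives the open image, and the derivative of the inverse is the
  pointwise inverse \<open>B\<close> of \<open>D\<close>. The rest is a bootstrap. The derivative of
  the inverse \<open>g\<close> at \<open>y\<close> is \<open>B (g y)\<close>, and \<open>B\<close>
  is smooth by Cramer's rule, so \<open>g\<close> gains one order of differentiability at each
  step.\<close>

proposition smooth_inverse:
  fixes f :: "real^'n \<Rightarrow> real^'n"
  assumes sm: "smooth_on U f" and inj: "inj_on f U"
    and nz: "\<And>x v. x \<in> U \<Longrightarrow> frechet_derivative f (at x) v = 0 \<Longrightarrow> v = 0"
  shows "open (f ` U)" and "smooth_on (f ` U) (inv_into U f)"
proof -
  define D where "D = (\<lambda>x. frechet_derivative f (at x))"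
  define B where "B = (\<lambda>x. inv_into UNIV (D x))"
  define g where "g = inv_into U f"
  have U: "open U" using sm smooth_on_open by auto
  have D: "(f has_derivative D x) (at x)" if "x \<in> U" for x
    unfolding D_def using sm that smooth_on_has_derivative by auto
  have lin: "linear (D x)" if "x \<in> U" for x
    using D[OF that] has_derivative_linear by blast
  have detnz: "det (matrix (D x)) \<noteq> 0" if "x \<in> U" for x
    using linear_inj_on_vec_det[OF lin[OF that]] nz[OF that] by (auto simp: D_def)
  have bijD: "bij (D x)" if "x \<in> U" for x
    by (metis (no_types, lifting) bij_def detnz[OF that] lin[OF that] det_nz_iff_inj linear_injective_imp_surjective)
  have DB: "D x (B x v) = v" if "x \<in> U" for x v
    using bijD[OF that] by (simp add: B_def bij_is_surj surj_f_inv_f)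
  have smB: "smooth_on U (\<lambda>x. B x v)" for v
  proof (rule smooth_on_inv_mult[where A = "\<lambda>x. matrix (D x)" and v = v])
    show "smooth_on U (\<lambda>x. matrix (D x) $ i $ j)" for i j
    proof -
      have "\<forall>k. Ck_on (Suc k) f U" using sm unfolding smooth_on_def by blast
      then have "smooth_on U (\<lambda>x. D x (axis j 1))"
        by (simp add: D_def smooth_on_def U)
      then have "smooth_on U (\<lambda>x. D x (axis j 1) \<bullet> axis i 1)"
        by (intro smooth_on_inner) (auto simp: U)
      then show ?thesis by (simp add: matrix_def inner_axis)
    qed
    show "matrix (D x) *v B x v = v" if "x \<in> U" for x
      using lin[OF that] DB[OF that] by (simp add: matrix_works)
  qed (use U detnz in auto)
  have gf: "g (f x) = x" if "x \<in> U" for x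
    using inj that by (simp add: g_def)
  have dg: "(g has_derivative B x) (at (f x))" if "x \<in> U" for x
    by (rule has_derivative_inverse_strong[OF U that smooth_on_continuous_on[OF sm] gf D[OF that]])
      (auto simp: fun_eq_iff DB[OF that])
  show op: "open (f ` U)"
    by (rule invariance_of_domain[OF smooth_on_continuous_on[OF sm] U inj])
  have "Ck_on k g (f ` U)" for k
  proof (induction k)
    case 0
    have "continuous_on (f ` U) g"
      using has_derivative_continuous[OF dg] by (intro continuous_at_imp_continuous_on) blast
    then show ?case by simp
  next
    case (Suc k)
    show ?case
    proof (rule Ck_on_SucI'[OF op, where f' = "\<lambda>y v. B (g y) v"])
      show "(g has_derivative B (g y)) (at y)" if y: "y \<in> f ` U" for y
      proof -
        obtain x where x: "x \<in> U" "y = f x" using y by blast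
        show ?thesis unfolding x(2) gf[OF x(1)] by (rule dg[OF x(1)])
      qed
      show "Ck_on k (\<lambda>x. B (g x) v) (f ` U)" for v
      proof (rule Ck_on_compose[OF op U, where f = g and g = "\<lambda>x. B x v"])
        show "Ck_on k (\<lambda>x. B x v) U" using smB[of v] by (simp add: smooth_on_def)
      qed (use Suc gf in auto)
    qed
  qed
  then show "smooth_on (f ` U) (inv_into U f)" by (simp add: smooth_on_def op g_def)
qed

section \<open>Smooth maps and diffeomorphisms between subsets of Euclidean spaces\<close>

lemma smooth_map_iff:
  "smooth_map S f \<longleftrightarrow> (\<forall>x\<in>S. \<exists>U F. x \<in> U \<and> smooth_on U F \<and> (\<forall>y\<in>U \<inter> S. F y = f y))"
  unfolding smooth_map_def smooth_on_def by meson

lemma smooth_mapE: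
  assumes "smooth_map S f" "x \<in> S"
  obtains U F where "x \<in> U" "smooth_on U F" "\<forall>y\<in>U \<inter> S. F y = f y"
  using assms unfolding smooth_map_iff by blast

lemma smooth_on_imp_smooth_map: "smooth_on U f \<Longrightarrow> S \<subseteq> U \<Longrightarrow> smooth_map S f"
  unfolding smooth_map_iff by blast

lemma smooth_map_cong: "smooth_map S f \<Longrightarrow> (\<And>x. x \<in> S \<Longrightarrow> f x = g x) \<Longrightarrow> smooth_map S g"
  unfolding smooth_map_iff by (metis IntD2)

lemma smooth_map_subset: "smooth_map S f \<Longrightarrow> T \<subseteq> S \<Longrightarrow> smooth_map T f"
  unfolding smooth_map_def
proof (rule ballI, drule bspec, erule (1) subsetD)
  fix x assume "T \<subseteq> S" "\<exists>U F. open U \<and> x \<in> U \<and> (\<forall>k. Ck_on k F U) \<and> (\<forall>y\<in>U \<inter> S. F y = f y)"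
  then show "\<exists>U F. open U \<and> x \<in> U \<and> (\<forall>k. Ck_on k F U) \<and> (\<forall>y\<in>U \<inter> T. F y = f y)"
    by (elim exE conjE, intro exI conjI) auto
qed

lemma smooth_map_id: "smooth_map S (\<lambda>x. x)"
  by (rule smooth_on_imp_smooth_map[OF smooth_on_id[OF open_UNIV]]) auto

lemma smooth_map_continuous_on:
  assumes "smooth_map S f"
  shows "continuous_on S f"
  unfolding continuous_on_eq_continuous_within
proof
  fix x assume "x \<in> S"
  then obtain U F where U: "x \<in> U" "smooth_on U F" "\<forall>y\<in>U \<inter> S. F y = f y"
    by (rule smooth_mapE[OF assms])
  have "open U" using U smooth_on_open by auto
  have "continuous (at x within S) F"
    using smooth_on_continuous_on[OF U(2)] \<open>open U\<close> U(1) continuous_on_eq_continuous_at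
      continuous_at_imp_continuous_at_within by blast
  moreover have "\<forall>\<^sub>F y in at x within S. F y = f y"
    using \<open>open U\<close> U unfolding eventually_at_topological by blast
  ultimately show "continuous (at x within S) f"
    using U \<open>x \<in> S\<close> unfolding continuous_within by (auto intro: Lim_transform_eventually)
qed

lemma smooth_map_has_derivative:
  assumes "x \<in> U" "smooth_on U F" "\<forall>y\<in>U \<inter> S. F y = f y" "x \<in> S"
  shows "(f has_derivative frechet_derivative F (at x)) (at x within S)"
proof -
  have *: "(F has_derivative frechet_derivative F (at x)) (at x within S)"
    using smooth_on_has_derivative[OF assms(2,1)] by (rule has_derivative_at_withinI)
  obtain d where "d > 0" "ball x d \<subseteq> U"
    using assms(1) smooth_on_open[OF assms(2)] open_contains_ball by blast
  show ?thesis
  proof (rule has_derivative_transform_within[OF * \<open>d > 0\<close> \<open>x \<in> S\<close>])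
    show "F y = f y" if "y \<in> S" "dist y x < d" for y
      using bspec[OF assms(3), of y] that \<open>ball x d \<subseteq> U\<close>[THEN subsetD, of y] by (simp add: dist_commute)
  qed
qed

lemma smooth_map_compose:
  assumes f: "smooth_map S f" and g: "smooth_map T g" and sub: "f ` S \<subseteq> T"
  shows "smooth_map S (\<lambda>x. g (f x))"
  unfolding smooth_map_iff
proof
  fix x assume "x \<in> S"
  then obtain U F where U: "x \<in> U" "smooth_on U F" "\<forall>y\<in>U \<inter> S. F y = f y"
    by (rule smooth_mapE[OF f])
  have "f x \<in> T" using sub \<open>x \<in> S\<close> by blast
  then obtain V G where V: "f x \<in> V" "smooth_on V G" "\<forall>y\<in>V \<inter> T. G y = g y"
    by (rule smooth_mapE[OF g])
  let ?W = "U \<inter> F -` V"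
  have op: "open ?W"
    by (intro continuous_open_preimage smooth_on_continuous_on[OF U(2)] smooth_on_open[OF U(2)] smooth_on_open[OF V(2)])
  have "smooth_on ?W (\<lambda>x. G (F x))"
    by (rule smooth_on_compose[OF V(2) smooth_on_subset[OF U(2) op]]) auto
  moreover have "x \<in> ?W" using U(1) V(1) bspec[OF U(3), of x] \<open>x \<in> S\<close> by simp
  moreover have "\<forall>y\<in>?W \<inter> S. G (F y) = g (f y)"
  proof
    fix y assume y: "y \<in> ?W \<inter> S"
    then have "F y = f y" using U(3) by simp
    then show "G (F y) = g (f y)" using bspec[OF V(3), of "f y"] y sub by auto
  qed
  ultimately show "\<exists>U F. x \<in> U \<and> smooth_on U F \<and> (\<forall>y\<in>U \<inter> S. F y = g (f y))"
    by (intro exI[of _ ?W] exI[of _ "\<lambda>x. G (F x)"] conjI)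
qed

lemma smooth_map_locally:
  assumes "\<And>x. x \<in> S \<Longrightarrow> \<exists>V. openin (top_of_set S) V \<and> x \<in> V \<and> smooth_map V f"
  shows "smooth_map S f"
  unfolding smooth_map_iff
proof
  fix x assume "x \<in> S"
  then obtain V where V: "openin (top_of_set S) V" "x \<in> V" "smooth_map V f" using assms by blast
  obtain U F where U: "x \<in> U" "smooth_on U F" "\<forall>y\<in>U \<inter> V. F y = f y"
    by (rule smooth_mapE[OF V(3,2)])
  obtain W where W: "open W" "V = S \<inter> W" using V(1) openin_open by metis
  have "smooth_on (U \<inter> W) F"
    by (rule smooth_on_subset[OF U(2)]) (use smooth_on_open[OF U(2)] W(1) in auto)
  then show "\<exists>U F. x \<in> U \<and> smooth_on U F \<and> (\<forall>y\<in>U \<inter> S. F y = f y)"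
    using U W V(2) by (intro exI[of _ "U \<inter> W"] exI[of _ F]) auto
qed

lemma smooth_map_Pair:
  assumes "smooth_map S f" "smooth_map S g"
  shows "smooth_map S (\<lambda>x. (f x, g x))"
  unfolding smooth_map_iff
proof
  fix x assume "x \<in> S"
  obtain U F where U: "x \<in> U" "smooth_on U F" "\<forall>y\<in>U \<inter> S. F y = f y"
    by (rule smooth_mapE[OF assms(1) \<open>x \<in> S\<close>])
  obtain V G where V: "x \<in> V" "smooth_on V G" "\<forall>y\<in>V \<inter> S. G y = g y"
    by (rule smooth_mapE[OF assms(2) \<open>x \<in> S\<close>])
  note * = U V
  have op: "open (U \<inter> V)" using smooth_on_open[OF U(2)] smooth_on_open[OF V(2)] by blast
  have "smooth_on (U \<inter> V) (\<lambda>x. (F x, G x))"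
    by (rule smooth_on_Pair; rule smooth_on_subset[OF _ op]) (use * in auto)
  then show "\<exists>U F. x \<in> U \<and> smooth_on U F \<and> (\<forall>y\<in>U \<inter> S. F y = (f y, g y))"
    using * by (intro exI[of _ "U \<inter> V"] exI[of _ "\<lambda>x. (F x, G x)"]) simp
qed

lemma diffeoI:
  assumes "f ` S = T" "smooth_map S f" "smooth_map T g" "\<And>x. x \<in> S \<Longrightarrow> g (f x) = x"
  shows "diffeo S T f"
proof -
  have inj: "inj_on f S" using assms(4) by (metis inj_onI)
  have "inv_into S f y = g y" if "y \<in> T" for y
    using that assms inj by (metis imageE inv_into_f_f)
  then show ?thesis
    unfolding diffeo_def using assms inj by (metis smooth_map_cong)
qed

lemma diffeoD:
  assumes "diffeo S T f"
  shows "inj_on f S" "f ` S = T" "smooth_map S f" "smooth_map T (inv_into S f)"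
    "\<And>x. x \<in> S \<Longrightarrow> inv_into S f (f x) = x" "\<And>y. y \<in> T \<Longrightarrow> f (inv_into S f y) = y"
    "\<And>y. y \<in> T \<Longrightarrow> inv_into S f y \<in> S" "inv_into S f ` T = S" "continuous_on S f"
    "continuous_on T (inv_into S f)"
  using assms unfolding diffeo_def
  by (auto simp: f_inv_into_f inv_into_into smooth_map_continuous_on)

lemma diffeo_inverse: "diffeo S T f \<Longrightarrow> diffeo T S (inv_into S f)"
  by (rule diffeoI[where g = f]) (auto simp: diffeoD)

lemma diffeo_compose:
  assumes f: "diffeo S T f" and g: "diffeo T R g"
  shows "diffeo S R (\<lambda>x. g (f x))"
proof (rule diffeoI[where g = "\<lambda>x. inv_into S f (inv_into T g x)"])
  show "(\<lambda>x. g (f x)) ` S = R" using diffeoD(2)[OF f] diffeoD(2)[OF g] by (auto simp flip: image_image)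
  show "smooth_map S (\<lambda>x. g (f x))"
    by (rule smooth_map_compose[OF diffeoD(3)[OF f] diffeoD(3)[OF g]]) (simp add: diffeoD(2)[OF f])
  show "smooth_map R (\<lambda>x. inv_into S f (inv_into T g x))"
    by (rule smooth_map_compose[OF diffeoD(4)[OF g] diffeoD(4)[OF f]]) (simp add: diffeoD(8)[OF g])
  show "inv_into S f (inv_into T g (g (f x))) = x" if "x \<in> S" for x
  proof -
    have "f x \<in> T" using diffeoD(2)[OF f] that by blast
    then show ?thesis using that by (simp add: diffeoD(5)[OF f] diffeoD(5)[OF g])
  qed
qed

lemma diffeo_subset:
  assumes f: "diffeo S T f" and "A \<subseteq> S"
  shows "diffeo A (f ` A) f"
proof (rule diffeoI[where g = "inv_into S f"])
  show "smooth_map A f" by (rule smooth_map_subset[OF diffeoD(3)[OF f] \<open>A \<subseteq> S\<close>])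
  show "smooth_map (f ` A) (inv_into S f)"
    by (rule smooth_map_subset[OF diffeoD(4)[OF f]]) (use assms diffeoD(2)[OF f] in blast)
  show "inv_into S f (f x) = x" if "x \<in> A" for x
    using that assms(2) diffeoD(5)[OF f] by blast
qed simp

lemma diffeo_cong:
  assumes f: "diffeo S T f" and eq: "\<And>x. x \<in> S \<Longrightarrow> f x = g x"
  shows "diffeo S T g"
proof (rule diffeoI[where g = "inv_into S f"])
  show "g ` S = T" using eq diffeoD(2)[OF f] by force
  show "smooth_map S g" by (rule smooth_map_cong[OF diffeoD(3)[OF f] eq])
  show "smooth_map T (inv_into S f)" by (rule diffeoD(4)[OF f])
  show "inv_into S f (g x) = x" if "x \<in> S" for x
    using diffeoD(5)[OF f that] eq[OF that] by simp
qed

lemma diffeo_homeomorphism: "diffeo S T f \<Longrightarrow> homeomorphism S T f (inv_into S f)"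
  by (simp add: homeomorphism_def diffeoD)

lemma diffeo_openin: "diffeo S T f \<Longrightarrow> openin (top_of_set S) A \<Longrightarrow> openin (top_of_set T) (f ` A)"
  using diffeo_homeomorphism homeomorphism_imp_open_map by blast

lemma diffeo_openin_vimage:
  "diffeo S T f \<Longrightarrow> openin (top_of_set T) B \<Longrightarrow> openin (top_of_set S) (S \<inter> f -` B)"
  by (metis continuous_on_open diffeoD(2,9) inf_commute)

lemma diffeo_smooth_inverse:
  fixes f :: "real^'n \<Rightarrow> real^'n"
  assumes "smooth_on U f" "inj_on f U"
    "\<And>x v. x \<in> U \<Longrightarrow> frechet_derivative f (at x) v = 0 \<Longrightarrow> v = 0"
  shows "diffeo U (f ` U) f"
  by (rule diffeoI[where g = "inv_into U f"])
    (auto intro: smooth_on_imp_smooth_map[OF smooth_inverse(2)[OF assms]] smooth_on_imp_smooth_map[OF assms(1)]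
      simp: assms(2))

subsection \<open>Bump functions\<close>

text \<open>The exponent is a parameter because the family is closed under differentiation: the
  derivative of \<open>flat n\<close> is a combination of \<open>flat (n+2)\<close> and
  \<open>flat (n+1)\<close>. Smoothness at 0 then follows by one induction over all \<open>n\<close>
  at once.\<close>

definition flat :: "nat \<Rightarrow> real \<Rightarrow> real" where
  "flat n t = (if t \<le> 0 then 0 else inverse t ^ n * exp (- inverse t))"

text \<open>One term of the exponential series, of degree \<open>n + 2\<close> in
  \<open>1/t\<close>, already dominates the difference quotient at 0; the two extra powers leave a
  factor that tends to 0 with \<open>t\<close>.\<close>

lemma flat_small:
  assumes "t \<noteq> 0"
  shows "\<bar>flat n t / t\<bar> \<le> fact (n + 2) * \<bar>t\<bar>"
proof (cases "t \<le> 0")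
  case True
  then have "flat n t / t = 0" by (simp add: flat_def)
  then have "\<bar>flat n t / t\<bar> = 0" by (simp only: abs_zero)
  also have "0 \<le> fact (n + 2) * \<bar>t\<bar>" by (intro mult_nonneg_nonneg) auto
  finally show ?thesis .
next
  case False
  define s where "s = inverse t"
  have s: "s > 0" using False by (simp add: s_def)
  have "s ^ (n+2) / fact (n+2) \<le> exp s"
  proof -
    have "s ^ (n+2) / fact (n+2) = (\<Sum>k\<in>{n+2}. s ^ k / fact k)" by simp
    also have "\<dots> \<le> suminf (\<lambda>k. s ^ k / fact k)"
      using s summable_exp[of s] by (intro sum_le_suminf) (auto simp: field_simps)
    also have "\<dots> = exp s" by (simp add: exp_def divide_inverse mult.commute)
    finally show ?thesis .
  qed
  then have "s ^ (n+2) \<le> exp s * fact (n+2)"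
    by (simp only: pos_divide_le_eq[OF fact_gt_zero])
  then have "s ^ (n+2) * exp (-s) \<le> exp s * fact (n+2) * exp (-s)"
    by (rule mult_right_mono) simp
  also have "\<dots> = fact (n+2)" by (simp add: exp_minus del: fact_Suc)
  finally have "s ^ (n+2) * exp (-s) \<le> fact (n+2)" .
  moreover have "flat n t / t = s ^ (n+2) * exp (-s) * t"
    using False by (simp add: flat_def s_def field_simps)
  ultimately show ?thesis
    using False s by (simp add: abs_mult mult_right_mono)
qed

lemma flat_deriv: "(flat n has_real_derivative (flat (n+2) t - real n * flat (n+1) t)) (at t)"
proof -
  consider "t < 0" | "t = 0" | "t > 0" by linarith
  then show ?thesis
  proof cases
    case 1
    have "((\<lambda>t. 0) has_real_derivative 0) (at t)" by simp
    then have "(flat n has_real_derivative 0) (at t)"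
      by (rule has_field_derivative_transform_within_open[where S = "{..<0}"]) (use 1 in \<open>auto simp: flat_def\<close>)
    then show ?thesis using 1 by (simp add: flat_def)
  next
    case 2
    have "((\<lambda>h. flat n h / h) \<longlongrightarrow> 0) (at 0)"
    proof (rule Lim_null_comparison)
      show "\<forall>\<^sub>F h in at 0. norm (flat n h / h) \<le> fact (n+2) * \<bar>h\<bar>"
        using flat_small by (auto simp: eventually_at intro!: exI[of _ 1])
      show "((\<lambda>h. fact (n+2) * \<bar>h\<bar>) \<longlongrightarrow> (0::real)) (at 0)"
        by (rule tendsto_mult_right_zero[OF tendsto_rabs_zero[OF tendsto_ident_at]])
    qed
    then show ?thesis using 2 by (simp add: DERIV_def flat_def)
  next
    case 3
    have "((\<lambda>t. inverse t ^ n * exp (- inverse t)) has_real_derivative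
        (inverse t ^ (n+2) * exp (- inverse t) - real n * (inverse t ^ (n+1) * exp (- inverse t)))) (at t)"
      apply (rule DERIV_cong, rule DERIV_mult, rule DERIV_power, rule DERIV_inverse)
      using 3 apply simp
       apply (rule DERIV_chain2[where f = exp], rule DERIV_exp, rule DERIV_minus, rule DERIV_inverse)
      using 3 apply simp
      by (cases n) (auto simp: algebra_simps)
    then have "(flat n has_real_derivative
       (inverse t ^ (n+2) * exp (- inverse t) - real n * (inverse t ^ (n+1) * exp (- inverse t)))) (at t)"
      by (rule has_field_derivative_transform_within_open[where S = "{0<..}"]) (use 3 in \<open>auto simp: flat_def\<close>)
    then show ?thesis using 3 by (simp add: flat_def)
  qed
qed

lemma smooth_on_flat: "smooth_on UNIV (flat n)"
proof -
  have "Ck_on k (flat n) UNIV" for k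
  proof (induction k arbitrary: n)
    case 0
    have "continuous_on UNIV (flat n)"
      by (meson DERIV_isCont continuous_at_imp_continuous_on flat_deriv)
    then show ?case by simp
  next
    case (Suc k)
    show ?case
    proof (rule Ck_on_SucI'[where f' = "\<lambda>t v. (flat (n+2) t + (- real n) * flat (n+1) t) * v"])
      show "(flat n has_derivative (\<lambda>v. (flat (n+2) t + (- real n) * flat (n+1) t) * v)) (at t)" for t
        using flat_deriv[of n t] by (simp add: has_field_derivative_def mult_commute_abs)
      show "Ck_on k (\<lambda>t. (flat (n+2) t + (- real n) * flat (n+1) t) * v) UNIV" for v
        by (intro Ck_on_mult Ck_on_add Ck_on_const Suc) auto
    qed auto
  qed
  then show ?thesis by (simp add: smooth_on_def)
qed

definition smooth_step :: "real \<Rightarrow> real" where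
  "smooth_step t = flat 0 t / (flat 0 t + flat 0 (1 - t))"

lemma smooth_step_denom: "flat 0 t + flat 0 (1 - t) > 0"
  by (auto simp: flat_def intro: add_pos_pos)

lemma smooth_on_step: "smooth_on UNIV smooth_step"
proof -
  have "smooth_on UNIV (\<lambda>t. flat 0 (1 - t))"
    by (rule smooth_on_compose[OF smooth_on_flat]) (auto intro!: smooth_on_diff smooth_on_id)
  then have "smooth_on UNIV (\<lambda>t. flat 0 t / (flat 0 t + flat 0 (1 - t)))"
    using smooth_step_denom by (intro smooth_on_divide smooth_on_add smooth_on_flat)
      (auto simp: less_le)
  then show ?thesis by (simp add: smooth_step_def[abs_def])
qed

lemma smooth_step_0: "t \<le> 0 \<Longrightarrow> smooth_step t = 0"
  by (simp add: smooth_step_def flat_def)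

lemma smooth_step_1: "t \<ge> 1 \<Longrightarrow> smooth_step t = 1"
  by (simp add: smooth_step_def flat_def)

lemma smooth_step_bounds: "0 \<le> smooth_step t" "smooth_step t \<le> 1"
  using smooth_step_denom[of t] by (auto simp: smooth_step_def flat_def divide_simps)

text \<open>The argument of the step is affine in the squared norm, with value 1 at radius
  \<open>r/2\<close> and 0 at radius \<open>r\<close>. The square avoids the singularity of the norm
  at the origin.\<close>

definition bump :: "real \<Rightarrow> 'a::euclidean_space \<Rightarrow> real" where
  "bump r x = smooth_step (4/3 - (norm x)\<^sup>2 / (3 * (r/2)\<^sup>2))"

lemma smooth_on_bump: "smooth_on UNIV (bump r :: 'a::euclidean_space \<Rightarrow> real)"
proof -
  have "smooth_on UNIV (\<lambda>x::'a. smooth_step (4/3 - (x \<bullet> x) * inverse (3 * (r/2)\<^sup>2)))"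
    by (rule smooth_on_compose[OF smooth_on_step, where f = "\<lambda>x::'a. 4/3 - (x \<bullet> x) * inverse (3 * (r/2)\<^sup>2)"])
      (intro smooth_on_diff smooth_on_mult smooth_on_inner smooth_on_id smooth_on_const open_UNIV subset_UNIV)+
  moreover have "(\<lambda>x::'a. smooth_step (4/3 - (x \<bullet> x) * inverse (3 * (r/2)\<^sup>2))) = bump r"
    by (simp only: bump_def fun_eq_iff power2_norm_eq_inner divide_inverse simp_thms)
  ultimately show ?thesis by (simp only:)
qed

lemma bump_1:
  assumes "r > 0" "norm x \<le> r/2"
  shows "bump r x = 1"
proof -
  have "(norm x)\<^sup>2 \<le> (r/2)\<^sup>2" using assms by (intro power_mono) auto
  then have "(norm x)\<^sup>2 / (3 * (r/2)\<^sup>2) \<le> 1/3" using assms by (simp add: divide_simps)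
  then show ?thesis unfolding bump_def by (intro smooth_step_1) simp
qed

lemma bump_0:
  assumes "r > 0" "norm x \<ge> r"
  shows "bump r x = 0"
proof -
  have "(norm x)\<^sup>2 \<ge> r\<^sup>2" using assms by (intro power_mono) auto
  then have "(norm x)\<^sup>2 / (3 * (r/2)\<^sup>2) \<ge> 4/3" using assms by (simp add: divide_simps)
  then show ?thesis unfolding bump_def by (intro smooth_step_0) simp
qed

lemma bump_bounds: "0 \<le> bump r x" "bump r x \<le> 1"
  using smooth_step_bounds by (auto simp: bump_def)

lemma bump_scale: "r > 0 \<Longrightarrow> bump r x = bump 1 (x /\<^sub>R r)"
proof -
  assume "r > 0"
  then have "norm (x /\<^sub>R r) = norm x / r" by (simp add: divide_inverse)
  then show ?thesis using \<open>r > 0\<close> by (simp add: bump_def power_divide mult.commute)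
qed

text \<open>In each fixed direction the derivative is continuous and vanishes outside the unit ball,
  hence is bounded by compactness; the finitely many basis directions combine to one
  constant.\<close>

lemma bump_derivative_bound:
  obtains C where "C > 0" "\<And>x v::'a::euclidean_space. \<bar>frechet_derivative (bump 1) (at x) v\<bar> \<le> C * norm v"
proof -
  let ?D = "\<lambda>x::'a. frechet_derivative (bump 1) (at x)"
  have D: "(bump 1 has_derivative ?D x) (at x)" for x :: 'a
    by (rule smooth_on_has_derivative[OF smooth_on_bump]) simp
  have cont: "continuous_on UNIV (\<lambda>x. ?D x v)" for v
  proof -
    have "Ck_on (Suc 0) (bump 1 :: 'a \<Rightarrow> real) UNIV" using smooth_on_bump smooth_on_def by blast
    then show ?thesis by simp
  qed
  have "\<exists>B. \<forall>x. \<bar>?D x v\<bar> \<le> B" for v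
  proof -
    have "compact ((\<lambda>x. ?D x v) ` cball 0 1)"
      by (rule compact_continuous_image[OF continuous_on_subset[OF cont]]) auto
    then have "bounded ((\<lambda>x. ?D x v) ` cball 0 1)" by (rule compact_imp_bounded)
    then obtain B where "\<forall>y\<in>(\<lambda>x. ?D x v) ` cball 0 1. norm y \<le> B"
      unfolding bounded_iff by (elim exE)
    then have B: "\<And>x. norm x \<le> 1 \<Longrightarrow> \<bar>?D x v\<bar> \<le> B" by simp
    have "?D x v = 0" if "norm x > 1" for x
    proof -
      have "((\<lambda>x::'a. 0::real) has_derivative (\<lambda>v. 0)) (at x)" by simp
      then have "(bump 1 has_derivative (\<lambda>v. 0)) (at x)"
        by (rule has_derivative_transform_within_open[where s = "- cball 0 1"])
          (use that in \<open>auto simp: bump_0\<close>)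
      then show ?thesis using fun_cong[OF has_derivative_unique[OF D[of x]]] by blast
    qed
    moreover have "B \<ge> 0" using order_trans[OF abs_ge_zero B[of 0]] by simp
    ultimately have "\<bar>?D x v\<bar> \<le> B" for x using B[of x] by (cases "norm x \<le> 1") auto
    then show ?thesis by blast
  qed
  then obtain B where B: "\<And>v x. \<bar>?D x v\<bar> \<le> B v" by metis
  define C where "C = (\<Sum>b\<in>Basis. B b) + 1"
  have Bnn: "B v \<ge> 0" for v by (rule order_trans[OF abs_ge_zero B[of 0 v]])
  have "\<bar>?D x v\<bar> \<le> C * norm v" for x v
  proof -
    have lin: "linear (?D x)" by (rule has_derivative_linear[OF D])
    have "?D x v = ?D x (\<Sum>b\<in>Basis. (v \<bullet> b) *\<^sub>R b)" by (simp only: euclidean_representation)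
    also have "\<dots> = (\<Sum>b\<in>Basis. (v \<bullet> b) * ?D x b)"
      using lin by (simp add: linear_sum linear_scale)
    also have "\<bar>\<dots>\<bar> \<le> (\<Sum>b\<in>Basis. \<bar>(v \<bullet> b) * ?D x b\<bar>)" by (rule sum_abs)
    also have "\<dots> \<le> (\<Sum>b\<in>Basis. norm v * B b)"
      unfolding abs_mult by (intro sum_mono mult_mono Basis_le_norm B) auto
    also have "\<dots> = norm v * (\<Sum>b\<in>Basis. B b)" by (simp add: sum_distrib_left)
    also have "\<dots> \<le> C * norm v" by (simp add: C_def algebra_simps)
    finally show ?thesis .
  qed
  moreover have "C > 0" using Bnn by (simp add: C_def add_nonneg_pos sum_nonneg)
  ultimately show ?thesis using that by blast
qed

section \<open>Perturbations of the identity by a contraction\<close>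

text \<open>The mean value inequality turns the derivative bound into a Lipschitz constant
  \<open>L < 1\<close>. This excludes both two points with the same image and a vector in the kernel
  of the derivative, which is what \<open>smooth_inverse\<close> asks for.\<close>

proposition diffeo_perturbation:
  fixes u :: "real^'n \<Rightarrow> real^'n"
  assumes sm: "smooth_on UNIV u" and L: "L < 1"
    and bd: "\<And>x v. norm (frechet_derivative u (at x) v) \<le> L * norm v"
  shows "diffeo UNIV (range (\<lambda>x. x + u x)) (\<lambda>x. x + u x)" "smooth_on UNIV (\<lambda>x. x + u x)"
    "norm (u x - u y) \<le> L * norm (x - y)"
    "frechet_derivative (\<lambda>x. x + u x) (at x) v = v + frechet_derivative u (at x) v"
    "v + frechet_derivative u (at x) v = 0 \<Longrightarrow> v = 0"
proof -
  have D: "(u has_derivative frechet_derivative u (at x)) (at x)" for x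
    by (rule smooth_on_has_derivative[OF sm]) simp
  show lip: "norm (u x - u y) \<le> L * norm (x - y)" for x y
  proof (rule differentiable_bound[of UNIV])
    show "(u has_derivative frechet_derivative u (at x)) (at x within UNIV)" for x using D by simp
    show "onorm (frechet_derivative u (at x)) \<le> L" for x
      by (rule onorm_le) (rule bd)
  qed auto
  show sm': "smooth_on UNIV (\<lambda>x. x + u x)" by (intro smooth_on_add smooth_on_id sm) simp
  have D': "((\<lambda>x. x + u x) has_derivative (\<lambda>v. v + frechet_derivative u (at x) v)) (at x)" for x
    by (intro has_derivative_add has_derivative_ident D)
  show fd: "frechet_derivative (\<lambda>x. x + u x) (at x) v = v + frechet_derivative u (at x) v" for x v
    by (simp add: frechet_derivative_at[OF D', symmetric])
  show nz: "v + frechet_derivative u (at x) v = 0 \<Longrightarrow> v = 0" for x v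
  proof -
    assume "v + frechet_derivative u (at x) v = 0"
    then have "frechet_derivative u (at x) v = - v" by (simp add: add_eq_0_iff)
    then have "norm v \<le> L * norm v" using bd[of x v] by simp
    then have "(1 - L) * norm v \<le> 0" by (simp add: algebra_simps)
    then show "v = 0" using L by (auto simp: mult_le_0_iff)
  qed
  have inj: "inj (\<lambda>x. x + u x)"
  proof (rule injI)
    fix x y assume "x + u x = y + u y"
    then have "x - y = u y - u x" by (simp add: algebra_simps)
    then have "norm (x - y) \<le> L * norm (x - y)" using lip[of y x] by (simp add: norm_minus_commute)
    then have "(1 - L) * norm (x - y) \<le> 0" by (simp add: algebra_simps)
    then show "x = y" using L by (simp add: mult_le_0_iff)
  qed
  show "diffeo UNIV (range (\<lambda>x. x + u x)) (\<lambda>x. x + u x)"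
    by (rule diffeo_smooth_inverse[OF sm' inj], rule nz, simp add: fd)
qed

section \<open>Derivatives and frames in charts\<close>

definition full :: "(real, 'n::{finite,one}) vec set \<Rightarrow> bool" where
  "full V \<longleftrightarrow> open V \<or> openin (top_of_set half_space) V"

lemma full_openin: "full V \<Longrightarrow> openin (top_of_set V) V' \<Longrightarrow> full V'"
  unfolding full_def by (meson openin_open_trans openin_trans)

text \<open>A point on the wall of the half-space can be moved to one side only along the first
  axis. One arbitrarily small move along each axis is all that uniqueness of the derivative within
  \<open>V\<close> requires.\<close>

lemma full_directions:
  assumes "full V" "y \<in> V" "i \<in> Basis" "e > 0"
  shows "\<exists>d. 0 < \<bar>d\<bar> \<and> \<bar>d\<bar> < e \<and> y + d *\<^sub>R i \<in> V"
proof -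
  obtain T H where T: "open T" "V = H \<inter> T" "H = UNIV \<or> H = half_space"
  proof (cases "open V")
    case True
    then show ?thesis using that[of V UNIV] by simp
  next
    case False
    then have "openin (top_of_set half_space) V" using assms(1) by (simp add: full_def)
    then show ?thesis using that unfolding openin_open by blast
  qed
  have "y \<in> T" using T assms(2) by simp
  then obtain r where r: "r > 0" "ball y r \<subseteq> T" using T(1) open_contains_ball by blast
  define d where "d = min e r / 2"
  have d: "d > 0" "d < e" "d < r" using assms(4) r by (auto simp: d_def)
  have "norm i = 1" using assms(3) by simp
  then have "y + d *\<^sub>R i \<in> ball y r" using d by (simp add: dist_norm)
  then have "y + d *\<^sub>R i \<in> T" using r(2) by blast
  moreover have "i $ 1 \<ge> 0" using assms(3) by (auto simp: Basis_vec_def axis_def)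
  then have "y + d *\<^sub>R i \<in> H" using T assms(2) d by (auto simp: half_space_def)
  ultimately show ?thesis using d T by (intro exI[of _ d]) auto
qed

lemma full_derivative_unique:
  fixes f :: "(real, 'n::{finite,one}) vec \<Rightarrow> 'b::euclidean_space"
  assumes "full V" "y \<in> V" "(f has_derivative D) (at y within V)" "(f has_derivative D') (at y within V)"
  shows "D = D'"
  by (rule frechet_derivative_unique_within[OF assms(3,4)]) (rule full_directions[OF assms(1,2)])

lemma smooth_chart_full: "smooth_chart M V \<phi> \<Longrightarrow> full V"
  by (simp add: smooth_chart_def full_def)

lemma smooth_chart_subset:
  assumes "smooth_chart M V \<phi>" "openin (top_of_set V) V'"
  shows "smooth_chart M V' \<phi>"
proof -
  have d: "diffeo V (\<phi> ` V) \<phi>" and o: "openin (top_of_set M) (\<phi> ` V)"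
    using assms(1) by (auto simp: smooth_chart_def)
  have "full V'" using full_openin[OF smooth_chart_full[OF assms(1)] assms(2)] .
  moreover have "openin (top_of_set M) (\<phi> ` V')"
    using openin_trans[OF diffeo_openin[OF d assms(2)] o] .
  moreover have "diffeo V' (\<phi> ` V') \<phi>"
    using diffeo_subset[OF d] openin_imp_subset[OF assms(2)] by blast
  ultimately show ?thesis by (simp add: smooth_chart_def full_def)
qed

lemma oriented_chart_smooth: "oriented_chart M V \<phi> \<Longrightarrow> smooth_chart (pts M) V \<phi>"
  by (simp add: oriented_chart_def)

lemma oriented_chart_full: "oriented_chart M V \<phi> \<Longrightarrow> full V"
  by (simp add: oriented_chart_smooth smooth_chart_full[of "pts M" V \<phi>])

lemma oriented_chart_diffeo: "oriented_chart M V \<phi> \<Longrightarrow> diffeo V (\<phi> ` V) \<phi>"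
  by (simp add: oriented_chart_def smooth_chart_def)

lemma oriented_chart_openin: "oriented_chart M V \<phi> \<Longrightarrow> openin (top_of_set (pts M)) (\<phi> ` V)"
  by (simp add: oriented_chart_def smooth_chart_def)

lemma oriented_chart_pts: "oriented_chart M V \<phi> \<Longrightarrow> \<phi> ` V \<subseteq> pts M"
  using openin_imp_subset[OF oriented_chart_openin] by blast

lemma oriented_chart_subset:
  assumes "oriented_chart M V \<phi>" "openin (top_of_set V) V'"
  shows "oriented_chart M V' \<phi>"
proof -
  have sub: "V' \<subseteq> V" using openin_imp_subset[OF assms(2)] .
  have "\<exists>D. (\<phi> has_derivative D) (at y within V') \<and> frames M (\<phi> y) = {D \<circ> (\<lambda>v. B *v v) |B. 0 < det B}"
    if y: "y \<in> V'" for y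
  proof -
    obtain D where D: "(\<phi> has_derivative D) (at y within V)" "frames M (\<phi> y) = {D \<circ> (\<lambda>v. B *v v) |B. 0 < det B}"
      using assms(1) subsetD[OF sub y] unfolding oriented_chart_def by blast
    show ?thesis using has_derivative_subset[OF D(1) sub] D(2) by (intro exI[of _ D] conjI)
  qed
  then show ?thesis
    using smooth_chart_subset[OF oriented_chart_smooth[OF assms(1)] assms(2)] by (simp add: oriented_chart_def)
qed

lemma oriented_chart_frames:
  assumes "oriented_chart M V \<phi>" "y \<in> V" "(\<phi> has_derivative D) (at y within V)"
  shows "frames M (\<phi> y) = {D \<circ> (\<lambda>v. B *v v) |B. 0 < det B}"
proof -
  obtain D' where D': "(\<phi> has_derivative D') (at y within V)" "frames M (\<phi> y) = {D' \<circ> (\<lambda>v. B *v v) |B. 0 < det B}"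
    using assms(1,2) unfolding oriented_chart_def by blast
  have "D' = D" by (rule full_derivative_unique[OF oriented_chart_full[OF assms(1)] assms(2) D'(1) assms(3)])
  then show ?thesis using D'(2) by simp
qed

lemma oriented_chart_derivative:
  fixes M :: "('a::euclidean_space, 'n::{finite,one}) omanifold"
  assumes "oriented_chart M V \<phi>" "y \<in> V"
  obtains D where "(\<phi> has_derivative D) (at y within V)" "D \<in> frames M (\<phi> y)"
    "frames M (\<phi> y) = {D \<circ> (\<lambda>v. B *v v) |B. 0 < det B}"
proof -
  obtain D where D: "(\<phi> has_derivative D) (at y within V)" "frames M (\<phi> y) = {D \<circ> (\<lambda>v. B *v v) |B. 0 < det B}"
    using assms unfolding oriented_chart_def by blast
  have "D = D \<circ> (\<lambda>v. mat 1 *v v)" by (simp add: fun_eq_iff)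
  moreover have "0 < det (mat 1 :: ((real, 'n) vec, 'n) vec)" by simp
  ultimately have "D \<in> frames M (\<phi> y)" unfolding D(2) by blast
  then show ?thesis using that D by blast
qed

lemma oriented_chart_at:
  assumes "oriented_manifold M" "openin (top_of_set (pts M)) N" "p \<in> N"
  obtains V \<phi> y where "oriented_chart M V \<phi>" "\<phi> ` V \<subseteq> N" "y \<in> V" "\<phi> y = p"
proof -
  have "p \<in> pts M" using assms openin_imp_subset by blast
  then obtain V \<phi> where V: "oriented_chart M V \<phi>" "p \<in> \<phi> ` V"
    using assms(1) unfolding oriented_manifold_def by blast
  then obtain y where y: "y \<in> V" "\<phi> y = p" by blast
  define V' where "V' = V \<inter> \<phi> -` N"
  have "continuous_on V \<phi>" using diffeoD(9)[OF oriented_chart_diffeo[OF V(1)]] .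
  moreover have "openin (top_of_set (\<phi> ` V)) (\<phi> ` V \<inter> N)"
    using openin_subset_trans[OF openin_Int[OF oriented_chart_openin[OF V(1)] assms(2)]] oriented_chart_pts[OF V(1)] by blast
  ultimately have "openin (top_of_set V) (V \<inter> \<phi> -` (\<phi> ` V \<inter> N))"
    using continuous_on_open by blast
  moreover have "V \<inter> \<phi> -` (\<phi> ` V \<inter> N) = V'" by (auto simp: V'_def)
  ultimately have "oriented_chart M V' \<phi>" using oriented_chart_subset[OF V(1)] by simp
  then show ?thesis using that[of V' \<phi> y] y assms(3) by (auto simp: V'_def)
qed

text \<open>The ambient derivative of an extension \<open>F\<close> depends on the extension;
  composed with the derivative \<open>D\<close> of a chart it does not. Tangent maps are handled in
  this composed form throughout.\<close>

lemma ext_compose_derivative: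
  assumes "\<phi> y \<in> U" "smooth_on U F" "\<forall>z\<in>U \<inter> N. F z = f z" "\<phi> ` V \<subseteq> N" "y \<in> V"
    "(\<phi> has_derivative D) (at y within V)"
  shows "((\<lambda>x. f (\<phi> x)) has_derivative (frechet_derivative F (at (\<phi> y)) \<circ> D)) (at y within V)"
proof -
  have "\<phi> y \<in> N" using assms(4,5) by blast
  then have "(f has_derivative frechet_derivative F (at (\<phi> y))) (at (\<phi> y) within N)"
    using smooth_map_has_derivative[OF assms(1-3)] by blast
  then have "(f has_derivative frechet_derivative F (at (\<phi> y))) (at (\<phi> y) within \<phi> ` V)"
    by (rule has_derivative_subset[OF _ assms(4)])
  then show ?thesis using has_derivative_in_compose[OF assms(6)] by (simp add: o_def)
qed

text \<open>Differentiating the inverse after \<open>\<phi>\<close>, which is the identity on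
  \<open>V\<close>, shows that any smooth extension of the inverse supplies a left inverse of
  \<open>D\<close>. This is the source of the injectivity of chart derivatives.\<close>

lemma diffeo_inverse_derivative:
  assumes "diffeo V T \<phi>" "full V" "y \<in> V" "(\<phi> has_derivative D) (at y within V)"
    "\<phi> y \<in> U" "smooth_on U G" "\<forall>z\<in>U \<inter> T. G z = inv_into V \<phi> z"
  shows "frechet_derivative G (at (\<phi> y)) \<circ> D = id"
proof (rule full_derivative_unique[OF assms(2,3)])
  show "((\<lambda>x. inv_into V \<phi> (\<phi> x)) has_derivative frechet_derivative G (at (\<phi> y)) \<circ> D) (at y within V)"
    by (rule ext_compose_derivative[OF assms(5-7) _ assms(3,4)]) (simp add: diffeoD(2)[OF assms(1)])
  have "((\<lambda>x. x) has_derivative id) (at y within V)" using has_derivative_id by (simp add: id_def)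
  then show "((\<lambda>x. inv_into V \<phi> (\<phi> x)) has_derivative id) (at y within V)"
    by (rule has_derivative_transform_within[where d = 1]) (simp_all add: assms(3) diffeoD(5)[OF assms(1)])
qed

lemma diffeo_derivative_inj:
  assumes "diffeo V T \<phi>" "full V" "y \<in> V" "(\<phi> has_derivative D) (at y within V)"
  shows "inj D"
proof -
  have "\<phi> y \<in> T" using diffeoD(2)[OF assms(1)] assms(3) by blast
  then obtain U G where "\<phi> y \<in> U" "smooth_on U G" "\<forall>z\<in>U \<inter> T. G z = inv_into V \<phi> z"
    by (rule smooth_mapE[OF diffeoD(4)[OF assms(1)]])
  then have "frechet_derivative G (at (\<phi> y)) \<circ> D = id"
    by (rule diffeo_inverse_derivative[OF assms])
  then show ?thesis by (metis inj_on_id inj_on_imageI2)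
qed

text \<open>The frames at a point form one orbit of the group of matrices with positive determinant,
  so any member can replace the derivative of a chart as the reference frame.\<close>

lemma frames_class:
  assumes "oriented_manifold M" "p \<in> pts M" "A \<in> frames M p"
  shows "frames M p = {A \<circ> (\<lambda>v. B *v v) |B. 0 < det B}" and "linear A" and "inj A"
proof -
  obtain V \<phi> y where V: "oriented_chart M V \<phi>" "y \<in> V" "\<phi> y = p"
    using oriented_chart_at[OF assms(1) openin_subtopology_self assms(2)] by metis
  obtain D where D: "(\<phi> has_derivative D) (at y within V)"
    "frames M (\<phi> y) = {D \<circ> (\<lambda>v. B *v v) |B. 0 < det B}"
    by (rule oriented_chart_derivative[OF V(1,2)])
  have injD: "inj D" by (rule diffeo_derivative_inj[OF oriented_chart_diffeo[OF V(1)] oriented_chart_full[OF V(1)] V(2) D(1)])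
  have linD: "linear D" by (rule has_derivative_linear[OF D(1)])
  obtain B where B: "A = D \<circ> (\<lambda>v. B *v v)" "0 < det B" using assms(3) D(2) V(3) by blast
  have inv: "invertible B" using B(2) by (simp add: invertible_det_nz)
  then obtain B' where B': "B ** B' = mat 1" "B' ** B = mat 1" unfolding invertible_def by blast
  have "det B * det B' = 1" using B'(1) by (metis det_I det_mul)
  then have pos: "0 < det B'" using B(2) by (metis zero_less_mult_pos zero_less_one)
  show "linear A" unfolding B(1) by (intro linear_compose linD matrix_vector_mul_linear)
  show "inj A" unfolding B(1)
  proof (rule inj_compose[OF injD], rule injI)
    fix v w assume "B *v v = B *v w"
    then have "B' *v (B *v v) = B' *v (B *v w)" by simp
    then show "v = w" by (simp add: matrix_vector_mul_assoc B')
  qed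
  show "frames M p = {A \<circ> (\<lambda>v. B *v v) |B. 0 < det B}"
  proof (intro equalityI subsetI)
    fix C assume "C \<in> frames M p"
    then obtain E where E: "C = D \<circ> (\<lambda>v. E *v v)" "0 < det E" using D(2) V(3) by blast
    have "B ** (B' ** E) = E" by (simp add: matrix_mul_assoc B')
    then have "C = A \<circ> (\<lambda>v. (B' ** E) *v v)"
      by (simp add: E(1) B(1) fun_eq_iff matrix_vector_mul_assoc)
    moreover have "0 < det (B' ** E)" using pos E(2) by (simp add: det_mul)
    ultimately show "C \<in> {A \<circ> (\<lambda>v. B *v v) |B. 0 < det B}" by blast
  next
    fix C assume "C \<in> {A \<circ> (\<lambda>v. B *v v) |B. 0 < det B}"
    then obtain E where E: "C = A \<circ> (\<lambda>v. E *v v)" "0 < det E" by blast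
    then have "C = D \<circ> (\<lambda>v. (B ** E) *v v)"
      by (simp add: B(1) fun_eq_iff matrix_vector_mul_assoc)
    moreover have "0 < det (B ** E)" using B(2) E(2) by (simp add: det_mul)
    ultimately show "C \<in> frames M p" using D(2) V(3) by blast
  qed
qed

subsection \<open>Orientation preserving embeddings of subsets\<close>

text \<open>Tested by ambient derivatives of local extensions rather than in charts, and on an
  arbitrary subset \<open>N\<close>, so that restriction and composition need no bookkeeping with
  charts or deleted manifolds.\<close>

definition oemb :: "('a::euclidean_space, 'n::{finite,one}) omanifold \<Rightarrow> ('b::euclidean_space, 'n) omanifold
    \<Rightarrow> 'a set \<Rightarrow> ('a \<Rightarrow> 'b) \<Rightarrow> bool" where
  "oemb M M' N f \<longleftrightarrow> N \<subseteq> pts M \<and> f ` N \<subseteq> pts M' \<and> diffeo N (f ` N) f \<and>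
     (\<forall>p\<in>N. \<exists>U F. p \<in> U \<and> smooth_on U F \<and> (\<forall>y\<in>U \<inter> N. F y = f y) \<and>
        (\<forall>A\<in>frames M p. frechet_derivative F (at p) \<circ> A \<in> frames M' (f p)))"

lemma oembD:
  assumes "oemb M M' N f"
  shows "N \<subseteq> pts M" "f ` N \<subseteq> pts M'" "diffeo N (f ` N) f"
  using assms by (auto simp: oemb_def)

lemma oembE:
  assumes "oemb M M' N f" "p \<in> N"
  obtains U F where "p \<in> U" "smooth_on U F" "\<forall>y\<in>U \<inter> N. F y = f y"
    "\<forall>A\<in>frames M p. frechet_derivative F (at p) \<circ> A \<in> frames M' (f p)"
  using assms unfolding oemb_def by blast

lemma oemb_subset:
  assumes "oemb M M' N f" "N' \<subseteq> N"
  shows "oemb M M' N' f"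
  unfolding oemb_def
proof (intro conjI ballI)
  show "N' \<subseteq> pts M" "f ` N' \<subseteq> pts M'" using assms oembD(1,2) by blast+
  show "diffeo N' (f ` N') f" by (rule diffeo_subset[OF oembD(3)[OF assms(1)] assms(2)])
  fix p assume "p \<in> N'"
  then have "p \<in> N" using assms(2) by blast
  then obtain U F where "p \<in> U" "smooth_on U F" "\<forall>y\<in>U \<inter> N. F y = f y"
    "\<forall>A\<in>frames M p. frechet_derivative F (at p) \<circ> A \<in> frames M' (f p)"
    by (rule oembE[OF assms(1)])
  then show "\<exists>U F. p \<in> U \<and> smooth_on U F \<and> (\<forall>y\<in>U \<inter> N'. F y = f y) \<and>
        (\<forall>A\<in>frames M p. frechet_derivative F (at p) \<circ> A \<in> frames M' (f p))"
    using assms(2) by (intro exI[of _ U] exI[of _ F] conjI) auto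
qed

lemma oemb_cong:
  assumes "oemb M M' N f" "\<And>x. x \<in> N \<Longrightarrow> f x = g x"
  shows "oemb M M' N g"
proof -
  have im: "f ` N = g ` N" using assms(2) by force
  have "diffeo N (g ` N) g" using diffeo_cong[OF oembD(3)[OF assms(1)] assms(2)] im by simp
  then show ?thesis using assms unfolding oemb_def im by auto
qed

lemma oemb_compose:
  assumes f: "oemb M M' N f" and g: "oemb M' M'' N' g" and sub: "f ` N \<subseteq> N'"
  shows "oemb M M'' N (\<lambda>x. g (f x))"
  unfolding oemb_def
proof (intro conjI ballI)
  show "N \<subseteq> pts M" using oembD(1)[OF f] .
  show "(\<lambda>x. g (f x)) ` N \<subseteq> pts M''" using oembD(2)[OF g] sub by blast
  show "diffeo N ((\<lambda>x. g (f x)) ` N) (\<lambda>x. g (f x))"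
    using diffeo_compose[OF oembD(3)[OF f] diffeo_subset[OF oembD(3)[OF g] sub]] by (simp add: image_image)
  fix p assume p: "p \<in> N"
  obtain U F where U: "p \<in> U" "smooth_on U F" "\<forall>y\<in>U \<inter> N. F y = f y"
    "\<forall>A\<in>frames M p. frechet_derivative F (at p) \<circ> A \<in> frames M' (f p)"
    by (rule oembE[OF f p])
  have fp: "f p \<in> N'" using p sub by blast
  obtain V G where V: "f p \<in> V" "smooth_on V G" "\<forall>y\<in>V \<inter> N'. G y = g y"
    "\<forall>A\<in>frames M' (f p). frechet_derivative G (at (f p)) \<circ> A \<in> frames M'' (g (f p))"
    by (rule oembE[OF g fp])
  have Fp: "F p = f p" using U p by blast
  let ?W = "U \<inter> F -` V"
  have op: "open ?W"
    by (intro continuous_open_preimage smooth_on_continuous_on[OF U(2)] smooth_on_open[OF U(2)] smooth_on_open[OF V(2)])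
  have "smooth_on ?W (\<lambda>x. G (F x))"
    by (rule smooth_on_compose[OF V(2) smooth_on_subset[OF U(2) op]]) auto
  moreover have "\<forall>y\<in>?W \<inter> N. G (F y) = g (f y)"
  proof
    fix y assume y: "y \<in> ?W \<inter> N"
    then have "F y = f y" using U(3) by simp
    then show "G (F y) = g (f y)" using bspec[OF V(3), of "f y"] y sub by auto
  qed
  moreover have "frechet_derivative (\<lambda>x. G (F x)) (at p) = frechet_derivative G (at (f p)) \<circ> frechet_derivative F (at p)"
  proof -
    have "(G has_derivative frechet_derivative G (at (F p))) (at (F p))"
      using smooth_on_has_derivative[OF V(2,1)] Fp by simp
    then have "((\<lambda>x. G (F x)) has_derivative (\<lambda>v. frechet_derivative G (at (F p)) (frechet_derivative F (at p) v))) (at p)"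
      by (rule has_derivative_compose[OF smooth_on_has_derivative[OF U(2,1)]])
    then show ?thesis using frechet_derivative_at[symmetric] Fp by (fastforce simp: o_def)
  qed
  moreover have "frechet_derivative G (at (f p)) \<circ> frechet_derivative F (at p) \<circ> A \<in> frames M'' (g (f p))"
    if "A \<in> frames M p" for A
    using bspec[OF V(4) bspec[OF U(4) that]] by (simp only: comp_assoc)
  ultimately show "\<exists>U F. p \<in> U \<and> smooth_on U F \<and> (\<forall>y\<in>U \<inter> N. F y = g (f y)) \<and>
        (\<forall>A\<in>frames M p. frechet_derivative F (at p) \<circ> A \<in> frames M'' (g (f p)))"
    using U(1) V(1) Fp by (intro exI[of _ ?W] exI[of _ "\<lambda>x. G (F x)"] conjI) auto
qed

lemma oriented_embedding_oemb:
  assumes e: "oriented_embedding M W f" and M: "oriented_manifold M" and W: "oriented_manifold W"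
  shows "oemb M W (pts M) f"
  unfolding oemb_def
proof (intro conjI ballI)
  show sub: "f ` pts M \<subseteq> pts W" and d: "diffeo (pts M) (f ` pts M) f"
    using e by (auto simp: oriented_embedding_def)
  fix p assume p: "p \<in> pts M"
  obtain U F where U: "p \<in> U" "smooth_on U F" "\<forall>y\<in>U \<inter> pts M. F y = f y"
    by (rule smooth_mapE[OF diffeoD(3)[OF d] p])
  obtain V \<phi> y where V: "oriented_chart M V \<phi>" "y \<in> V" "\<phi> y = p"
    using oriented_chart_at[OF M openin_subtopology_self p] by metis
  obtain D where D: "(\<phi> has_derivative D) (at y within V)"
    "frames M (\<phi> y) = {D \<circ> (\<lambda>v. B *v v) |B. 0 < det B}"
    by (rule oriented_chart_derivative[OF V(1,2)])
  obtain D' where D': "((f \<circ> \<phi>) has_derivative D') (at y within V)" "D' \<in> frames W (f (\<phi> y))"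
    using e V(1,2) unfolding oriented_embedding_def by blast
  have "\<phi> y \<in> U" using U V by simp
  then have "((\<lambda>x. f (\<phi> x)) has_derivative (frechet_derivative F (at (\<phi> y)) \<circ> D)) (at y within V)"
    by (rule ext_compose_derivative[OF _ U(2,3) oriented_chart_pts[OF V(1)] V(2) D(1)])
  then have eq: "D' = frechet_derivative F (at p) \<circ> D"
    using full_derivative_unique[OF oriented_chart_full[OF V(1)] V(2) D'(1)] V(3) by (simp add: o_def)
  have fp: "f p \<in> pts W" using sub p by blast
  have "frechet_derivative F (at p) \<circ> A \<in> frames W (f p)" if A: "A \<in> frames M p" for A
  proof -
    obtain B where "A = D \<circ> (\<lambda>v. B *v v)" "0 < det B" using D(2) V(3) A by blast
    then have "frechet_derivative F (at p) \<circ> A = D' \<circ> (\<lambda>v. B *v v)" "0 < det B" by (simp_all add: eq comp_assoc)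
    moreover have "D' \<in> frames W (f p)" using D'(2) V(3) by simp
    ultimately show ?thesis using frames_class(1)[OF W fp, of D'] by blast
  qed
  then show "\<exists>U F. p \<in> U \<and> smooth_on U F \<and> (\<forall>y\<in>U \<inter> pts M. F y = f y) \<and>
        (\<forall>A\<in>frames M p. frechet_derivative F (at p) \<circ> A \<in> frames W (f p))"
    using U by (intro exI[of _ U] exI[of _ F] conjI) auto
qed simp

text \<open>Openness of \<open>N\<close> provides a chart of \<open>M\<close> inside
  \<open>N\<close>; for its derivative \<open>D\<close>, the extensions \<open>F\<close> and
  \<open>G\<close> of the map and of its inverse satisfy
  \<open>?G \<circ> (?F \<circ> D) = D\<close>. As frames at either end are one orbit, this one
  frame decides the orientation of the inverse.\<close>

lemma oemb_inverse:
  assumes f: "oemb M M' N f" and M: "oriented_manifold M" and M': "oriented_manifold M'"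
    and op: "openin (top_of_set (pts M)) N"
  shows "oemb M' M (f ` N) (inv_into N f)"
  unfolding oemb_def
proof (intro conjI ballI)
  have d: "diffeo N (f ` N) f" by (rule oembD(3)[OF f])
  show "f ` N \<subseteq> pts M'" by (rule oembD(2)[OF f])
  show "inv_into N f ` f ` N \<subseteq> pts M" using oembD(1)[OF f] by (simp add: diffeoD(8)[OF d])
  show "diffeo (f ` N) (inv_into N f ` f ` N) (inv_into N f)"
    using diffeo_inverse[OF d] by (simp add: diffeoD(8)[OF d])
  fix q assume q: "q \<in> f ` N"
  then obtain p where p: "p \<in> N" "q = f p" by blast
  obtain U F where U: "p \<in> U" "smooth_on U F" "\<forall>y\<in>U \<inter> N. F y = f y"
    "\<forall>A\<in>frames M p. frechet_derivative F (at p) \<circ> A \<in> frames M' (f p)"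
    by (rule oembE[OF f p(1)])
  obtain W G where G: "q \<in> W" "smooth_on W G" "\<forall>y\<in>W \<inter> f ` N. G y = inv_into N f y"
    by (rule smooth_mapE[OF diffeoD(4)[OF d] q])
  obtain V \<phi> y where V: "oriented_chart M V \<phi>" "\<phi> ` V \<subseteq> N" "y \<in> V" "\<phi> y = p"
    by (rule oriented_chart_at[OF M op p(1)])
  obtain D where D: "(\<phi> has_derivative D) (at y within V)" "D \<in> frames M (\<phi> y)"
    by (rule oriented_chart_derivative[OF V(1,3)])
  let ?F = "frechet_derivative F (at p)" and ?G = "frechet_derivative G (at q)"
  have "\<phi> y \<in> U" using U V by simp
  then have 1: "((\<lambda>x. f (\<phi> x)) has_derivative (?F \<circ> D)) (at y within V)"
    using ext_compose_derivative[OF _ U(2,3) V(2,3) D(1)] V(4) by simp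
  have "f (\<phi> y) \<in> W" "(\<lambda>x. f (\<phi> x)) ` V \<subseteq> f ` N" using G(1) V p(2) by auto
  then have "((\<lambda>x. inv_into N f (f (\<phi> x))) has_derivative (?G \<circ> (?F \<circ> D))) (at y within V)"
    using ext_compose_derivative[where \<phi> = "\<lambda>x. f (\<phi> x)", OF _ G(2,3) _ V(3) 1] V(4) p(2) by simp
  moreover have "inv_into N f (f (\<phi> x)) = \<phi> x" if "x \<in> V" for x
    using diffeoD(5)[OF d] V(2) that by blast
  ultimately have "(\<phi> has_derivative (?G \<circ> (?F \<circ> D))) (at y within V)"
    using has_derivative_transform[OF V(3)] by metis
  then have GFD: "?G \<circ> (?F \<circ> D) = D"
    using full_derivative_unique[OF oriented_chart_full[OF V(1)] V(3) _ D(1)] by blast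
  have DM: "D \<in> frames M p" using D(2) V(4) by simp
  then have "?F \<circ> D \<in> frames M' q" using U(4) p(2) by blast
  moreover have "q \<in> pts M'" using q oembD(2)[OF f] by blast
  ultimately have fr: "frames M' q = {?F \<circ> D \<circ> (\<lambda>v. B *v v) |B. 0 < det B}"
    using frames_class(1)[OF M'] by blast
  have fM: "frames M p = {D \<circ> (\<lambda>v. B *v v) |B. 0 < det B}"
    using frames_class(1)[OF M _ DM] p(1) oembD(1)[OF f] by blast
  have "?G \<circ> A \<in> frames M p" if A: "A \<in> frames M' q" for A
  proof -
    obtain B where B: "A = ?F \<circ> D \<circ> (\<lambda>v. B *v v)" "0 < det B" using fr A by blast
    have "?G \<circ> A = ?G \<circ> (?F \<circ> D) \<circ> (\<lambda>v. B *v v)" by (simp add: B(1) comp_assoc)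
    then have "?G \<circ> A = D \<circ> (\<lambda>v. B *v v)" by (simp only: GFD)
    then show ?thesis using fM B(2) by blast
  qed
  moreover have "inv_into N f q = p" using p diffeoD(5)[OF d] by simp
  ultimately show "\<exists>U F. q \<in> U \<and> smooth_on U F \<and> (\<forall>y\<in>U \<inter> f ` N. F y = inv_into N f y) \<and>
        (\<forall>A\<in>frames M' q. frechet_derivative F (at q) \<circ> A \<in> frames M (inv_into N f q))"
    using G by (intro exI[of _ W] exI[of _ G] conjI) auto
qed

lemma inv_into_subset_eq:
  assumes "inj_on f N" "A \<subseteq> N" "z \<in> f ` A"
  shows "inv_into N f z = inv_into A f z"
  using assms by (metis f_inv_into_f inj_on_subset inv_into_f_eq inv_into_into subsetD)

text \<open>Smoothness of \<open>f\<close> is local in the source and smoothness of its inverse is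
  local in the image, so the two pieces have to be relatively open on both sides.\<close>

lemma oemb_glue:
  assumes A: "oemb M M' A f" and B: "oemb M M' B f" and inj: "inj_on f (A \<union> B)"
    and opA: "openin (top_of_set (A \<union> B)) A" and opB: "openin (top_of_set (A \<union> B)) B"
    and ofA: "openin (top_of_set (f ` (A \<union> B))) (f ` A)" and ofB: "openin (top_of_set (f ` (A \<union> B))) (f ` B)"
  shows "oemb M M' (A \<union> B) f"
proof -
  have loc: "\<exists>U F. p \<in> U \<and> smooth_on U F \<and> (\<forall>y\<in>U \<inter> (A \<union> B). F y = f y) \<and>
        (\<forall>A\<in>frames M p. frechet_derivative F (at p) \<circ> A \<in> frames M' (f p))"
    if C: "oemb M M' C f" and op: "openin (top_of_set (A \<union> B)) C" and p: "p \<in> C" for C p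
  proof -
    obtain U F where U: "p \<in> U" "smooth_on U F" "\<forall>y\<in>U \<inter> C. F y = f y"
      "\<forall>A\<in>frames M p. frechet_derivative F (at p) \<circ> A \<in> frames M' (f p)"
      by (rule oembE[OF C p])
    obtain T where T: "open T" "C = (A \<union> B) \<inter> T" using op openin_open by metis
    have "smooth_on (U \<inter> T) F"
      by (rule smooth_on_subset[OF U(2)]) (use smooth_on_open[OF U(2)] T(1) in auto)
    then show ?thesis using U T p by (intro exI[of _ "U \<inter> T"] exI[of _ F] conjI) auto
  qed
  have "smooth_map (A \<union> B) f"
    by (rule smooth_map_locally)
      (use opA opB diffeoD(3)[OF oembD(3)[OF A]] diffeoD(3)[OF oembD(3)[OF B]] in blast)
  moreover have "smooth_map (f ` (A \<union> B)) (inv_into (A \<union> B) f)"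
  proof (rule smooth_map_locally)
    fix z assume z: "z \<in> f ` (A \<union> B)"
    have "smooth_map (f ` A) (inv_into (A \<union> B) f)"
      by (rule smooth_map_cong[OF diffeoD(4)[OF oembD(3)[OF A]]])
        (use inv_into_subset_eq[OF inj, of A] in simp)
    moreover have "smooth_map (f ` B) (inv_into (A \<union> B) f)"
      by (rule smooth_map_cong[OF diffeoD(4)[OF oembD(3)[OF B]]])
        (use inv_into_subset_eq[OF inj, of B] in simp)
    ultimately show "\<exists>V. openin (top_of_set (f ` (A \<union> B))) V \<and> z \<in> V \<and> smooth_map V (inv_into (A \<union> B) f)"
      using z ofA ofB by blast
  qed
  ultimately have "diffeo (A \<union> B) (f ` (A \<union> B)) f" using inj by (simp add: diffeo_def)
  moreover have "A \<union> B \<subseteq> pts M" "f ` (A \<union> B) \<subseteq> pts M'" using oembD(1,2)[OF A] oembD(1,2)[OF B] by auto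
  ultimately show ?thesis
    unfolding oemb_def using loc[OF A opA] loc[OF B opB] by (intro conjI) auto
qed

subsection \<open>Open subsets of Euclidean space and of the half-space\<close>

text \<open>With constant frames, charts become instances of \<open>oemb\<close> and orientation
  questions inside a chart become signs of determinants.\<close>

definition std :: "(real, 'n::{finite,one}) vec set \<Rightarrow> ((real, 'n) vec, 'n) omanifold" where
  "std S = \<lparr>pts = S, frames = \<lambda>_. {(\<lambda>v. B *v v) |B. 0 < det B}\<rparr>"

lemma std_simps [simp]: "pts (std S) = S" "frames (std S) p = {(\<lambda>v. B *v v) |B. 0 < det B}"
  by (simp_all add: std_def)

lemma diffeo_id: "diffeo S S (\<lambda>x. x)"
  by (rule diffeoI[where g = "\<lambda>x. x"]) (auto simp: smooth_map_id)

lemma oriented_chart_std: "full S \<Longrightarrow> oriented_chart (std S) S (\<lambda>x. x)"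
  unfolding oriented_chart_def smooth_chart_def full_def
  using diffeo_id[of S] by (auto intro!: exI[of _ id] simp: has_derivative_id id_def o_def)

lemma oriented_manifold_std: "full S \<Longrightarrow> oriented_manifold (std S)"
  using oriented_chart_std unfolding oriented_manifold_def by (metis image_ident std_simps(1))

lemma oriented_chart_oemb:
  assumes "oriented_chart M V \<phi>" "V \<subseteq> S"
  shows "oemb (std S) M V \<phi>"
  unfolding oemb_def
proof (intro conjI ballI)
  show "V \<subseteq> pts (std S)" "\<phi> ` V \<subseteq> pts M" "diffeo V (\<phi> ` V) \<phi>"
    using assms(2) oriented_chart_pts[OF assms(1)] oriented_chart_diffeo[OF assms(1)] by simp_all
  fix y assume y: "y \<in> V"
  obtain U F where U: "y \<in> U" "smooth_on U F" "\<forall>z\<in>U \<inter> V. F z = \<phi> z"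
    by (rule smooth_mapE[OF diffeoD(3)[OF oriented_chart_diffeo[OF assms(1)]] y])
  have "frames M (\<phi> y) = {frechet_derivative F (at y) \<circ> (\<lambda>v. B *v v) |B. 0 < det B}"
    by (rule oriented_chart_frames[OF assms(1) y smooth_map_has_derivative[OF U y]])
  then show "\<exists>U F. y \<in> U \<and> smooth_on U F \<and> (\<forall>z\<in>U \<inter> V. F z = \<phi> z) \<and>
        (\<forall>A\<in>frames (std S) y. frechet_derivative F (at y) \<circ> A \<in> frames M (\<phi> y))"
    using U by (intro exI[of _ U] exI[of _ F] conjI) auto
qed

text \<open>Read in an oriented chart, the derivative of \<open>g\<close> has a nonzero determinant
  depending continuously on the point, so its sign is locally constant, hence constant on the
  connected set \<open>V\<close>.\<close>

proposition immersion_orientation: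
  fixes g :: "(real, 'n::{finite,one}) vec \<Rightarrow> 'a::euclidean_space"
  assumes g: "smooth_on V g" and con: "connected V" and M: "oriented_manifold M" and im: "g ` V \<subseteq> pts M"
    and inj: "\<And>x. x \<in> V \<Longrightarrow> inj (frechet_derivative g (at x))"
  shows "(\<forall>x\<in>V. frechet_derivative g (at x) \<in> frames M (g x)) \<or>
    (\<forall>x\<in>V. frechet_derivative g (at x) \<notin> frames M (g x) \<and>
       (\<forall>B. det B < 0 \<longrightarrow> frechet_derivative g (at x) \<circ> (\<lambda>v. B *v v) \<in> frames M (g x)))"
proof -
  let ?D = "\<lambda>x. frechet_derivative g (at x)"
  define A where "A = {x\<in>V. ?D x \<in> frames M (g x)}"
  have V: "open V" by (rule smooth_on_open[OF g])
  have key: "\<exists>T m. open T \<and> x0 \<in> T \<and> T \<subseteq> V \<and> continuous_on T m \<and>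
      (\<forall>x\<in>T. m x \<noteq> 0 \<and> (?D x \<in> frames M (g x) \<longleftrightarrow> m x > (0::real)) \<and>
         (m x < 0 \<longrightarrow> (\<forall>B. det B < 0 \<longrightarrow> ?D x \<circ> (\<lambda>v. B *v v) \<in> frames M (g x))))" if x0: "x0 \<in> V" for x0
  proof -
    have "g x0 \<in> pts M" using im x0 by blast
    then obtain V1 \<phi> y0 where V1: "oriented_chart M V1 \<phi>" "y0 \<in> V1" "\<phi> y0 = g x0"
      using oriented_chart_at[OF M openin_subtopology_self] by metis
    have d: "diffeo V1 (\<phi> ` V1) \<phi>" by (rule oriented_chart_diffeo[OF V1(1)])
    have "g x0 \<in> \<phi> ` V1" using V1 by (metis imageI)
    then obtain U G where U: "g x0 \<in> U" "smooth_on U G" "\<forall>z\<in>U \<inter> \<phi> ` V1. G z = inv_into V1 \<phi> z"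
      by (rule smooth_mapE[OF diffeoD(4)[OF d]])
    obtain O' where O': "open O'" "\<phi> ` V1 = pts M \<inter> O'"
      using oriented_chart_openin[OF V1(1)] openin_open by metis
    define T where "T = V \<inter> g -` (U \<inter> O')"
    have T: "open T" unfolding T_def
      by (intro continuous_open_preimage smooth_on_continuous_on[OF g] V open_Int smooth_on_open[OF U(2)] O'(1))
    have TV: "T \<subseteq> V" by (auto simp: T_def)
    have gT: "g x \<in> U" "g x \<in> \<phi> ` V1" if "x \<in> T" for x using that im O'(2) by (auto simp: T_def)
    \<comment> \<open>\<open>k\<close> reads \<open>g\<close> in the chart around
      \<open>g x0\<close>. Defined through the extension \<open>G\<close>, it is smooth on an open
      set in the ordinary sense even if the chart lives on a piece of the half-space.\<close>
    define k where "k = (\<lambda>x. G (g x))"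
    have k: "smooth_on T k" unfolding k_def
      by (rule smooth_on_compose[OF U(2) smooth_on_subset[OF g T TV]]) (use gT in auto)
    have kV1: "k x \<in> V1" "\<phi> (k x) = g x" if "x \<in> T" for x
      using U(3) gT[OF that] diffeoD(6,7)[OF d] by (auto simp: k_def)
    define m where "m = (\<lambda>x. det (matrix (frechet_derivative k (at x))))"
    have "smooth_on T m" unfolding m_def
    proof (rule smooth_on_det[OF T])
      fix i j
      have "\<forall>n. Ck_on (Suc n) k T" using k by (simp only: smooth_on_def) blast
      then have "smooth_on T (\<lambda>x. frechet_derivative k (at x) (axis j 1))"
        using T by (simp add: smooth_on_def)
      then have "smooth_on T (\<lambda>x. frechet_derivative k (at x) (axis j 1) \<bullet> axis i 1)"
        by (rule smooth_on_inner[OF _ smooth_on_const[OF T]])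
      then show "smooth_on T (\<lambda>x. matrix (frechet_derivative k (at x)) $ i $ j)"
        by (simp add: matrix_def inner_axis)
    qed
    then have contm: "continuous_on T m" by (rule smooth_on_continuous_on)
    have "m x \<noteq> 0 \<and> (?D x \<in> frames M (g x) \<longleftrightarrow> m x > 0) \<and>
         (m x < 0 \<longrightarrow> (\<forall>B. det B < 0 \<longrightarrow> ?D x \<circ> (\<lambda>v. B *v v) \<in> frames M (g x)))" if x: "x \<in> T" for x
    proof -
      let ?K = "frechet_derivative k (at x)"
      have Dk: "(k has_derivative ?K) (at x)" by (rule smooth_on_has_derivative[OF k x])
      have linK: "linear ?K" by (rule has_derivative_linear[OF Dk])
      obtain D where D: "(\<phi> has_derivative D) (at (k x) within V1)"
        "frames M (\<phi> (k x)) = {D \<circ> (\<lambda>v. B *v v) |B. 0 < det B}"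
        by (rule oriented_chart_derivative[OF V1(1) kV1(1)[OF x]])
      have injD: "inj D" by (rule diffeo_derivative_inj[OF d oriented_chart_full[OF V1(1)] kV1(1)[OF x] D(1)])
      have "(k has_derivative ?K) (at x within T)" by (rule has_derivative_at_withinI[OF Dk])
      moreover have "(\<phi> has_derivative D) (at (k x) within k ` T)"
        by (rule has_derivative_subset[OF D(1)]) (use kV1 in blast)
      ultimately have "((\<lambda>x. \<phi> (k x)) has_derivative (\<lambda>v. D (?K v))) (at x within T)"
        by (rule has_derivative_in_compose)
      then have "((\<lambda>x. \<phi> (k x)) has_derivative (\<lambda>v. D (?K v))) (at x)"
        using at_within_open[OF x T] by simp
      then have "(g has_derivative (\<lambda>v. D (?K v))) (at x)"
        by (rule has_derivative_transform_within_open[OF _ T x]) (use kV1 in auto)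
      then have eq: "?D x = (\<lambda>v. D (?K v))" by (rule frechet_derivative_at[symmetric])
      have "inj (\<lambda>v. D (?K v))" using inj[OF subsetD[OF TV x]] eq by simp
      then have "inj (D \<circ> ?K)" by (simp only: comp_def)
      then have "inj ?K" by (rule inj_on_imageI2)
      then have nz: "m x \<noteq> 0" unfolding m_def using det_nz_iff_inj[OF linK] by simp
      have K: "?K = (\<lambda>v. matrix ?K *v v)" using linK by (simp add: matrix_works)
      have fr: "frames M (g x) = {D \<circ> (\<lambda>v. B *v v) |B. 0 < det B}" using D(2) kV1(2)[OF x] by simp
      have "?D x \<in> frames M (g x) \<longleftrightarrow> m x > 0"
      proof
        assume "?D x \<in> frames M (g x)"
        then obtain B where B: "?D x = D \<circ> (\<lambda>v. B *v v)" "0 < det B" using fr by blast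
        then have "D (?K v) = D (B *v v)" for v using eq by (metis comp_apply)
        then have "?K = (\<lambda>v. B *v v)" using injD by (auto simp: inj_def)
        then show "m x > 0" using B(2) by (simp add: m_def)
      next
        assume "m x > 0"
        moreover have "?D x = D \<circ> (\<lambda>v. matrix ?K *v v)" using eq K by (simp add: o_def)
        ultimately show "?D x \<in> frames M (g x)" using fr m_def by blast
      qed
      moreover have "?D x \<circ> (\<lambda>v. B *v v) \<in> frames M (g x)" if "m x < 0" "det B < 0" for B
      proof -
        have "?D x \<circ> (\<lambda>v. B *v v) = D \<circ> (\<lambda>v. (matrix ?K ** B) *v v)"
        proof
          fix v
          have "?K (B *v v) = (matrix ?K ** B) *v v"
            using linK matrix_vector_mul_assoc[of "matrix ?K" B v] by (simp add: matrix_works)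
          then show "(?D x \<circ> (\<lambda>v. B *v v)) v = (D \<circ> (\<lambda>v. (matrix ?K ** B) *v v)) v" by (simp add: eq)
        qed
        moreover have "0 < det (matrix ?K ** B)"
          using that by (simp add: det_mul m_def mult_neg_neg)
        ultimately show ?thesis using fr by blast
      qed
      ultimately show ?thesis using nz by blast
    qed
    moreover have "x0 \<in> T" using x0 U(1) \<open>g x0 \<in> \<phi> ` V1\<close> O'(2) by (auto simp: T_def)
    ultimately show ?thesis using T TV contm by blast
  qed
  have neg: "\<forall>B. det B < 0 \<longrightarrow> ?D x \<circ> (\<lambda>v. B *v v) \<in> frames M (g x)" if "x \<in> V" "x \<notin> A" for x
    using key[OF that(1)] that by (auto simp: A_def)
  have "open A"
  proof (subst open_subopen, intro ballI)
    fix x0 assume x0: "x0 \<in> A"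
    then obtain T m where T: "open T" "x0 \<in> T" "T \<subseteq> V" "continuous_on T m"
      "\<forall>x\<in>T. ?D x \<in> frames M (g x) \<longleftrightarrow> m x > (0::real)"
      using key[of x0] by (auto simp: A_def)
    have "open (T \<inter> m -` {0<..})" by (rule continuous_open_preimage[OF T(4,1)]) simp
    then show "\<exists>S. open S \<and> x0 \<in> S \<and> S \<subseteq> A"
      using T x0 by (intro exI[of _ "T \<inter> m -` {0<..}"]) (auto simp: A_def)
  qed
  moreover have "open (V - A)"
  proof (subst open_subopen, intro ballI)
    fix x0 assume x0: "x0 \<in> V - A"
    then obtain T m where T: "open T" "x0 \<in> T" "T \<subseteq> V" "continuous_on T m"
      "\<forall>x\<in>T. m x \<noteq> 0 \<and> (?D x \<in> frames M (g x) \<longleftrightarrow> m x > (0::real))"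
      using key[of x0] by blast
    have "open (T \<inter> m -` {..<0})" by (rule continuous_open_preimage[OF T(4,1)]) simp
    moreover have "m x0 < 0" using T x0 by (auto simp: A_def)
    ultimately show "\<exists>S. open S \<and> x0 \<in> S \<and> S \<subseteq> V - A"
      using T x0 by (intro exI[of _ "T \<inter> m -` {..<0}"]) (auto simp: A_def)
  qed
  ultimately have "A = {} \<or> V - A = {}"
    using connectedD[OF con, of A "V - A"] by (auto simp: A_def)
  then show ?thesis
  proof
    assume "A = {}"
    then show ?thesis using neg by (auto simp: A_def)
  next
    assume "V - A = {}"
    then show ?thesis by (auto simp: A_def)
  qed
qed

subsection \<open>Thin sets\<close>

text \<open>Two sets of dimensions 2 and 1 in a 4-manifold are disjoint after a small translation; thinness
  is stated for differentiable images of arbitrary planar sets so that it survives taking subsets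
  and the smooth changes of coordinates that are used on the way.\<close>

definition thin :: "'a::euclidean_space set \<Rightarrow> bool" where
  "thin P \<longleftrightarrow> (\<exists>\<F> :: ((real^2 \<Rightarrow> 'a) \<times> (real^2) set) set. countable \<F> \<and>
     (\<forall>(f, V)\<in>\<F>. f differentiable_on V) \<and> P \<subseteq> (\<Union>(f, V)\<in>\<F>. f ` V))"

lemma thinE:
  fixes P :: "'a::euclidean_space set"
  assumes "thin P"
  obtains \<F> :: "((real^2 \<Rightarrow> 'a) \<times> (real^2) set) set" where "countable \<F>" "\<forall>(f, V)\<in>\<F>. f differentiable_on V" "P \<subseteq> (\<Union>(f, V)\<in>\<F>. f ` V)"
  using assms unfolding thin_def by blast

lemma thin_subset: "thin P \<Longrightarrow> Q \<subseteq> P \<Longrightarrow> thin Q"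
  unfolding thin_def by (meson order_trans)

lemma thin_Un:
  fixes P Q :: "'a::euclidean_space set"
  assumes "thin P" "thin Q"
  shows "thin (P \<union> Q)"
proof -
  obtain \<F> :: "((real^2 \<Rightarrow> 'a) \<times> (real^2) set) set" where F: "countable \<F>" "\<forall>(f, V)\<in>\<F>. f differentiable_on V" "P \<subseteq> (\<Union>(f, V)\<in>\<F>. f ` V)"
    by (rule thinE[OF assms(1)])
  obtain \<G> :: "((real^2 \<Rightarrow> 'a) \<times> (real^2) set) set" where G: "countable \<G>" "\<forall>(f, V)\<in>\<G>. f differentiable_on V" "Q \<subseteq> (\<Union>(f, V)\<in>\<G>. f ` V)"
    by (rule thinE[OF assms(2)])
  have "P \<union> Q \<subseteq> (\<Union>(f, V)\<in>\<F> \<union> \<G>. f ` V)" 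
    unfolding UN_Un by (rule Un_mono[OF F(3) G(3)])
  then show ?thesis unfolding thin_def
    by (intro exI[of _ "\<F> \<union> \<G>"] conjI countable_Un F(1) G(1)) (use F(2) G(2) in auto)
qed

lemma thin_sing: "thin {p}"
  unfolding thin_def by (intro exI[of _ "{(\<lambda>x. p, UNIV)}"]) auto

lemma thin_negligible:
  fixes P :: "'a::euclidean_space set"
  assumes "thin P" "2 < DIM('a)"
  shows "negligible P"
proof -
  obtain \<F> :: "((real^2 \<Rightarrow> 'a) \<times> (real^2) set) set" where F: "countable \<F>" "\<forall>(f, V)\<in>\<F>. f differentiable_on V" "P \<subseteq> (\<Union>(f, V)\<in>\<F>. f ` V)"
    by (rule thinE[OF assms(1)])
  have "negligible (\<Union>((\<lambda>(f, V). f ` V) ` \<F>))"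
  proof (rule negligible_countable_Union)
    show "negligible S" if "S \<in> (\<lambda>(f, V). f ` V) ` \<F>" for S
      using that F(2) assms(2) by (auto intro!: negligible_differentiable_image_lowdim)
  qed (use F(1) in simp)
  then show ?thesis using F(3) negligible_subset by blast
qed

lemma smooth_map_differentiable:
  assumes "smooth_map S f"
  shows "f differentiable_on S"
  unfolding differentiable_on_def
proof
  fix x assume x: "x \<in> S"
  obtain U F where U: "x \<in> U" "smooth_on U F" "\<forall>y\<in>U \<inter> S. F y = f y"
    by (rule smooth_mapE[OF assms x])
  show "f differentiable at x within S"
    using smooth_map_has_derivative[OF U x] by (rule differentiableI)
qed

lemma thin_image:
  fixes g :: "'a::euclidean_space \<Rightarrow> 'b::euclidean_space"
  assumes g: "smooth_map S g" and P: "thin P" "P \<subseteq> S"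
  shows "thin (g ` P)"
proof -
  obtain \<F> :: "((real^2 \<Rightarrow> 'a) \<times> (real^2) set) set" where F: "countable \<F>" "\<forall>(f, V)\<in>\<F>. f differentiable_on V" "P \<subseteq> (\<Union>(f, V)\<in>\<F>. f ` V)"
    by (rule thinE[OF P(1)])
  define h where "h = (\<lambda>(f :: real^2 \<Rightarrow> 'a, V). (\<lambda>x. g (f x), V \<inter> f -` S))"
  have "g differentiable_on S" by (rule smooth_map_differentiable[OF g])
  have "(\<lambda>x. g (f x)) differentiable_on (V \<inter> f -` S)" if "(f, V) \<in> \<F>" for f V
  proof -
    have "f differentiable_on (V \<inter> f -` S)"
      by (rule differentiable_on_subset[of _ V]) (use F(2) that in auto)
    moreover have "g differentiable_on f ` (V \<inter> f -` S)"
      by (rule differentiable_on_subset[OF \<open>g differentiable_on S\<close>]) auto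
    ultimately show ?thesis by (rule differentiable_on_compose)
  qed
  moreover have "g ` P \<subseteq> (\<Union>(f, V)\<in>h ` \<F>. f ` V)"
  proof
    fix z assume "z \<in> g ` P"
    then obtain p where p: "p \<in> P" "z = g p" by blast
    then have "p \<in> (\<Union>(f, V)\<in>\<F>. f ` V)" using F(3) by blast
    then obtain f V x where f: "(f, V) \<in> \<F>" "x \<in> V" "p = f x" by auto
    have "x \<in> V \<inter> f -` S" using f p P(2) by auto
    then have "z \<in> (\<lambda>x. g (f x)) ` (V \<inter> f -` S)" using p f by blast
    moreover have "((\<lambda>x. g (f x)), V \<inter> f -` S) \<in> h ` \<F>"
      using imageI[OF f(1), of h] by (simp add: h_def)
    ultimately show "z \<in> (\<Union>(f, V)\<in>h ` \<F>. f ` V)" by blast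
  qed
  ultimately show ?thesis unfolding thin_def
    by (intro exI[of _ "h ` \<F>"] conjI countable_image F(1)) (auto simp: h_def)
qed

text \<open>By the Lindelof property countably many charts cover the surface, and their domains are
  planar.\<close>

lemma closed_surface_thin:
  fixes F :: "('a::euclidean_space, 2) omanifold"
  assumes "closed_surface F"
  shows "thin (pts F)"
proof -
  have "\<forall>p\<in>pts F. \<exists>c. oriented_chart F (fst c) (snd c) \<and> p \<in> snd c ` fst c"
    using assms by (simp add: closed_surface_def oriented_manifold_def)
  then obtain c where c: "\<forall>p\<in>pts F. oriented_chart F (fst (c p)) (snd (c p)) \<and> p \<in> snd (c p) ` fst (c p)"
    by (rule bchoice[THEN exE])
  define V where "V = (\<lambda>p. fst (c p))"
  define \<phi> where "\<phi> = (\<lambda>p. snd (c p))"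
  from c have V: "\<And>p. p \<in> pts F \<Longrightarrow> oriented_chart F (V p) (\<phi> p)" "\<And>p. p \<in> pts F \<Longrightarrow> p \<in> \<phi> p ` V p"
    by (auto simp: V_def \<phi>_def)
  obtain \<F>' where F': "\<F>' \<subseteq> (\<lambda>p. \<phi> p ` V p) ` pts F" "countable \<F>'" "\<Union>\<F>' = \<Union>((\<lambda>p. \<phi> p ` V p) ` pts F)"
  proof (rule Lindelof_openin)
    show "openin (top_of_set (pts F)) S" if "S \<in> (\<lambda>p. \<phi> p ` V p) ` pts F" for S
      using that oriented_chart_openin[OF V(1)] by blast
  qed
  obtain Q where Q: "countable Q" "Q \<subseteq> pts F" "\<F>' = (\<lambda>p. \<phi> p ` V p) ` Q"
    using iffD1[OF countable_subset_image, OF conjI[OF F'(2,1)]] by (elim exE conjE)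
  have "pts F \<subseteq> (\<Union>p\<in>Q. \<phi> p ` V p)" 
  proof
    fix p assume "p \<in> pts F"
    then have "p \<in> \<Union>((\<lambda>p. \<phi> p ` V p) ` pts F)" by (rule UN_I[where B = "\<lambda>p. \<phi> p ` V p"]) (rule V(2), fact)
    then show "p \<in> (\<Union>p\<in>Q. \<phi> p ` V p)" unfolding F'(3)[symmetric] Q(3) .
  qed
  moreover have "\<phi> p differentiable_on V p" if "p \<in> Q" for p
    using smooth_map_differentiable[OF diffeoD(3)[OF oriented_chart_diffeo[OF V(1)]]] Q(2) that by blast
  ultimately show ?thesis unfolding thin_def
    by (intro exI[of _ "(\<lambda>p. (\<phi> p, V p)) ` Q"] conjI countable_image Q(1)) auto
qed

subsection \<open>Transport of surfaces\<close>

lemma homologous_rel_chain_map: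
  assumes "homologous_rel p X S c c'" "continuous_map X Y f" "f \<in> S \<rightarrow> T"
  shows "homologous_rel p Y T (chain_map p f c) (chain_map p f c')"
  using singular_relboundary_chain_map[OF _ assms(2,3), of p "c - c'"] assms(1)
  by (simp add: homologous_rel_def chain_map_diff)

text \<open>\<open>E p\<close> stands for the ambient derivative at \<open>p\<close> of a local
  extension of \<open>f\<close>. It is a parameter, so that two surfaces meeting at \<open>p\<close>
  can be pushed with the same linear map.\<close>

definition push :: "('a::euclidean_space, 2) omanifold \<Rightarrow> ('a \<Rightarrow> 'b::euclidean_space) \<Rightarrow> ('a \<Rightarrow> 'a \<Rightarrow> 'b)
    \<Rightarrow> ('b, 2) omanifold" where
  "push F f E = \<lparr>pts = f ` pts F, frames = \<lambda>q. (\<lambda>A. E (inv_into (pts F) f q) \<circ> A) ` frames F (inv_into (pts F) f q)\<rparr>"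

locale surface_push =
  fixes F :: "('a::euclidean_space, 2) omanifold" and f :: "'a \<Rightarrow> 'b::euclidean_space" and E
  assumes F: "closed_surface F" and d: "diffeo (pts F) (f ` pts F) f"
    and E: "\<And>p. p \<in> pts F \<Longrightarrow> \<exists>U G. p \<in> U \<and> smooth_on U G \<and> (\<forall>y\<in>U \<inter> pts F. G y = f y) \<and> E p = frechet_derivative G (at p)"
begin

lemma inv_f [simp]: "p \<in> pts F \<Longrightarrow> inv_into (pts F) f (f p) = p"
  by (rule diffeoD(5)[OF d])

lemma pts_push: "pts (push F f E) = f ` pts F" by (simp add: push_def)

lemma frames_push: "p \<in> pts F \<Longrightarrow> frames (push F f E) (f p) = (\<lambda>A. E p \<circ> A) ` frames F p"
  by (simp add: push_def)

lemma smooth_chart_push: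
  fixes \<phi> :: "(real, 'k::{finite,one}) vec \<Rightarrow> 'a"
  assumes "smooth_chart (pts F) V \<phi>"
  shows "smooth_chart (f ` pts F) V (\<lambda>x. f (\<phi> x))"
proof -
  have op: "openin (top_of_set (pts F)) (\<phi> ` V)" and dV: "diffeo V (\<phi> ` V) \<phi>"
    using assms by (auto simp: smooth_chart_def)
  have sub: "\<phi> ` V \<subseteq> pts F" by (rule openin_imp_subset[OF op])
  have "diffeo V (f ` \<phi> ` V) (\<lambda>x. f (\<phi> x))"
    by (rule diffeo_compose[OF dV diffeo_subset[OF d sub]])
  moreover have "openin (top_of_set (f ` pts F)) (f ` \<phi> ` V)" by (rule diffeo_openin[OF d op])
  ultimately show ?thesis using assms by (simp add: smooth_chart_def image_image)
qed

lemma oriented_chart_push: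
  assumes V: "oriented_chart F V \<phi>"
  shows "oriented_chart (push F f E) V (\<lambda>x. f (\<phi> x))"
proof -
  have "\<exists>D. ((\<lambda>x. f (\<phi> x)) has_derivative D) (at y within V) \<and>
     frames (push F f E) (f (\<phi> y)) = {D \<circ> (\<lambda>v. B *v v) |B. 0 < det B}" if y: "y \<in> V" for y
  proof -
    have p: "\<phi> y \<in> pts F" using oriented_chart_pts[OF V] y by blast
    obtain U G where U: "\<phi> y \<in> U" "smooth_on U G" "\<forall>z\<in>U \<inter> pts F. G z = f z" "E (\<phi> y) = frechet_derivative G (at (\<phi> y))"
      using E[OF p] by blast
    obtain D where D: "(\<phi> has_derivative D) (at y within V)"
      "frames F (\<phi> y) = {D \<circ> (\<lambda>v. B *v v) |B. 0 < det B}"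
      by (rule oriented_chart_derivative[OF V y])
    have "((\<lambda>x. f (\<phi> x)) has_derivative (E (\<phi> y) \<circ> D)) (at y within V)"
      unfolding U(4) by (rule ext_compose_derivative[OF U(1-3) oriented_chart_pts[OF V] y D(1)])
    moreover have "frames (push F f E) (f (\<phi> y)) = {E (\<phi> y) \<circ> D \<circ> (\<lambda>v. B *v v) |B. 0 < det B}"
      unfolding frames_push[OF p] D(2) by (auto simp: comp_assoc image_iff)
    ultimately show ?thesis by blast
  qed
  then show ?thesis
    using smooth_chart_push[OF oriented_chart_smooth[OF V]] by (simp add: oriented_chart_def pts_push)
qed

lemma closed_surface_push: "closed_surface (push F f E)"
  unfolding closed_surface_def
proof (intro conjI)
  have cs: "oriented_manifold F" "compact (pts F)" "connected (pts F)" "pts F \<noteq> {}" "bdry F = {}"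
    using F by (auto simp: closed_surface_def)
  show "oriented_manifold (push F f E)"
    unfolding oriented_manifold_def pts_push
  proof
    fix q assume "q \<in> f ` pts F"
    then obtain p where p: "p \<in> pts F" "q = f p" by blast
    then obtain V \<phi> where "oriented_chart F V \<phi>" "p \<in> \<phi> ` V" using cs(1) unfolding oriented_manifold_def by blast
    then show "\<exists>V \<phi>. oriented_chart (push F f E) V \<phi> \<and> q \<in> \<phi> ` V"
      using oriented_chart_push p(2) by (metis (no_types, lifting) image_iff)
  qed
  show "compact (pts (push F f E))" unfolding pts_push
    by (rule compact_continuous_image[OF diffeoD(9)[OF d] cs(2)])
  show "connected (pts (push F f E))" unfolding pts_push
    by (rule connected_continuous_image[OF diffeoD(9)[OF d] cs(3)])
  show "pts (push F f E) \<noteq> {}" using cs(4) by (simp add: pts_push)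
  show "bdry (push F f E) = {}"
    unfolding bdry_def mfd_boundary_def pts_push
  proof -
    have "\<exists>V (\<phi> :: (real, 2) vec \<Rightarrow> 'b). open V \<and> smooth_chart (f ` pts F) V \<phi> \<and> f p \<in> \<phi> ` V" if "p \<in> pts F" for p
    proof -
      have "\<exists>V (\<phi> :: (real, 2) vec \<Rightarrow> 'a). open V \<and> smooth_chart (pts F) V \<phi> \<and> p \<in> \<phi> ` V"
        using cs(5) that unfolding bdry_def mfd_boundary_def by blast
      then obtain V and \<phi> :: "(real, 2) vec \<Rightarrow> 'a" where "open V" "smooth_chart (pts F) V \<phi>" "p \<in> \<phi> ` V" by blast
      then show ?thesis using smooth_chart_push[of V \<phi>]
        by (intro exI[of _ V] exI[of _ "\<lambda>x. f (\<phi> x)"]) auto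
    qed
    then show "{p \<in> f ` pts F. \<nexists>V (\<phi> :: (real, 2) vec \<Rightarrow> 'b). open V \<and> smooth_chart (f ` pts F) V \<phi> \<and> p \<in> \<phi> ` V} = {}"
      by blast
  qed
qed

text \<open>The triangle witnessing the local orientation is kept and only its chart is followed by
  \<open>f\<close>; injectivity of \<open>f\<close> sends the complement of \<open>p\<close> into
  the complement of its image.\<close>

lemma fundamental_cycle_push:
  assumes z: "fundamental_cycle F z"
  shows "fundamental_cycle (push F f E) (chain_map 2 f z)"
  unfolding fundamental_cycle_def pts_push
proof (intro conjI ballI)
  have cont: "continuous_map (top_of_set (pts F)) (top_of_set (f ` pts F)) f"
    using diffeoD(9)[OF d] by auto
  show "singular_relcycle 2 (top_of_set (f ` pts F)) {} (chain_map 2 f z)"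
    by (rule singular_relcycle_chain_map[OF _ cont]) (use z in \<open>auto simp: fundamental_cycle_def\<close>)
  fix q assume "q \<in> f ` pts F"
  then obtain p where p: "p \<in> pts F" "q = f p" by blast
  have "\<exists>V \<phi> a0 a1 a2. oriented_chart F V \<phi> \<and>
        convex hull {a0, a1, a2} \<subseteq> V \<and> p \<in> \<phi> ` interior (convex hull {a0, a1, a2}) \<and>
        0 < det (vector [a1 - a0, a2 - a0]) \<and>
        homologous_rel 2 (top_of_set (pts F)) (pts F - {p}) z
          (frag_of (restrict (\<lambda>x. \<phi> (x 0 *\<^sub>R a0 + x 1 *\<^sub>R a1 + x 2 *\<^sub>R a2)) (standard_simplex 2)))"
    using z p(1) unfolding fundamental_cycle_def by blast
  then obtain V \<phi> a0 a1 a2 where V: "oriented_chart F V \<phi>"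
        "convex hull {a0, a1, a2} \<subseteq> V" "p \<in> \<phi> ` interior (convex hull {a0, a1, a2})"
        "0 < det (vector [a1 - a0, a2 - a0])"
        "homologous_rel 2 (top_of_set (pts F)) (pts F - {p}) z
          (frag_of (restrict (\<lambda>x. \<phi> (x 0 *\<^sub>R a0 + x 1 *\<^sub>R a1 + x 2 *\<^sub>R a2)) (standard_simplex 2)))"
    by blast
  have "f \<in> pts F - {p} \<rightarrow> f ` pts F - {q}"
    using p diffeoD(1)[OF d] by (auto simp: inj_on_def)
  then have "homologous_rel 2 (top_of_set (f ` pts F)) (f ` pts F - {q}) (chain_map 2 f z)
     (chain_map 2 f (frag_of (restrict (\<lambda>x. \<phi> (x 0 *\<^sub>R a0 + x 1 *\<^sub>R a1 + x 2 *\<^sub>R a2)) (standard_simplex 2))))"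
    by (rule homologous_rel_chain_map[OF V(5) cont])
  moreover have "chain_map 2 f (frag_of (restrict (\<lambda>x. \<phi> (x 0 *\<^sub>R a0 + x 1 *\<^sub>R a1 + x 2 *\<^sub>R a2)) (standard_simplex 2)))
     = frag_of (restrict (\<lambda>x. f (\<phi> (x 0 *\<^sub>R a0 + x 1 *\<^sub>R a1 + x 2 *\<^sub>R a2))) (standard_simplex 2))"
    unfolding chain_map_of simplex_map_def
    by (rule arg_cong[where f = frag_of]) (simp only: restrict_def o_def fun_eq_iff if_True if_False split: if_splits, simp)
  moreover have "q \<in> (\<lambda>x. f (\<phi> x)) ` interior (convex hull {a0, a1, a2})" using V(3) p(2) by blast
  ultimately show "\<exists>V \<phi> a0 a1 a2. oriented_chart (push F f E) V \<phi> \<and>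
        convex hull {a0, a1, a2} \<subseteq> V \<and> q \<in> \<phi> ` interior (convex hull {a0, a1, a2}) \<and>
        0 < det (vector [a1 - a0, a2 - a0]) \<and>
        homologous_rel 2 (top_of_set (f ` pts F)) (f ` pts F - {q}) (chain_map 2 f z)
          (frag_of (restrict (\<lambda>x. \<phi> (x 0 *\<^sub>R a0 + x 1 *\<^sub>R a1 + x 2 *\<^sub>R a2)) (standard_simplex 2)))"
    using V(2,4) oriented_chart_push[OF V(1)]
    by (intro exI[of _ V] exI[of _ "\<lambda>x. f (\<phi> x)"] exI[of _ a0] exI[of _ a1] exI[of _ a2] conjI) simp_all
qed

lemma has_genus_push:
  assumes "has_genus F g"
  shows "has_genus (push F f E) g"
proof -
  have "pts F homeomorphic f ` pts F" 
    unfolding homeomorphic_def by (intro exI) (rule diffeo_homeomorphism[OF d])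
  then have "top_of_set (f ` pts F) homeomorphic_space top_of_set (pts F)"
    using homeomorphic_sym[of "pts F" "f ` pts F"] by (simp only: homeomorphic_space_iff_homeomorphic)
  then have "homology_group 1 (top_of_set (f ` pts F)) \<cong> homology_group 1 (top_of_set (pts F))"
    by (rule homeomorphic_space_imp_isomorphic_homology_groups)
  then show ?thesis using assms unfolding has_genus_def pts_push by (rule iso_trans)
qed

end

text \<open>Near \<open>p\<close> a chart of the surface is \<open>\<phi>\<close> composed with a
  smooth map into \<open>V\<close>; differentiating factors each surface frame through
  \<open>D\<close>. Two such frames at a common point then combine to a linear endomorphism of
  \<open>real^4\<close>, to which determinants apply.\<close>

lemma tangent_factor:
  fixes M :: "('a::euclidean_space, 4) omanifold" and F :: "('a, 2) omanifold"
  assumes F: "closed_surface F" "pts F \<subseteq> pts M" "p \<in> pts F" "A \<in> frames F p"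
    and V: "oriented_chart M V \<phi>" "y \<in> V" "\<phi> y = p" "(\<phi> has_derivative D) (at y within V)"
  shows "\<exists>L. linear L \<and> A = D \<circ> L"
proof -
  have oF: "oriented_manifold F" using F(1) by (simp add: closed_surface_def)
  have dV: "diffeo V (\<phi> ` V) \<phi>" by (rule oriented_chart_diffeo[OF V(1)])
  have "openin (top_of_set (pts F)) (pts F \<inter> \<phi> ` V)"
    using oriented_chart_openin[OF V(1)] F(2) unfolding openin_open by blast
  moreover have "p \<in> pts F \<inter> \<phi> ` V" using F(3) V(2,3) by blast
  ultimately obtain W \<psi> x where W: "oriented_chart F W \<psi>" "\<psi> ` W \<subseteq> pts F \<inter> \<phi> ` V" "x \<in> W" "\<psi> x = p"
    by (rule oriented_chart_at[OF oF])
  obtain D' where D': "(\<psi> has_derivative D') (at x within W)"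
    "frames F (\<psi> x) = {D' \<circ> (\<lambda>v. B *v v) |B. 0 < det B}"
    by (rule oriented_chart_derivative[OF W(1,3)])
  have "p \<in> \<phi> ` V" using V(2,3) by blast
  then obtain U G where U: "p \<in> U" "smooth_on U G" "\<forall>z\<in>U \<inter> \<phi> ` V. G z = inv_into V \<phi> z"
    by (rule smooth_mapE[OF diffeoD(4)[OF dV]])
  let ?h = "\<lambda>x. inv_into V \<phi> (\<psi> x)" and ?L = "frechet_derivative G (at p) \<circ> D'"
  have h: "(?h has_derivative ?L) (at x within W)"
    using ext_compose_derivative[where \<phi> = \<psi>, OF _ U(2,3) _ W(3) D'(1)] U(1) W(2,4) by simp
  have "?h x = y" using diffeoD(5)[OF dV V(2)] V(3) W(4) by simp
  moreover have "?h ` W \<subseteq> V" using W(2) diffeoD(7)[OF dV] by blast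
  ultimately have "(\<phi> has_derivative D) (at (?h x) within ?h ` W)"
    using has_derivative_subset[OF V(4)] by simp
  from has_derivative_in_compose[OF h this]
  have a: "((\<lambda>x. \<phi> (?h x)) has_derivative (\<lambda>v. D (?L v))) (at x within W)" .
  have b: "\<psi> z = \<phi> (?h z)" if "z \<in> W" for z
  proof -
    have "\<psi> z \<in> \<phi> ` V" using W(2) that by blast
    then show ?thesis using diffeoD(6)[OF dV] by metis
  qed
  have "(\<psi> has_derivative (\<lambda>v. D (?L v))) (at x within W)"
    by (rule has_derivative_transform[OF W(3) b a])
  then have eq: "D' = (\<lambda>v. D (?L v))"
    by (rule full_derivative_unique[OF oriented_chart_full[OF W(1)] W(3) D'(1)])
  obtain B where B: "A = D' \<circ> (\<lambda>v. B *v v)" using F(4) D'(2) W(4) by blast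
  have "linear (?L \<circ> (\<lambda>v. B *v v))"
    by (intro linear_compose matrix_vector_mul_linear has_derivative_linear[OF h])
  moreover have "A = D \<circ> (?L \<circ> (\<lambda>v. B *v v))"
  proof
    fix v
    have "A v = D' (B *v v)" by (simp add: B)
    also have "\<dots> = D (?L (B *v v))" by (rule fun_cong[OF eq])
    finally show "A v = (D \<circ> (?L \<circ> (\<lambda>v. B *v v))) v" by simp
  qed
  ultimately show ?thesis by blast
qed

lemma linear_juxtapose:
  fixes L L' :: "real^2 \<Rightarrow> 'a::euclidean_space"
  assumes "linear L" "linear L'"
  shows "linear (juxtapose L L')"
proof -
  have 1: "linear (\<lambda>v::real^4. vector [v $ 1, v $ 2] :: real^2)"
    by (rule linearI) (simp_all add: vec_eq_iff forall_2)
  have 2: "linear (\<lambda>v::real^4. vector [v $ 3, v $ 4] :: real^2)"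
    by (rule linearI) (simp_all add: vec_eq_iff forall_2)
  have "linear (\<lambda>v. (L \<circ> (\<lambda>v::real^4. vector [v $ 1, v $ 2])) v + (L' \<circ> (\<lambda>v. vector [v $ 3, v $ 4])) v)"
    by (intro linear_compose_add linear_compose 1 2 assms)
  then show ?thesis by (simp add: juxtapose_def[abs_def] o_def)
qed

lemma juxtapose_compose: "linear D \<Longrightarrow> juxtapose (D \<circ> L) (D \<circ> L') = D \<circ> juxtapose L L'"
  by (simp add: fun_eq_iff juxtapose_def linear_add)

text \<open>\<open>D\<close> is injective, so a second expression of \<open>D \<circ> J\<close>
  through a matrix determines that matrix.\<close>

lemma frames_compose:
  fixes M :: "('a::euclidean_space, 'n::{finite,one}) omanifold"
  assumes M: "oriented_manifold M" "p \<in> pts M" "D \<in> frames M p" and J: "linear J"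
  shows "D \<circ> J \<in> frames M p \<longleftrightarrow> 0 < det (matrix J)"
proof
  assume "D \<circ> J \<in> frames M p"
  then obtain B where B: "D \<circ> J = D \<circ> (\<lambda>v. B *v v)" "0 < det B" using frames_class(1)[OF M] by blast
  have "J v = B *v v" for v
    using fun_cong[OF B(1), of v] injD[OF frames_class(3)[OF M]] by simp
  then have "J = (\<lambda>v. B *v v)" by blast
  then show "0 < det (matrix J)" using B(2) by simp
next
  assume "0 < det (matrix J)"
  moreover have "D \<circ> J = D \<circ> (\<lambda>v. matrix J *v v)" using J by (simp add: fun_eq_iff matrix_works)
  ultimately show "D \<circ> J \<in> frames M p" unfolding frames_class(1)[OF M] by blast
qed

lemma oemb_choice:
  assumes "oemb M M' N f"
  obtains E where "\<forall>p\<in>N. \<exists>U F. p \<in> U \<and> smooth_on U F \<and> (\<forall>y\<in>U \<inter> N. F y = f y) \<and> E p = frechet_derivative F (at p)"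
    "\<forall>p\<in>N. \<forall>A\<in>frames M p. E p \<circ> A \<in> frames M' (f p)"
proof -
  have "\<forall>p\<in>N. \<exists>e. (\<exists>U F. p \<in> U \<and> smooth_on U F \<and> (\<forall>y\<in>U \<inter> N. F y = f y) \<and> e = frechet_derivative F (at p))
     \<and> (\<forall>A\<in>frames M p. e \<circ> A \<in> frames M' (f p))" (is "\<forall>p\<in>N. \<exists>e. ?P p e")
  proof
    fix p assume p: "p \<in> N"
    obtain U F where U: "p \<in> U" "smooth_on U F" "\<forall>y\<in>U \<inter> N. F y = f y"
      "\<forall>A\<in>frames M p. frechet_derivative F (at p) \<circ> A \<in> frames M' (f p)"
      by (rule oembE[OF assms p])
    have "\<exists>U F'. p \<in> U \<and> smooth_on U F' \<and> (\<forall>y\<in>U \<inter> N. F' y = f y) \<and>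
        frechet_derivative F (at p) = frechet_derivative F' (at p)"
      by (intro exI[of _ U] exI[of _ F] conjI U(1-3) refl)
    then show "\<exists>e. ?P p e" using U(4) by (intro exI[of _ "frechet_derivative F (at p)"] conjI)
  qed
  then obtain E where "\<forall>p\<in>N. ?P p (E p)" by (rule bchoice[THEN exE])
  then show ?thesis by (intro that[of E]) blast+
qed

lemma surface_push_subset:
  assumes F: "closed_surface F" "pts F \<subseteq> N" and d: "diffeo N (f ` N) f"
    and E: "\<And>p. p \<in> N \<Longrightarrow> \<exists>U G. p \<in> U \<and> smooth_on U G \<and> (\<forall>y\<in>U \<inter> N. G y = f y) \<and> E p = frechet_derivative G (at p)"
  shows "surface_push F f E"
proof
  show "closed_surface F" by fact
  show "diffeo (pts F) (f ` pts F) f" by (rule diffeo_subset[OF d F(2)])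
  fix p assume "p \<in> pts F"
  then have "p \<in> N" using F(2) by blast
  from E[OF this] obtain U G where "p \<in> U" "smooth_on U G" "\<forall>y\<in>U \<inter> N. G y = f y" "E p = frechet_derivative G (at p)"
    by (elim exE conjE)
  then show "\<exists>U G. p \<in> U \<and> smooth_on U G \<and> (\<forall>y\<in>U \<inter> pts F. G y = f y) \<and> E p = frechet_derivative G (at p)"
    using F(2) by (intro exI[of _ U] exI[of _ G] conjI) auto
qed

text \<open>At a common point the juxtaposed frames are \<open>D \<circ> J\<close> with
  \<open>D\<close> a frame of the 4-manifold and \<open>J\<close> an endomorphism of
  \<open>real^4\<close>. Pushing replaces \<open>D\<close> by \<open>E p \<circ> D\<close> and keeps
  \<open>J\<close>, while transversality and sign are read off from \<open>J\<close> alone.\<close>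

proposition push_pair:
  fixes M :: "('a::euclidean_space, 4) omanifold" and M' :: "('b::euclidean_space, 4) omanifold"
    and F G :: "('a, 2) omanifold"
  assumes M: "oriented_manifold M" "oriented_manifold M'" and f: "oemb M M' N f"
    and F: "closed_surface F" "pts F \<subseteq> N" and G: "closed_surface G" "pts G \<subseteq> N"
    and E: "\<And>p. p \<in> N \<Longrightarrow> \<exists>U F. p \<in> U \<and> smooth_on U F \<and> (\<forall>y\<in>U \<inter> N. F y = f y) \<and> E p = frechet_derivative F (at p)"
    and E': "\<And>p A. p \<in> N \<Longrightarrow> A \<in> frames M p \<Longrightarrow> E p \<circ> A \<in> frames M' (f p)"
  shows "transverse F G \<Longrightarrow> transverse (push F f E) (push G f E)"
    and "(\<Sum>p \<in> pts (push F f E) \<inter> pts (push G f E). intersection_sign M' (push F f E) (push G f E) p)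
       = (\<Sum>p \<in> pts F \<inter> pts G. intersection_sign M F G p)"
proof -
  interpret F: surface_push F f E by (rule surface_push_subset[OF F oembD(3)[OF f] E])
  interpret G: surface_push G f E by (rule surface_push_subset[OF G oembD(3)[OF f] E])
  have N: "N \<subseteq> pts M" and inj: "inj_on f N" using oembD(1)[OF f] diffeoD(1)[OF oembD(3)[OF f]] .
  have key: "\<exists>D J. D \<in> frames M p \<and> linear J \<and> juxtapose A B = D \<circ> J \<and> juxtapose (E p \<circ> A) (E p \<circ> B) = E p \<circ> D \<circ> J"
    if p: "p \<in> pts F" "p \<in> pts G" and A: "A \<in> frames F p" and B: "B \<in> frames G p" for p A B
  proof -
    have pM: "p \<in> pts M" and pN: "p \<in> N" using p F N by auto
    obtain V \<phi> y where V: "oriented_chart M V \<phi>" "y \<in> V" "\<phi> y = p"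
      using oriented_chart_at[OF M(1) openin_subtopology_self pM] by metis
    obtain D where D: "(\<phi> has_derivative D) (at y within V)" "D \<in> frames M (\<phi> y)"
      by (rule oriented_chart_derivative[OF V(1,2)])
    have sF: "pts F \<subseteq> pts M" and sG: "pts G \<subseteq> pts M" using F(2) G(2) N by auto
    obtain L where L: "linear L" "A = D \<circ> L" using tangent_factor[OF F(1) sF p(1) A V D(1)] by blast
    obtain L' where L': "linear L'" "B = D \<circ> L'" using tangent_factor[OF G(1) sG p(2) B V D(1)] by blast
    have linD: "linear D" by (rule has_derivative_linear[OF D(1)])
    obtain U H where U: "p \<in> U" "smooth_on U H" "E p = frechet_derivative H (at p)" using E[OF pN] by blast
    have "linear (E p)" unfolding U(3) by (rule has_derivative_linear[OF smooth_on_has_derivative[OF U(2,1)]])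
    then have linED: "linear (E p \<circ> D)" using linD linear_compose by blast
    have "juxtapose A B = D \<circ> juxtapose L L'" unfolding L(2) L'(2) by (rule juxtapose_compose[OF linD])
    moreover have "juxtapose (E p \<circ> A) (E p \<circ> B) = E p \<circ> D \<circ> juxtapose L L'"
      unfolding L(2) L'(2) comp_assoc[symmetric] by (rule juxtapose_compose[OF linED])
    ultimately show ?thesis using D(2) V(3) linear_juxtapose[OF L(1) L'(1)]
      by (intro exI[of _ D] exI[of _ "juxtapose L L'"] conjI) simp_all
  qed
  have pM': "f p \<in> pts M'" if "p \<in> N" for p using oembD(2)[OF f] that by blast
  have int: "pts (push F f E) \<inter> pts (push G f E) = f ` (pts F \<inter> pts G)"
    unfolding F.pts_push G.pts_push using inj_on_image_Int[OF inj F(2) G(2)] by simp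
  show "transverse (push F f E) (push G f E)" if t: "transverse F G"
    unfolding transverse_def int
  proof (intro ballI)
    fix q A' B' assume q: "q \<in> f ` (pts F \<inter> pts G)" "A' \<in> frames (push F f E) q" "B' \<in> frames (push G f E) q"
    then obtain p where p: "p \<in> pts F" "p \<in> pts G" "q = f p" by blast
    obtain A B where AB: "A \<in> frames F p" "A' = E p \<circ> A" "B \<in> frames G p" "B' = E p \<circ> B"
      using q(2,3) unfolding p(3) F.frames_push[OF p(1)] G.frames_push[OF p(2)] by blast
    obtain D J where D: "D \<in> frames M p" "juxtapose A B = D \<circ> J" "juxtapose A' B' = E p \<circ> D \<circ> J"
      using key[OF p(1,2) AB(1,3)] AB(2,4) by blast
    have pN: "p \<in> N" using p F by auto
    have "inj (juxtapose A B)" using t p(1,2) AB(1,3) unfolding transverse_def by blast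
    then have "inj J" unfolding D(2) by (rule inj_on_imageI2)
    moreover have "inj (E p \<circ> D)" by (rule frames_class(3)[OF M(2) pM'[OF pN] E'[OF pN D(1)]])
    ultimately show "inj (juxtapose A' B')" unfolding D(3) by (rule inj_compose[rotated])
  qed
  have sign: "intersection_sign M' (push F f E) (push G f E) (f p) = intersection_sign M F G p"
    if p: "p \<in> pts F \<inter> pts G" for p
  proof -
    have p': "p \<in> pts F" "p \<in> pts G" "p \<in> N" "p \<in> pts M" using p F N by auto
    have "juxtapose (E p \<circ> A) (E p \<circ> B) \<in> frames M' (f p) \<longleftrightarrow> juxtapose A B \<in> frames M p"
      if A: "A \<in> frames F p" and B: "B \<in> frames G p" for A B
    proof -
      obtain D J where D: "D \<in> frames M p" "linear J" "juxtapose A B = D \<circ> J" "juxtapose (E p \<circ> A) (E p \<circ> B) = E p \<circ> D \<circ> J"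
        using key[OF p'(1,2) A B] by blast
      show ?thesis unfolding D(3,4)
        using frames_compose[OF M(1) p'(4) D(1,2)] frames_compose[OF M(2) pM'[OF p'(3)] E'[OF p'(3) D(1)] D(2)] by simp
    qed
    then show ?thesis
      unfolding intersection_sign_def F.frames_push[OF p'(1)] G.frames_push[OF p'(2)] by simp
  qed
  have "inj_on f (pts F \<inter> pts G)" by (rule inj_on_subset[OF inj]) (use F(2) in auto)
  then show "(\<Sum>p \<in> pts (push F f E) \<inter> pts (push G f E). intersection_sign M' (push F f E) (push G f E) p)
       = (\<Sum>p \<in> pts F \<inter> pts G. intersection_sign M F G p)"
    unfolding int by (simp add: sum.reindex sign)
qed

subsection \<open>A criterion for algebraic equivalence\<close>

abbreviation cls :: "('a::euclidean_space, 4) omanifold \<Rightarrow> 'a chain \<Rightarrow> 'a chain set" where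
  "cls X z \<equiv> homologous_rel_set 2 (top_of_set (pts X)) {} z"

lemma cls_carrier: "singular_relcycle 2 (top_of_set (pts X)) {} z \<Longrightarrow> cls X z \<in> carrier (H2 X)"
  using carrier_relative_homology_group[of 2 "top_of_set (pts X)" "{}"] by auto

lemma fundamental_cycle_mono:
  assumes "fundamental_cycle F z" "pts F \<subseteq> N"
  shows "singular_relcycle 2 (top_of_set N) {} z"
  using singular_cycle_mono[of 2 euclidean "pts F" z N] assms by (auto simp: fundamental_cycle_def)

lemma represents_carrier: "represents X F \<alpha> \<Longrightarrow> \<alpha> \<in> carrier (H2 X)"
  unfolding represents_def using cls_carrier fundamental_cycle_mono by blast

text \<open>\<open>P\<close> plays the role of a union of two surfaces, since intersections are
  preserved only if one embedding carries both. \<open>R\<close> compares the class of a cycle with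
  the class of its image.\<close>

definition movable :: "('a::euclidean_space, 4) omanifold \<Rightarrow> ('b::euclidean_space, 4) omanifold
    \<Rightarrow> ('a chain \<Rightarrow> 'b chain \<Rightarrow> bool) \<Rightarrow> bool" where
  "movable X W R \<longleftrightarrow> (\<forall>P. compact P \<longrightarrow> thin P \<longrightarrow> P \<subseteq> pts X \<longrightarrow>
     (\<exists>N f. P \<subseteq> N \<and> oemb X W N f \<and>
       (\<forall>z. singular_relcycle 2 (top_of_set N) {} z \<longrightarrow> R z (chain_map 2 f z))))"

text \<open>Both surfaces are pushed by the same \<open>f\<close> and the same \<open>E\<close>, so
  their intersection pattern travels with them. The relation \<open>Q\<close> on classes is left
  abstract because it is used with the isomorphism pointing in either direction.\<close>

lemma movable_surfaces:
  fixes X :: "('a::euclidean_space, 4) omanifold" and W :: "('b::euclidean_space, 4) omanifold"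
  assumes X: "oriented_manifold X" and W: "oriented_manifold W" and mv: "movable X W R"
    and F: "represents X F \<alpha>" and G: "represents X G \<beta>"
    and R: "\<And>z w. singular_relcycle 2 (top_of_set (pts X)) {} z \<Longrightarrow>
       singular_relcycle 2 (top_of_set (pts W)) {} w \<Longrightarrow> R z w \<Longrightarrow> Q (cls X z) (cls W w)"
  shows "\<exists>F' G' \<alpha>' \<beta>'. represents W F' \<alpha>' \<and> represents W G' \<beta>' \<and> Q \<alpha> \<alpha>' \<and> Q \<beta> \<beta>' \<and>
    (\<forall>g. has_genus F g \<longrightarrow> has_genus F' g) \<and> (transverse F G \<longrightarrow> transverse F' G') \<and>
    (\<Sum>p \<in> pts F' \<inter> pts G'. intersection_sign W F' G' p) = (\<Sum>p \<in> pts F \<inter> pts G. intersection_sign X F G p)"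
proof -
  have cF: "closed_surface F" "pts F \<subseteq> pts X" and cG: "closed_surface G" "pts G \<subseteq> pts X"
    using F G by (auto simp: represents_def)
  have "compact (pts F \<union> pts G)" using cF cG by (auto simp: closed_surface_def)
  moreover have "thin (pts F \<union> pts G)" by (intro thin_Un closed_surface_thin cF cG)
  moreover have "pts F \<union> pts G \<subseteq> pts X" using cF cG by auto
  ultimately obtain N f where N: "pts F \<union> pts G \<subseteq> N" "oemb X W N f"
    "\<forall>z. singular_relcycle 2 (top_of_set N) {} z \<longrightarrow> R z (chain_map 2 f z)"
    using mv unfolding movable_def by meson
  have FN: "pts F \<subseteq> N" and GN: "pts G \<subseteq> N" using N(1) by auto
  obtain E where E0: "\<forall>p\<in>N. \<exists>U F. p \<in> U \<and> smooth_on U F \<and> (\<forall>y\<in>U \<inter> N. F y = f y) \<and> E p = frechet_derivative F (at p)"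
    "\<forall>p\<in>N. \<forall>A\<in>frames X p. E p \<circ> A \<in> frames W (f p)"
    by (rule oemb_choice[OF N(2)])
  note E = bspec[OF E0(1)] bspec[OF bspec[OF E0(2)]]
  have rep: "\<exists>\<gamma>'. represents W (push H f E) \<gamma>' \<and> Q \<gamma> \<gamma>'"
    if H: "represents X H \<gamma>" and HN: "pts H \<subseteq> N" for H \<gamma>
  proof -
    obtain z where z: "closed_surface H" "fundamental_cycle H z" "\<gamma> = cls X z"
      using H by (auto simp: represents_def)
    interpret H: surface_push H f E by (rule surface_push_subset[OF z(1) HN oembD(3)[OF N(2)] E(1)])
    have zN: "singular_relcycle 2 (top_of_set N) {} z" by (rule fundamental_cycle_mono[OF z(2) HN])
    have zX: "singular_relcycle 2 (top_of_set (pts X)) {} z"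
      by (rule fundamental_cycle_mono[OF z(2)]) (use HN oembD(1)[OF N(2)] in blast)
    have fc: "fundamental_cycle (push H f E) (chain_map 2 f z)" by (rule H.fundamental_cycle_push[OF z(2)])
    have sub: "pts (push H f E) \<subseteq> pts W" using HN oembD(2)[OF N(2)] by (auto simp: H.pts_push)
    have zW: "singular_relcycle 2 (top_of_set (pts W)) {} (chain_map 2 f z)" by (rule fundamental_cycle_mono[OF fc sub])
    have "represents W (push H f E) (cls W (chain_map 2 f z))"
      unfolding represents_def using H.closed_surface_push sub fc by blast
    moreover have "Q \<gamma> (cls W (chain_map 2 f z))" unfolding z(3) by (rule R[OF zX zW]) (use N(3) zN in blast)
    ultimately show ?thesis by blast
  qed
  obtain \<alpha>' where a: "represents W (push F f E) \<alpha>'" "Q \<alpha> \<alpha>'" using rep[OF F FN] by blast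
  obtain \<beta>' where b: "represents W (push G f E) \<beta>'" "Q \<beta> \<beta>'" using rep[OF G GN] by blast
  interpret F: surface_push F f E by (rule surface_push_subset[OF cF(1) FN oembD(3)[OF N(2)] E(1)])
  note pp = push_pair[OF X W N(2) cF(1) FN cG(1) GN E]
  have gen: "\<forall>g. has_genus F g \<longrightarrow> has_genus (push F f E) g" using F.has_genus_push by blast
  have tr: "transverse F G \<longrightarrow> transverse (push F f E) (push G f E)" using pp(1) by blast
  show ?thesis
    by (rule exI[of _ "push F f E"], rule exI[of _ "push G f E"], rule exI[of _ \<alpha>'], rule exI[of _ \<beta>'])
      (intro conjI a b gen tr pp(2))
qed

text \<open>Moving surfaces both ways makes the predicates under \<open>LEAST\<close> and
  \<open>THE\<close> equivalent for each value \<open>g\<close> or \<open>n\<close>; the described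
  numbers then coincide even where no surface satisfies the predicate.\<close>

proposition alg_equivI:
  fixes X :: "('a::euclidean_space, 4) omanifold" and W :: "('b::euclidean_space, 4) omanifold"
  assumes X: "oriented_manifold X" and W: "oriented_manifold W" and h: "h \<in> iso (H2 X) (H2 W)"
    and XW: "movable X W (\<lambda>z w. h (cls X z) = cls W w)" and WX: "movable W X (\<lambda>w z. h (cls X z) = cls W w)"
  shows "alg_equiv X W"
  unfolding alg_equiv_def
proof (intro bexI[of _ h] conjI ballI h)
  have inj: "inj_on h (carrier (H2 X))" using h by (simp add: iso_def bij_betw_def)
  note tXW = movable_surfaces[OF X W XW, where Q = "\<lambda>\<alpha> \<alpha>'. h \<alpha> = \<alpha>'"]
  note tWX = movable_surfaces[OF W X WX, where Q = "\<lambda>\<alpha>' \<alpha>. h \<alpha> = \<alpha>'"]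
  {
    fix \<alpha> assume a: "\<alpha> \<in> carrier (H2 X)"
    have "(\<exists>F. represents W F (h \<alpha>) \<and> has_genus F g) \<longleftrightarrow> (\<exists>F. represents X F \<alpha> \<and> has_genus F g)" for g
    proof
      assume "\<exists>F. represents X F \<alpha> \<and> has_genus F g"
      then obtain F where F: "represents X F \<alpha>" "has_genus F g" by blast
      from tXW[OF F(1) F(1)] F(2) show "\<exists>F. represents W F (h \<alpha>) \<and> has_genus F g" by blast
    next
      assume "\<exists>F. represents W F (h \<alpha>) \<and> has_genus F g"
      then obtain F where F: "represents W F (h \<alpha>)" "has_genus F g" by blast
      from tWX[OF F(1) F(1)] obtain F' \<alpha>' where F': "represents X F' \<alpha>'" "h \<alpha>' = h \<alpha>" "has_genus F g \<longrightarrow> has_genus F' g"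
        by blast
      \<comment> \<open>The surface moved back represents some class with the same image under
        \<open>h\<close>; injectivity identifies this class.\<close>
      have "\<alpha>' = \<alpha>" by (rule inj_onD[OF inj F'(2) represents_carrier[OF F'(1)] a])
      then show "\<exists>F. represents X F \<alpha> \<and> has_genus F g" using F' F(2) by blast
    qed
    then show "genus_function W (h \<alpha>) = genus_function X \<alpha>" by (simp add: genus_function_def)
  next
    fix \<alpha> \<beta> assume a: "\<alpha> \<in> carrier (H2 X)" and b: "\<beta> \<in> carrier (H2 X)"
    have "(\<exists>F G. represents W F (h \<alpha>) \<and> represents W G (h \<beta>) \<and> transverse F G \<and>
        n = (\<Sum>p \<in> pts F \<inter> pts G. intersection_sign W F G p)) \<longleftrightarrow>
       (\<exists>F G. represents X F \<alpha> \<and> represents X G \<beta> \<and> transverse F G \<and>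
        n = (\<Sum>p \<in> pts F \<inter> pts G. intersection_sign X F G p))" (is "?L \<longleftrightarrow> ?R") for n
    proof
      assume ?R
      then obtain F G where FG: "represents X F \<alpha>" "represents X G \<beta>" "transverse F G"
        "n = (\<Sum>p \<in> pts F \<inter> pts G. intersection_sign X F G p)" by blast
      from tXW[OF FG(1,2)] obtain F' G' where F': "represents W F' (h \<alpha>)" "represents W G' (h \<beta>)" "transverse F G \<longrightarrow> transverse F' G'"
         "(\<Sum>p \<in> pts F' \<inter> pts G'. intersection_sign W F' G' p) = (\<Sum>p \<in> pts F \<inter> pts G. intersection_sign X F G p)" by blast
      show ?L by (rule exI[of _ F'], rule exI[of _ G']) (use FG F' in simp)
    next
      assume ?L
      then obtain F G where FG: "represents W F (h \<alpha>)" "represents W G (h \<beta>)" "transverse F G"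
        "n = (\<Sum>p \<in> pts F \<inter> pts G. intersection_sign W F G p)" by blast
      from tWX[OF FG(1,2)] obtain F' G' \<alpha>' \<beta>' where F': "represents X F' \<alpha>'" "represents X G' \<beta>'" "h \<alpha>' = h \<alpha>" "h \<beta>' = h \<beta>"
        "transverse F G \<longrightarrow> transverse F' G'"
         "(\<Sum>p \<in> pts F' \<inter> pts G'. intersection_sign X F' G' p) = (\<Sum>p \<in> pts F \<inter> pts G. intersection_sign W F G p)" by blast
      have "\<alpha>' = \<alpha>" "\<beta>' = \<beta>"
        using inj_onD[OF inj F'(3) represents_carrier[OF F'(1)] a] inj_onD[OF inj F'(4) represents_carrier[OF F'(2)] b] by auto
      then show ?R using FG F' by (intro exI[of _ F'] exI[of _ G']) simp
    qed
    then show "intersection_form W (h \<alpha>) (h \<beta>) = intersection_form X \<alpha> \<beta>" by (simp add: intersection_form_def)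
  }
qed

lemma alg_equiv_sym:
  assumes "alg_equiv X Y"
  shows "alg_equiv Y X"
proof -
  obtain h where h: "h \<in> iso (H2 X) (H2 Y)"
    "\<forall>\<alpha> \<in> carrier (H2 X). genus_function Y (h \<alpha>) = genus_function X \<alpha>"
    "\<forall>\<alpha> \<in> carrier (H2 X). \<forall>\<beta> \<in> carrier (H2 X). intersection_form Y (h \<alpha>) (h \<beta>) = intersection_form X \<alpha> \<beta>"
    using assms unfolding alg_equiv_def by blast
  let ?k = "inv_into (carrier (H2 X)) h"
  have k: "?k \<in> iso (H2 Y) (H2 X)"
    by (rule group.iso_set_sym[OF group_relative_homology_group h(1)])
  have im: "h ` carrier (H2 X) = carrier (H2 Y)" using h(1) by (simp add: iso_def bij_betw_def)
  have kc: "?k \<beta> \<in> carrier (H2 X)" "h (?k \<beta>) = \<beta>" if "\<beta> \<in> carrier (H2 Y)" for \<beta>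
    using that im by (auto simp: inv_into_into f_inv_into_f)
  show ?thesis unfolding alg_equiv_def
    by (rule bexI[OF _ k]) (metis h(2,3) kc)
qed

lemma alg_equiv_trans:
  assumes "alg_equiv X Y" "alg_equiv Y Z"
  shows "alg_equiv X Z"
proof -
  obtain h where h: "h \<in> iso (H2 X) (H2 Y)"
    "\<forall>\<alpha> \<in> carrier (H2 X). genus_function Y (h \<alpha>) = genus_function X \<alpha>"
    "\<forall>\<alpha> \<in> carrier (H2 X). \<forall>\<beta> \<in> carrier (H2 X). intersection_form Y (h \<alpha>) (h \<beta>) = intersection_form X \<alpha> \<beta>"
    using assms(1) unfolding alg_equiv_def by blast
  obtain k where k: "k \<in> iso (H2 Y) (H2 Z)"
    "\<forall>\<alpha> \<in> carrier (H2 Y). genus_function Z (k \<alpha>) = genus_function Y \<alpha>"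
    "\<forall>\<alpha> \<in> carrier (H2 Y). \<forall>\<beta> \<in> carrier (H2 Y). intersection_form Z (k \<alpha>) (k \<beta>) = intersection_form Y \<alpha> \<beta>"
    using assms(2) unfolding alg_equiv_def by blast
  have c: "h \<alpha> \<in> carrier (H2 Y)" if "\<alpha> \<in> carrier (H2 X)" for \<alpha>
    using h(1) that by (auto simp: iso_def bij_betw_def)
  have kh: "k \<circ> h \<in> iso (H2 X) (H2 Z)" using iso_set_trans[OF h(1) k(1)] .
  show ?thesis unfolding alg_equiv_def
    by (rule bexI[OF _ kh]) (use h(2,3) k(2,3) c in simp)
qed

subsection \<open>A Mayer-Vietoris argument\<close>

abbreviation cyc :: "nat \<Rightarrow> 'a::topological_space set \<Rightarrow> 'a chain \<Rightarrow> bool" where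
  "cyc p S z \<equiv> singular_relcycle p (top_of_set S) {} z"

abbreviation bd :: "nat \<Rightarrow> 'a::topological_space set \<Rightarrow> 'a chain \<Rightarrow> bool" where
  "bd p S z \<equiv> singular_relboundary p (top_of_set S) {} z"

abbreviation hlg :: "nat \<Rightarrow> 'a::topological_space set \<Rightarrow> 'a chain \<Rightarrow> 'a chain \<Rightarrow> bool" where
  "hlg p S \<equiv> homologous_rel p (top_of_set S) {}"

text \<open>Vanishing homology stated for chains, so that the exactness arguments can be made with
  explicit chains.\<close>

definition ac :: "nat \<Rightarrow> 'a::topological_space set \<Rightarrow> bool" where
  "ac p S \<longleftrightarrow> (\<forall>z. cyc p S z \<longrightarrow> bd p S z)"

lemma acD: "ac p S \<Longrightarrow> cyc p S z \<Longrightarrow> bd p S z"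
  by (simp add: ac_def)

lemma hlg_iff: "hlg p S z w \<longleftrightarrow> bd p S (z - w)"
  by (simp add: homologous_rel_def)

lemma bd_mono: "bd p S z \<Longrightarrow> S \<subseteq> T \<Longrightarrow> bd p T z"
  unfolding singular_boundary by (blast intro: singular_chain_mono)

lemma cyc_mono: "cyc p S z \<Longrightarrow> S \<subseteq> T \<Longrightarrow> cyc p T z"
  by (rule singular_cycle_mono)

lemma hlg_mono: "hlg p S z w \<Longrightarrow> S \<subseteq> T \<Longrightarrow> hlg p T z w"
  unfolding hlg_iff by (rule bd_mono)

lemma cyc_map: "cyc p S z \<Longrightarrow> continuous_on S f \<Longrightarrow> f ` S \<subseteq> T \<Longrightarrow> cyc p T (chain_map p f z)"
  by (rule singular_relcycle_chain_map) (auto simp: image_subset_iff)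

lemma bd_map: "bd p S z \<Longrightarrow> continuous_on S f \<Longrightarrow> f ` S \<subseteq> T \<Longrightarrow> bd p T (chain_map p f z)"
  by (rule singular_relboundary_chain_map) (auto simp: image_subset_iff)

lemma hlg_map: "hlg p S z w \<Longrightarrow> continuous_on S f \<Longrightarrow> f ` S \<subseteq> T \<Longrightarrow> hlg p T (chain_map p f z) (chain_map p f w)"
  by (rule homologous_rel_chain_map) (auto simp: image_subset_iff)

lemma chain_map_chain_map: "chain_map p g (chain_map p f z) = chain_map p (\<lambda>x. g (f x)) z"
proof -
  have "chain_map p (g \<circ> f) z = (chain_map p g \<circ> chain_map p f) z" by (rule fun_cong[OF chain_map_compose])
  then show ?thesis unfolding comp_def by (rule sym)
qed

lemma chain_map_id_on:
  assumes "cyc p S z" "\<And>x. x \<in> S \<Longrightarrow> f x = x"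
  shows "chain_map p f z = z"
  by (rule chain_map_id_gen[of p "top_of_set S"]) (use assms in \<open>auto simp: singular_cycle\<close>)

lemma singular_chain_Int:
  "singular_chain p (top_of_set A) c \<Longrightarrow> singular_chain p (top_of_set B) c \<Longrightarrow> singular_chain p (top_of_set (A \<inter> B)) c"
  unfolding singular_chain_subtopology by blast

text \<open>This is the subdivision step of excision, with \<open>B - A\<close> as the excised set:
  it is closed because \<open>A\<close> is open, and it lies in the open set \<open>B\<close>. What
  remains of the union after excising it is \<open>A\<close>.\<close>

lemma split_chain:
  assumes c: "singular_chain p (top_of_set (A \<union> B)) c"
    and A: "openin (top_of_set (A \<union> B)) A" and B: "openin (top_of_set (A \<union> B)) B"
  obtains n d e where "singular_chain p (top_of_set A) d" "singular_chain p (top_of_set B) e"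
    "(singular_subdivision p ^^ n) c = d + e"
proof -
  let ?X = "top_of_set (A \<union> B)"
  have "?X closure_of (B - A) = B - A"
  proof (rule closure_of_closedin)
    have "closedin ?X (A \<union> B - A)" using closedin_diff[OF closedin_topspace A] by simp
    moreover have "A \<union> B - A = B - A" by blast
    ultimately show "closedin ?X (B - A)" by simp
  qed
  moreover have "?X interior_of B = B" by (rule interior_of_openin[OF B])
  ultimately have 1: "?X closure_of (B - A) \<subseteq> ?X interior_of B" by auto
  have 2: "subtopology ?X (A \<union> B) = ?X" by (simp add: subtopology_subtopology)
  have 3: "subtopology ?X (A \<union> B - (B - A)) = top_of_set A"
  proof -
    have "(A \<union> B) \<inter> (A \<union> B - (B - A)) = A" by blast
    then show ?thesis by (simp only: subtopology_subtopology)
  qed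
  have 4: "subtopology ?X B = top_of_set B" 
  proof -
    have "(A \<union> B) \<inter> B = B" by blast
    then show ?thesis by (simp only: subtopology_subtopology)
  qed
  obtain n d e where "singular_chain p (subtopology ?X (A \<union> B - (B - A))) d" "singular_chain p (subtopology ?X B) e"
    "(singular_subdivision p ^^ n) c = d + e"
  proof (rule excised_chain_exists)
    show "?X closure_of (B - A) \<subseteq> ?X interior_of B" by (rule 1)
    show "singular_chain p (subtopology ?X (A \<union> B)) c" unfolding 2 by (rule c)
  qed auto
  then show ?thesis unfolding 3 4 by (rule that)
qed

lemma subdivision_chain: "singular_chain p X c \<Longrightarrow> singular_chain p X ((singular_subdivision p ^^ n) c)"
  by (induction n) (auto simp: singular_chain_singular_subdivision)

lemma subdivision_boundary:
  "singular_chain p X c \<Longrightarrow>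
    chain_boundary p ((singular_subdivision p ^^ n) c) = (singular_subdivision (p - Suc 0) ^^ n) (chain_boundary p c)"
proof (induction n)
  case (Suc n)
  then show ?case using chain_boundary_singular_subdivision[OF subdivision_chain[OF Suc.prems, of n]] by simp
qed simp

lemma subdivision_homologous:
  assumes "singular_relcycle p X T c"
  shows "homologous_rel p X T ((singular_subdivision p ^^ n) c) c"
proof (induction n)
  case (Suc n)
  have "singular_relcycle p X T ((singular_subdivision p ^^ n) c)"
    using homologous_rel_singular_relcycle[OF Suc] assms by blast
  then show ?case using homologous_rel_singular_subdivision Suc homologous_rel_trans by fastforce
qed simp

text \<open>After subdivision a cycle is \<open>d + e\<close>, and the boundary of \<open>d\<close>
  is minus that of \<open>e\<close>, hence a cycle in the intersection. A chain \<open>c\<close>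
  bounding it there corrects both summands to cycles.\<close>

lemma mv_split:
  assumes z: "cyc (Suc p) (A \<union> B) z" and A: "openin (top_of_set (A \<union> B)) A" and B: "openin (top_of_set (A \<union> B)) B"
    and ac: "ac p (A \<inter> B)"
  obtains x y where "cyc (Suc p) A x" "cyc (Suc p) B y" "hlg (Suc p) (A \<union> B) z (x + y)"
proof -
  have zc: "singular_chain (Suc p) (top_of_set (A \<union> B)) z" "chain_boundary (Suc p) z = 0"
    using z by (auto simp: singular_cycle)
  obtain n d e where de: "singular_chain (Suc p) (top_of_set A) d" "singular_chain (Suc p) (top_of_set B) e"
    "(singular_subdivision (Suc p) ^^ n) z = d + e"
    by (rule split_chain[OF zc(1) A B])
  have h: "hlg (Suc p) (A \<union> B) ((singular_subdivision (Suc p) ^^ n) z) z"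
    by (rule subdivision_homologous[OF z])
  have "chain_boundary (Suc p) (d + e) = 0"
    using subdivision_boundary[OF zc(1), of n] zc(2) de(3) by simp
  then have eq: "chain_boundary (Suc p) d = - chain_boundary (Suc p) e"
    by (simp add: chain_boundary_add eq_neg_iff_add_eq_0)
  have "singular_chain p (top_of_set A) (chain_boundary (Suc p) d)"
    using singular_chain_boundary[OF de(1)] by simp
  moreover have "singular_chain p (top_of_set B) (chain_boundary (Suc p) d)"
    unfolding eq using singular_chain_boundary[OF de(2)] by (simp add: singular_chain_minus)
  ultimately have "singular_chain p (top_of_set (A \<inter> B)) (chain_boundary (Suc p) d)" by (rule singular_chain_Int)
  then have "cyc p (A \<inter> B) (chain_boundary (Suc p) d)"
    using chain_boundary_boundary[OF de(1)] by (simp add: singular_cycle)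
  then have "bd p (A \<inter> B) (chain_boundary (Suc p) d)" by (rule acD[OF ac])
  then obtain c where c: "singular_chain (Suc p) (top_of_set (A \<inter> B)) c" "chain_boundary (Suc p) c = chain_boundary (Suc p) d"
    by (auto simp: singular_boundary)
  have cA: "singular_chain (Suc p) (top_of_set A) c" and cB: "singular_chain (Suc p) (top_of_set B) c"
    using singular_chain_mono[OF c(1)] by auto
  show ?thesis
  proof
    show "cyc (Suc p) A (d - c)"
      using de(1) cA c(2) by (simp add: singular_cycle singular_chain_diff chain_boundary_diff)
    show "cyc (Suc p) B (e + c)"
      using de(2) cB c(2) eq by (simp add: singular_cycle singular_chain_add chain_boundary_add)
    have "(d - c) + (e + c) = (singular_subdivision (Suc p) ^^ n) z" by (simp add: de(3))
    then show "hlg (Suc p) (A \<union> B) z ((d - c) + (e + c))" using h homologous_rel_sym by metis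
  qed
qed

text \<open>A chain bounding \<open>x\<close> in the union subdivides into \<open>d + e\<close>. The
  boundary of \<open>e\<close> is the subdivided \<open>x\<close> minus the boundary of
  \<open>d\<close>, so it lies in \<open>A\<close> as well as in \<open>B\<close> and bounds in the
  intersection.\<close>

lemma mv_inject:
  assumes x: "cyc p A x" and bx: "bd p (A \<union> B) x"
    and A: "openin (top_of_set (A \<union> B)) A" and B: "openin (top_of_set (A \<union> B)) B"
    and ac: "ac p (A \<inter> B)"
  shows "bd p A x"
proof -
  obtain w where w: "singular_chain (Suc p) (top_of_set (A \<union> B)) w" "chain_boundary (Suc p) w = x"
    using bx by (auto simp: singular_boundary)
  obtain n d e where de: "singular_chain (Suc p) (top_of_set A) d" "singular_chain (Suc p) (top_of_set B) e"
    "(singular_subdivision (Suc p) ^^ n) w = d + e"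
    by (rule split_chain[OF w(1) A B])
  let ?x = "(singular_subdivision p ^^ n) x"
  have eq: "?x = chain_boundary (Suc p) d + chain_boundary (Suc p) e"
    using subdivision_boundary[OF w(1), of n] w(2) de(3) by (simp add: chain_boundary_add)
  have xA: "singular_chain p (top_of_set A) ?x"
    by (rule subdivision_chain) (use x in \<open>simp add: singular_cycle\<close>)
  have dA: "singular_chain p (top_of_set A) (chain_boundary (Suc p) d)"
    using singular_chain_boundary[OF de(1)] by simp
  have "singular_chain p (top_of_set A) (chain_boundary (Suc p) e)"
    using singular_chain_diff[OF xA dA] by (simp add: eq)
  moreover have "singular_chain p (top_of_set B) (chain_boundary (Suc p) e)"
    using singular_chain_boundary[OF de(2)] by simp
  ultimately have "singular_chain p (top_of_set (A \<inter> B)) (chain_boundary (Suc p) e)" by (rule singular_chain_Int)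
  then have "cyc p (A \<inter> B) (chain_boundary (Suc p) e)"
    using chain_boundary_boundary[OF de(2)] by (simp add: singular_cycle)
  then have "bd p (A \<inter> B) (chain_boundary (Suc p) e)" by (rule acD[OF ac])
  then have "bd p A (chain_boundary (Suc p) e)" by (rule bd_mono) simp
  moreover have "bd p A (chain_boundary (Suc p) d)" using de(1) by (auto simp: singular_boundary)
  ultimately have "bd p A ?x" unfolding eq by (intro singular_relboundary_add)
  moreover have "hlg p A ?x x" by (rule subdivision_homologous[OF x])
  ultimately show ?thesis
    using singular_relboundary_diff[of p "top_of_set A" "{}" ?x "?x - x"] by (simp add: hlg_iff)
qed

lemma mv_surject:
  assumes z: "cyc 2 (A \<union> B) z" and A: "openin (top_of_set (A \<union> B)) A" and B: "openin (top_of_set (A \<union> B)) B"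
    and ac: "ac 1 (A \<inter> B)" "ac 2 B"
  obtains x where "cyc 2 A x" "hlg 2 (A \<union> B) z x"
proof -
  obtain x y where xy: "cyc 2 A x" "cyc 2 B y" "hlg 2 (A \<union> B) z (x + y)"
    using mv_split[of 1 A B z] assms by (auto simp: numeral_2_eq_2)
  have "bd 2 (A \<union> B) y" by (rule bd_mono[OF acD[OF ac(2) xy(2)]]) simp
  then have "bd 2 (A \<union> B) ((z - (x + y)) + y)"
    using xy(3) singular_relboundary_add unfolding hlg_iff by blast
  moreover have "(z - (x + y)) + y = z - x" by simp
  ultimately show ?thesis using that[OF xy(1)] by (simp add: hlg_iff)
qed

lemma ac_iff: "ac p S \<longleftrightarrow> trivial_group (homology_group (int p) (top_of_set S))"
proof
  assume ac: "ac p S"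
  have "carrier (homology_group (int p) (top_of_set S)) = {\<one>\<^bsub>homology_group (int p) (top_of_set S)\<^esub>}"
  proof (intro equalityI subsetI)
    fix c assume "c \<in> carrier (homology_group (int p) (top_of_set S))"
    then obtain z where "cyc p S z" "c = homologous_rel_set p (top_of_set S) {} z"
      by (auto simp: carrier_relative_homology_group)
    then show "c \<in> {\<one>\<^bsub>homology_group (int p) (top_of_set S)\<^esub>}"
      using acD[OF ac] homologous_rel_set_eq_relboundary[of p "top_of_set S" "{}" z] by simp
  qed (use group_relative_homology_group group.is_monoid monoid.one_closed in blast)
  then show "trivial_group (homology_group (int p) (top_of_set S))"
    unfolding trivial_group_def using group_relative_homology_group by blast
next
  assume tr: "trivial_group (homology_group (int p) (top_of_set S))"
  show "ac p S" unfolding ac_def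
  proof (intro allI impI)
    fix z assume z: "cyc p S z"
    then have "homologous_rel_set p (top_of_set S) {} z \<in> carrier (homology_group (int p) (top_of_set S))"
      by (auto simp: carrier_relative_homology_group)
    then have "homologous_rel_set p (top_of_set S) {} z = singular_relboundary_set p (top_of_set S) {}"
      using tr unfolding trivial_group_def by simp
    then show "bd p S z" using homologous_rel_set_eq_relboundary by blast
  qed
qed

lemma ac_contractible:
  assumes "contractible S" "p > 0"
  shows "ac p S"
proof -
  have "contractible_space (top_of_set S)" using assms(1) by (simp add: contractible_space_top_of_set)
  then have "trivial_group (reduced_homology_group (int p) (top_of_set S))"
    by (rule trivial_reduced_homology_group_contractible_space)
  then show ?thesis using assms(2) unfolding ac_iff by (simp add: un_reduced_homology_group)
qed

lemma ac_retract:
  assumes "continuous_on S f" "f ` S \<subseteq> T" "continuous_on T g" "g ` T \<subseteq> S" "\<And>x. x \<in> S \<Longrightarrow> g (f x) = x" "ac p T"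
  shows "ac p S"
  unfolding ac_def
proof (intro allI impI)
  fix z assume z: "cyc p S z"
  have "bd p T (chain_map p f z)" by (rule acD[OF assms(6) cyc_map[OF z assms(1,2)]])
  then have "bd p S (chain_map p g (chain_map p f z))" by (rule bd_map[OF _ assms(3,4)])
  then show "bd p S z" unfolding chain_map_chain_map using chain_map_id_on[OF z, of "\<lambda>x. g (f x)"] assms(5) by simp
qed

lemma ac_diffeo:
  assumes d: "diffeo S T f" and ac: "ac p S"
  shows "ac p T"
  by (rule ac_retract[OF diffeoD(10)[OF d] _ diffeoD(9)[OF d] _ diffeoD(6)[OF d] ac])
    (simp_all add: diffeoD(2)[OF d] diffeoD(8)[OF d])

lemma homotopic_hlg:
  assumes "homotopic_with_canon (\<lambda>_. True) S T f g" "cyc p S z"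
  shows "hlg p T (chain_map p f z) (chain_map p g z)"
proof (rule homotopic_imp_homologous_rel_chain_maps)
  show "homotopic_with (\<lambda>h. h \<in> {} \<rightarrow> {}) (top_of_set S) (top_of_set T) f g" using assms(1) by simp
qed (rule assms(2))

text \<open>The unit sphere of \<open>real^4\<close> is the 3-sphere, whose reduced homology is
  concentrated in degree 3.\<close>

lemma ac_sphere:
  assumes "p = 1 \<or> p = 2"
  shows "ac p (sphere 0 1 :: (real^4) set)"
proof -
  let ?S = "sphere 0 1 :: (real^4) set"
  have "card (Basis :: (real^4) set) = 4" using DIM_cart[where 'a = real and 'b = 4] by simp
  then obtain f :: "(nat \<Rightarrow> real) \<Rightarrow> real^4" and g
    where fg: "homeomorphic_maps (nsphere (4 - 1)) (top_of_set (sphere 0 1 \<inter> span Basis)) f g"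
    by (rule homeomorphic_maps_nsphere_euclidean_sphere[OF independent_Basis orthogonal_Basis]) auto
  have "homeomorphic_maps (top_of_set (sphere 0 1 \<inter> span Basis)) (nsphere (4 - 1)) g f"
    using fg unfolding homeomorphic_maps_sym[of "nsphere (4 - 1)"] .
  then have "top_of_set ?S homeomorphic_space nsphere 3"
    unfolding homeomorphic_space_def span_Basis by (intro exI[of _ g] exI[of _ f]) simp
  then have "reduced_homology_group (int p) (top_of_set ?S) \<cong> reduced_homology_group (int p) (nsphere 3)"
    by (rule homeomorphic_space_imp_isomorphic_reduced_homology_groups)
  moreover have "trivial_group (reduced_homology_group (int p) (nsphere 3))"
    using assms by (auto simp: trivial_reduced_homology_group_nsphere reduced_homology_group_nsphere)
  ultimately have "trivial_group (reduced_homology_group (int p) (top_of_set ?S))"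
    using isomorphic_group_triviality[of "reduced_homology_group (int p) (top_of_set ?S)" "reduced_homology_group (int p) (nsphere 3)"]
    by simp
  then show ?thesis using assms unfolding ac_iff by (auto simp: un_reduced_homology_group)
qed

text \<open>Radial deformation onto the sphere of radius \<open>r/2\<close>: the segment from a
  point to its projection stays on the ray through it, so it misses 0 and remains inside the
  ball.\<close>

lemma ac_punctured_ball:
  assumes "p = 1 \<or> p = 2" "r > 0"
  shows "ac p (ball 0 r - {0} :: (real^4) set)"
  unfolding ac_def
proof (intro allI impI)
  let ?S = "ball 0 r - {0} :: (real^4) set" and ?T = "sphere 0 1 :: (real^4) set"
  fix z assume z: "cyc p ?S z"
  let ?f = "\<lambda>x::real^4. x /\<^sub>R norm x" and ?g = "\<lambda>x::real^4. (r/2) *\<^sub>R x"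
  have f: "continuous_on ?S ?f" "?f ` ?S \<subseteq> ?T"
  proof -
    show "continuous_on ?S ?f" by (auto intro!: continuous_intros)
    have n: "norm (?f x) = 1" if "x \<noteq> 0" for x using that by simp
    show "?f ` ?S \<subseteq> ?T"
    proof (rule image_subsetI)
      fix x assume "x \<in> ?S"
      then show "?f x \<in> ?T" using n[of x] by (simp only: mem_sphere_0) blast
    qed
  qed
  have g: "continuous_on ?T ?g" "?g ` ?T \<subseteq> ?S" using assms(2) by (auto intro!: continuous_intros)
  have "homotopic_with_canon (\<lambda>_. True) ?S ?S (\<lambda>x. x) (\<lambda>x. ?g (?f x))"
  proof (rule homotopic_with_linear)
    show "continuous_on ?S (\<lambda>x. ?g (?f x))" by (auto intro!: continuous_intros)
    fix x assume x: "x \<in> ?S"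
    show "closed_segment x (?g (?f x)) \<subseteq> ?S"
    proof
      fix y assume "y \<in> closed_segment x (?g (?f x))"
      then obtain u where u: "0 \<le> u" "u \<le> 1" "y = (1 - u) *\<^sub>R x + u *\<^sub>R (?g (?f x))" by (auto simp: in_segment)
      define s where "s = (1 - u) + u * (r / 2 * inverse (norm x))"
      have y: "y = s *\<^sub>R x" by (simp add: u(3) s_def scaleR_add_left)
      have nx: "0 < norm x" "norm x < r" using x by auto
      have "s > 0"
      proof (cases "u = 1")
        case False then show ?thesis unfolding s_def using u nx assms(2) by (intro add_pos_nonneg) auto
      qed (use nx assms(2) in \<open>simp add: s_def\<close>)
      moreover have "s * norm x = (1 - u) * norm x + u * (r/2)"
      proof -
        have "inverse (norm x) * norm x = 1" using nx by simp
        then have "u * (r / 2 * inverse (norm x)) * norm x = u * (r/2)" by (simp only: mult.assoc mult_1_right)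
        then show ?thesis by (simp only: s_def distrib_right)
      qed
      moreover have "(1 - u) * norm x + u * (r/2) < r"
        using convex_bound_lt[of "norm x" r "r/2" "1-u" u] u nx assms(2) by auto
      ultimately have "norm y < r" "y \<noteq> 0" using nx by (simp_all add: y)
      then show "y \<in> ?S" by simp
    qed
  qed (auto intro!: continuous_intros)
  then have "hlg p ?S (chain_map p (\<lambda>x. x) z) (chain_map p (\<lambda>x. ?g (?f x)) z)" by (rule homotopic_hlg[OF _ z])
  moreover have "chain_map p (\<lambda>x. x) z = z" by (rule chain_map_id_on[OF z]) simp
  moreover have "bd p ?S (chain_map p ?g (chain_map p ?f z))"
    by (rule bd_map[OF acD[OF ac_sphere[OF assms(1)] cyc_map[OF z f]] g])
  ultimately show "bd p ?S z"
    using singular_relboundary_add unfolding chain_map_chain_map hlg_iff by fastforce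
qed

text \<open>The centre of the star lies on the inward normal. Along a segment from it to
  \<open>x\<close> the first coordinate stays positive until \<open>x\<close> is reached, so the
  segment misses 0.\<close>

lemma punctured_half_ball_contractible:
  assumes "r > 0"
  shows "contractible (ball 0 r \<inter> half_space - {0} :: (real^4) set)"
proof (rule starlike_imp_contractible)
  let ?e = "(r/2) *\<^sub>R axis 1 1 :: real^4"
  have e: "?e \<in> ball 0 r \<inter> half_space - {0}"
    using assms by (auto simp: half_space_def axis_eq_0_iff)
  have "closed_segment ?e x \<subseteq> ball 0 r \<inter> half_space - {0}" if x: "x \<in> ball 0 r \<inter> half_space - {0}" for x
  proof
    fix y assume y: "y \<in> closed_segment ?e x"
    have "convex (ball 0 r \<inter> half_space :: (real^4) set)"
      unfolding half_space_def by (intro convex_Int convex_ball) (auto simp: convex_def)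
    moreover have "?e \<in> ball 0 r \<inter> half_space" "x \<in> ball 0 r \<inter> half_space" using e x by simp_all
    ultimately have "closed_segment ?e x \<subseteq> ball 0 r \<inter> half_space" by (rule closed_segment_subset[rotated 2])
    then have 1: "y \<in> ball 0 r \<inter> half_space" using y by (rule subsetD)
    obtain u where u: "0 \<le> u" "u \<le> 1" "y = (1 - u) *\<^sub>R ?e + u *\<^sub>R x" using y by (auto simp: in_segment)
    have "y \<noteq> 0"
    proof (cases "u = 1")
      case False
      then have "0 < (1 - u) * r" using u assms by simp
      moreover have "0 \<le> u * x $ 1" using x u by (auto simp: half_space_def)
      ultimately have "y $ 1 > 0" using u(3) by (simp add: axis_def)
      then show ?thesis by auto
    qed (use u x in auto)
    then show "y \<in> ball 0 r \<inter> half_space - {0}" using 1 by blast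
  qed
  then show "starlike (ball 0 r \<inter> half_space - {0} :: (real^4) set)" unfolding starlike_def using e by blast
qed

lemma ac_punctured:
  fixes H :: "(real^4) set"
  assumes "H = UNIV \<or> H = half_space" "p = 1 \<or> p = 2" "r > 0"
  shows "ac p (ball 0 r \<inter> H - {0})"
  using assms(1)
proof
  assume "H = UNIV"
  then show ?thesis using ac_punctured_ball[OF assms(2,3)] by simp
next
  assume "H = half_space"
  then show ?thesis using ac_contractible[OF punctured_half_ball_contractible[OF assms(3)], of p] assms(2) by auto
qed

lemma ac_ball:
  fixes H :: "(real^4) set"
  assumes "H = UNIV \<or> H = half_space" "p > 0"
  shows "ac p (ball 0 r \<inter> H)"
proof (rule ac_contractible[OF convex_imp_contractible assms(2)])
  show "convex (ball 0 r \<inter> H)"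
    using assms(1) by (intro convex_Int convex_ball) (auto simp: convex_def half_space_def)
qed

text \<open>Passage from chains to groups; because chain maps are additive, injectivity has to be
  checked only on cycles whose images bound.\<close>

lemma hom_induced_iso:
  assumes f: "continuous_on S f" "f ` S \<subseteq> T"
    and surj: "\<And>z. cyc 2 T z \<Longrightarrow> \<exists>x. cyc 2 S x \<and> hlg 2 T z (chain_map 2 f x)"
    and inj: "\<And>x. cyc 2 S x \<Longrightarrow> bd 2 T (chain_map 2 f x) \<Longrightarrow> bd 2 S x"
  shows "hom_induced 2 (top_of_set S) {} (top_of_set T) {} f
     \<in> iso (homology_group 2 (top_of_set S)) (homology_group 2 (top_of_set T))"
proof -
  let ?h = "hom_induced 2 (top_of_set S) {} (top_of_set T) {} f"
  have cS: "carrier (homology_group 2 (top_of_set S)) = homologous_rel_set 2 (top_of_set S) {} ` {z. cyc 2 S z}"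
    and cT: "carrier (homology_group 2 (top_of_set T)) = homologous_rel_set 2 (top_of_set T) {} ` {z. cyc 2 T z}"
    using carrier_relative_homology_group[of 2 "top_of_set S" "{}"] carrier_relative_homology_group[of 2 "top_of_set T" "{}"] by auto
  have hz: "?h (homologous_rel_set 2 (top_of_set S) {} z) = homologous_rel_set 2 (top_of_set T) {} (chain_map 2 f z)"
    if "cyc 2 S z" for z
    using hom_induced_chain_map[of "top_of_set S" "top_of_set T" f "{}" "{}" 2 z] f that by auto
  have "inj_on ?h (carrier (homology_group 2 (top_of_set S)))"
    unfolding cS
  proof (rule inj_onI, clarify)
    fix x y assume x: "cyc 2 S x" and y: "cyc 2 S y"
      and "?h (homologous_rel_set 2 (top_of_set S) {} x) = ?h (homologous_rel_set 2 (top_of_set S) {} y)"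
    then have "hlg 2 T (chain_map 2 f x) (chain_map 2 f y)" by (simp add: hz homologous_rel_set_eq)
    then have "bd 2 T (chain_map 2 f (x - y))" by (simp add: hlg_iff chain_map_diff)
    then have "bd 2 S (x - y)" by (rule inj[OF singular_relcycle_diff[OF x y]])
    then show "homologous_rel_set 2 (top_of_set S) {} x = homologous_rel_set 2 (top_of_set S) {} y"
      by (simp add: homologous_rel_set_eq hlg_iff)
  qed
  moreover have "?h ` carrier (homology_group 2 (top_of_set S)) = carrier (homology_group 2 (top_of_set T))"
  proof (intro equalityI subsetI)
    fix c assume "c \<in> ?h ` carrier (homology_group 2 (top_of_set S))"
    then show "c \<in> carrier (homology_group 2 (top_of_set T))" using hom_induced_carrier by blast
  next
    fix c assume "c \<in> carrier (homology_group 2 (top_of_set T))"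
    then obtain z where z: "cyc 2 T z" "c = homologous_rel_set 2 (top_of_set T) {} z" by (auto simp: cT)
    obtain x where x: "cyc 2 S x" "hlg 2 T z (chain_map 2 f x)" using surj[OF z(1)] by blast
    then have "c = ?h (homologous_rel_set 2 (top_of_set S) {} x)" unfolding z(2) hz[OF x(1)] homologous_rel_set_eq by simp
    then show "c \<in> ?h ` carrier (homology_group 2 (top_of_set S))" using x(1) by (auto simp: cS)
  qed
  ultimately show ?thesis
    unfolding iso_def bij_betw_def by (intro CollectI conjI hom_induced_hom)
qed

subsection \<open>Isotopies supported in charts and tubes\<close>

lemma smooth_map_imp_smooth_on:
  assumes "open V" "smooth_map V g"
  shows "smooth_on V g"
proof (rule smooth_on_local)
  fix x assume x: "x \<in> V"
  obtain U F where U: "x \<in> U" "smooth_on U F" "\<forall>y\<in>U \<inter> V. F y = g y"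
    by (rule smooth_mapE[OF assms(2) x])
  have op: "open (U \<inter> V)" using smooth_on_open[OF U(2)] assms(1) by blast
  have "smooth_on (U \<inter> V) F" by (rule smooth_on_subset[OF U(2) op]) simp
  then have "smooth_on (U \<inter> V) g" by (rule smooth_on_cong) (use U(3) in blast)
  then show "\<exists>W. x \<in> W \<and> W \<subseteq> V \<and> smooth_on W g"
    using U(1) x by (intro exI[of _ "U \<inter> V"] conjI) auto
qed

lemma smooth_on_cos_sin: "smooth_on UNIV (cos :: real \<Rightarrow> real)" "smooth_on UNIV (sin :: real \<Rightarrow> real)"
proof -
  have "Ck_on k (cos :: real \<Rightarrow> real) UNIV \<and> Ck_on k (sin :: real \<Rightarrow> real) UNIV" for k
  proof (induction k)
    case 0
    have "continuous_on UNIV (cos :: real \<Rightarrow> real)" "continuous_on UNIV (sin :: real \<Rightarrow> real)"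
      by (intro continuous_on_cos continuous_on_sin continuous_on_id)+
    then show ?case by simp
  next
    case (Suc k)
    have "Ck_on (Suc k) (cos :: real \<Rightarrow> real) UNIV"
    proof (rule Ck_on_SucI'[where f' = "\<lambda>x v. (-v) * sin x"])
      show "(cos has_derivative (\<lambda>v. (-v) * sin x)) (at x)" for x :: real
        by (rule has_derivative_eq_rhs[OF DERIV_cos[of x, unfolded has_field_derivative_def]]) (simp add: fun_eq_iff)
      show "Ck_on k (\<lambda>x::real. (-v) * sin x) UNIV" for v :: real
        by (rule Ck_on_mult[OF open_UNIV Ck_on_const[OF open_UNIV]]) (use Suc in blast)
    qed simp
    moreover have "Ck_on (Suc k) (sin :: real \<Rightarrow> real) UNIV"
    proof (rule Ck_on_SucI'[where f' = "\<lambda>x v. v * cos x"])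
      show "(sin has_derivative (\<lambda>v. v * cos x)) (at x)" for x :: real
        by (rule has_derivative_eq_rhs[OF DERIV_sin[of x, unfolded has_field_derivative_def]]) (simp add: fun_eq_iff)
      show "Ck_on k (\<lambda>x::real. v * cos x) UNIV" for v :: real
        by (rule Ck_on_mult[OF open_UNIV Ck_on_const[OF open_UNIV]]) (use Suc in blast)
    qed simp
    ultimately show ?case by blast
  qed
  then show "smooth_on UNIV (cos :: real \<Rightarrow> real)" "smooth_on UNIV (sin :: real \<Rightarrow> real)"
    by (simp_all add: smooth_on_def)
qed

text \<open>\<open>em\<close> embeds \<open>real^3\<close> as the wall of the half-space and
  \<open>pr\<close> forgets the normal coordinate. Translations by \<open>em c\<close> preserve the
  half-space, so interior and boundary discs admit the same shift.\<close>

definition pr :: "real^4 \<Rightarrow> real^3" where "pr x = vector [x $ 2, x $ 3, x $ 4]"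
definition em :: "real^3 \<Rightarrow> real^4" where "em y = vector [0, y $ 1, y $ 2, y $ 3]"

lemma vector_4 [simp]:
  "(vector [a, b, c, d] :: 'a::zero^4) $ 1 = a" "(vector [a, b, c, d] :: 'a^4) $ 2 = b"
  "(vector [a, b, c, d] :: 'a^4) $ 3 = c" "(vector [a, b, c, d] :: 'a^4) $ 4 = d"
  by (simp_all add: vector_def)

lemma linear_pr: "linear pr"
  by (rule linearI) (simp_all add: pr_def vec_eq_iff forall_3)

lemma linear_em: "linear em"
  by (rule linearI) (simp_all add: em_def vec_eq_iff forall_4)

lemma pr_em [simp]: "pr (em y) = y"
  by (simp add: pr_def em_def vec_eq_iff forall_3)

lemma em_1 [simp]: "em y $ 1 = 0"
  by (simp add: em_def)

lemma norm_em [simp]: "norm (em y) = norm y"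
  by (simp add: norm_vec_def L2_set_def sum_4 sum_3 em_def)

lemma norm_pr: "norm (pr x) \<le> norm x"
  by (simp add: norm_vec_def L2_set_def sum_4 sum_3 pr_def)

text \<open>Planar pieces are negligible in three dimensions. The sign anticipates the use:
  translation by \<open>c\<close> moves exactly \<open>- c\<close> to the origin.\<close>

lemma thin_avoid:
  fixes P :: "(real^3) set"
  assumes "thin P" "e > 0"
  obtains c where "norm c < e" "- c \<notin> P"
proof -
  have "negligible P" by (rule thin_negligible[OF assms(1)]) simp
  moreover have "\<not> negligible (ball (0::real^3) e)" using assms(2) by (simp add: open_not_negligible)
  ultimately have "\<not> ball 0 e \<subseteq> P" using negligible_subset by blast
  then obtain d where "d \<in> ball 0 e" "d \<notin> P" by blast
  then have "norm d < e" "d \<notin> P" by simp_all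
  then show ?thesis using that[of "- d"] by simp
qed

text \<open>The path from the identity obtained by scaling \<open>B\<close> consists of invertible
  maps, so the determinant cannot change sign on the way from 1.\<close>

lemma det_perturbation_pos:
  fixes B :: "real^'n \<Rightarrow> real^'n"
  assumes lin: "linear B" and L: "L < 1" and bd: "\<And>v. norm (B v) \<le> L * norm v"
  shows "0 < det (matrix (\<lambda>v. v + B v))"
proof -
  let ?f = "\<lambda>t. det (mat 1 + t *\<^sub>R matrix B)"
  have cont: "continuous_on {0..1} ?f"
    unfolding det_def by (intro continuous_intros)
  have nz: "?f t \<noteq> 0" if t: "t \<in> {0..1}" for t
  proof -
    have "v = 0" if "(mat 1 + t *\<^sub>R matrix B) *v v = 0" for v
    proof -
      have "v + t *\<^sub>R B v = 0"
        using that lin by (simp add: matrix_vector_mult_add_rdistrib scaleR_matrix_vector_assoc[symmetric] matrix_works)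
      then have "v = - (t *\<^sub>R B v)" by (simp add: eq_neg_iff_add_eq_0)
      then have "norm v = t * norm (B v)" using t by (metis abs_of_nonneg atLeastAtMost_iff norm_minus_cancel norm_scaleR)
      also have "\<dots> \<le> 1 * (L * norm v)" using t bd[of v] by (intro mult_mono) auto
      finally have "(1 - L) * norm v \<le> 0" by (simp add: algebra_simps)
      then show "v = 0" using L by (auto simp: mult_le_0_iff)
    qed
    then have "inj ((*v) (mat 1 + t *\<^sub>R matrix B))"
      using linear_injective_0[OF matrix_vector_mul_linear] by blast
    then show ?thesis using det_nz_iff_inj[OF matrix_vector_mul_linear, of "mat 1 + t *\<^sub>R matrix B"] by simp
  qed
  have "?f 1 > 0"
  proof (rule ccontr)
    assume "\<not> ?f 1 > 0"
    then have "?f 1 \<le> 0" "0 \<le> ?f 0" by auto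
    then obtain t where "0 \<le> t" "t \<le> 1" "?f t = 0" using IVT2'[of ?f 1 0 0] cont by auto
    then show False using nz[of t] by simp
  qed
  moreover have "matrix (\<lambda>v. v + B v) = mat 1 + 1 *\<^sub>R matrix B"
    by (simp add: matrix_def mat_def vec_eq_iff axis_def)
  ultimately show ?thesis by simp
qed

lemma oemb_perturbation:
  fixes u :: "(real, 'n::{finite,one}) vec \<Rightarrow> (real, 'n) vec"
  assumes sm: "smooth_on UNIV u" and L: "L < 1"
    and bd: "\<And>x v. norm (frechet_derivative u (at x) v) \<le> L * norm v"
    and im: "\<And>x. x \<in> A \<Longrightarrow> x + u x \<in> B"
  shows "oemb (std A) (std B) A (\<lambda>x. x + u x)"
  unfolding oemb_def
proof (intro conjI ballI)
  note p = diffeo_perturbation[OF sm L bd]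
  show "diffeo A ((\<lambda>x. x + u x) ` A) (\<lambda>x. x + u x)" by (rule diffeo_subset[OF p(1)]) simp
  fix x assume "x \<in> A"
  let ?D = "frechet_derivative (\<lambda>x. x + u x) (at x)" and ?u = "frechet_derivative u (at x)"
  have D: "?D = (\<lambda>v. v + ?u v)" using p(4) by blast
  have linu: "linear ?u" by (rule has_derivative_linear[OF smooth_on_has_derivative[OF sm]]) simp
  have pos: "0 < det (matrix ?D)" unfolding D by (rule det_perturbation_pos[OF linu L bd])
  have lin: "linear ?D" unfolding D by (rule linear_compose_add[OF linear_ident linu])
  have "?D \<circ> (\<lambda>v. C *v v) = (\<lambda>v. (matrix ?D ** C) *v v)" for C
    using lin by (simp add: fun_eq_iff matrix_works flip: matrix_vector_mul_assoc)
  moreover have "0 < det (matrix ?D ** C)" if "0 < det C" for C using pos that by (simp add: det_mul)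
  ultimately have "\<forall>C\<in>frames (std A) x. ?D \<circ> C \<in> frames (std B) (x + u x)" by auto
  then show "\<exists>U F. x \<in> U \<and> smooth_on U F \<and> (\<forall>y\<in>U \<inter> A. F y = y + u y) \<and>
      (\<forall>C\<in>frames (std A) x. frechet_derivative F (at x) \<circ> C \<in> frames (std B) (x + u x))"
    by (intro exI[of _ UNIV] exI[of _ "\<lambda>x. x + u x"] conjI p(2)) auto
qed (use im in auto)

lemma oemb_id: "A \<subseteq> pts M \<Longrightarrow> oemb M M A (\<lambda>x. x)"
  unfolding oemb_def
proof (intro conjI ballI)
  assume "A \<subseteq> pts M"
  then show "A \<subseteq> pts M" "(\<lambda>x. x) ` A \<subseteq> pts M" by auto
  show "diffeo A ((\<lambda>x. x) ` A) (\<lambda>x. x)" using diffeo_id[of A] by simp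
  fix p assume "p \<in> A"
  show "\<exists>U F. p \<in> U \<and> smooth_on U F \<and> (\<forall>y\<in>U \<inter> A. F y = y) \<and>
      (\<forall>C\<in>frames M p. frechet_derivative F (at p) \<circ> C \<in> frames M p)"
    by (intro exI[of _ UNIV] exI[of _ "\<lambda>x. x"] conjI smooth_on_id) (simp_all add: frechet_derivative_ident comp_def)
qed

lemma openin_Int_subset: "openin (top_of_set M) A \<Longrightarrow> S \<subseteq> M \<Longrightarrow> openin (top_of_set S) (S \<inter> A)"
  unfolding openin_open by blast

text \<open>\<open>C\<close> contains the support of \<open>\<psi>\<close> and \<open>A\<close> is
  an open neighbourhood of it. As \<open>A\<close> and \<open>C\<close> are mapped into themselves,
  the images of \<open>A\<close> and of the complement of \<open>C\<close> are traces of open sets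
  on the whole image, and \<open>oemb_glue\<close> applies.\<close>

lemma oemb_patch:
  assumes A: "oemb M M A \<psi>" and opA: "openin (top_of_set (pts M)) A" and CA: "C \<subseteq> A"
    and clC: "closedin (top_of_set (pts M)) C" and imA: "\<psi> ` A \<subseteq> A" and imC: "\<psi> ` C \<subseteq> C"
    and id: "\<And>x. x \<in> pts M \<Longrightarrow> x \<notin> C \<Longrightarrow> \<psi> x = x"
  shows "oemb M M (pts M) \<psi>"
proof -
  let ?B = "pts M - C"
  have AM: "A \<subseteq> pts M" by (rule openin_imp_subset[OF opA])
  have un: "A \<union> ?B = pts M" using AM CA by blast
  have opB: "openin (top_of_set (pts M)) ?B" using openin_diff[OF openin_topspace clC] by simp
  have B: "oemb M M ?B \<psi>" by (rule oemb_cong[OF oemb_id]) (use id in auto)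
  have injA: "inj_on \<psi> A" by (rule diffeoD(1)[OF oembD(3)[OF A]])
  have im: "\<psi> ` pts M \<subseteq> pts M" using imC id AM CA by (metis image_subset_iff subsetD)
  have inj: "inj_on \<psi> (pts M)"
  proof (rule inj_onI)
    fix x y assume xy: "x \<in> pts M" "y \<in> pts M" "\<psi> x = \<psi> y"
    have mem: "x \<in> A \<longleftrightarrow> \<psi> x \<in> A" if "x \<in> pts M" for x using imA id[OF that] CA by (metis image_subset_iff subsetD)
    show "x = y"
    proof (cases "x \<in> A")
      case True
      then have "y \<in> A" using mem xy by metis
      then show ?thesis using inj_onD[OF injA xy(3) True] by blast
    next
      case False
      then have "y \<notin> A" using mem xy by metis
      then show ?thesis using False id[OF xy(1)] id[OF xy(2)] xy(3) CA by auto
    qed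
  qed
  have "\<psi> ` A = \<psi> ` pts M \<inter> A"
  proof -
    have "\<psi> x \<notin> A" if "x \<in> pts M" "x \<notin> A" for x using that id[OF that(1)] CA by (metis subsetD)
    then show ?thesis using imA AM by blast
  qed
  then have "openin (top_of_set (\<psi> ` pts M)) (\<psi> ` A)"
    using openin_Int_subset[OF opA im] by (simp only:)
  moreover have "\<psi> ` ?B = \<psi> ` pts M \<inter> ?B"
  proof -
    have "\<psi> x \<in> ?B" if "x \<in> ?B" for x using that id[of x] by auto
    moreover have "\<psi> x \<notin> ?B" if "x \<in> C" for x using imC that by blast
    ultimately show ?thesis by blast
  qed
  then have "openin (top_of_set (\<psi> ` pts M)) (\<psi> ` ?B)"
    using openin_Int_subset[OF opB im] by (simp only:)
  ultimately have "oemb M M (A \<union> ?B) \<psi>"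
    by (intro oemb_glue[OF A B]) (simp_all only: un inj opA opB)
  then show ?thesis by (simp only: un)
qed

lemma bump_derivative_scale:
  fixes x :: "'a::euclidean_space"
  assumes "r > 0"
  shows "frechet_derivative (bump r) (at x) v = frechet_derivative (bump 1) (at (x /\<^sub>R r)) (v /\<^sub>R r)"
proof -
  have "(bump 1 has_derivative frechet_derivative (bump 1) (at (x /\<^sub>R r))) (at (x /\<^sub>R r))"
    by (rule smooth_on_has_derivative[OF smooth_on_bump]) simp
  moreover have "((\<lambda>x::'a. x /\<^sub>R r) has_derivative (\<lambda>v. v /\<^sub>R r)) (at x)"
    by (intro derivative_intros)
  ultimately have "((\<lambda>x. bump 1 (x /\<^sub>R r)) has_derivative (\<lambda>v. frechet_derivative (bump 1) (at (x /\<^sub>R r)) (v /\<^sub>R r))) (at x)"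
    by (rule has_derivative_compose[rotated])
  moreover have "(\<lambda>x::'a. bump 1 (x /\<^sub>R r)) = bump r" by (rule ext) (rule bump_scale[OF assms, symmetric])
  ultimately show ?thesis using frechet_derivative_at by metis
qed

lemma bump_shift_bound:
  assumes "r > 0"
  obtains e where "0 < e" "e \<le> r/2"
    "\<And>c :: 'b::euclidean_space. norm c < e \<Longrightarrow> smooth_on UNIV (\<lambda>x::'a::euclidean_space. bump r x *\<^sub>R c)"
    "\<And>(c :: 'b) (x :: 'a) v. norm c < e \<Longrightarrow> norm (frechet_derivative (\<lambda>x. bump r x *\<^sub>R c) (at x) v) \<le> 1/2 * norm v"
proof -
  obtain C where C: "C > 0" "\<And>x v::'a. \<bar>frechet_derivative (bump 1) (at x) v\<bar> \<le> C * norm v"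
    by (rule bump_derivative_bound[where 'a = 'a]) blast
  \<comment> \<open>The derivative of \<open>bump r\<close> is bounded by \<open>C / r\<close>, so
    vectors shorter than \<open>r / (2 * C)\<close> give displacements with derivative at most 1/2.
    The bound \<open>r/2\<close> keeps the preimage of 0 in the region where the bump equals
    1.\<close>
  define e where "e = min (r/2) (r / (2 * C))"
  have sm: "smooth_on UNIV (\<lambda>x::'a. bump r x *\<^sub>R c)" for c :: 'b
    by (rule smooth_on_scaleR[OF smooth_on_bump smooth_on_const[OF open_UNIV]])
  show ?thesis
  proof
    show "0 < e" "e \<le> r/2" using C(1) assms by (auto simp: e_def)
    show "smooth_on UNIV (\<lambda>x::'a. bump r x *\<^sub>R c)" for c :: 'b by (rule sm)
    fix c :: 'b and x v :: 'a assume c: "norm c < e"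
    have "(bump r has_derivative frechet_derivative (bump r) (at x)) (at x)"
      by (rule smooth_on_has_derivative[OF smooth_on_bump]) simp
    then have "((\<lambda>x. bump r x *\<^sub>R c) has_derivative (\<lambda>v. frechet_derivative (bump r) (at x) v *\<^sub>R c)) (at x)"
      by (rule has_derivative_scaleR_left)
    then have "frechet_derivative (\<lambda>x. bump r x *\<^sub>R c) (at x) = (\<lambda>v. frechet_derivative (bump r) (at x) v *\<^sub>R c)"
      by (rule frechet_derivative_at[symmetric])
    then have "norm (frechet_derivative (\<lambda>x. bump r x *\<^sub>R c) (at x) v) = \<bar>frechet_derivative (bump r) (at x) v\<bar> * norm c"
      by simp
    also have "\<dots> \<le> (C * norm (v /\<^sub>R r)) * (r / (2 * C))"
      unfolding bump_derivative_scale[OF assms] using c C(1) by (intro mult_mono C(2)) (auto simp: e_def)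
    also have "\<dots> = 1/2 * norm v" using C(1) assms by (simp add: field_simps)
    finally show "norm (frechet_derivative (\<lambda>x. bump r x *\<^sub>R c) (at x) v) \<le> 1/2 * norm v" .
  qed
qed

text \<open>Outside the ball the map is the identity. A point leaving the ball would have an image
  that is fixed, so by injectivity the point would itself be that image.\<close>

lemma shift_ball:
  assumes "inj (\<lambda>x. x + bump r x *\<^sub>R c)" "norm x \<le> r" "r > 0"
  shows "norm (x + bump r x *\<^sub>R c) \<le> r"
proof (rule ccontr)
  let ?T = "\<lambda>x. x + bump r x *\<^sub>R c"
  assume n: "\<not> norm (?T x) \<le> r"
  then have "bump r (?T x) = 0" using assms(3) by (intro bump_0) auto
  then have "?T (?T x) = ?T x" by (simp only: scaleR_zero_left add_0_right)
  then have "?T x = x" by (rule injD[OF assms(1)])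
  then have "norm (?T x) = norm x" by (rule arg_cong)
  then show False using n assms(2) by linarith
qed

text \<open>A preimage of 0 has norm at most that of \<open>c\<close>, hence lies where the bump is
  1 and the map is the plain translation.\<close>

lemma shift_zero:
  assumes "x + bump r x *\<^sub>R c = 0" "norm c < r/2" "r > 0"
  shows "x = - c"
proof -
  have xe: "x = - (bump r x *\<^sub>R c)" using assms(1) by (simp add: eq_neg_iff_add_eq_0)
  then have "norm x = \<bar>bump r x\<bar> * norm c" by (metis norm_minus_cancel norm_scaleR)
  also have "\<dots> \<le> 1 * norm c" using bump_bounds[of r x] by (intro mult_right_mono) auto
  finally have "norm x \<le> r/2" using assms(2) by simp
  then have "bump r x = 1" by (rule bump_1[OF assms(3)])
  then show ?thesis using xe by (simp only: scaleR_one)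
qed

text \<open>A translation parallel to the wall, cut off inside the unit disc of the chart, moves a
  single point to the centre, and \<open>c\<close> is chosen so that this point is not in
  \<open>P\<close>. Scaling the translation vector from 0 to 1 gives the homotopy to the identity,
  which later keeps homology classes fixed.\<close>

proposition chart_shift:
  fixes H :: "(real^4) set" and M :: "('a::euclidean_space, 4) omanifold"
  assumes M: "oriented_manifold M" and H: "H = UNIV \<or> H = half_space"
    and V: "oriented_chart M V \<phi>" "openin (top_of_set H) V" "cball 0 1 \<inter> H \<subseteq> V"
    and P: "thin P" "P \<subseteq> pts M"
  obtains \<psi> where "oemb M M (pts M) \<psi>" "\<phi> 0 \<notin> \<psi> ` P"
    "homotopic_with_canon (\<lambda>_. True) (pts M) (pts M) (\<lambda>x. x) \<psi>"
proof -
  let ?T = "\<lambda>c x. x + bump 1 x *\<^sub>R em c"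
  have d: "diffeo V (\<phi> ` V) \<phi>" by (rule oriented_chart_diffeo[OF V(1)])
  have VM: "\<phi> ` V \<subseteq> pts M" by (rule oriented_chart_pts[OF V(1)])
  define j where "j = inv_into V \<phi>"
  have j: "j (\<phi> x) = x" if "x \<in> V" for x using diffeoD(5)[OF d that] by (simp add: j_def)
  have VH: "V \<subseteq> H" by (rule openin_imp_subset[OF V(2)])
  have H0: "em c \<in> H" "0 \<in> H" for c using H by (auto simp: half_space_def)
  have Hadd: "x + t *\<^sub>R em c \<in> H" if "x \<in> H" for x t c using H that by (auto simp: half_space_def)
  obtain e where e: "0 < e" "e \<le> 1/2"
    "\<And>c :: real^4. norm c < e \<Longrightarrow> smooth_on UNIV (\<lambda>x::real^4. bump 1 x *\<^sub>R c)"
    "\<And>(c :: real^4) (x :: real^4) v. norm c < e \<Longrightarrow> norm (frechet_derivative (\<lambda>x. bump 1 x *\<^sub>R c) (at x) v) \<le> 1/2 * norm v"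
    by (rule bump_shift_bound[OF zero_less_one, where 'a = "real^4" and 'b = "real^4"]) blast
  have "thin (j ` (P \<inter> \<phi> ` V))"
    unfolding j_def by (rule thin_image[OF diffeoD(4)[OF d] thin_subset[OF P(1)]]) auto
  moreover have "smooth_map UNIV pr"
    by (rule smooth_on_imp_smooth_map[OF smooth_on_linear[OF open_UNIV linear_pr]]) simp
  ultimately have "thin (pr ` j ` (P \<inter> \<phi> ` V))"
    by (rule thin_image[OF _ _ subset_UNIV, rotated])
  \<comment> \<open>Avoiding the projection of \<open>P\<close> along the normal direction is more
    than avoiding \<open>P\<close>, but it allows \<open>c\<close> to be chosen within the
    wall.\<close>
  then obtain c where c: "norm c < e" "- c \<notin> pr ` j ` (P \<inter> \<phi> ` V)" by (rule thin_avoid[OF _ e(1)])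
  have ce: "norm (em c) < e" using c(1) by simp
  note pd = diffeo_perturbation[OF e(3)[OF ce] _ e(4)[OF ce], simplified]
  have injT: "inj (?T c)" using diffeoD(1)[OF pd(1)] .
  \<comment> \<open>Intermediate points of the homotopy are convex combinations of \<open>x\<close>
    and its final position, both of which lie in the unit ball; outside the ball nothing
    moves.\<close>
  have TV: "x + (s * bump 1 x) *\<^sub>R em c \<in> V" if x: "x \<in> V" and s: "0 \<le> s" "s \<le> 1" for x s
  proof (cases "norm x \<le> 1")
    case True
    have 1: "norm (?T c x) \<le> 1" by (rule shift_ball[OF injT True zero_less_one])
    have "x + (s * bump 1 x) *\<^sub>R em c = (1 - s) *\<^sub>R x + s *\<^sub>R ?T c x" by (simp add: algebra_simps)
    then have "norm (x + (s * bump 1 x) *\<^sub>R em c) \<le> (1 - s) * norm x + s * norm (?T c x)"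
      using s by (metis norm_triangle_ineq norm_scaleR abs_of_nonneg diff_ge_0_iff_ge)
    also have "\<dots> \<le> 1" using convex_bound_le[OF True 1, of "1 - s" s] s by simp
    finally have "x + (s * bump 1 x) *\<^sub>R em c \<in> cball 0 1 \<inter> H" using Hadd VH x by auto
    then show ?thesis using V(3) by blast
  next
    case False then show ?thesis using x by (simp add: bump_0)
  qed
  have TV1: "?T c x \<in> V" if "x \<in> V" for x using TV[OF that, of 1] by simp
  define \<psi> where "\<psi> = (\<lambda>x. if x \<in> \<phi> ` V then \<phi> (?T c (j x)) else x)"
  have \<psi>: "\<psi> (\<phi> x) = \<phi> (?T c x)" if "x \<in> V" for x using that by (simp add: \<psi>_def j)
  define C where "C = \<phi> ` (cball 0 1 \<inter> H)"
  have "closed H" using H by (auto simp: half_space_def intro!: closed_Collect_le continuous_intros)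
  then have "compact (cball 0 1 \<inter> H)" by (intro compact_Int_closed) auto
  then have "compact C" unfolding C_def
    by (rule compact_continuous_image[OF continuous_on_subset[OF diffeoD(9)[OF d] V(3)]])
  moreover have "C \<subseteq> pts M" using V(3) VM by (auto simp: C_def)
  ultimately have clC: "closedin (top_of_set (pts M)) C"
    by (simp add: closed_subset compact_imp_closed)
  have CV: "C \<subseteq> \<phi> ` V" using V(3) by (auto simp: C_def)
  have idC: "\<psi> x = x" if "x \<notin> C" for x
  proof (cases "x \<in> \<phi> ` V")
    case True
    then obtain y where y: "y \<in> V" "x = \<phi> y" by blast
    then have "norm y > 1" using that VH by (auto simp: C_def)
    then show ?thesis using y by (simp add: \<psi> bump_0)
  qed (simp add: \<psi>_def)
  have full: "full V" by (rule oriented_chart_full[OF V(1)])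
  have o1: "oemb (std V) M V \<phi>" by (rule oriented_chart_oemb[OF V(1)]) simp
  have o2: "oemb M (std V) (\<phi> ` V) j" unfolding j_def
    by (rule oemb_inverse[OF o1 oriented_manifold_std[OF full] M]) simp
  have o3: "oemb (std V) (std V) V (?T c)"
    by (rule oemb_perturbation[OF e(3)[OF ce] _ e(4)[OF ce]]) (use TV1 in auto)
  have "oemb M M (\<phi> ` V) (\<lambda>x. \<phi> (?T c (j x)))"
  proof (rule oemb_compose[OF o2 oemb_compose[OF o3 o1]])
    show "(\<lambda>x. ?T c x) ` V \<subseteq> V" using TV1 by blast
    show "j ` \<phi> ` V \<subseteq> V" using j by auto
  qed
  then have oA: "oemb M M (\<phi> ` V) \<psi>" by (rule oemb_cong) (simp add: \<psi>_def)
  show ?thesis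
  proof
    show "oemb M M (pts M) \<psi>"
    proof (rule oemb_patch[OF oA oriented_chart_openin[OF V(1)] CV clC])
      show "\<psi> ` \<phi> ` V \<subseteq> \<phi> ` V" using \<psi> TV1 by auto
      show "\<psi> ` C \<subseteq> C"
      proof
        fix z assume "z \<in> \<psi> ` C"
        then obtain x where x: "norm x \<le> 1" "x \<in> H" "z = \<psi> (\<phi> x)" by (auto simp: C_def)
        then have "x \<in> V" using V(3) by auto
        moreover have "norm (?T c x) \<le> 1" by (rule shift_ball[OF injT x(1) zero_less_one])
        moreover have "?T c x \<in> H" using Hadd[OF x(2)] by simp
        ultimately show "z \<in> C" unfolding C_def x(3) using \<psi>[of x] by auto
      qed
    qed (use idC in blast)
    show "\<phi> 0 \<notin> \<psi> ` P"
    proof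
      assume "\<phi> 0 \<in> \<psi> ` P"
      then obtain p where p: "p \<in> P" "\<phi> 0 = \<psi> p" by blast
      have 0: "0 \<in> V" using V(3) H0 by auto
      have "p \<in> \<phi> ` V"
      proof (rule ccontr)
        assume "p \<notin> \<phi> ` V"
        then have "\<psi> p = p" by (simp add: \<psi>_def)
        then show False using p(2) 0 \<open>p \<notin> \<phi> ` V\<close> by auto
      qed
      then obtain x where x: "x \<in> V" "p = \<phi> x" by blast
      have "\<phi> 0 = \<phi> (?T c x)" using p(2) x \<psi> by simp
      then have T0: "?T c x = 0" using inj_onD[OF diffeoD(1)[OF d] _ 0 TV1[OF x(1)]] by simp
      then have "x = - em c" by (rule shift_zero) (use ce e(2) in auto)
      then have "pr x = - c" using linear_neg[OF linear_pr, of "em c"] by simp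
      moreover have "pr x \<in> pr ` j ` (P \<inter> \<phi> ` V)" using p(1) x j[OF x(1)] by force
      ultimately show False using c(2) by simp
    qed
    show "homotopic_with_canon (\<lambda>_. True) (pts M) (pts M) (\<lambda>x. x) \<psi>"
    proof -
      \<comment> \<open>The homotopy is glued from two relatively open pieces: the chart domain,
        where it is the scaled translation, and the complement of the compact support, where it is
        constant.\<close>
      define h where "h = (\<lambda>(t::real, x). if x \<in> \<phi> ` V then \<phi> (j x + (t * bump 1 (j x)) *\<^sub>R em c) else x)"
      let ?I = "{0..1::real}"
      have un: "?I \<times> \<phi> ` V \<union> ?I \<times> (pts M - C) = ?I \<times> pts M" using VM CV by blast
      have contj: "continuous_on (\<phi> ` V) j" unfolding j_def by (rule diffeoD(10)[OF d])
      have contb: "continuous_on UNIV (bump 1 :: real^4 \<Rightarrow> real)" by (rule smooth_on_continuous_on[OF smooth_on_bump])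
      have "continuous_on (?I \<times> \<phi> ` V) (\<lambda>z. j (snd z))"
        by (rule continuous_on_compose2[OF contj continuous_on_snd]) (auto intro: continuous_on_id)
      moreover from this have "continuous_on (?I \<times> \<phi> ` V) (\<lambda>z. bump 1 (j (snd z)))"
        by (rule continuous_on_compose2[OF contb]) simp
      ultimately have "continuous_on (?I \<times> \<phi> ` V) (\<lambda>z. j (snd z) + (fst z * bump 1 (j (snd z))) *\<^sub>R em c)"
        by (intro continuous_on_add continuous_on_scaleR continuous_on_mult continuous_on_fst continuous_on_id continuous_on_const)
      then have "continuous_on (?I \<times> \<phi> ` V) (\<lambda>z. \<phi> (j (snd z) + (fst z * bump 1 (j (snd z))) *\<^sub>R em c))"
        by (rule continuous_on_compose2[OF diffeoD(9)[OF d]]) (use j TV in auto)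
      then have c1: "continuous_on (?I \<times> \<phi> ` V) h"
        by (rule continuous_on_eq) (auto simp: h_def)
      have hid: "h (t, x) = x" if "x \<notin> C" for t x
      proof (cases "x \<in> \<phi> ` V")
        case True
        then obtain y where y: "y \<in> V" "x = \<phi> y" by blast
        then have "norm y > 1" using that VH by (auto simp: C_def)
        then show ?thesis using y by (simp add: h_def j bump_0)
      qed (simp add: h_def)
      have c2: "continuous_on (?I \<times> (pts M - C)) h"
        by (rule continuous_on_eq[OF continuous_on_snd[OF continuous_on_id]]) (auto simp: hid)
      have "openin (top_of_set (?I \<times> pts M)) (?I \<times> \<phi> ` V)"
        by (rule openin_Times[OF openin_subtopology_self oriented_chart_openin[OF V(1)]])
      moreover have "openin (top_of_set (pts M)) (pts M - C)" using openin_diff[OF openin_topspace clC] by simp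
      then have "openin (top_of_set (?I \<times> pts M)) (?I \<times> (pts M - C))"
        by (rule openin_Times[OF openin_subtopology_self])
      ultimately have cont: "continuous_on (?I \<times> pts M) h"
        using continuous_on_Un_local_open[of "?I \<times> \<phi> ` V" "?I \<times> (pts M - C)" h] c1 c2 unfolding un by blast
      have "h ` (?I \<times> pts M) \<subseteq> pts M"
      proof
        fix z assume "z \<in> h ` (?I \<times> pts M)"
        then obtain t x where tx: "t \<in> ?I" "x \<in> pts M" "z = h (t, x)" by blast
        show "z \<in> pts M"
        proof (cases "x \<in> \<phi> ` V")
          case True
          then obtain y where "y \<in> V" "x = \<phi> y" by blast
          then show ?thesis using tx TV[of y t] VM by (auto simp: h_def j)
        qed (use tx in \<open>simp add: h_def\<close>)
      qed
      moreover have "h (0, x) = x" for x using j by (auto simp: h_def)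
      moreover have "h (1, x) = \<psi> x" for x by (simp add: h_def \<psi>_def)
      ultimately show ?thesis using cont unfolding homotopic_with_def
        by (intro exI[of _ h]) (auto simp: prod_topology_subtopology_eu image_subset_iff)
    qed
  qed
qed

definition refl_mat :: "((real, 'n::{finite,one}) vec, 'n) vec" where
  "refl_mat = (\<chi> i j. if i = j then (if i = 1 then -1 else 1) else 0)"

lemma det_refl_mat: "det (refl_mat :: ((real, 'n::{finite,one}) vec, 'n) vec) = -1"
proof -
  have "det (refl_mat :: ((real, 'n::{finite,one}) vec, 'n) vec) = (\<Prod>i\<in>(UNIV :: 'n set). refl_mat $ i $ i)"
    by (rule det_diagonal) (simp add: refl_mat_def)
  also have "\<dots> = (\<Prod>i\<in>(UNIV :: 'n set). if i = 1 then -1 else 1)" by (simp add: refl_mat_def)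
  also have "\<dots> = -1" by (subst prod.delta) auto
  finally show ?thesis .
qed

text \<open>An immersion of a connected set preserves or reverses orientation everywhere, so one
  constant matrix, the identity or a reflection, corrects it at all points.\<close>

lemma immersion_frames:
  fixes g :: "(real, 'n::{finite,one}) vec \<Rightarrow> 'a::euclidean_space"
  assumes "smooth_on V g" "connected V" "oriented_manifold M" "g ` V \<subseteq> pts M"
    "\<And>x. x \<in> V \<Longrightarrow> inj (frechet_derivative g (at x))"
  obtains R where "det R \<noteq> 0" "\<forall>x\<in>V. frechet_derivative g (at x) \<circ> (\<lambda>v. R *v v) \<in> frames M (g x)"
proof (cases "\<forall>x\<in>V. frechet_derivative g (at x) \<in> frames M (g x)")
  case True
  have "det (mat 1 :: ((real, 'n) vec, 'n) vec) \<noteq> 0" by simp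
  moreover have "\<forall>x\<in>V. frechet_derivative g (at x) \<circ> (\<lambda>v. mat 1 *v v) \<in> frames M (g x)"
    using True by (simp add: comp_def)
  ultimately show ?thesis by (rule that)
next
  case False
  then have "\<forall>x\<in>V. \<forall>B. det B < 0 \<longrightarrow> frechet_derivative g (at x) \<circ> (\<lambda>v. B *v v) \<in> frames M (g x)"
    using immersion_orientation[OF assms] by blast
  then have "\<forall>x\<in>V. frechet_derivative g (at x) \<circ> (\<lambda>v. refl_mat *v v) \<in> frames M (g x)"
    using det_refl_mat by (metis neg_less_0_iff_less zero_less_one)
  moreover have "det (refl_mat :: ((real, 'n) vec, 'n) vec) \<noteq> 0" by (simp add: det_refl_mat)
  ultimately show ?thesis using that by blast
qed

text \<open>The angle in the circle factor is read off the first coordinate of \<open>real^4\<close>.\<close>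

definition tube_coord :: "real^4 \<Rightarrow> (real^3) \<times> (real^2)" where
  "tube_coord x = (pr x, cos (x $ 1) *\<^sub>R axis 1 1 + sin (x $ 1) *\<^sub>R axis 2 1)"

lemma linear_comp1: "linear (\<lambda>x::real^'n. x $ i)"
  by (rule linearI) simp_all

lemma smooth_on_tube_coord: "smooth_on UNIV tube_coord"
proof -
  have l: "smooth_on UNIV (\<lambda>x::real^4. x $ 1)" by (rule smooth_on_linear[OF open_UNIV linear_comp1])
  have c: "smooth_on UNIV (\<lambda>x::real^4. cos (x $ 1))" by (rule smooth_on_compose[OF smooth_on_cos_sin(1) l]) simp
  have s: "smooth_on UNIV (\<lambda>x::real^4. sin (x $ 1))" by (rule smooth_on_compose[OF smooth_on_cos_sin(2) l]) simp
  have "smooth_on UNIV (\<lambda>x. (pr x, cos (x $ 1) *\<^sub>R axis 1 1 + sin (x $ 1) *\<^sub>R axis 2 1 :: real^2))"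
    by (intro smooth_on_Pair smooth_on_add smooth_on_scaleR c s smooth_on_const smooth_on_linear linear_pr open_UNIV)
  then show ?thesis by (simp add: tube_coord_def[abs_def])
qed

lemma tube_coord_sphere: "snd (tube_coord x) \<in> sphere 0 1"
proof -
  have "(norm (cos (x $ 1) *\<^sub>R axis 1 1 + sin (x $ 1) *\<^sub>R axis 2 1 :: real^2))\<^sup>2 = 1"
    unfolding power2_norm_eq_inner
    by (simp add: inner_add_left inner_add_right inner_axis_axis power2_eq_square[symmetric])
  then show ?thesis by (simp add: tube_coord_def norm_eq_1 power2_norm_eq_inner)
qed

lemma tube_coord_surj:
  assumes "v \<in> sphere 0 1"
  obtains x where "tube_coord x = (y, v)"
proof -
  have "(v $ 1)\<^sup>2 + (v $ 2)\<^sup>2 = 1"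
    using assms by (simp add: norm_eq_sqrt_inner inner_vec_def sum_2 power2_eq_square)
  then obtain t where t: "v $ 1 = cos t" "v $ 2 = sin t" using sincos_total_2pi by metis
  let ?x = "em y + t *\<^sub>R axis 1 1"
  have "?x $ 1 = t" by (simp add: axis_def)
  moreover have "pr ?x = y" by (simp add: pr_def vec_eq_iff forall_3 axis_def em_def)
  moreover have "cos t *\<^sub>R axis 1 1 + sin t *\<^sub>R axis 2 1 = v"
    by (simp add: vec_eq_iff forall_2 axis_def t)
  ultimately have "tube_coord ?x = (y, v)" by (simp add: tube_coord_def)
  then show ?thesis by (rule that)
qed

lemma tube_coord_immersion: "inj (frechet_derivative tube_coord (at x))"
proof -
  let ?D = "\<lambda>v. (pr v, (v $ 1 * - sin (x $ 1)) *\<^sub>R axis 1 1 + (v $ 1 * cos (x $ 1)) *\<^sub>R axis 2 1 :: real^2)"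
  have l: "((\<lambda>x::real^4. x $ 1) has_derivative (\<lambda>v. v $ 1)) (at x)"
    by (rule bounded_linear_imp_has_derivative) (rule bounded_linear_vec_nth)
  have p: "(pr has_derivative pr) (at x)"
    by (rule bounded_linear_imp_has_derivative) (simp add: linear_conv_bounded_linear[symmetric] linear_pr)
  have c: "((\<lambda>x::real^4. cos (x $ 1)) has_derivative (\<lambda>v. v $ 1 * - sin (x $ 1))) (at x)"
    by (rule DERIV_cos[THEN DERIV_compose_FDERIV, OF l])
  have s: "((\<lambda>x::real^4. sin (x $ 1)) has_derivative (\<lambda>v. v $ 1 * cos (x $ 1))) (at x)"
    by (rule DERIV_sin[THEN DERIV_compose_FDERIV, OF l])
  have "(tube_coord has_derivative ?D) (at x)"
    unfolding tube_coord_def[abs_def]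
    by (intro has_derivative_Pair has_derivative_add has_derivative_scaleR_left p c s)
  then have eq: "frechet_derivative tube_coord (at x) = ?D" by (rule frechet_derivative_at[symmetric])
  have lin: "linear ?D" unfolding eq[symmetric]
    by (rule has_derivative_linear[OF smooth_on_has_derivative[OF smooth_on_tube_coord]]) simp
  show ?thesis unfolding eq
  proof (subst linear_injective_0[OF lin], intro allI impI)
    fix v assume v: "?D v = 0"
    then have pv: "pr v = 0" and q: "(v $ 1 * - sin (x $ 1)) *\<^sub>R axis 1 1 + (v $ 1 * cos (x $ 1)) *\<^sub>R axis 2 1 = (0 :: real^2)"
      by (simp_all add: prod_eq_iff)
    have "v $ 2 = 0" "v $ 3 = 0" "v $ 4 = 0" using pv by (simp_all add: pr_def vec_eq_iff forall_3)
    moreover have "v $ 1 * sin (x $ 1) = 0" "v $ 1 * cos (x $ 1) = 0"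
      using arg_cong[OF q, of "\<lambda>w. w $ 1"] arg_cong[OF q, of "\<lambda>w. w $ 2"] by (auto simp: axis_def)
    then have "v $ 1 = 0" using sin_zero_abs_cos_one[of "x $ 1"] by auto
    ultimately show "v = 0" by (simp add: vec_eq_iff forall_4)
  qed
qed

text \<open>The shift acts on the ball factor and is constant along the circle factor. Projecting
  \<open>Q\<close> to the ball factor gives a thin set in \<open>real^3\<close>, so a small
  \<open>c\<close> moves all of \<open>Q\<close> away from the core. For orientations the circle is
  unrolled by \<open>tube_coord\<close>, which makes the shift a perturbation of the identity of
  \<open>real^4\<close>.\<close>

proposition tube_shift:
  fixes b :: "(real^3) \<times> (real^2) \<Rightarrow> 'a::euclidean_space" and S :: "('a, 4) omanifold"
  defines "D \<equiv> ball 0 1 \<times> sphere 0 1"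
  assumes S: "oriented_manifold S" and b: "diffeo D (b ` D) b" and op: "openin (top_of_set (pts S)) (b ` D)"
    and Q: "thin Q" "Q \<subseteq> pts S"
  obtains \<theta> where "oemb S S (pts S) \<theta>" "\<forall>x\<in>pts S - b ` D. \<theta> x = x"
    "\<theta> ` b ` D \<subseteq> b ` D" "\<theta> ` Q \<inter> b ` ({0} \<times> sphere 0 1) = {}"
proof -
  have bS: "b ` D \<subseteq> pts S" by (rule openin_imp_subset[OF op])
  define j where "j = inv_into D b"
  have j: "j (b x) = x" if "x \<in> D" for x using diffeoD(5)[OF b that] by (simp add: j_def)
  \<comment> \<open>Support radius 1/2 leaves a margin inside the open unit ball, so the support of
    the shift is compact in the tube.\<close>
  have r: "(0::real) < 1/2" by simp
  obtain e where e: "0 < e" "e \<le> (1/2)/2"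
    "\<And>c :: real^3. norm c < e \<Longrightarrow> smooth_on UNIV (\<lambda>x::real^3. bump (1/2) x *\<^sub>R c)"
    "\<And>(c :: real^3) (x :: real^3) v. norm c < e \<Longrightarrow> norm (frechet_derivative (\<lambda>x. bump (1/2) x *\<^sub>R c) (at x) v) \<le> 1/2 * norm v"
    by (rule bump_shift_bound[OF r, where 'a = "real^3" and 'b = "real^3"]) blast
  have "thin (j ` (Q \<inter> b ` D))"
    unfolding j_def by (rule thin_image[OF diffeoD(4)[OF b] thin_subset[OF Q(1)]]) auto
  moreover have "smooth_map UNIV (fst :: (real^3) \<times> (real^2) \<Rightarrow> real^3)"
    by (rule smooth_on_imp_smooth_map[OF smooth_on_linear[OF open_UNIV linear_fst]]) simp
  ultimately have "thin (fst ` j ` (Q \<inter> b ` D))" by (rule thin_image[OF _ _ subset_UNIV, rotated])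
  then obtain c where c: "norm c < e" "- c \<notin> fst ` j ` (Q \<inter> b ` D)" by (rule thin_avoid[OF _ e(1)])
  define u where "u = (\<lambda>y::real^3. bump (1/2) y *\<^sub>R c)"
  define T where "T = (\<lambda>y. y + u y)"
  define TT where "TT = (\<lambda>z::(real^3) \<times> (real^2). (T (fst z), snd z))"
  note su = e(3)[OF c(1), folded u_def] and bu = e(4)[OF c(1), folded u_def]
  have half: "1/2 < (1::real)" by simp
  note pd = diffeo_perturbation[OF su half bu, folded T_def]
  have injT: "inj T" by (rule diffeoD(1)[OF pd(1)])
  have T_le: "norm (T y) \<le> 1/2" if "norm y \<le> 1/2" for y
    using shift_ball[OF injT[unfolded T_def u_def] that r] by (simp add: T_def u_def)
  have T_id: "T y = y" if "norm y \<ge> 1/2" for y using that by (simp add: T_def u_def bump_0)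
  have T1: "norm (T y) < 1" if "norm y < 1" for y
    using T_le[of y] T_id[of y] that by (cases "norm y \<le> 1/2") auto
  have TTD: "TT z \<in> D" if "z \<in> D" for z using that T1 by (auto simp: D_def TT_def)
  define \<psi> where "\<psi> = (\<lambda>x. if x \<in> b ` D then b (TT (j x)) else x)"
  have \<psi>: "\<psi> (b z) = b (TT z)" if "z \<in> D" for z using that by (simp add: \<psi>_def j)
  have \<psi>D: "\<psi> ` b ` D \<subseteq> b ` D" using \<psi> TTD by auto
  define C where "C = b ` (cball 0 (1/2) \<times> sphere 0 1)"
  have subD: "cball 0 (1/2) \<times> sphere 0 1 \<subseteq> D" by (auto simp: D_def)
  have CD: "C \<subseteq> b ` D" unfolding C_def using subD by blast
  have "compact C" unfolding C_def
    by (rule compact_continuous_image[OF continuous_on_subset[OF diffeoD(9)[OF b] subD]])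
      (intro compact_Times compact_cball compact_sphere)
  then have clC: "closedin (top_of_set (pts S)) C"
    using CD bS by (intro closed_subset compact_imp_closed) auto
  have idC: "\<psi> x = x" if "x \<notin> C" for x
  proof (cases "x \<in> b ` D")
    case True
    then obtain z where z: "z \<in> D" "x = b z" by blast
    then have "\<not> norm (fst z) \<le> 1/2" using that by (cases z) (auto simp: C_def D_def)
    then have "TT z = z" using T_id[of "fst z"] by (simp add: TT_def)
    then show ?thesis using z \<psi> by simp
  qed (simp add: \<psi>_def)
  have dTT: "diffeo D (TT ` D) TT"
  proof (rule diffeoI[where g = "\<lambda>z. (inv_into UNIV T (fst z), snd z)"])
    have s1: "smooth_on UNIV (\<lambda>z::(real^3) \<times> (real^2). fst z)" "smooth_on UNIV (\<lambda>z::(real^3) \<times> (real^2). snd z)"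
      by (rule smooth_on_linear[OF open_UNIV], intro linear_fst linear_snd)+
    have "smooth_on UNIV (\<lambda>z::(real^3) \<times> (real^2). T (fst z))"
      by (rule smooth_on_compose[OF pd(2) s1(1)]) simp
    then have "smooth_on UNIV TT" unfolding TT_def by (rule smooth_on_Pair[OF _ s1(2)])
    then show "smooth_map D TT" by (rule smooth_on_imp_smooth_map) simp
    show "smooth_map (TT ` D) (\<lambda>z. (inv_into UNIV T (fst z), snd z))"
    proof (rule smooth_map_Pair)
      show "smooth_map (TT ` D) (\<lambda>z. inv_into UNIV T (fst z))"
        by (rule smooth_map_compose[OF smooth_on_imp_smooth_map[OF s1(1)] diffeoD(4)[OF pd(1)]])
          (auto simp: TT_def)
      show "smooth_map (TT ` D) (\<lambda>z. snd z)" by (rule smooth_on_imp_smooth_map[OF s1(2)]) simp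
    qed
    show "(inv_into UNIV T (fst (TT z)), snd (TT z)) = z" if "z \<in> D" for z
      using injT by (simp add: TT_def)
  qed (rule refl)
  have d\<psi>: "diffeo (b ` D) (\<psi> ` b ` D) \<psi>"
  proof -
    have "diffeo (b ` D) (b ` TT ` D) (\<lambda>x. b (TT (j x)))"
    proof (rule diffeo_compose[where f = "\<lambda>x. TT (j x)" and T = "TT ` D"])
      show "diffeo (b ` D) (TT ` D) (\<lambda>x. TT (j x))"
        using diffeo_compose[OF diffeo_inverse[OF b] dTT] by (simp add: j_def)
      show "diffeo (TT ` D) (b ` TT ` D) b" by (rule diffeo_subset[OF b]) (use TTD in blast)
    qed
    then have "diffeo (b ` D) (b ` TT ` D) \<psi>" by (rule diffeo_cong) (simp add: \<psi>_def)
    moreover have "b ` TT ` D = \<psi> ` b ` D" using \<psi> by (force simp: image_image)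
    ultimately show ?thesis by simp
  qed
  \<comment> \<open>\<open>V\<close> is an open convex set that unrolls the tube, and
    \<open>g\<close> is the corresponding immersion into \<open>S\<close>. Connectedness of
    \<open>V\<close> gives \<open>g\<close> a uniform orientation behaviour.\<close>
  define V where "V = {x. norm (pr x) < 1}"
  define g where "g = (\<lambda>x. b (tube_coord x))"
  have "continuous_on UNIV (\<lambda>x. norm (pr x))"
    by (intro continuous_on_norm linear_continuous_on) (simp add: linear_conv_bounded_linear[symmetric] linear_pr)
  then have opV: "open V" unfolding V_def by (intro open_Collect_less continuous_on_const)
  have conV: "connected V"
  proof (rule convex_connected)
    have "V = pr -` ball 0 1" by (auto simp: V_def)
    then show "convex V" using convex_linear_vimage[OF linear_pr convex_ball] by simp
  qed
  have tcD: "tube_coord x \<in> D \<longleftrightarrow> x \<in> V" for x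
    using tube_coord_sphere[of x] by (cases "tube_coord x") (auto simp: D_def V_def tube_coord_def)
  have smg: "smooth_on V g" unfolding g_def
  proof (rule smooth_map_imp_smooth_on[OF opV])
    show "smooth_map V (\<lambda>x. b (tube_coord x))"
      by (rule smooth_map_compose[OF smooth_on_imp_smooth_map[OF smooth_on_tube_coord] diffeoD(3)[OF b]])
        (use tcD in auto)
  qed
  have gS: "g ` V \<subseteq> b ` D" using tcD by (auto simp: g_def)
  have injg: "inj (frechet_derivative g (at x))" if x: "x \<in> V" for x
  proof -
    have "g x \<in> b ` D" using gS x by blast
    then obtain U G where U: "g x \<in> U" "smooth_on U G" "\<forall>y\<in>U \<inter> b ` D. G y = inv_into D b y"
      by (rule smooth_mapE[OF diffeoD(4)[OF b]])
    have "(g has_derivative frechet_derivative g (at x)) (at x within V)"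
      by (rule has_derivative_at_withinI[OF smooth_on_has_derivative[OF smg x]])
    from ext_compose_derivative[OF U gS x this]
    have "((\<lambda>x. inv_into D b (g x)) has_derivative frechet_derivative G (at (g x)) \<circ> frechet_derivative g (at x)) (at x)"
      using at_within_open[OF x opV] by simp
    moreover have "inv_into D b (g y) = tube_coord y" if "y \<in> V" for y
      using diffeoD(5)[OF b] tcD[of y] that by (simp add: g_def)
    ultimately have "(tube_coord has_derivative frechet_derivative G (at (g x)) \<circ> frechet_derivative g (at x)) (at x)"
      by (rule has_derivative_transform_within_open[OF _ opV x])
    then have "frechet_derivative tube_coord (at x) = frechet_derivative G (at (g x)) \<circ> frechet_derivative g (at x)"
      by (rule frechet_derivative_at[symmetric])
    then show ?thesis using tube_coord_immersion[of x] by (metis inj_on_imageI2)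
  qed
  have gp: "g ` V \<subseteq> pts S" using gS bS by blast
  \<comment> \<open>The map \<open>b\<close> may preserve or reverse orientation; the constant
    matrix \<open>R\<close> turns the derivatives of \<open>g\<close> into positive frames in both
    cases.\<close>
  obtain R where R: "det R \<noteq> 0" "\<forall>x\<in>V. frechet_derivative g (at x) \<circ> (\<lambda>v. R *v v) \<in> frames S (g x)"
    by (rule immersion_frames[OF smg conV S gp injg])
  have "invertible R" using R(1) by (simp add: invertible_det_nz)
  then obtain R' where R': "R ** R' = mat 1" "R' ** R = mat 1" unfolding invertible_def by blast
  have detR: "det R' * det R = 1" using R'(2) by (metis det_I det_mul)
  define u4 where "u4 = (\<lambda>x. em (u (pr x)))"
  define T4 where "T4 = (\<lambda>x. x + u4 x)"
  have su4: "smooth_on UNIV u4" unfolding u4_def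
    by (rule smooth_on_linear_compose[OF linear_em])
      (rule smooth_on_compose[OF su smooth_on_linear[OF open_UNIV linear_pr]], simp)
  have bu4: "norm (frechet_derivative u4 (at x) v) \<le> 1/2 * norm v" for x v
  proof -
    have "(u has_derivative frechet_derivative u (at (pr x))) (at (pr x))"
      by (rule smooth_on_has_derivative[OF su]) simp
    moreover have "(pr has_derivative pr) (at x)"
      by (rule bounded_linear_imp_has_derivative) (simp add: linear_conv_bounded_linear[symmetric] linear_pr)
    ultimately have "((\<lambda>x. u (pr x)) has_derivative (\<lambda>v. frechet_derivative u (at (pr x)) (pr v))) (at x)"
      by (rule has_derivative_compose[rotated])
    moreover have "bounded_linear em" by (simp add: linear_conv_bounded_linear[symmetric] linear_em)
    ultimately have "(u4 has_derivative (\<lambda>v. em (frechet_derivative u (at (pr x)) (pr v)))) (at x)"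
      unfolding u4_def by (rule bounded_linear.has_derivative[rotated])
    then have "frechet_derivative u4 (at x) v = em (frechet_derivative u (at (pr x)) (pr v))"
      using frechet_derivative_at by metis
    then have "norm (frechet_derivative u4 (at x) v) \<le> 1/2 * norm (pr v)" using bu[of "pr x" "pr v"] by simp
    then show ?thesis using norm_pr[of v] by linarith
  qed
  note pd4 = diffeo_perturbation[OF su4 half bu4, folded T4_def]
  \<comment> \<open>\<open>T4\<close> lifts \<open>TT\<close> to the unrolled tube: the displacement
    has first coordinate 0, so the angle is unchanged.\<close>
  have tc4: "tube_coord (T4 x) = TT (tube_coord x)" for x
    by (simp add: tube_coord_def T4_def u4_def TT_def T_def linear_add[OF linear_pr])
  have T4V: "T4 x \<in> V" if "x \<in> V" for x
    using that TTD[of "tube_coord x"] tcD[of x] tcD[of "T4 x"] by (simp add: tc4)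
  have oD: "oemb S S (b ` D) \<psi>"
    unfolding oemb_def
  proof (intro conjI ballI)
    show "b ` D \<subseteq> pts S" by (rule bS)
    show "\<psi> ` b ` D \<subseteq> pts S" using \<psi>D bS by blast
    show "diffeo (b ` D) (\<psi> ` b ` D) \<psi>" by (rule d\<psi>)
    fix p assume p: "p \<in> b ` D"
    then obtain z where z: "z \<in> D" "p = b z" by blast
    then have "snd z \<in> sphere 0 1" by (auto simp: D_def)
    then obtain x where "tube_coord x = (fst z, snd z)" by (rule tube_coord_surj)
    then have x: "tube_coord x = z" by simp
    have xV: "x \<in> V" using tcD[of x] z x by simp
    have gx: "g x = p" using x z by (simp add: g_def)
    obtain U F where U: "p \<in> U" "smooth_on U F" "\<forall>y\<in>U \<inter> b ` D. F y = \<psi> y"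
      by (rule smooth_mapE[OF diffeoD(3)[OF d\<psi>] p])
    let ?DF = "frechet_derivative F (at p)" and ?Dg = "\<lambda>x. frechet_derivative g (at x)"
      and ?D4 = "frechet_derivative T4 (at x)"
    have dg: "(g has_derivative ?Dg y) (at y)" if "y \<in> V" for y by (rule smooth_on_has_derivative[OF smg that])
    have d4: "(T4 has_derivative ?D4) (at x)" by (rule smooth_on_has_derivative[OF pd4(2)]) simp
    have gxU: "g x \<in> U" using U(1) gx by simp
    from ext_compose_derivative[OF gxU U(2,3) gS xV has_derivative_at_withinI[OF dg[OF xV]]]
    have 1: "((\<lambda>x. \<psi> (g x)) has_derivative ?DF \<circ> ?Dg x) (at x)"
      using at_within_open[OF xV opV] gx by simp
    have "((\<lambda>x. g (T4 x)) has_derivative (\<lambda>v. ?Dg (T4 x) (?D4 v))) (at x)"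
      by (rule has_derivative_compose[OF d4 dg[OF T4V[OF xV]]])
    moreover have "g (T4 y) = \<psi> (g y)" if "y \<in> V" for y
      using \<psi>[of "tube_coord y"] tcD[of y] that by (simp add: g_def tc4)
    ultimately have "((\<lambda>x. \<psi> (g x)) has_derivative (\<lambda>v. ?Dg (T4 x) (?D4 v))) (at x)"
      by (rule has_derivative_transform_within_open[OF _ opV xV])
    then have eq: "?DF \<circ> ?Dg x = (\<lambda>v. ?Dg (T4 x) (?D4 v))" by (rule has_derivative_unique[OF 1])
    have lin4: "linear ?D4" by (rule has_derivative_linear[OF d4])
    have D4: "?D4 = (\<lambda>v. v + frechet_derivative u4 (at x) v)" using pd4(4) by blast
    have "linear (frechet_derivative u4 (at x))"
      by (rule has_derivative_linear[OF smooth_on_has_derivative[OF su4]]) simp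
    then have det4: "0 < det (matrix ?D4)" unfolding D4 by (rule det_perturbation_pos[OF _ half bu4])
    have pS: "p \<in> pts S" using p bS by blast
    have \<psi>p: "g (T4 x) = \<psi> p" "\<psi> p \<in> pts S"
    proof -
      show "g (T4 x) = \<psi> p" using \<psi>[of "tube_coord x"] x z tc4 by (simp add: g_def)
      show "\<psi> p \<in> pts S" using \<psi>D p bS by blast
    qed
    have fr1: "frames S p = {(?Dg x \<circ> (\<lambda>v. R *v v)) \<circ> (\<lambda>v. B *v v) |B. 0 < det B}"
      using frames_class(1)[OF S pS] R(2) xV gx by blast
    have fr2: "frames S (\<psi> p) = {(?Dg (T4 x) \<circ> (\<lambda>v. R *v v)) \<circ> (\<lambda>v. B *v v) |B. 0 < det B}"
      using frames_class(1)[OF S \<psi>p(2)] R(2) T4V[OF xV] \<psi>p(1) by fastforce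
    have "?DF \<circ> A \<in> frames S (\<psi> p)" if A: "A \<in> frames S p" for A
    proof -
      obtain B where B: "A = (?Dg x \<circ> (\<lambda>v. R *v v)) \<circ> (\<lambda>v. B *v v)" "0 < det B" using A fr1 by blast
      \<comment> \<open>The matrices \<open>R'\<close> and \<open>R\<close> have determinants with
        product 1, so the sign of this determinant is that of the derivative of \<open>T4\<close>
        times \<open>B\<close>, and both are positive.\<close>
      let ?E = "R' ** (matrix ?D4 ** (R ** B))"
      have "?DF \<circ> A = (?Dg (T4 x) \<circ> (\<lambda>v. R *v v)) \<circ> (\<lambda>v. ?E *v v)"
      proof
        fix v
        have "(?DF \<circ> A) v = (?DF \<circ> ?Dg x) (R *v (B *v v))" by (simp add: B(1))
        also have "\<dots> = ?Dg (T4 x) (?D4 (R *v (B *v v)))" by (rule fun_cong[OF eq])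
        also have "?D4 (R *v (B *v v)) = matrix ?D4 *v (R *v (B *v v))" using lin4 by (simp add: matrix_works)
        also have "\<dots> = (matrix ?D4 ** (R ** B)) *v v" by (simp add: matrix_vector_mul_assoc matrix_mul_assoc)
        also have "\<dots> = R *v (?E *v v)"
          by (simp add: matrix_vector_mul_assoc) (simp add: matrix_mul_assoc R')
        finally show "(?DF \<circ> A) v = ((?Dg (T4 x) \<circ> (\<lambda>v. R *v v)) \<circ> (\<lambda>v. ?E *v v)) v" by simp
      qed
      moreover have "det ?E = (det R' * det R) * (det (matrix ?D4) * det B)" by (simp add: det_mul)
      then have "0 < det ?E" using detR det4 B(2) by simp
      ultimately show ?thesis unfolding fr2 by blast
    qed
    then show "\<exists>U F. p \<in> U \<and> smooth_on U F \<and> (\<forall>y\<in>U \<inter> b ` D. F y = \<psi> y) \<and>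
        (\<forall>A\<in>frames S p. frechet_derivative F (at p) \<circ> A \<in> frames S (\<psi> p))"
      by (intro exI[of _ U] exI[of _ F] conjI U ballI)
  qed
  show ?thesis
  proof
    show "oemb S S (pts S) \<psi>"
    proof (rule oemb_patch[OF oD op CD clC \<psi>D])
      show "\<psi> ` C \<subseteq> C"
      proof
        fix w assume "w \<in> \<psi> ` C"
        then obtain y v where y: "norm y \<le> 1/2" "v \<in> sphere 0 1" "w = \<psi> (b (y, v))" by (auto simp: C_def)
        then have "(y, v) \<in> D" by (auto simp: D_def)
        then have "w = b (T y, v)" using y(3) \<psi> by (simp add: TT_def)
        then show "w \<in> C" unfolding C_def using T_le[OF y(1)] y(2) by auto
      qed
    qed (use idC in blast)
    show "\<forall>x\<in>pts S - b ` D. \<psi> x = x" by (simp add: \<psi>_def)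
    show "\<psi> ` b ` D \<subseteq> b ` D" by (rule \<psi>D)
    show "\<psi> ` Q \<inter> b ` ({0} \<times> sphere 0 1) = {}"
    proof (rule ccontr)
      assume "\<psi> ` Q \<inter> b ` ({0} \<times> sphere 0 1) \<noteq> {}"
      then obtain q v where q: "q \<in> Q" "v \<in> sphere 0 1" "\<psi> q = b (0, v)" by blast
      have 0: "(0, v) \<in> D" using q(2) by (simp add: D_def)
      have "q \<in> b ` D"
      proof (rule ccontr)
        assume n: "q \<notin> b ` D"
        then have "\<psi> q = q" by (simp add: \<psi>_def)
        then show False using n q(3) 0 by auto
      qed
      then obtain z where z: "z \<in> D" "q = b z" by blast
      have "b (0, v) = b (TT z)" using q(3) z \<psi> by simp
      then have "TT z = (0, v)" using inj_onD[OF diffeoD(1)[OF b] _ 0 TTD[OF z(1)]] by simp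
      then have "T (fst z) = 0" by (simp add: TT_def)
      then have "fst z = - c" unfolding T_def u_def by (rule shift_zero) (use c(1) e(2) in auto)
      moreover have "fst z \<in> fst ` j ` (Q \<inter> b ` D)" using q(1) z j[OF z(1)] by force
      ultimately show False using c(2) by simp
    qed
  qed
qed

text \<open>Each further shift maps its own tube into itself and fixes everything else. Since the
  tubes are disjoint, it cannot bring points back to a core that was cleared before.\<close>

lemma tube_shift_finite:
  fixes S :: "('a::euclidean_space, 4) omanifold" and b :: "'i \<Rightarrow> (real^3) \<times> (real^2) \<Rightarrow> 'a"
  assumes S: "oriented_manifold S" and fin: "finite I"
    and b: "\<And>i. i \<in> I \<Longrightarrow> diffeo (ball 0 1 \<times> sphere 0 1) (b i ` (ball 0 1 \<times> sphere 0 1)) (b i)"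
    and op: "\<And>i. i \<in> I \<Longrightarrow> openin (top_of_set (pts S)) (b i ` (ball 0 1 \<times> sphere 0 1))"
    and dis: "disjoint_family_on (\<lambda>i. b i ` (ball 0 1 \<times> sphere 0 1)) I"
    and Q: "thin Q" "Q \<subseteq> pts S"
  obtains \<theta> where "oemb S S (pts S) \<theta>" "\<forall>i\<in>I. \<theta> ` Q \<inter> b i ` ({0} \<times> sphere 0 1) = {}"
proof -
  let ?D = "ball 0 1 \<times> sphere 0 1 :: ((real^3) \<times> (real^2)) set"
  let ?K = "{0} \<times> sphere 0 1 :: ((real^3) \<times> (real^2)) set"
  have "\<exists>\<theta>. oemb S S (pts S) \<theta> \<and> (\<forall>i\<in>J. \<theta> ` Q \<inter> b i ` ?K = {})" if "finite J" "J \<subseteq> I" for J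
    using that
  proof (induction J)
    case empty
    show ?case by (intro exI[of _ "\<lambda>x. x"] conjI oemb_id) auto
  next
    case (insert i J)
    then obtain \<theta> where \<theta>: "oemb S S (pts S) \<theta>" "\<forall>i\<in>J. \<theta> ` Q \<inter> b i ` ?K = {}" by auto
    have i: "i \<in> I" using insert by simp
    have "thin (\<theta> ` Q)" by (rule thin_image[OF diffeoD(3)[OF oembD(3)[OF \<theta>(1)]] Q])
    moreover have sub: "\<theta> ` Q \<subseteq> pts S" using oembD(2)[OF \<theta>(1)] Q(2) by blast
    ultimately obtain \<eta> where \<eta>: "oemb S S (pts S) \<eta>" "\<forall>x\<in>pts S - b i ` ?D. \<eta> x = x"
      "\<eta> ` b i ` ?D \<subseteq> b i ` ?D" "\<eta> ` \<theta> ` Q \<inter> b i ` ?K = {}"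
      by (rule tube_shift[OF S b[OF i] op[OF i]])
    have KD: "b k ` ?K \<subseteq> b k ` ?D" for k by (intro image_mono) auto
    have "\<eta> (\<theta> q) \<notin> b k ` ?K" if q: "q \<in> Q" and k: "k \<in> J" for q k
    proof
      assume a: "\<eta> (\<theta> q) \<in> b k ` ?K"
      have ki: "k \<noteq> i" "k \<in> I" using insert k by auto
      have disj: "b k ` ?D \<inter> b i ` ?D = {}" using dis ki i unfolding disjoint_family_on_def by blast
      show False
      proof (cases "\<theta> q \<in> b i ` ?D")
        case True
        then have "\<eta> (\<theta> q) \<in> b i ` ?D" using \<eta>(3) by blast
        then show False using a KD[of k] disj by blast
      next
        case False
        moreover have "\<theta> q \<in> pts S" using sub q by blast
        ultimately have "\<eta> (\<theta> q) = \<theta> q" using \<eta>(2) by blast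
        then show False using a \<theta>(2) k q by auto
      qed
    qed
    then have 1: "\<forall>k\<in>J. (\<lambda>x. \<eta> (\<theta> x)) ` Q \<inter> b k ` ?K = {}" by blast
    have 2: "(\<lambda>x. \<eta> (\<theta> x)) ` Q \<inter> b i ` ?K = {}" using \<eta>(4) by (simp add: image_image)
    show ?case
      by (intro exI[of _ "\<lambda>x. \<eta> (\<theta> x)"] conjI oemb_compose[OF \<theta>(1) \<eta>(1) oembD(2)[OF \<theta>(1)]]) (use 1 2 in simp)
  qed
  then show ?thesis using that fin by blast
qed

section \<open>Finiteness of the set of link components\<close>

text \<open>In a chart, the trace of a small ball on the whole space or on the half-space is convex,
  so its image is a connected open neighbourhood.\<close>

lemma smooth_manifold_locally_connected:
  fixes L :: "'a::euclidean_space set"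
  assumes "smooth_manifold TYPE('n::{finite,one}) L"
  shows "locally connected L"
proof (rule locallyI)
  fix w x assume w: "openin (top_of_set L) w" "x \<in> w"
  have "x \<in> L" using w openin_imp_subset by blast
  then obtain V and \<phi> :: "(real, 'n) vec \<Rightarrow> 'a" where V: "smooth_chart L V \<phi>" "x \<in> \<phi> ` V"
    using assms unfolding smooth_manifold_def by blast
  have d: "diffeo V (\<phi> ` V) \<phi>" and o: "openin (top_of_set L) (\<phi> ` V)" using V(1) by (auto simp: smooth_chart_def)
  have o2: "openin (top_of_set (\<phi> ` V)) (\<phi> ` V \<inter> w)"
    by (rule openin_Int_subset[OF w(1) openin_imp_subset[OF o]])
  define V' where "V' = V \<inter> \<phi> -` (\<phi> ` V \<inter> w)"
  have V': "openin (top_of_set V) V'" unfolding V'_def by (rule diffeo_openin_vimage[OF d o2])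
  obtain y where y: "y \<in> V'" "\<phi> y = x" using V(2) w(2) by (auto simp: V'_def)
  have "full V'" by (rule full_openin[OF smooth_chart_full[OF V(1)] V'])
  have cH: "convex (half_space :: (real, 'n) vec set)" by (auto simp: convex_def half_space_def)
  obtain H T where T: "open T" "V' = H \<inter> T" "convex H"
  proof (cases "open V'")
    case True
    then show ?thesis using that[of V' UNIV] by simp
  next
    case False
    then have "openin (top_of_set half_space) V'" using \<open>full V'\<close> by (simp add: full_def)
    then show ?thesis using that cH unfolding openin_open by blast
  qed
  then obtain r where r: "r > 0" "ball y r \<subseteq> T" using y open_contains_ball by blast
  define B where "B = ball y r \<inter> H"
  have "openin (top_of_set V') B" unfolding openin_open B_def using T r by (intro exI[of _ "ball y r"]) auto
  then have oB: "openin (top_of_set V) B" by (rule openin_trans[OF _ V'])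
  have "openin (top_of_set L) (\<phi> ` B)" by (rule openin_trans[OF diffeo_openin[OF d oB] o])
  moreover have "connected (\<phi> ` B)"
  proof (rule connected_continuous_image)
    show "continuous_on B \<phi>" by (rule continuous_on_subset[OF diffeoD(9)[OF d] openin_imp_subset[OF oB]])
    show "connected B" unfolding B_def by (rule convex_connected[OF convex_Int[OF convex_ball T(3)]])
  qed
  moreover have "x \<in> \<phi> ` B" using y r T by (auto simp: B_def)
  moreover have "\<phi> ` B \<subseteq> w" using r T by (auto simp: B_def V'_def)
  ultimately show "\<exists>U V. openin (top_of_set L) U \<and> connected V \<and> x \<in> U \<and> U \<subseteq> V \<and> V \<subseteq> w"
    by (intro exI[of _ "\<phi> ` B"] conjI) auto
qed

text \<open>Components of a locally connected set are relatively open; being disjoint and nonempty,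
  all of them belong to any finite subcover.\<close>

lemma finite_components_link:
  assumes "S2_link L"
  shows "finite (components L)"
proof -
  have L: "compact L" "locally connected L"
    using assms smooth_manifold_locally_connected[where 'n = 2] by (auto simp: S2_link_def)
  have op: "openin (top_of_set L) c" if "c \<in> components L" for c
    by (rule openin_components_locally_connected[OF L(2) that])
  have "L \<subseteq> \<Union>(components L)" by (simp add: Union_components)
  then obtain F where F: "F \<subseteq> components L" "finite F" "L \<subseteq> \<Union>F"
    using L(1) op unfolding compact_eq_openin_cover by metis
  have "c \<in> F" if c: "c \<in> components L" for c
  proof -
    obtain x where x: "x \<in> c" using in_components_nonempty[OF c] by blast
    then have "x \<in> L" using in_components_subset[OF c] by blast
    then obtain d where d: "d \<in> F" "x \<in> d" using F(3) by blast
    then have "c = d" using components_nonoverlap[of c L d] c F(1) x by blast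
    then show ?thesis using d by simp
  qed
  then have "components L \<subseteq> F" by blast
  then show ?thesis using F(2) finite_subset by blast
qed

subsection \<open>The standard orientation of the 4-sphere\<close>

lemma exhaust_5: "(x::5) = 1 \<or> x = 2 \<or> x = 3 \<or> x = 4 \<or> x = 5"
proof (induct x)
  case (of_int z)
  then have "z = 0 \<or> z = 1 \<or> z = 2 \<or> z = 3 \<or> z = 4" by fastforce
  then show ?case by auto
qed

lemma UNIV_5: "UNIV = {1, 2, 3, 4, 5::5}"
  using exhaust_5 by auto

lemma sum_5: "sum f (UNIV::5 set) = f 1 + f 2 + f 3 + f 4 + f 5"
  unfolding UNIV_5 by (simp add: ac_simps)

lemma prod_5: "prod f (UNIV::5 set) = f 1 * (f 2 * (f 3 * (f 4 * f 5)))"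
  unfolding UNIV_5 by simp

lemma prod_4: "prod f (UNIV::4 set) = f 1 * (f 2 * (f 3 * f 4))"
  unfolding UNIV_4 by simp

text \<open>\<open>lo\<close> and \<open>hi\<close> match the last four indices of
  \<open>real^5\<close> with those of \<open>real^4\<close>. The value of \<open>lo\<close> at 1 is
  a default.\<close>

definition lo :: "5 \<Rightarrow> 4" where
  "lo i = (if i = 2 then 1 else if i = 3 then 2 else if i = 4 then 3 else 4)"

definition hi :: "4 \<Rightarrow> 5" where
  "hi i = (if i = 1 then 2 else if i = 2 then 3 else if i = 3 then 4 else 5)"

lemma lo_hi [simp]: "lo (hi i) = i"
  using exhaust_4[of i] by (auto simp: lo_def hi_def)

lemma hi_lo [simp]: "i \<noteq> 1 \<Longrightarrow> hi (lo i) = i"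
  using exhaust_5[of i] by (auto simp: lo_def hi_def)

lemma hi_1 [simp]: "hi i \<noteq> 1" "1 \<noteq> hi i"
  using exhaust_4[of i] by (auto simp: hi_def)

lemma hi_inj [simp]: "hi i = hi j \<longleftrightarrow> i = j"
  by (metis lo_hi)

lemma lo_eq_iff: "i \<noteq> 1 \<Longrightarrow> lo i = j \<longleftrightarrow> i = hi j"
  by (metis lo_hi hi_lo)

lemma lo_inj: "i \<noteq> 1 \<Longrightarrow> j \<noteq> 1 \<Longrightarrow> lo i = lo j \<longleftrightarrow> i = j"
  by (metis hi_lo)

definition blk :: "real^4^4 \<Rightarrow> real^5^5" where
  "blk A = (\<chi> i j. if i = 1 then of_bool (j = 1) else if j = 1 then 0 else A $ lo i $ lo j)"

lemma blk_mult: "blk (A ** B) = blk A ** blk B"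
proof -
  have "(\<Sum>k\<in>UNIV. blk A $ i $ k * blk B $ k $ j) = blk (A ** B) $ i $ j" for i j
  proof -
    have s: "(\<Sum>k\<in>UNIV. f k) = f 1 + (\<Sum>k\<in>UNIV. f (hi k))" for f :: "5 \<Rightarrow> real"
      by (simp add: sum_5 sum_4 hi_def)
    show ?thesis unfolding s by (simp add: blk_def matrix_matrix_mult_def)
  qed
  then show ?thesis by (simp add: matrix_matrix_mult_def vec_eq_iff)
qed

lemma det_swap_mat:
  assumes "m \<noteq> n"
  shows "det (\<chi> i j. mat 1 $ i $ Transposition.transpose m n j :: real^'n^'n) = -1"
proof -
  have "det (\<chi> i j. mat 1 $ i $ Transposition.transpose m n j :: real^'n^'n) = of_int (sign (Transposition.transpose m n)) * det (mat 1 :: real^'n^'n)"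
    by (rule det_permute_columns) (simp add: permutes_swap_id)
  then show ?thesis using assms by (simp add: sign_swap_id)
qed

lemma det_idplus_mat:
  assumes "m \<noteq> n"
  shows "det (\<chi> i j. if i = m \<and> j = n then c else of_bool (i = j) :: real^'n^'n) = 1"
proof -
  have "(\<chi> i j. if i = m \<and> j = n then c else of_bool (i = j) :: real^'n^'n)
      = (\<chi> k. if k = m then row m (mat 1) + c *s row n (mat 1) else row k (mat 1))"
    using assms by (auto simp: vec_eq_iff row_def mat_def of_bool_def)
  then show ?thesis using det_row_operation[OF assms, of "mat 1 :: real^'n^'n" c] by simp
qed

text \<open>Both sides are multiplicative, so they are compared on matrices with a zero row,
  diagonal matrices, transpositions and shears; the block map sends each kind to the same
  kind.\<close>

lemma det_blk: "det (blk A) = det A"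
proof (induction A rule: induct_matrix_elementary)
  case (1 A B)
  then show ?case by (simp add: blk_mult det_mul)
next
  case (2 A i)
  have "row (hi i) (blk A) = 0"
    using 2 by (auto simp: row_def blk_def vec_eq_iff)
  then show ?case using det_zero_row 2 by metis
next
  case (3 A)
  have "det (blk A) = (\<Prod>i\<in>UNIV. blk A $ i $ i)"
    by (rule det_diagonal) (use 3 lo_inj in \<open>auto simp: blk_def\<close>)
  also have "\<dots> = (\<Prod>i\<in>UNIV. A $ i $ i)" by (simp add: prod_5 prod_4 blk_def lo_def)
  also have "\<dots> = det A" by (rule det_diagonal[symmetric]) (rule 3)
  finally show ?case .
next
  case (4 m n)
  have "blk (\<chi> i j. mat 1 $ i $ Transposition.transpose m n j) = (\<chi> i j. mat 1 $ i $ Transposition.transpose (hi m) (hi n) j)"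
    by (auto simp: vec_eq_iff blk_def mat_def Transposition.transpose_def lo_eq_iff lo_inj)
  then show ?case using det_swap_mat[OF 4] det_swap_mat[of "hi m" "hi n"] 4 by simp
next
  case (5 m n c)
  have "blk (\<chi> i j. if i = m \<and> j = n then c else of_bool (i = j)) = (\<chi> i j. if i = hi m \<and> j = hi n then c else of_bool (i = j))"
    by (auto simp: vec_eq_iff blk_def lo_eq_iff lo_inj)
  then show ?case using det_idplus_mat[OF 5] det_idplus_mat[of "hi m" "hi n"] 5 by simp
qed

definition qr :: "real^5 \<Rightarrow> real^4" where "qr v = vector [v $ 2, v $ 3, v $ 4, v $ 5]"
definition io :: "real^4 \<Rightarrow> real^5" where "io w = (\<chi> i. if i = 1 then 0 else w $ lo i)"

lemma qr_nth: "qr v $ i = v $ hi i"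
  using exhaust_4[of i] by (auto simp: qr_def hi_def)

lemma linear_qr: "linear qr"
  by (rule linearI) (simp_all add: vec_eq_iff qr_nth)

lemma linear_io: "linear io"
  by (rule linearI) (simp_all add: vec_eq_iff io_def)

lemma qr_io [simp]: "qr (io w) = w"
  by (simp add: vec_eq_iff qr_nth io_def)

lemma io_1 [simp]: "io w $ 1 = 0"
  by (simp add: io_def)

lemma io_qr: "v = v $ 1 *\<^sub>R axis 1 1 + io (qr v)"
  by (simp add: vec_eq_iff io_def qr_nth axis_def)

lemma axis_nth: "axis k x $ i = (if i = k then x else 0)"
  by (simp add: axis_def)

lemma qr_axis_1 [simp]: "qr (axis 1 c) = 0"
  by (simp add: vec_eq_iff qr_nth axis_def)

lemma inner_5: "(v::real^5) \<bullet> w = v $ 1 * w $ 1 + qr v \<bullet> qr w"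
  by (simp add: inner_vec_def sum_5 sum_4 qr_nth hi_def)

lemma matrix_blk: "matrix (\<lambda>v. v $ 1 *\<^sub>R axis 1 1 + io (B *v qr v)) = blk B"
proof -
  have "(axis j 1 $ 1 *\<^sub>R axis 1 1 + io (B *v qr (axis j 1))) $ i = blk B $ i $ j" for i j :: 5
  proof (cases "j = 1")
    case True
    then show ?thesis by (simp add: blk_def axis_nth of_bool_def linear_0[OF linear_io])
  next
    case False
    have "qr (axis j 1) = axis (lo j) 1"
      using False by (auto simp: vec_eq_iff qr_nth axis_def lo_eq_iff)
    then have "B *v qr (axis j 1) = column (lo j) B" by (simp add: matrix_vector_mult_basis)
    then show ?thesis using False by (simp add: blk_def io_def column_def axis_def)
  qed
  then show ?thesis by (simp add: matrix_def vec_eq_iff)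
qed

text \<open>The square matrix with \<open>p\<close> as first column followed by the columns of
  \<open>A\<close>; the sign of its determinant is the outward normal first orientation.\<close>

definition outer :: "real^5 \<Rightarrow> (real^4 \<Rightarrow> real^5) \<Rightarrow> real^5 \<Rightarrow> real^5" where
  "outer p A v = v $ 1 *\<^sub>R p + A (qr v)"

lemma sphere4_frames:
  "frames sphere4 p = {A. linear A \<and> (\<forall>v. A v \<bullet> p = 0) \<and> 0 < det (matrix (outer p A))}"
  by (simp add: sphere4_def outer_def[abs_def] qr_def)

lemma sphere4_pts [simp]: "pts sphere4 = sphere 0 1"
  by (simp add: sphere4_def)

lemma linear_outer: "linear A \<Longrightarrow> linear (outer p A)"
  unfolding outer_def[abs_def]
  by (rule linearI) (simp_all add: linear_add linear_scale linear_add[OF linear_qr] linear_scale[OF linear_qr] algebra_simps)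

text \<open>Changing the tangent frame by \<open>B\<close> multiplies this matrix by the block
  matrix \<open>blk B\<close>, which leaves the normal alone.\<close>

lemma outer_compose:
  assumes "linear A"
  shows "det (matrix (outer p (A \<circ> (\<lambda>v. B *v v)))) = det (matrix (outer p A)) * det B"
proof -
  have lin: "linear (\<lambda>v. v $ 1 *\<^sub>R axis 1 1 + io (B *v qr v))"
    by (rule linearI) (simp_all add: linear_add[OF linear_qr] linear_scale[OF linear_qr] linear_add[OF linear_io]
        linear_scale[OF linear_io] matrix_vector_right_distrib matrix_vector_mult_scaleR algebra_simps)
  have "outer p (A \<circ> (\<lambda>v. B *v v)) = outer p A \<circ> (\<lambda>v. v $ 1 *\<^sub>R axis 1 1 + io (B *v qr v))"
    by (simp add: fun_eq_iff outer_def linear_add[OF linear_qr] linear_scale[OF linear_qr])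
  then have "matrix (outer p (A \<circ> (\<lambda>v. B *v v))) = matrix (outer p A) ** blk B"
    using matrix_compose[OF lin linear_outer[OF assms, of p]] by (simp add: matrix_blk)
  then show ?thesis by (simp add: det_mul det_blk)
qed

lemma outer_inj:
  assumes "linear D" "inj D" "\<And>v. D v \<bullet> p = 0" "p \<bullet> p = 1"
  shows "inj (outer p D)"
proof (subst linear_injective_0[OF linear_outer[OF assms(1)]], intro allI impI)
  fix v assume v: "outer p D v = 0"
  have "outer p D v \<bullet> p = v $ 1" using assms(3,4) by (simp add: outer_def inner_add_left)
  then have 1: "v $ 1 = 0" using v by simp
  then have "D (qr v) = 0" using v by (simp add: outer_def)
  then have "qr v = 0" using linear_injective_0[OF assms(1)] assms(2) by blast
  then show "v = 0" using io_qr[of v] 1 linear_0[OF linear_io] by simp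
qed

text \<open>For another tangent frame \<open>A\<close>, solving against \<open>outer p D\<close>
  expresses \<open>A v\<close> through \<open>p\<close> and the image of \<open>D\<close>. The
  coefficient of \<open>p\<close> vanishes because \<open>A v\<close> and the image of
  \<open>D\<close> are orthogonal to \<open>p\<close>, so \<open>A\<close> differs from
  \<open>D\<close> by a matrix whose determinant has a known sign.\<close>

lemma outer_frames:
  assumes D: "linear D" "\<And>v. D v \<bullet> p = 0" "0 < det (matrix (outer p D))" and p: "p \<bullet> p = 1"
  shows "frames sphere4 p = {D \<circ> (\<lambda>v. B *v v) |B. 0 < det B}"
proof (intro equalityI subsetI)
  fix A assume "A \<in> {D \<circ> (\<lambda>v. B *v v) |B. 0 < det B}"
  then obtain B where B: "A = D \<circ> (\<lambda>v. B *v v)" "0 < det B" by blast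
  then have "0 < det (matrix (outer p A))" using outer_compose[OF D(1), of p B] D(3) by simp
  moreover have "linear A" unfolding B(1) by (intro linear_compose D(1) matrix_vector_mul_linear)
  ultimately show "A \<in> frames sphere4 p" using D(2) by (simp add: sphere4_frames B(1))
next
  fix A assume "A \<in> frames sphere4 p"
  then have A: "linear A" "\<And>v. A v \<bullet> p = 0" "0 < det (matrix (outer p A))" by (auto simp: sphere4_frames)
  let ?M = "matrix (outer p D)"
  have linM: "linear (outer p D)" by (rule linear_outer[OF D(1)])
  have "invertible ?M" using D(3) by (simp add: invertible_det_nz)
  then obtain N where N: "?M ** N = mat 1" unfolding invertible_def by blast
  define f where "f = (\<lambda>v. qr (N *v A v))"
  have "linear f" unfolding f_def
    using linear_compose[OF linear_compose[OF A(1) matrix_vector_mul_linear] linear_qr] by (simp add: o_def)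
  then have f: "f v = matrix f *v v" for v by (simp add: matrix_works)
  have Av: "A v = D (f v)" for v
  proof -
    have "A v = ?M *v (N *v A v)" by (simp add: matrix_vector_mul_assoc N)
    also have "\<dots> = outer p D (N *v A v)" using linM by (simp add: matrix_works)
    finally have 1: "A v = (N *v A v) $ 1 *\<^sub>R p + D (f v)" by (simp add: outer_def f_def)
    have "A v \<bullet> p = (N *v A v) $ 1" by (subst 1) (simp add: inner_add_left D(2) p)
    then have "(N *v A v) $ 1 = 0" using A(2) by simp
    then show ?thesis using 1 by simp
  qed
  then have eq: "A = D \<circ> (\<lambda>v. matrix f *v v)" using f by (simp add: fun_eq_iff)
  have "det (matrix (outer p A)) = det ?M * det (matrix f)" unfolding eq by (rule outer_compose[OF D(1)])
  then have "0 < det (matrix f)" using A(3) D(3) by (simp add: zero_less_mult_iff)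
  then show "A \<in> {D \<circ> (\<lambda>v. B *v v) |B. 0 < det B}" using eq by blast
qed

text \<open>An orthogonal transformation moves the pole from the first basis vector to
  \<open>p\<close>, so the classical formulas are needed for that pole only.\<close>

lemma stereographic:
  fixes p :: "real^5"
  assumes "norm p = 1"
  obtains st :: "real^4 \<Rightarrow> real^5" where "smooth_on UNIV st" "diffeo UNIV (sphere 0 1 - {p}) st"
proof -
  have "norm (axis 1 1 :: real^5) = norm p" using assms by simp
  then obtain f :: "real^5 \<Rightarrow> real^5" where f: "orthogonal_transformation f" "f (axis 1 1) = p"
    by (rule orthogonal_transformation_exists)
  define f' where "f' = inv_into UNIV f"
  have f': "orthogonal_transformation f'" unfolding f'_def by (rule orthogonal_transformation_inv[OF f(1)])
  have ff: "f (f' x) = x" "f' (f x) = x" for x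
    using orthogonal_transformation_bij[OF f(1)] by (simp_all add: f'_def bij_is_surj surj_f_inv_f bij_is_inj)
  have linf: "linear f" "linear f'" using f(1) f' by (auto simp: orthogonal_transformation_def)
  have nf: "norm (f x) = norm x" "norm (f' x) = norm x" for x
    using orthogonal_transformation_norm[OF f(1)] orthogonal_transformation_norm[OF f'] by auto
  \<comment> \<open>Inverse stereographic projection sends \<open>y\<close> to the point with normal
    coordinate \<open>s1 y\<close> and remaining coordinates \<open>s2 y *\<^sub>R y\<close>.
    \<open>sg\<close> is the projection itself, dividing by one minus the normal coordinate.\<close>
  define s1 where "s1 = (\<lambda>y::real^4. (y \<bullet> y - 1) / (y \<bullet> y + 1))"
  define s2 where "s2 = (\<lambda>y::real^4. 2 / (y \<bullet> y + 1))"
  define st where "st = (\<lambda>y. f (s1 y *\<^sub>R axis 1 1 + s2 y *\<^sub>R io y))"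
  define sg where "sg = (\<lambda>x. inverse (1 - f' x $ 1) *\<^sub>R qr (f' x))"
  have pos: "y \<bullet> y + 1 \<noteq> 0" for y :: "real^4" using inner_ge_zero[of y] by linarith
  have sm1: "smooth_on UNIV s1" and sm2: "smooth_on UNIV s2" unfolding s1_def s2_def
    by (intro smooth_on_divide smooth_on_add smooth_on_diff smooth_on_inner smooth_on_id smooth_on_const open_UNIV pos)+
  have sm: "smooth_on UNIV st" unfolding st_def
    by (intro smooth_on_linear_compose[OF linf(1)] smooth_on_add smooth_on_scaleR sm1 sm2 smooth_on_const open_UNIV
        smooth_on_linear linear_io)
  have 12: "1 - s1 y = s2 y" "s2 y \<noteq> 0" for y using pos[of y] by (auto simp: s1_def s2_def field_simps)
  have "diffeo UNIV (sphere 0 1 - {p}) st"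
  proof (rule diffeoI[where g = sg])
    let ?w = "\<lambda>y. s1 y *\<^sub>R axis 1 1 + s2 y *\<^sub>R io y :: real^5"
    have w1: "?w y $ 1 = s1 y" "qr (?w y) = s2 y *\<^sub>R y" for y
      by (simp_all add: axis_nth linear_add[OF linear_qr] linear_scale[OF linear_qr])
    have nst: "st y \<in> sphere 0 1" for y
    proof -
      have "(s1 y)\<^sup>2 + (s2 y)\<^sup>2 * (y \<bullet> y) = 1"
      proof -
        have "s2 y * (y \<bullet> y + 1) = 2" 
          unfolding s2_def times_divide_eq_left by (rule nonzero_mult_div_cancel_right[OF pos])
        moreover have "(1 - s2 y)\<^sup>2 + (s2 y)\<^sup>2 * (y \<bullet> y) = 1 - 2 * s2 y + s2 y * (s2 y * (y \<bullet> y + 1))"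
          by (simp add: power2_eq_square algebra_simps)
        moreover have "s1 y = 1 - s2 y" using 12(1)[of y] by simp
        ultimately show ?thesis by simp
      qed
      then have "?w y \<bullet> ?w y = 1" unfolding inner_5 w1 by (simp add: power2_eq_square algebra_simps)
      then have "norm (?w y) = 1" by (simp add: norm_eq_1)
      then show ?thesis by (simp add: st_def nf)
    qed
    have stp: "st y \<noteq> p" for y
    proof
      assume "st y = p"
      then have "f' (st y) = f' (f (axis 1 1))" using f(2) by simp
      then have "?w y = axis 1 1" by (simp add: ff st_def)
      then have "?w y $ 1 = (axis 1 1 :: real^5) $ 1" by (rule arg_cong[where f = "\<lambda>w. w $ 1"])
      then have "s1 y = 1" unfolding w1 by (simp add: axis_def)
      then show False using 12[of y] by simp
    qed
    show "sg (st y) = y" for y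
    proof -
      have "sg (st y) = inverse (1 - ?w y $ 1) *\<^sub>R qr (?w y)" by (simp add: sg_def st_def ff)
      also have "\<dots> = inverse (s2 y) *\<^sub>R (s2 y *\<^sub>R y)" by (simp only: w1 12)
      finally show ?thesis using 12(2)[of y] by simp
    qed
    have ne1: "f' x $ 1 \<noteq> 1" if x: "x \<in> sphere 0 1 - {p}" for x
    proof
      assume 1: "f' x $ 1 = 1"
      have "f' x \<bullet> f' x = 1" using x nf(2)[of x] by (simp add: norm_eq_1[symmetric])
      then have "qr (f' x) \<bullet> qr (f' x) = 0" unfolding inner_5 using 1 by simp
      then have "f' x = axis 1 1" using io_qr[of "f' x"] 1 linear_0[OF linear_io] by simp
      then have "f (f' x) = p" using f(2) by simp
      then show False using x ff by simp
    qed
    have stsg: "st (sg x) = x" if x: "x \<in> sphere 0 1 - {p}" for x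
    proof -
      define w where "w = f' x"
      have w: "w $ 1 \<noteq> 1" "w \<bullet> w = 1" using ne1[OF x] x nf(2)[of x] by (auto simp: w_def norm_eq_1[symmetric])
      have q: "qr w \<bullet> qr w = (1 - w $ 1) * (1 + w $ 1)"
        using w(2) unfolding inner_5 by (simp add: algebra_simps)
      define y where "y = inverse (1 - w $ 1) *\<^sub>R qr w"
      have "y \<bullet> y = (1 + w $ 1) / (1 - w $ 1)"
        using w(1) q by (simp add: y_def divide_inverse mult.assoc)
      then have e: "y \<bullet> y * (1 - w $ 1) = 1 + w $ 1" using w(1) by simp
      have "y \<bullet> y - 1 = w $ 1 * (y \<bullet> y + 1)" "2 = (1 - w $ 1) * (y \<bullet> y + 1)"
        using e by (simp_all add: algebra_simps)
      then have "s1 y = w $ 1" "s2 y = 1 - w $ 1"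
        unfolding s1_def s2_def by (simp_all only: nonzero_divide_eq_eq[OF pos])
      then have "?w y = w $ 1 *\<^sub>R axis 1 1 + io (qr w)"
        using w(1) by (simp add: y_def linear_scale[OF linear_io])
      then have "?w y = w" using io_qr[of w] by simp
      moreover have "sg x = y" by (simp add: sg_def y_def w_def)
      ultimately show ?thesis by (simp add: st_def w_def ff)
    qed
    show "range st = sphere 0 1 - {p}"
    proof (intro equalityI subsetI)
      fix x assume "x \<in> sphere 0 1 - {p}"
      then show "x \<in> range st" using stsg by (metis rangeI)
    qed (use nst stp in auto)
    show "smooth_map UNIV st" by (rule smooth_on_imp_smooth_map[OF sm]) simp
    have cont: "continuous_on UNIV (\<lambda>x. f' x $ 1)"
      by (rule smooth_on_continuous_on[OF smooth_on_linear[OF open_UNIV]])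
        (use linear_compose[OF linf(2) linear_comp1[of 1]] in \<open>simp add: o_def\<close>)
    let ?U = "{x. f' x $ 1 \<noteq> 1}"
    have op: "open ?U" by (rule open_Collect_neq[OF cont continuous_on_const])
    have l1: "smooth_on ?U (\<lambda>x. f' x $ 1)"
      by (rule smooth_on_linear[OF op]) (use linear_compose[OF linf(2) linear_comp1[of 1]] in \<open>simp add: o_def\<close>)
    have "smooth_on ?U (\<lambda>x. 1 - f' x $ 1)" by (intro smooth_on_diff l1 smooth_on_const op)
    then have "smooth_on ?U (\<lambda>x. inverse (1 - f' x $ 1))"
      by (rule smooth_on_compose[OF smooth_on_inverse]) auto
    then have "smooth_on ?U sg" unfolding sg_def
      by (rule smooth_on_scaleR) (intro smooth_on_linear_compose[OF linear_qr] smooth_on_linear op linf)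
    then show "smooth_map (sphere 0 1 - {p}) sg" by (rule smooth_on_imp_smooth_map) (use ne1 in blast)
  qed
  then show ?thesis using that sm by blast
qed

text \<open>The determinant with the outward normal never vanishes and its domain is connected, so
  its sign is constant. If it is negative, the chart is composed with a reflection of
  \<open>real^4\<close>.\<close>

proposition sphere4_chart:
  assumes "norm p = 1"
  obtains \<phi> where "oriented_chart sphere4 UNIV \<phi>" "range \<phi> = sphere 0 1 - {p}"
proof -
  note goal = that
  obtain st :: "real^4 \<Rightarrow> real^5" where st: "smooth_on UNIV st" "diffeo UNIV (sphere 0 1 - {p}) st"
    by (rule stereographic[OF assms])
  let ?D = "\<lambda>y. frechet_derivative st (at y)"
  have D: "(st has_derivative ?D y) (at y)" for y by (rule smooth_on_has_derivative[OF st(1)]) simp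
  have linD: "linear (?D y)" for y by (rule has_derivative_linear[OF D])
  have "full (UNIV :: (real^4) set)" by (simp add: full_def)
  then have injD: "inj (?D y)" for y by (rule diffeo_derivative_inj[OF st(2) _ UNIV_I D])
  have "st y \<in> sphere 0 1" for y using diffeoD(2)[OF st(2)] by blast
  then have n1: "st y \<bullet> st y = 1" for y by (simp add: norm_eq_1[symmetric])
  \<comment> \<open>Differentiating the constant function \<open>st y \<bullet> st y\<close> shows
    that the derivative is tangent to the sphere.\<close>
  have tan: "?D y v \<bullet> st y = 0" for y v
  proof -
    have "((\<lambda>y. st y \<bullet> st y) has_derivative (\<lambda>v. st y \<bullet> ?D y v + ?D y v \<bullet> st y)) (at y)"
      by (rule has_derivative_inner[OF D D])
    moreover have "((\<lambda>y. st y \<bullet> st y) has_derivative (\<lambda>v. 0)) (at y)" by (simp add: n1)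
    ultimately have "(\<lambda>v. st y \<bullet> ?D y v + ?D y v \<bullet> st y) = (\<lambda>v. 0)" by (rule has_derivative_unique)
    then have "st y \<bullet> ?D y v + ?D y v \<bullet> st y = 0" by (rule fun_cong)
    then show ?thesis by (simp add: inner_commute)
  qed
  let ?\<Delta> = "\<lambda>y. det (matrix (outer (st y) (?D y)))"
  have nz: "?\<Delta> y \<noteq> 0" for y
    using det_nz_iff_inj[OF linear_outer[OF linD]] outer_inj[OF linD injD tan n1] by blast
  have "smooth_on UNIV ?\<Delta>"
  proof (rule smooth_on_det[OF open_UNIV])
    fix i j
    have "\<forall>n. Ck_on (Suc n) st UNIV" using st(1) unfolding smooth_on_def by blast
    then have "smooth_on UNIV (\<lambda>y. ?D y w)" for w by (simp add: smooth_on_def)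
    then have "smooth_on UNIV (\<lambda>y. axis j 1 $ 1 *\<^sub>R st y + ?D y (qr (axis j 1)))"
      by (intro smooth_on_add smooth_on_scaleR smooth_on_const open_UNIV st(1))
    then have "smooth_on UNIV (\<lambda>y. (axis j 1 $ 1 *\<^sub>R st y + ?D y (qr (axis j 1))) $ i)"
      by (rule smooth_on_linear_compose[OF linear_comp1])
    then show "smooth_on UNIV (\<lambda>y. matrix (outer (st y) (?D y)) $ i $ j)" by (simp add: matrix_def outer_def)
  qed
  then have cont: "continuous_on UNIV ?\<Delta>" by (rule smooth_on_continuous_on)
  have "open {y. 0 < ?\<Delta> y}" "open {y. ?\<Delta> y < 0}"
    using cont by (auto intro: open_Collect_less continuous_on_const)
  moreover have "{y. 0 < ?\<Delta> y} \<inter> {y. ?\<Delta> y < 0} \<inter> UNIV = {}" by auto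
  moreover have "UNIV \<subseteq> {y. 0 < ?\<Delta> y} \<union> {y. ?\<Delta> y < 0}" using nz by (auto simp: neq_iff)
  ultimately have "{y. 0 < ?\<Delta> y} \<inter> UNIV = {} \<or> {y. ?\<Delta> y < 0} \<inter> UNIV = {}"
    using connectedD[OF connected_UNIV] by blast
  then have sgn: "(\<forall>y. ?\<Delta> y < 0) \<or> (\<forall>y. 0 < ?\<Delta> y)" using nz by (auto simp: neq_iff)
  have op: "openin (top_of_set (sphere 0 1)) (sphere 0 1 - {p})" by (simp add: openin_delete)
  have main: ?thesis if \<phi>: "diffeo UNIV (sphere 0 1 - {p}) \<phi>"
    and D: "\<And>y. (\<phi> has_derivative D y) (at y)" "\<And>y v. D y v \<bullet> \<phi> y = 0" "\<And>y. 0 < det (matrix (outer (\<phi> y) (D y)))"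
    for \<phi> :: "real^4 \<Rightarrow> real^5" and D
  proof -
    have im: "range \<phi> = sphere 0 1 - {p}" using diffeoD(2)[OF \<phi>] .
    have "\<phi> y \<bullet> \<phi> y = 1" for y using im by (metis DiffD1 mem_sphere_0 norm_eq_1 rangeI)
    then have fr: "frames sphere4 (\<phi> y) = {D y \<circ> (\<lambda>v. B *v v) |B. 0 < det B}" for y
      by (intro outer_frames has_derivative_linear[OF D(1)] D(2,3))
    have "\<forall>y\<in>UNIV. \<exists>Da. (\<phi> has_derivative Da) (at y within UNIV) \<and> frames sphere4 (\<phi> y) = {Da \<circ> (\<lambda>v. B *v v) |B. 0 < det B}"
      by (intro ballI exI conjI, rule D(1), rule fr)
    then have "oriented_chart sphere4 UNIV \<phi>"
      unfolding oriented_chart_def smooth_chart_def using \<phi> op im by (intro conjI) simp_all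
    then show ?thesis by (rule goal[OF _ im])
  qed
  show ?thesis using sgn
  proof
    assume "\<forall>y. 0 < ?\<Delta> y"
    then have pos: "0 < ?\<Delta> y" for y by blast
    show ?thesis by (rule main[OF st(2) D tan pos])
  next
    assume neg: "\<forall>y. ?\<Delta> y < 0"
    let ?r = "\<lambda>y::real^4. refl_mat *v y"
    have "invertible (refl_mat :: real^4^4)" by (simp add: invertible_det_nz det_refl_mat)
    then obtain r' :: "real^4^4" where r': "refl_mat ** r' = mat 1" "r' ** refl_mat = mat 1" unfolding invertible_def by blast
    have dr: "diffeo UNIV UNIV ?r"
    proof (rule diffeoI[where g = "\<lambda>y. r' *v y"])
      show "range ?r = UNIV" using r'(1) by (metis matrix_vector_mul_assoc matrix_vector_mul_lid surjI)
      show "smooth_map UNIV ?r" "smooth_map UNIV (\<lambda>y. r' *v y)"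
        by (rule smooth_on_imp_smooth_map[OF smooth_on_linear[OF open_UNIV matrix_vector_mul_linear]], simp)+
      show "r' *v (refl_mat *v x) = x" for x by (simp add: matrix_vector_mul_assoc r')
    qed
    have lr: "(?r has_derivative ?r) (at y)" for y
      by (rule bounded_linear_imp_has_derivative) (simp add: linear_conv_bounded_linear[symmetric])
    have Dr: "((\<lambda>y. st (?r y)) has_derivative (?D (?r y) \<circ> ?r)) (at y)" for y
      using has_derivative_compose[OF lr D] by (simp add: o_def)
    have pos: "0 < det (matrix (outer (st (?r y)) (?D (?r y) \<circ> ?r)))" for y
      unfolding outer_compose[OF linD] det_refl_mat using spec[OF neg, of "?r y"] by simp
    have tan': "(?D (?r y) \<circ> ?r) v \<bullet> st (?r y) = 0" for y v by (simp add: tan)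
    show ?thesis by (rule main[OF diffeo_compose[OF dr st(2)] Dr tan' pos])
  qed
qed

lemma oriented_manifold_sphere4: "oriented_manifold sphere4"
  unfolding oriented_manifold_def
proof
  fix x assume "x \<in> pts sphere4"
  then have x: "norm x = 1" by simp
  then obtain \<phi> where \<phi>: "oriented_chart sphere4 UNIV \<phi>" "range \<phi> = sphere 0 1 - {- x}"
    using sphere4_chart[of "- x"] by auto
  have "x \<noteq> - x" using x by (metis eq_neg_iff_add_eq_0 norm_zero scaleR_2 scaleR_eq_0_iff zero_neq_numeral zero_neq_one)
  then have "x \<in> range \<phi>" using \<phi>(2) x by auto
  then show "\<exists>V \<phi>. oriented_chart sphere4 V \<phi> \<and> x \<in> \<phi> ` V" using \<phi>(1) by blast
qed

section \<open>Punctured manifolds, and pushing thin sets off the surgery cores\<close>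

lemma oriented_manifold_delete:
  assumes M: "oriented_manifold M" and op: "openin (top_of_set (pts M)) (pts M - T)"
  shows "oriented_manifold (delete M T)"
  unfolding oriented_manifold_def
proof
  fix x assume "x \<in> pts (delete M T)"
  then have x: "x \<in> pts M - T" by (simp add: delete_def)
  obtain V \<phi> y where V: "oriented_chart M V \<phi>" "\<phi> ` V \<subseteq> pts M - T" "y \<in> V" "\<phi> y = x"
    by (rule oriented_chart_at[OF M op x])
  have "openin (top_of_set (pts M - T)) (\<phi> ` V)"
    by (rule openin_subset_trans[OF oriented_chart_openin[OF V(1)] V(2)]) auto
  then have "oriented_chart (delete M T) V \<phi>"
    using V(1) by (simp add: oriented_chart_def smooth_chart_def delete_def)
  then show "\<exists>V \<phi>. oriented_chart (delete M T) V \<phi> \<and> x \<in> \<phi> ` V" using V(3,4) by blast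
qed

lemma oemb_delete: "oemb (delete M T) W (pts M - T) a \<longleftrightarrow> oemb M W (pts M - T) a"
  by (auto simp: oemb_def delete_def)

text \<open>Deleting points leaves the frames unchanged, so an embedding of the punctured manifold
  is an \<open>oemb\<close> on a subset of the original one and \<open>delete\<close> can be
  forgotten.\<close>

lemma open_embedding_delete:
  assumes M: "oriented_manifold M" and W: "oriented_manifold W" and op: "openin (top_of_set (pts M)) (pts M - T)"
    and a: "open_oriented_embedding (delete M T) W a"
  shows "oemb M W (pts M - T) a" "openin (top_of_set (pts W)) (a ` (pts M - T))"
proof -
  have "oemb (delete M T) W (pts (delete M T)) a"
    by (rule oriented_embedding_oemb[OF _ oriented_manifold_delete[OF M op] W])
      (use a in \<open>simp add: open_oriented_embedding_def\<close>)
  then show "oemb M W (pts M - T) a" using oemb_delete[of M T W a] by (simp add: delete_def)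
  show "openin (top_of_set (pts W)) (a ` (pts M - T))"
    using a by (simp add: open_oriented_embedding_def delete_def)
qed

text \<open>The cores of the surgeries are circles, so a thin set can be pushed off them into the complement
  of the link; this lies in the 4-sphere, and some point of the sphere is missed as well.\<close>

proposition surgery_flatten:
  fixes S :: "('a::euclidean_space, 4) omanifold"
  assumes L: "S2_link L" and S: "surgery L S" and Q: "thin Q" "Q \<subseteq> pts S"
  obtains S' \<kappa> where "openin (top_of_set (pts S)) S'" "Q \<subseteq> S'" "oemb S (std UNIV) S' \<kappa>"
proof -
  let ?D = "ball 0 1 \<times> sphere 0 1 :: ((real^3) \<times> (real^2)) set"
  let ?D' = "sphere 0 1 \<times> cball 0 1 :: ((real^3) \<times> (real^2)) set"
  have oS: "oriented_manifold S" using S by (simp add: surgery_def)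
  show ?thesis
    using conjunct2[OF S[unfolded surgery_def]]
  proof (elim exE conjE)
    fix \<phi> :: "(real^5) set \<Rightarrow> (real^3) \<times> (real^2) \<Rightarrow> real^5" and a and b :: "(real^5) set \<Rightarrow> (real^3) \<times> (real^2) \<Rightarrow> 'a"
    assume \<phi>: "\<forall>C \<in> components L. diffeo ?D' (\<phi> C ` ?D') (\<phi> C) \<and> \<phi> C ` ?D' \<subseteq> pts sphere4 \<and> \<phi> C ` (sphere 0 1 \<times> {0}) = C"
      and \<phi>d: "disjoint_family_on (\<lambda>C. \<phi> C ` ?D') (components L)"
      and a: "open_oriented_embedding (delete sphere4 L) S a"
      and b: "\<forall>C \<in> components L. diffeo ?D (b C ` ?D) (b C) \<and> openin (top_of_set (pts S)) (b C ` ?D)"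
      and bd: "disjoint_family_on (\<lambda>C. b C ` ?D) (components L)"
      and un: "pts S = a ` (pts sphere4 - L) \<union> (\<Union>C \<in> components L. b C ` ?D)"
      and gl: "\<forall>C \<in> components L. \<forall>x \<in> pts sphere4 - L. \<forall>y \<in> ball 0 1. \<forall>v \<in> sphere 0 1.
           a x = b C (y, v) \<longleftrightarrow> (\<exists>u \<in> sphere 0 1. \<exists>t \<in> {0<..<1}. x = \<phi> C (u, t *\<^sub>R v) \<and> y = t *\<^sub>R u)"
  have "closed L" using L by (simp add: S2_link_def compact_imp_closed)
  then have opL: "openin (top_of_set (pts sphere4)) (pts sphere4 - L)"
    by (metis Diff_eq openin_open open_Compl)
  note A = open_embedding_delete[OF oriented_manifold_sphere4 oS opL a]
  have da: "diffeo (pts sphere4 - L) (a ` (pts sphere4 - L)) a" by (rule oembD(3)[OF A(1)])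
  obtain \<theta> where \<theta>: "oemb S S (pts S) \<theta>" "\<forall>C\<in>components L. \<theta> ` Q \<inter> b C ` ({0} \<times> sphere 0 1) = {}"
    by (rule tube_shift_finite[OF oS finite_components_link[OF L] _ _ bd Q]) (use b in auto)
  \<comment> \<open>After the push, a point of a tube has nonzero ball coordinate \<open>y\<close>.
    The gluing rule then identifies it with the point of the link complement whose sphere coordinate
    is \<open>y\<close> normalized and whose fibre coordinate is \<open>v\<close> scaled by the norm
    of \<open>y\<close>.\<close>
  have QA: "\<theta> ` Q \<subseteq> a ` (pts sphere4 - L)"
  proof
    fix x assume x: "x \<in> \<theta> ` Q"
    have "x \<in> pts S" using x oembD(2)[OF \<theta>(1)] Q(2) by blast
    moreover have "x \<in> a ` (pts sphere4 - L)" if C: "C \<in> components L" and xC: "x \<in> b C ` ?D" for C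
    proof -
      obtain y v where y: "norm y < 1" "v \<in> sphere 0 1" "x = b C (y, v)" using xC by auto
      have y0: "y \<noteq> 0"
      proof
        assume "y = 0"
        then have "x \<in> b C ` ({0} \<times> sphere 0 1)" using y by auto
        then show False using \<theta>(2) C x by blast
      qed
      define u where "u = y /\<^sub>R norm y"
      define t where "t = norm y"
      have ut: "u \<in> sphere 0 1" "t \<in> {0<..<1}" "y = t *\<^sub>R u" using y0 y(1) by (auto simp: u_def t_def)
      have zD: "(u, t *\<^sub>R v) \<in> ?D'" using ut y(2) by auto
      have dC: "diffeo ?D' (\<phi> C ` ?D') (\<phi> C)" and sC: "\<phi> C ` ?D' \<subseteq> pts sphere4" using \<phi> C by auto
      \<comment> \<open>On its own component the fibre coordinate would have to vanish; the other
        components are kept away by disjointness of the tubes.\<close>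
      have "\<phi> C (u, t *\<^sub>R v) \<notin> L"
      proof
        assume "\<phi> C (u, t *\<^sub>R v) \<in> L"
        then obtain C' where C': "C' \<in> components L" "\<phi> C (u, t *\<^sub>R v) \<in> C'" by (metis UnionE Union_components)
        then have "\<phi> C (u, t *\<^sub>R v) \<in> \<phi> C' ` (sphere 0 1 \<times> {0})" using \<phi> by blast
        then obtain w where w: "w \<in> sphere 0 1" "\<phi> C (u, t *\<^sub>R v) = \<phi> C' (w, 0)" by blast
        show False
        proof (cases "C' = C")
          case True
          then have "(u, t *\<^sub>R v) = (w, 0)"
            using inj_onD[OF diffeoD(1)[OF dC] _ zD, of "(w, 0)"] w by auto
          then show False using ut(2) y(2) by auto
        next
          case False
          then have "\<phi> C ` ?D' \<inter> \<phi> C' ` ?D' = {}" using \<phi>d C C'(1) unfolding disjoint_family_on_def by blast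
          moreover have "(w, 0) \<in> ?D'" using w by auto
          ultimately show False using w(2) zD by blast
        qed
      qed
      then have mem: "\<phi> C (u, t *\<^sub>R v) \<in> pts sphere4 - L" using sC zD by blast
      have "y \<in> ball 0 1" using y(1) by simp
      note gl' = bspec[OF bspec[OF bspec[OF bspec[OF gl C] mem] this] y(2)]
      have "a (\<phi> C (u, t *\<^sub>R v)) = b C (y, v)"
        unfolding gl' using ut by (intro bexI[of _ u] bexI[of _ t] conjI refl)
      then show ?thesis using mem y(3) by (metis image_eqI)
    qed
    ultimately show "x \<in> a ` (pts sphere4 - L)" unfolding un by blast
  qed
  define j where "j = inv_into (pts sphere4 - L) a"
  have oj: "oemb S sphere4 (a ` (pts sphere4 - L)) j"
    unfolding j_def by (rule oemb_inverse[OF A(1) oriented_manifold_sphere4 oS opL])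
  define Q' where "Q' = j ` \<theta> ` Q"
  have thQ': "thin Q'" unfolding Q'_def
    by (rule thin_image[OF diffeoD(3)[OF oembD(3)[OF oj]] thin_image[OF diffeoD(3)[OF oembD(3)[OF \<theta>(1)]] Q] QA])
  \<comment> \<open>A chart around most of the sphere turns \<open>Q'\<close> into a negligible
    subset of \<open>real^4\<close>, so a point outside \<open>Q'\<close> exists. Removing it makes
    stereographic coordinates available.\<close>
  obtain p where p: "norm p = 1" "p \<notin> Q'"
  proof -
    obtain \<phi>1 where \<phi>1: "oriented_chart sphere4 UNIV \<phi>1" "range \<phi>1 = sphere 0 1 - {axis 1 1}"
      by (rule sphere4_chart[of "axis 1 1"]) auto
    have "smooth_map (range \<phi>1) (inv_into UNIV \<phi>1)" by (rule diffeoD(4)[OF oriented_chart_diffeo[OF \<phi>1(1)]])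
    then have "thin (inv_into UNIV \<phi>1 ` (Q' \<inter> range \<phi>1))" by (rule thin_image[OF _ thin_subset[OF thQ']]) auto
    then have "negligible (inv_into UNIV \<phi>1 ` (Q' \<inter> range \<phi>1))" by (rule thin_negligible) simp
    then have "inv_into UNIV \<phi>1 ` (Q' \<inter> range \<phi>1) \<noteq> UNIV" using non_negligible_UNIV by metis
    then obtain y where y: "y \<notin> inv_into UNIV \<phi>1 ` (Q' \<inter> range \<phi>1)" by blast
    have "\<phi>1 y \<notin> Q'"
    proof
      assume "\<phi>1 y \<in> Q'"
      then have "inv_into UNIV \<phi>1 (\<phi>1 y) \<in> inv_into UNIV \<phi>1 ` (Q' \<inter> range \<phi>1)" by blast
      then show False using y diffeoD(5)[OF oriented_chart_diffeo[OF \<phi>1(1)]] by simp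
    qed
    moreover have "\<phi>1 y \<in> sphere 0 1" using \<phi>1(2) by blast
    ultimately show ?thesis using that by simp
  qed
  obtain \<zeta> where \<zeta>: "oriented_chart sphere4 UNIV \<zeta>" "range \<zeta> = sphere 0 1 - {p}"
    by (rule sphere4_chart[OF p(1)])
  have o\<zeta>: "oemb (std UNIV) sphere4 UNIV \<zeta>" by (rule oriented_chart_oemb[OF \<zeta>(1)]) simp
  have "full (UNIV :: (real^4) set)" by (simp add: full_def)
  then have ok: "oemb sphere4 (std UNIV) (range \<zeta>) (inv_into UNIV \<zeta>)"
    by (intro oemb_inverse[OF o\<zeta> oriented_manifold_std oriented_manifold_sphere4]) auto
  \<comment> \<open>The open set in which the flattening is defined: the link complement without
    \<open>p\<close>, as seen in \<open>S\<close>. Its preimage under \<open>\<theta>\<close> is the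
    required neighbourhood of \<open>Q\<close>.\<close>
  define A' where "A' = a ` (pts sphere4 - L - {p})"
  have "openin (top_of_set (pts sphere4 - L)) (pts sphere4 - L - {p})" by (simp add: openin_delete)
  then have opA': "openin (top_of_set (pts S)) A'"
    unfolding A'_def by (rule openin_trans[OF diffeo_openin[OF da] A(2)])
  define S' where "S' = pts S \<inter> \<theta> -` A'"
  have "openin (top_of_set (\<theta> ` pts S)) (\<theta> ` pts S \<inter> A')" by (rule openin_Int_subset[OF opA' oembD(2)[OF \<theta>(1)]])
  then have "openin (top_of_set (pts S)) (pts S \<inter> \<theta> -` (\<theta> ` pts S \<inter> A'))"
    by (rule diffeo_openin_vimage[OF oembD(3)[OF \<theta>(1)]])
  moreover have "pts S \<inter> \<theta> -` (\<theta> ` pts S \<inter> A') = S'" by (auto simp: S'_def)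
  ultimately have opS': "openin (top_of_set (pts S)) S'" by simp
  have jA': "j x \<in> pts sphere4 - L - {p}" if "x \<in> A'" for x
    using that diffeoD(5)[OF da] by (auto simp: A'_def j_def)
  have QS': "Q \<subseteq> S'"
  proof
    fix q assume q: "q \<in> Q"
    then obtain x where x: "x \<in> pts sphere4 - L" "\<theta> q = a x" using QA by blast
    then have "j (\<theta> q) = x" using diffeoD(5)[OF da] by (simp add: j_def)
    moreover have "j (\<theta> q) \<in> Q'" using q by (simp add: Q'_def)
    ultimately have "x \<noteq> p" using p(2) by blast
    then show "q \<in> S'" using x q Q(2) by (auto simp: S'_def A'_def)
  qed
  have o1: "oemb S sphere4 S' (\<lambda>x. j (\<theta> x))"
    by (rule oemb_compose[OF oemb_subset[OF \<theta>(1)] oj]) (auto simp: S'_def A'_def)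
  have "oemb S (std UNIV) S' (\<lambda>x. inv_into UNIV \<zeta> (j (\<theta> x)))"
    by (rule oemb_compose[OF o1 ok]) (use jA' in \<open>auto simp: \<zeta>(2) S'_def\<close>)
  then show ?thesis by (rule that[OF opS' QS'])
  qed
qed

subsection \<open>Turning a punctured chart inside out\<close>

lemma flat_mono: "s \<le> t \<Longrightarrow> flat 0 s \<le> flat 0 t"
  by (auto simp: flat_def intro: le_imp_inverse_le)

lemma smooth_step_mono: "s \<le> t \<Longrightarrow> smooth_step s \<le> smooth_step t"
proof -
  assume st: "s \<le> t"
  define a b a' b' where "a = flat 0 s" and "b = flat 0 (1 - s)" and "a' = flat 0 t" and "b' = flat 0 (1 - t)"
  have nn: "0 \<le> a" "0 \<le> b" "0 \<le> a'" "0 \<le> b'" by (auto simp: a_def b_def a'_def b'_def flat_def)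
  have le: "a \<le> a'" "b' \<le> b" using st by (auto simp: a_def b_def a'_def b'_def intro: flat_mono)
  have pos: "0 < a + b" "0 < a' + b'" using smooth_step_denom[of s] smooth_step_denom[of t] by (auto simp: a_def b_def a'_def b'_def)
  have "a * b' \<le> a' * b" using le nn by (intro mult_mono) auto
  then have "a * (a' + b') \<le> a' * (a + b)" by (simp add: algebra_simps)
  then have "a / (a + b) \<le> a' / (a' + b')" using pos by (simp add: divide_simps)
  then show ?thesis by (simp add: smooth_step_def a_def b_def a'_def b'_def)
qed

text \<open>Near 0 the profile is \<open>1 - s\<close>, the inversion used in the neck; beyond
  \<open>2 * d\<close> it is at most \<open>c\<close>, so everything far away is contracted.
  Negative derivative and positive values make the radial map with this profile a diffeomorphism
  onto its image.\<close>

lemma radial_profile: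
  assumes "0 < d" "d \<le> 1/4" "0 < c" "c \<le> 1/4"
  obtains l :: "real \<Rightarrow> real" and l' :: "real \<Rightarrow> real" where
    "smooth_on {0<..} l" "\<forall>s>0. (l has_real_derivative l' s) (at s) \<and> l' s < 0"
    "\<forall>s>0. s \<le> d \<longrightarrow> l s = 1 - s" "\<forall>s>0. 0 < l s \<and> l s < 1" "\<forall>s\<ge>2 * d. l s \<le> c" "\<forall>s\<ge>d. l s \<le> 1 - d"
proof -
  define \<sigma> where "\<sigma> = (\<lambda>s. smooth_step (2 - s / d))"
  \<comment> \<open>The weight \<open>\<sigma>\<close> is 1 up to \<open>d\<close> and 0 from
    \<open>2 * d\<close> on. It is only allowed to decrease while \<open>1 - s\<close> exceeds the
    second branch, which holds up to \<open>2 * d\<close> because \<open>1 - s\<close> is at least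
    1/2 there and \<open>c\<close> is at most 1/4; this keeps the interpolation decreasing. The
    branch \<open>c / (1 + s)\<close> is positive, decreasing and below \<open>c\<close>.\<close>
  define l where "l = (\<lambda>s. \<sigma> s * (1 - s) + (1 - \<sigma> s) * (c / (1 + s)))"
  have sb: "0 \<le> \<sigma> s" "\<sigma> s \<le> 1" for s using smooth_step_bounds by (auto simp: \<sigma>_def)
  have s1: "\<sigma> s = 1" if "s \<le> d" for s
    unfolding \<sigma>_def by (rule smooth_step_1) (use that assms in \<open>simp add: field_simps\<close>)
  have s0: "\<sigma> s = 0" if "s \<ge> 2 * d" for s
    unfolding \<sigma>_def by (rule smooth_step_0) (use that assms in \<open>simp add: field_simps\<close>)
  have anti: "\<sigma> t \<le> \<sigma> s" if "s \<le> t" for s t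
    unfolding \<sigma>_def by (rule smooth_step_mono) (use that assms in \<open>simp add: divide_right_mono\<close>)
  have sm\<sigma>: "smooth_on UNIV \<sigma>" unfolding \<sigma>_def
    by (rule smooth_on_compose[OF smooth_on_step, where f = "\<lambda>s. 2 - s / d"])
      (simp_all add: divide_inverse smooth_on_diff smooth_on_mult smooth_on_const smooth_on_id)
  have sm\<sigma>': "smooth_on {0<..} \<sigma>" by (rule smooth_on_subset[OF sm\<sigma>]) auto
  have sml: "smooth_on {0<..} l" unfolding l_def
    by (intro smooth_on_add smooth_on_mult smooth_on_divide smooth_on_diff sm\<sigma>' smooth_on_const smooth_on_id) auto
  define \<sigma>' where "\<sigma>' = (\<lambda>s. frechet_derivative \<sigma> (at s) 1)"
  have D\<sigma>: "(\<sigma> has_real_derivative \<sigma>' s) (at s)" for s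
  proof -
    have h: "(\<sigma> has_derivative frechet_derivative \<sigma> (at s)) (at s)" by (rule smooth_on_has_derivative[OF sm\<sigma>]) simp
    have "frechet_derivative \<sigma> (at s) v = \<sigma>' s * v" for v
      using linear_scale[OF has_derivative_linear[OF h], of v 1] by (simp add: \<sigma>'_def mult.commute)
    then have "frechet_derivative \<sigma> (at s) = (*) (\<sigma>' s)" by (simp add: fun_eq_iff)
    then show ?thesis using h by (simp add: has_field_derivative_def)
  qed
  have \<sigma>'_le: "\<sigma>' s \<le> 0" for s
  proof -
    have "mono_on UNIV (\<lambda>s. - \<sigma> s)" by (rule mono_onI) (use anti in simp)
    moreover have "((\<lambda>s. - \<sigma> s) has_real_derivative - \<sigma>' s) (at s)" by (rule DERIV_minus[OF D\<sigma>])
    ultimately have "- \<sigma>' s \<ge> 0" by (rule mono_on_imp_deriv_nonneg) simp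
    then show ?thesis by simp
  qed
  have \<sigma>'_0: "\<sigma>' s = 0" if "s > 2 * d" for s
  proof -
    have "((\<lambda>s. 0::real) has_real_derivative 0) (at s)" by simp
    then have "(\<sigma> has_real_derivative 0) (at s)"
      by (rule has_field_derivative_transform_within_open[where S = "{2 * d<..}"]) (use that s0 in auto)
    then show ?thesis using D\<sigma> DERIV_unique by blast
  qed
  define l' where "l' = (\<lambda>s. \<sigma>' s * ((1 - s) - c / (1 + s)) - \<sigma> s - (1 - \<sigma> s) * (c / (1 + s)\<^sup>2))"
  have Dl: "(l has_real_derivative l' s) (at s)" if s: "s > 0" for s
  proof -
    have 1: "((\<lambda>s. c / (1 + s)) has_real_derivative - (c / (1 + s)\<^sup>2)) (at s)"
      using s by (auto intro!: derivative_eq_intros simp: power2_eq_square)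
    have 2: "((\<lambda>s. 1 - s) has_real_derivative - 1) (at s)" by (auto intro!: derivative_eq_intros)
    have 3: "((\<lambda>s. 1 - \<sigma> s) has_real_derivative - \<sigma>' s) (at s)" by (auto intro!: derivative_eq_intros D\<sigma>)
    have "(l has_real_derivative (\<sigma>' s * (1 - s) + - 1 * \<sigma> s) + (- \<sigma>' s * (c / (1 + s)) + - (c / (1 + s)\<^sup>2) * (1 - \<sigma> s))) (at s)"
      unfolding l_def by (rule DERIV_add[OF DERIV_mult[OF D\<sigma> 2] DERIV_mult[OF 3 1]])
    moreover have "(\<sigma>' s * (1 - s) + - 1 * \<sigma> s) + (- \<sigma>' s * (c / (1 + s)) + - (c / (1 + s)\<^sup>2) * (1 - \<sigma> s)) = l' s"
      by (simp add: l'_def algebra_simps)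
    ultimately show ?thesis by simp
  qed
  have cs: "0 < c / (1 + s)" "c / (1 + s) < c" "0 < c / (1 + s)\<^sup>2" if "s > 0" for s
    using that assms by (auto simp: divide_simps)
  have neg: "l' s < 0" if s: "s > 0" for s
  proof -
    have "\<sigma>' s * ((1 - s) - c / (1 + s)) \<le> 0"
    proof (cases "s > 2 * d")
      case False
      then have "0 \<le> (1 - s) - c / (1 + s)" using cs(2)[OF s] assms by linarith
      then show ?thesis using \<sigma>'_le[of s] by (simp add: mult_nonpos_nonneg)
    qed (simp add: \<sigma>'_0)
    moreover have "0 < \<sigma> s + (1 - \<sigma> s) * (c / (1 + s)\<^sup>2)"
    proof (cases "\<sigma> s = 0")
      case False
      then have "0 < \<sigma> s" using sb[of s] by linarith
      moreover have "0 \<le> (1 - \<sigma> s) * (c / (1 + s)\<^sup>2)" using sb[of s] cs(3)[OF s] by (intro mult_nonneg_nonneg) auto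
      ultimately show ?thesis by linarith
    qed (use cs(3)[OF s] in simp)
    ultimately show ?thesis by (simp add: l'_def)
  qed
  have bounds: "0 < l s \<and> l s < 1" if s: "s > 0" for s
  proof (cases "s > 2 * d")
    case True
    then show ?thesis using s0[of s] cs[OF s] assms by (simp add: l_def)
  next
    case False
    then have a: "0 < 1 - s" "1 - s < 1" using assms s by auto
    define z where "z = c / (1 + s)"
    have b: "0 < z" "z < 1" using cs[OF s] assms by (auto simp: z_def)
    define m where "m = min (1 - s) z"
    define M where "M = max (1 - s) z"
    have "\<sigma> s * (1 - s) \<ge> \<sigma> s * m" "(1 - \<sigma> s) * z \<ge> (1 - \<sigma> s) * m" "\<sigma> s * (1 - s) \<le> \<sigma> s * M" "(1 - \<sigma> s) * z \<le> (1 - \<sigma> s) * M"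
      using sb[of s] by (auto simp: m_def M_def intro!: mult_left_mono)
    then have "m \<le> l s" "l s \<le> M" by (auto simp: l_def z_def algebra_simps)
    moreover have "0 < m" "M < 1" using a b by (auto simp: m_def M_def)
    ultimately show ?thesis by linarith
  qed
  have le: "l s \<le> 1 - d" if s: "s \<ge> d" for s
  proof -
    have s': "s > 0" using s assms by linarith
    have "\<sigma> s * (1 - s) \<le> \<sigma> s * (1 - d)" using sb[of s] s by (intro mult_left_mono) auto
    moreover have "c / (1 + s) \<le> 1 - d" using cs(2)[OF s'] assms by linarith
    then have "(1 - \<sigma> s) * (c / (1 + s)) \<le> (1 - \<sigma> s) * (1 - d)" using sb[of s] by (intro mult_left_mono) auto
    ultimately show ?thesis by (simp add: l_def algebra_simps)
  qed
  have le_c: "l s \<le> c" if s: "s \<ge> 2 * d" for s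
    using s0[OF s] cs(2)[of s] s assms by (simp add: l_def)
  show ?thesis
    by (rule that[of l l', OF sml]) (use Dl neg s1 bounds le le_c in \<open>auto simp: l_def\<close>)
qed

text \<open>The derivative at \<open>x\<close> scales tangential directions by
  \<open>l (norm x) / norm x\<close>, which is positive, and the radial direction by
  \<open>l' (norm x)\<close>, which is negative. Hence it has no kernel, and monotonicity of
  \<open>l\<close> gives injectivity.\<close>

lemma radial_diffeo:
  fixes l l' :: "real \<Rightarrow> real"
  assumes sm: "smooth_on {0<..} l" and D: "\<And>s. s > 0 \<Longrightarrow> (l has_real_derivative l' s) (at s)"
    and neg: "\<And>s. s > 0 \<Longrightarrow> l' s < 0" and pos: "\<And>s. s > 0 \<Longrightarrow> 0 < l s"
  defines "R \<equiv> \<lambda>x::real^'n. (l (norm x) / norm x) *\<^sub>R x"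
  shows "diffeo (-{0}) (R ` (-{0})) R" "x \<noteq> 0 \<Longrightarrow> norm (R x) = l (norm x)"
proof -
  show nR: "norm (R x) = l (norm x)" if "x \<noteq> 0" for x
    using pos[of "norm x"] that by (simp add: R_def)
  have o: "open (-{0::real^'n})" by (simp add: open_Compl)
  have smR: "smooth_on (-{0}) R"
  proof -
    have "smooth_on (-{0::real^'n}) (\<lambda>x. l (norm x))"
      by (rule smooth_on_compose[OF sm smooth_on_norm]) auto
    then show ?thesis unfolding R_def
      by (intro smooth_on_scaleR smooth_on_divide smooth_on_norm smooth_on_id o) auto
  qed
  have inj_l: "s = t" if "s > 0" "t > 0" "l s = l t" for s t
  proof (rule ccontr)
    have dec: "l b < l a" if "0 < a" "a < b" for a b
    proof (rule DERIV_neg_imp_decreasing[OF that(2)])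
      fix x assume "a \<le> x" "x \<le> b"
      then have "x > 0" using that(1) by linarith
      then show "\<exists>y. DERIV l x :> y \<and> y < 0" using D[of x] neg[of x] by blast
    qed
    assume "s \<noteq> t"
    then show False using dec[of s t] dec[of t s] that by linarith
  qed
  show "diffeo (-{0}) (R ` (-{0})) R"
  proof (rule diffeo_smooth_inverse[OF smR])
    show "inj_on R (-{0})"
    proof (rule inj_onI)
      fix x y assume xy: "x \<in> -{0}" "y \<in> -{0}" "R x = R y"
      then have "l (norm x) = l (norm y)" using nR[of x] nR[of y] by simp
      then have n: "norm x = norm y" using inj_l[of "norm x" "norm y"] xy by simp
      then have "(l (norm x) / norm x) *\<^sub>R x = (l (norm x) / norm x) *\<^sub>R y" using xy(3) by (simp add: R_def)
      moreover have "l (norm x) / norm x \<noteq> 0" using pos[of "norm x"] xy by simp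
      ultimately show "x = y" by simp
    qed
    fix x v :: "real^'n" assume x: "x \<in> -{0}" and v: "frechet_derivative R (at x) v = 0"
    define s where "s = norm x"
    have s: "s > 0" "x \<bullet> x = s\<^sup>2" using x by (auto simp: s_def power2_norm_eq_inner)
    define m where "m = l s / s"
    define m' where "m' = (l' s * s - l s) / s\<^sup>2"
    have "((\<lambda>t. l t / t) has_real_derivative m') (at s)"
      using DERIV_divide[OF D[OF s(1)] DERIV_ident] s(1) by (simp add: m'_def power2_eq_square)
    then have 1: "((\<lambda>t. l t / t) has_derivative (\<lambda>h. m' * h)) (at (norm x))"
      by (simp add: has_field_derivative_def s_def)
    have "(norm has_derivative (\<lambda>h. h \<bullet> sgn x)) (at x)" using x by (intro has_derivative_norm) auto
    from has_derivative_compose[OF this 1]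
    have "((\<lambda>x. l (norm x) / norm x) has_derivative (\<lambda>h. m' * (h \<bullet> sgn x))) (at x)" .
    from has_derivative_scaleR[OF this has_derivative_ident]
    have "(R has_derivative (\<lambda>h. (l (norm x) / norm x) *\<^sub>R h + (m' * (h \<bullet> sgn x)) *\<^sub>R x)) (at x)"
      by (simp add: R_def)
    then have "frechet_derivative R (at x) = (\<lambda>h. (l (norm x) / norm x) *\<^sub>R h + (m' * (h \<bullet> sgn x)) *\<^sub>R x)"
      by (rule frechet_derivative_at[symmetric])
    then have e: "m *\<^sub>R v + (m' * (v \<bullet> sgn x)) *\<^sub>R x = 0" using v by (simp add: m_def s_def)
    have vs: "v \<bullet> sgn x = (v \<bullet> x) / s" by (simp add: sgn_div_norm s_def divide_inverse mult.commute)
    \<comment> \<open>The inner product with \<open>x\<close> isolates the radial component, on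
      which the derivative acts by \<open>l' s\<close>.\<close>
    have "(m *\<^sub>R v + (m' * (v \<bullet> sgn x)) *\<^sub>R x) \<bullet> x = (m + m' * s) * (v \<bullet> x)"
      using s(1) by (simp add: inner_add_left vs s(2) power2_eq_square algebra_simps)
    moreover have "m + m' * s = l' s" using s(1) by (simp add: m_def m'_def field_simps power2_eq_square)
    ultimately have "l' s * (v \<bullet> x) = 0" using e by simp
    then have "v \<bullet> x = 0" using neg[OF s(1)] by simp
    then have "m *\<^sub>R v = 0" using e vs by simp
    moreover have "m \<noteq> 0" using pos[OF s(1)] s(1) by (simp add: m_def)
    ultimately show "v = 0" by simp
  qed
qed

text \<open>The germ is tangent to the identity, so \<open>f x - x\<close> and its derivative are
  small near 0 and remain controlled after multiplication by a bump. The result extends the germ to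
  a map of the form required by \<open>diffeo_perturbation\<close>.\<close>

lemma perturb_germ:
  fixes f :: "real^'n \<Rightarrow> real^'n"
  assumes sm: "smooth_on W f" and W: "0 \<in> W" and f0: "f 0 = 0" and Df: "frechet_derivative f (at 0) = (\<lambda>v. v)"
  obtains u e where "0 < e" "cball 0 e \<subseteq> W" "smooth_on UNIV u"
    "\<forall>x v. norm (frechet_derivative u (at x) v) \<le> 1/2 * norm v" "\<forall>x. norm x \<le> e \<longrightarrow> x + u x = f x"
proof -
  obtain C where C: "C > 0" "\<And>x v::real^'n. \<bar>frechet_derivative (bump 1) (at x) v\<bar> \<le> C * norm v"
    by (rule bump_derivative_bound[where 'a = "real^'n"]) blast
  \<comment> \<open>If the derivative of \<open>f x - x\<close> is at most \<open>\<eta>\<close>,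
    the product rule bounds the derivative of \<open>u\<close> by
    \<open>\<eta> + \<eta> * C\<close>, which this choice makes 1/2. The factor \<open>1 / r\<close>
    from the derivative of the bump cancels against \<open>norm x \<le> r\<close>.\<close>
  define \<eta> where "\<eta> = 1 / (2 * (C + 1))"
  have "\<eta> * (C + 1) = 1/2" using C(1) by (simp add: \<eta>_def)
  then have \<eta>: "\<eta> > 0" "\<eta> * C + \<eta> = 1/2" using C(1) by (auto simp: \<eta>_def distrib_left)
  let ?Df = "\<lambda>x. frechet_derivative f (at x)"
  have D: "(f has_derivative ?Df x) (at x)" if "x \<in> W" for x by (rule smooth_on_has_derivative[OF sm that])
  define S where "S = (\<lambda>x. \<Sum>b\<in>Basis. norm (?Df x b - b))"
  have "Ck_on (Suc 0) f W" using sm unfolding smooth_on_def by blast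
  then have cD: "continuous_on W (\<lambda>x. ?Df x b)" for b by simp
  have contS: "continuous_on W S" unfolding S_def
    by (intro continuous_on_sum continuous_on_norm continuous_on_diff continuous_on_const cD)
  have opW: "open W" by (rule smooth_on_open[OF sm])
  have "open (W \<inter> S -` {..<\<eta>})" by (rule continuous_open_preimage[OF contS opW]) simp
  moreover have "0 \<in> W \<inter> S -` {..<\<eta>}" using W \<eta> by (simp add: S_def Df)
  ultimately obtain r where r: "r > 0" "cball 0 r \<subseteq> W \<inter> S -` {..<\<eta>}" using open_contains_cball by blast
  have DfI: "norm (?Df x v - v) \<le> \<eta> * norm v" if x: "norm x \<le> r" for x v
  proof -
    have xW: "x \<in> W" "S x < \<eta>" using x r(2) by auto
    have lin: "linear (\<lambda>v. ?Df x v - v)"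
      by (intro linear_compose_sub has_derivative_linear[OF D[OF xW(1)]] linear_ident)
    have "?Df x v - v = (\<lambda>v. ?Df x v - v) (\<Sum>b\<in>Basis. (v \<bullet> b) *\<^sub>R b)" by (simp only: euclidean_representation)
    also have "\<dots> = (\<Sum>b\<in>Basis. (v \<bullet> b) *\<^sub>R (?Df x b - b))"
      by (simp only: linear_sum[OF lin] linear_scale[OF lin])
    also have "norm \<dots> \<le> (\<Sum>b\<in>Basis. norm ((v \<bullet> b) *\<^sub>R (?Df x b - b)))" by (rule norm_sum)
    also have "\<dots> \<le> (\<Sum>b\<in>Basis. norm v * norm (?Df x b - b))"
      unfolding norm_scaleR by (intro sum_mono mult_right_mono) (auto simp: Basis_le_norm)
    also have "\<dots> = S x * norm v" by (simp add: S_def sum_distrib_left mult.commute)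
    also have "\<dots> \<le> \<eta> * norm v" using xW(2) by (intro mult_right_mono) auto
    finally show ?thesis .
  qed
  have fI: "norm (f x - x) \<le> \<eta> * norm x" if x: "norm x \<le> r" for x
  proof -
    have "norm ((f x - x) - (f 0 - 0)) \<le> \<eta> * norm (x - 0)"
    proof (rule differentiable_bound[of "cball 0 r" "\<lambda>x. f x - x" "\<lambda>x v. ?Df x v - v"])
      fix y :: "real^'n" assume y: "y \<in> cball 0 r"
      then have "y \<in> W" using r(2) by blast
      then show "((\<lambda>x. f x - x) has_derivative (\<lambda>v. ?Df y v - v)) (at y within cball 0 r)"
        by (intro has_derivative_diff has_derivative_ident has_derivative_at_withinI[OF D])
      show "onorm (\<lambda>v. ?Df y v - v) \<le> \<eta>" by (rule onorm_le) (use DfI y in simp)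
    qed (use x r in auto)
    then show ?thesis using f0 by simp
  qed
  define u where "u = (\<lambda>x. bump r x *\<^sub>R (f x - x))"
  have u0: "u x = 0" if "norm x \<ge> r" for x using bump_0[OF r(1) that] by (simp add: u_def)
  have smu: "smooth_on UNIV u"
  proof (rule smooth_on_local)
    fix x :: "real^'n"
    show "\<exists>V. x \<in> V \<and> V \<subseteq> UNIV \<and> smooth_on V u"
    proof (cases "x \<in> W")
      case True
      have "smooth_on W u" unfolding u_def
        by (intro smooth_on_scaleR smooth_on_diff sm smooth_on_id opW smooth_on_subset[OF smooth_on_bump]) auto
      then show ?thesis using True by (intro exI[of _ W] conjI) simp_all
    next
      case False
      have "smooth_on (- cball 0 r) (\<lambda>x. 0 :: real^'n)" by (rule smooth_on_const) (simp add: open_Compl)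
      then have "smooth_on (- cball 0 r) u" by (rule smooth_on_cong) (simp add: u0)
      moreover have "x \<in> - cball 0 r" using False r(2) by auto
      ultimately show ?thesis by (intro exI[of _ "- cball 0 r"] conjI) simp_all
    qed
  qed
  have bd: "norm (frechet_derivative u (at x) v) \<le> 1/2 * norm v" for x v
  proof (cases "norm x \<le> r")
    case True
    then have xW: "x \<in> W" using r(2) by auto
    have "(bump r has_derivative frechet_derivative (bump r) (at x)) (at x)"
      by (rule smooth_on_has_derivative[OF smooth_on_bump]) simp
    then have Du: "(u has_derivative (\<lambda>v. bump r x *\<^sub>R (?Df x v - v) + frechet_derivative (bump r) (at x) v *\<^sub>R (f x - x))) (at x)"
      unfolding u_def by (intro has_derivative_scaleR has_derivative_diff D[OF xW] has_derivative_ident)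
    have eq: "frechet_derivative u (at x) v = bump r x *\<^sub>R (?Df x v - v) + frechet_derivative (bump r) (at x) v *\<^sub>R (f x - x)"
      by (simp only: frechet_derivative_at[OF Du, symmetric])
    have "norm (bump r x *\<^sub>R (?Df x v - v)) \<le> 1 * (\<eta> * norm v)"
      unfolding norm_scaleR using bump_bounds[of r x] by (intro mult_mono DfI[OF True]) auto
    moreover have "norm (frechet_derivative (bump r) (at x) v *\<^sub>R (f x - x)) \<le> (C * norm (v /\<^sub>R r)) * (\<eta> * norm x)"
      unfolding norm_scaleR[of _ "f x - x"] bump_derivative_scale[OF r(1)] real_norm_def
      using C(1) by (intro mult_mono C(2) fI[OF True]) auto
    moreover have "(C * norm (v /\<^sub>R r)) * (\<eta> * norm x) \<le> (C * norm (v /\<^sub>R r)) * (\<eta> * r)"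
      using C(1) \<eta>(1) True by (intro mult_left_mono) auto
    moreover have "(C * norm (v /\<^sub>R r)) * (\<eta> * r) = \<eta> * C * norm v" using r(1) by (simp add: field_simps)
    ultimately have "norm (frechet_derivative u (at x) v) \<le> \<eta> * norm v + \<eta> * C * norm v"
      unfolding eq by (intro order_trans[OF norm_triangle_ineq]) linarith
    also have "\<dots> = (\<eta> * C + \<eta>) * norm v" by (simp add: algebra_simps)
    finally show ?thesis by (simp only: \<eta>(2))
  next
    case False
    have "((\<lambda>x::real^'n. 0::real^'n) has_derivative (\<lambda>v. 0)) (at x)" by simp
    then have Du: "(u has_derivative (\<lambda>v. 0)) (at x)"
      by (rule has_derivative_transform_within_open[where s = "- cball 0 r"]) (use False u0 in \<open>auto simp: open_Compl\<close>)
    have "frechet_derivative u (at x) v = 0" by (simp only: frechet_derivative_at[OF Du, symmetric])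
    then show ?thesis by simp
  qed
  have "x + u x = f x" if "norm x \<le> r/2" for x using bump_1[OF r(1) that] by (simp add: u_def)
  moreover have "cball 0 (r/2) \<subseteq> W" using r by auto
  ultimately show ?thesis using r(1) bd by (intro that[of "r/2" u] smu) auto
qed

text \<open>\<open>E\<close> turns the complement of \<open>g 0\<close> inside out. It normalizes \<open>g\<close> to the identity near 0,
  inverts radially, contracting everything outside a small ball towards 0, and finally shifts a
  vicinity of 0 into the half-space.\<close>

lemma disc_extension:
  fixes g :: "real^4 \<Rightarrow> real^4" and H Y :: "(real^4) set"
  assumes H: "H = UNIV \<or> H = half_space" and r: "r > 0"
    and g: "diffeo (ball 0 r \<inter> H) (g ` (ball 0 r \<inter> H)) g"
    and op: "openin (top_of_set Y) (g ` (ball 0 r \<inter> H))"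
  obtains E \<delta> where "0 < \<delta>" "\<delta> \<le> r" "\<delta> < 1" "smooth_on (-{g 0}) E" "diffeo (-{g 0}) (E ` (-{g 0})) E"
    "\<forall>u\<in>sphere 0 1 \<inter> H. \<forall>s\<in>{0<..<\<delta>}. E (g (s *\<^sub>R u)) = (1 - s) *\<^sub>R u"
    "E ` (Y - {g 0}) \<subseteq> ball 0 1 \<inter> H"
    "\<forall>y\<in>Y - {g 0}. 1 - \<delta> < norm (E y) \<longrightarrow> (\<exists>u\<in>sphere 0 1 \<inter> H. \<exists>s\<in>{0<..<\<delta>}. y = g (s *\<^sub>R u))"
proof -
  note goal = that
  let ?B = "ball 0 r \<inter> H"
  define q where "q = g 0"
  have H0: "0 \<in> H" using H by (auto simp: half_space_def)
  have Hs: "a *\<^sub>R x \<in> H" if "x \<in> H" "0 \<le> a" for a x using H that by (auto simp: half_space_def)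
  have fullB: "full ?B" using H unfolding full_def by (auto simp: openin_open)
  have B0: "0 \<in> ?B" using r H0 by simp
  obtain U1 F1 where F1: "0 \<in> U1" "smooth_on U1 F1" "\<forall>y\<in>U1 \<inter> ?B. F1 y = g y"
    by (rule smooth_mapE[OF diffeoD(3)[OF g] B0])
  define D where "D = frechet_derivative F1 (at 0)"
  have D: "(g has_derivative D) (at 0 within ?B)" unfolding D_def by (rule smooth_map_has_derivative[OF F1 B0])
  have qB: "g 0 \<in> g ` ?B" using B0 by (rule imageI)
  obtain U F where F: "g 0 \<in> U" "smooth_on U F" "\<forall>z\<in>U \<inter> g ` ?B. F z = inv_into ?B g z"
    by (rule smooth_mapE[OF diffeoD(4)[OF g] qB])
  define A where "A = frechet_derivative F (at q)"
  have AD: "A (D v) = v" for v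
    using fun_cong[OF diffeo_inverse_derivative[OF g fullB B0 D F], of v] by (simp add: A_def q_def)
  have DF: "(F has_derivative A) (at q)" unfolding A_def q_def by (rule smooth_on_has_derivative[OF F(2,1)])
  have linA: "linear A" by (rule has_derivative_linear[OF DF])
  have linD: "linear D" by (rule has_derivative_linear[OF D])
  have "inj D" by (rule inj_on_inverseI[where g = A]) (rule AD)
  then have "surj D" by (rule linear_inj_imp_surj[OF linD])
  then have DA: "D (A w) = w" for w
  proof -
    obtain v where "w = D v" using \<open>surj D\<close> by (rule surjE)
    then show ?thesis by (simp add: AD)
  qed
  \<comment> \<open>Affine normalization: \<open>L\<close> moves \<open>g 0\<close> to 0 and undoes
    the derivative of \<open>g\<close> there.\<close>
  define L where "L = (\<lambda>y. A (y - q))"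
  have smL: "smooth_on UNIV L" unfolding L_def
    by (rule smooth_on_linear_compose[OF linA smooth_on_diff[OF smooth_on_id smooth_on_const]]) simp_all
  have smq: "smooth_on UNIV (\<lambda>w. q + D w)"
    by (rule smooth_on_add[OF smooth_on_const smooth_on_linear[OF _ linD]]) simp_all
  have diL: "diffeo UNIV UNIV L"
  proof (rule diffeoI)
    show "range L = UNIV"
    proof (rule surjI)
      show "L (q + D w) = w" for w by (simp add: L_def AD)
    qed
    show "smooth_map UNIV L" by (rule smooth_on_imp_smooth_map[OF smL]) simp
    show "smooth_map UNIV (\<lambda>w. q + D w)" by (rule smooth_on_imp_smooth_map[OF smq]) simp
    show "q + D (L y) = y" for y by (simp add: L_def DA)
  qed
  have L0: "L q = 0" by (simp add: L_def linear_0[OF linA])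
  \<comment> \<open>A local inverse of \<open>g\<close> read in the coordinates of \<open>L\<close>;
    it fixes 0 and its derivative there is the identity, so \<open>perturb_germ\<close> extends it
    globally.\<close>
  define f where "f = (\<lambda>w. F (q + D w))"
  define W where "W = (\<lambda>w. q + D w) -` U"
  have opW: "open W" unfolding W_def
    by (rule open_vimage[OF smooth_on_open[OF F(2)] smooth_on_continuous_on[OF smq]])
  have smf: "smooth_on W f" unfolding f_def
    by (rule smooth_on_compose[OF F(2) smooth_on_subset[OF smq opW]]) (auto simp: W_def)
  have W0: "0 \<in> W" using F(1) by (simp add: W_def q_def linear_0[OF linD])
  have Fg: "F (g x) = x" if "x \<in> ?B" "g x \<in> U" for x
    using F(3) diffeoD(5)[OF g that(1)] that by auto
  have f0: "f 0 = 0" using Fg[OF B0] F(1) by (simp add: f_def q_def linear_0[OF linD])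
  have dq: "((\<lambda>w. q + D w) has_derivative D) (at 0)"
    using has_derivative_add[OF has_derivative_const linear_imp_has_derivative[OF linD], of q "at 0"] by simp
  have DF': "(F has_derivative A) (at (q + D 0))" using DF by (simp add: linear_0[OF linD])
  have "(f has_derivative (\<lambda>v. A (D v))) (at 0)" unfolding f_def
    by (rule has_derivative_compose[OF dq DF'])
  then have Df: "frechet_derivative f (at 0) = (\<lambda>v. v)"
    using frechet_derivative_at[of f "\<lambda>v. A (D v)" 0] by (simp add: AD)
  obtain u e where u: "0 < e" "cball 0 e \<subseteq> W" "smooth_on UNIV u"
    "\<forall>x v. norm (frechet_derivative u (at x) v) \<le> 1/2 * norm v" "\<forall>x. norm x \<le> e \<longrightarrow> x + u x = f x"
    by (rule perturb_germ[OF smf W0 f0 Df])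
  define \<tau> where "\<tau> = (\<lambda>x. x + u x)"
  have h: "(1/2::real) < 1" by simp
  note pert = diffeo_perturbation[OF u(3) h u(4)[rule_format]]
  have di\<tau>: "diffeo UNIV (range \<tau>) \<tau>" unfolding \<tau>_def by (rule pert(1))
  have \<tau>0: "\<tau> 0 = 0" using u(1) u(5)[rule_format, of 0] f0 by (simp add: \<tau>_def)
  have \<tau>n: "norm x \<le> 2 * norm (\<tau> x)" for x
  proof -
    have u0: "u 0 = 0" using \<tau>0 by (simp add: \<tau>_def)
    have "norm (u x - u 0) \<le> 1/2 * norm (x - 0)" by (rule pert(3))
    then have "norm (u x) \<le> norm x / 2" by (simp add: u0)
    moreover have "norm (\<tau> x) \<ge> norm x - norm (u x)" unfolding \<tau>_def using norm_diff_ineq by blast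
    ultimately show ?thesis by linarith
  qed
  define t where "t = (\<lambda>y. \<tau> (L y))"
  \<comment> \<open>The normalized map \<open>t\<close> is a left inverse of \<open>g\<close>
    wherever the extended germ still agrees with \<open>f\<close>.\<close>
  have tg: "t (g x) = x" if x: "x \<in> ?B" "norm (L (g x)) \<le> e" for x
  proof -
    have qD: "q + D (L (g x)) = g x" by (simp add: L_def DA)
    have "L (g x) \<in> W" using u(2) x(2) by auto
    then have "g x \<in> U" by (simp add: W_def qD)
    moreover have "t (g x) = F (g x)" using u(5) x(2) by (simp add: t_def \<tau>_def f_def qD)
    ultimately show ?thesis using Fg[OF x(1)] by simp
  qed
  obtain K where K: "K > 0" "\<And>v. norm (D v) \<le> norm v * K"
    using bounded_linear.pos_bounded[OF linear_conv_bounded_linear[THEN iffD1, OF linD]] by blast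
  obtain \<rho> where \<rho>: "\<rho> > 0" "\<forall>y\<in>Y. dist y q < \<rho> \<longrightarrow> y \<in> g ` ?B"
    using op qB unfolding openin_euclidean_subtopology_iff q_def by blast
  have sub: "g ` ?B \<subseteq> Y" using op openin_imp_subset by blast
  have "continuous_on ?B (\<lambda>x. L (g x))"
    by (rule continuous_on_compose2[OF smooth_on_continuous_on[OF smL] diffeoD(9)[OF g]]) simp
  then obtain d2 where d2: "d2 > 0" "\<forall>x\<in>?B. dist x 0 < d2 \<longrightarrow> dist (L (g x)) (L (g 0)) < e"
    using B0 u(1) unfolding continuous_on_iff by blast
  \<comment> \<open>The entries of the minimum serve different purposes: \<open>e / 2\<close> keeps
    \<open>L y\<close> where the extension is the germ, \<open>\<rho> / (4 * K)\<close> brings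
    \<open>y\<close> close enough to \<open>q\<close> to lie in the embedded disc, 1/2 provides the
    bound needed by \<open>radial_profile\<close>, and \<open>r\<close> and \<open>d2\<close> keep
    small points of \<open>H\<close> in the domain of \<open>g\<close> with \<open>L\<close> of
    their images below \<open>e\<close>.\<close>
  define \<delta>1 where "\<delta>1 = Min {e / 2, \<rho> / (4 * K), 1/2, r, d2}"
  have \<delta>1: "\<delta>1 > 0" "2 * \<delta>1 \<le> e" "\<delta>1 \<le> \<rho> / (4 * K)" "\<delta>1 \<le> 1/2" "\<delta>1 \<le> r" "\<delta>1 \<le> d2"
    using u(1) \<rho>(1) K(1) r d2(1) by (auto simp: \<delta>1_def)
  \<comment> \<open>The converse of \<open>tg\<close>. A point of \<open>Y\<close> with small
    normalized image is near \<open>q\<close>, because \<open>\<tau>\<close> and \<open>D\<close>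
    distort norms by bounded factors, and relative openness of the disc in \<open>Y\<close> then
    places it in the image of \<open>g\<close>.\<close>
  have inv: "t y \<in> ?B \<and> y = g (t y)" if y: "y \<in> Y" "norm (t y) < \<delta>1" for y
  proof -
    have Ly: "norm (L y) < 2 * \<delta>1" using \<tau>n[of "L y"] y(2) by (simp add: t_def)
    have "y - q = D (L y)" by (simp add: L_def DA)
    then have "norm (y - q) \<le> norm (L y) * K" using K(2) by simp
    also have "\<dots> \<le> (2 * \<delta>1) * K" using Ly K(1) by (intro mult_right_mono) auto
    also have "\<dots> \<le> (2 * (\<rho> / (4 * K))) * K" using \<delta>1(3) K(1) by (intro mult_right_mono mult_left_mono) auto
    also have "\<dots> < \<rho>" using K(1) \<rho>(1) by simp
    finally have "y \<in> g ` ?B" using \<rho>(2) y(1) by (simp add: dist_norm)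
    then obtain x where x: "x \<in> ?B" "y = g x" by blast
    have "t y = x" unfolding x(2) by (rule tg[OF x(1)]) (use Ly \<delta>1(2) x(2) in simp)
    then show ?thesis using x by simp
  qed
  have half: "(1/2::real) > 0" by simp
  define \<delta> where "\<delta> = \<delta>1 / 2"
  have \<delta>: "0 < \<delta>" "\<delta> \<le> 1/4" "2 * \<delta> = \<delta>1" using \<delta>1 by (auto simp: \<delta>_def)
  obtain \<epsilon> where \<epsilon>: "0 < \<epsilon>" "\<epsilon> \<le> (1/2)/2"
    "\<And>c :: real^4. norm c < \<epsilon> \<Longrightarrow> smooth_on UNIV (\<lambda>x::real^4. bump (1/2) x *\<^sub>R c)"
    "\<And>(c :: real^4) (x :: real^4) v. norm c < \<epsilon> \<Longrightarrow> norm (frechet_derivative (\<lambda>x. bump (1/2) x *\<^sub>R c) (at x) v) \<le> 1/2 * norm v"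
    by (rule bump_shift_bound[where 'a = "real^4" and 'b = "real^4", OF half]) auto
  \<comment> \<open>\<open>c1\<close> is both the radius to which far points are contracted and the
    length of the final shift \<open>a\<close> along the inward normal; the equality is what makes
    \<open>Tmid\<close> work.\<close>
  define c1 where "c1 = \<epsilon> / 2"
  define a where "a = c1 *\<^sub>R (axis 1 1 :: real^4)"
  have c1: "0 < c1" "c1 \<le> 1/4" using \<epsilon> by (auto simp: c1_def)
  have na: "norm a < \<epsilon>" using \<epsilon> by (simp add: a_def c1_def)
  define T where "T = (\<lambda>x::real^4. x + bump (1/2) x *\<^sub>R a)"
  note pertT = diffeo_perturbation[OF \<epsilon>(3)[OF na] h \<epsilon>(4)[OF na]]
  have diT: "diffeo UNIV (range T) T" unfolding T_def by (rule pertT(1))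
  obtain l l' where l: "smooth_on {0<..} l" "\<forall>s>0. (l has_real_derivative l' s) (at s) \<and> l' s < 0"
    "\<forall>s>0. s \<le> \<delta> \<longrightarrow> l s = 1 - s" "\<forall>s>0. 0 < l s \<and> l s < 1" "\<forall>s\<ge>2 * \<delta>. l s \<le> c1" "\<forall>s\<ge>\<delta>. l s \<le> 1 - \<delta>"
    by (rule radial_profile[OF \<delta>(1,2) c1])
  define R where "R = (\<lambda>x::real^4. (l (norm x) / norm x) *\<^sub>R x)"
  have l2: "(l has_real_derivative l' s) (at s)" "l' s < 0" "0 < l s" if "s > 0" for s using l(2,4) that by auto
  have diR: "diffeo (-{0}) (R ` (-{0})) R" unfolding R_def by (rule radial_diffeo(1)[OF l(1) l2])
  have nR: "norm (R x) = l (norm x)" if "x \<noteq> 0" for x unfolding R_def by (rule radial_diffeo(2)[OF l(1) l2 that])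
  define E where "E = (\<lambda>y. T (R (t y)))"
  have Tsmall: "norm (T x) \<le> 1/2" if "norm x \<le> 1/2" for x
    unfolding T_def by (rule shift_ball) (use that diffeoD(1)[OF diT] in \<open>auto simp: T_def\<close>)
  have Tbig: "T x = x" if "norm x \<ge> 1/2" for x using bump_0[of "1/2" x] that by (simp add: T_def)
  have TH: "T x \<in> H" if "x \<in> H" for x
    using H that c1 bump_bounds[of "1/2" x] by (auto simp: T_def a_def half_space_def)
  \<comment> \<open>The first coordinate of such a point is at least \<open>- c1\<close>, and the
    full shift by \<open>c1\<close> is in effect there, so the point lands in the
    half-space.\<close>
  have Tmid: "T x \<in> H" if x: "norm x \<le> c1" for x
  proof -
    have "bump (1/2) x = 1" by (rule bump_1) (use x c1 in auto)
    moreover have "- (x $ 1) \<le> norm x" using component_le_norm_cart[of x 1] by linarith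
    ultimately show ?thesis using H x by (auto simp: T_def a_def half_space_def)
  qed
  have t0: "t y \<noteq> 0" if "y \<noteq> q" for y
  proof
    assume "t y = 0"
    then have "L y = L q" using \<tau>n[of "L y"] L0 by (simp add: t_def)
    then show False using diffeoD(1)[OF diL] that by (simp add: inj_eq)
  qed
  have diE: "diffeo (-{q}) (E ` (-{q})) E"
  proof -
    have 1: "diffeo (-{q}) (t ` (-{q})) t"
      unfolding t_def by (rule diffeo_subset[OF diffeo_compose[OF diL di\<tau>]]) simp
    have "t ` (-{q}) \<subseteq> -{0}" by (rule image_subsetI) (simp add: t0)
    then have 2: "diffeo (t ` (-{q})) (R ` t ` (-{q})) R" by (rule diffeo_subset[OF diR])
    have 3: "diffeo (R ` t ` (-{q})) (T ` R ` t ` (-{q})) T" by (rule diffeo_subset[OF diT]) simp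
    have "E ` (-{q}) = T ` R ` t ` (-{q})" by (simp add: E_def image_image)
    then show ?thesis unfolding E_def using diffeo_compose[OF diffeo_compose[OF 1 2] 3] by simp
  qed
  have smE: "smooth_on (-{q}) E"
    by (rule smooth_map_imp_smooth_on[OF _ diffeoD(3)[OF diE]]) (simp add: open_Compl)
  have E1: "E (g (s *\<^sub>R v)) = (1 - s) *\<^sub>R v" if v: "v \<in> sphere 0 1 \<inter> H" and s: "s \<in> {0<..<\<delta>}" for v s
  proof -
    have n: "norm (s *\<^sub>R v) = s" using v s by simp
    have vB: "s *\<^sub>R v \<in> ?B" using v s \<delta> \<delta>1 Hs[of v s] n by auto
    have "dist (L (g (s *\<^sub>R v))) (L (g 0)) < e" using d2(2) vB n s \<delta> \<delta>1(6) by auto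
    then have "norm (L (g (s *\<^sub>R v))) \<le> e" using L0 by (simp add: q_def)
    then have tv: "t (g (s *\<^sub>R v)) = s *\<^sub>R v" by (rule tg[OF vB])
    have "R (s *\<^sub>R v) = (l s / s) *\<^sub>R (s *\<^sub>R v)" unfolding R_def n ..
    also have "\<dots> = (1 - s) *\<^sub>R v" using l(3) s by simp
    finally have Rv: "R (s *\<^sub>R v) = (1 - s) *\<^sub>R v" .
    have "norm ((1 - s) *\<^sub>R v) \<ge> 1/2" using v s \<delta> by simp
    then show ?thesis unfolding E_def tv Rv by (rule Tbig)
  qed
  \<comment> \<open>\<open>T\<close> preserves the ball of radius 1/2 and fixes everything outside
    it, so the norm of \<open>E y\<close> is given by the profile unless it is at most 1/2.\<close>
  have nE: "norm (E y) \<le> max (1/2) (l (norm (t y)))" if y: "y \<noteq> q" for y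
  proof (cases "norm (R (t y)) \<le> 1/2")
    case True
    then show ?thesis using Tsmall[OF True] by (simp add: E_def)
  next
    case False
    then show ?thesis using Tbig[of "R (t y)"] nR[OF t0[OF y]] by (simp add: E_def)
  qed
  have E2: "E y \<in> ball 0 1 \<inter> H" if y: "y \<in> Y - {q}" for y
  proof -
    have ty: "t y \<noteq> 0" using t0 y by simp
    have "l (norm (t y)) < 1" using l(4) ty by simp
    then have "norm (E y) < 1" using nE[of y] y by auto
    moreover have "E y \<in> H"
    proof (cases "norm (t y) < \<delta>1")
      case True
      then have "t y \<in> H" using inv[of y] y by simp
      moreover have "0 \<le> l (norm (t y)) / norm (t y)" using l2(3)[of "norm (t y)"] ty by simp
      ultimately have "R (t y) \<in> H" unfolding R_def by (rule Hs)
      then show ?thesis unfolding E_def by (rule TH)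
    next
      case False
      then have "norm (R (t y)) \<le> c1" using nR[OF ty] l(5) \<delta>(3) by simp
      then show ?thesis unfolding E_def by (rule Tmid)
    qed
    ultimately show ?thesis by simp
  qed
  \<comment> \<open>A value of norm above \<open>1 - \<delta>\<close> can only arise from the
    initial branch of the profile, that is from points with normalized norm below
    \<open>\<delta>\<close>; these lie in the disc by \<open>inv\<close>.\<close>
  have E3: "\<exists>u\<in>sphere 0 1 \<inter> H. \<exists>s\<in>{0<..<\<delta>}. y = g (s *\<^sub>R u)" if y: "y \<in> Y - {q}" and n: "1 - \<delta> < norm (E y)" for y
  proof -
    have ty: "t y \<noteq> 0" using t0 y by simp
    have s: "norm (t y) < \<delta>"
    proof (rule ccontr)
      assume "\<not> norm (t y) < \<delta>"
      then have "l (norm (t y)) \<le> 1 - \<delta>" using l(6) by simp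
      then show False using nE[of y] y n \<delta>(2) by auto
    qed
    have ty': "t y \<in> ?B \<and> y = g (t y)" using inv[of y] y s \<delta>(1,3) by simp
    let ?s = "norm (t y)" and ?u = "(1 / norm (t y)) *\<^sub>R t y"
    have "?u \<in> H" by (rule Hs) (use ty' in auto)
    then have 1: "?u \<in> sphere 0 1 \<inter> H" using ty by simp
    have 2: "?s \<in> {0<..<\<delta>}" using ty s by simp
    have 3: "y = g (?s *\<^sub>R ?u)" using ty ty' by simp
    show ?thesis by (intro bexI[of _ ?u] bexI[of _ ?s] 1 2 3)
  qed
  have "\<delta> \<le> r" "\<delta> < 1" using \<delta> \<delta>1 by auto
  moreover have "\<forall>u\<in>sphere 0 1 \<inter> H. \<forall>s\<in>{0<..<\<delta>}. E (g (s *\<^sub>R u)) = (1 - s) *\<^sub>R u" using E1 by blast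
  moreover have "E ` (Y - {g 0}) \<subseteq> ball 0 1 \<inter> H" using E2 unfolding q_def by blast
  moreover have "\<forall>y\<in>Y - {g 0}. 1 - \<delta> < norm (E y) \<longrightarrow> (\<exists>u\<in>sphere 0 1 \<inter> H. \<exists>s\<in>{0<..<\<delta>}. y = g (s *\<^sub>R u))"
    using E3 unfolding q_def by blast
  ultimately show ?thesis using smE diE unfolding q_def by (intro goal[OF \<delta>(1), of E])
qed

section \<open>Homology of a manifold punctured in a chart\<close>

text \<open>Mayer-Vietoris for the punctured set and the disc, which meet in the punctured disc or
  half-disc. Its acyclicity in degree 1 makes second homology surject when the puncture is filled,
  and its acyclicity in degree 2 makes it inject.\<close>

lemma punctured_chart:
  fixes H :: "(real^4) set" and S :: "'a::euclidean_space set"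
  assumes H: "H = UNIV \<or> H = half_space" and V: "openin (top_of_set H) V" "cball 0 1 \<inter> H \<subseteq> V"
    and c: "smooth_chart S V \<phi>"
  shows "openin (top_of_set S) (S - {\<phi> 0})"
    and "r \<le> 1 \<Longrightarrow> openin (top_of_set S) (\<phi> ` (ball 0 r \<inter> H))"
    and "p = 1 \<or> p = 2 \<Longrightarrow> 0 < r \<Longrightarrow> r \<le> 1 \<Longrightarrow> ac p (\<phi> ` (ball 0 r \<inter> H - {0}))"
    and "ac 2 (\<phi> ` (ball 0 1 \<inter> H))"
    and "cyc 2 S z \<Longrightarrow> \<exists>x. cyc 2 (S - {\<phi> 0}) x \<and> hlg 2 S z x"
    and "cyc 2 (S - {\<phi> 0}) x \<Longrightarrow> bd 2 S x \<Longrightarrow> bd 2 (S - {\<phi> 0}) x"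
proof -
  let ?C = "ball 0 1 \<inter> H" and ?S0 = "S - {\<phi> 0}"
  have d: "diffeo V (\<phi> ` V) \<phi>" and opV: "openin (top_of_set S) (\<phi> ` V)" using c by (simp_all add: smooth_chart_def)
  have H0: "0 \<in> H" using H by (auto simp: half_space_def)
  have V0: "0 \<in> V" using V(2) H0 by auto
  have CV: "ball 0 r \<inter> H \<subseteq> V" if "r \<le> 1" for r
    using V(2) that by (force simp: subset_iff)
  show S0: "openin (top_of_set S) ?S0" by (rule openin_delete) simp
  show op: "openin (top_of_set S) (\<phi> ` (ball 0 r \<inter> H))" if r: "r \<le> 1" for r
  proof -
    have VH: "V \<subseteq> H" by (rule openin_imp_subset[OF V(1)])
    have "ball 0 r \<inter> H = V \<inter> ball 0 r" using CV[OF r] VH by blast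
    then have "openin (top_of_set V) (ball 0 r \<inter> H)" by (simp add: openin_open_Int)
    then show ?thesis by (rule openin_trans[OF diffeo_openin[OF d] opV])
  qed
  have ac1: "ac p (\<phi> ` (ball 0 r \<inter> H - {0}))" if "p = 1 \<or> p = 2" "0 < r" "r \<le> 1" for p r
  proof -
    have "ball 0 r \<inter> H - {0} \<subseteq> V" using CV[OF that(3)] by blast
    then show ?thesis by (rule ac_diffeo[OF diffeo_subset[OF d] ac_punctured[OF H that(1,2)]])
  qed
  then show "p = 1 \<or> p = 2 \<Longrightarrow> 0 < r \<Longrightarrow> r \<le> 1 \<Longrightarrow> ac p (\<phi> ` (ball 0 r \<inter> H - {0}))" .
  show acC: "ac 2 (\<phi> ` ?C)"
    by (rule ac_diffeo[OF diffeo_subset[OF d CV] ac_ball[OF H]]) simp_all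
  have un: "?S0 \<union> \<phi> ` ?C = S"
    using openin_imp_subset[OF op[of 1]] H0 by auto
  have int: "?S0 \<inter> \<phi> ` ?C = \<phi> ` (?C - {0})"
  proof -
    have "\<phi> x \<noteq> \<phi> 0" if "x \<in> ?C" "x \<noteq> 0" for x
      using inj_onD[OF diffeoD(1)[OF d], of x 0] that V0 CV[of 1] by auto
    then show ?thesis using openin_imp_subset[OF op[of 1]] by auto
  qed
  have op1: "openin (top_of_set S) (\<phi> ` ?C)" by (rule op) simp
  show "\<exists>x. cyc 2 ?S0 x \<and> hlg 2 S z x" if z: "cyc 2 S z"
  proof -
    obtain x where "cyc 2 ?S0 x" "hlg 2 (?S0 \<union> \<phi> ` ?C) z x"
      by (rule mv_surject[of ?S0 "\<phi> ` ?C" z]) (use z S0 op1 acC ac1[of 1 1] in \<open>simp_all only: un int, simp_all\<close>)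
    then show ?thesis unfolding un by blast
  qed
  show "bd 2 ?S0 x" if x: "cyc 2 ?S0 x" "bd 2 S x"
    by (rule mv_inject[of 2 ?S0 x "\<phi> ` ?C"]) (use x S0 op1 ac1[of 2 1] in \<open>simp_all only: un int, simp_all\<close>)
qed

section \<open>The sum as a union of two punctured summands\<close>

locale disc_gluing =
  fixes H :: "(real^4) set"
    and X :: "('a::euclidean_space, 4) omanifold" and Z :: "('b::euclidean_space, 4) omanifold"
    and W :: "('c::euclidean_space, 4) omanifold" and U i U' j a b
  assumes H: "H = UNIV \<or> H = half_space"
    and oX: "oriented_manifold X" and oZ: "oriented_manifold Z" and oW: "oriented_manifold W"
    and U: "openin (top_of_set H) U" "cball 0 1 \<inter> H \<subseteq> U" "oriented_chart X U i"
    and U': "openin (top_of_set H) U'" "cball 0 1 \<inter> H \<subseteq> U'" "smooth_chart (pts Z) U' j"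
    and a: "open_oriented_embedding (delete X {i 0}) W a"
    and b: "open_oriented_embedding (delete Z {j 0}) W b"
    and ptsW: "pts W = a ` (pts X - {i 0}) \<union> b ` (pts Z - {j 0})"
    and neck: "\<forall>x \<in> pts X - {i 0}. \<forall>z \<in> pts Z - {j 0}. a x = b z \<longleftrightarrow>
             (\<exists>u \<in> sphere 0 1 \<inter> H. \<exists>t \<in> {0<..<1}. x = i (t *\<^sub>R u) \<and> z = j ((1 - t) *\<^sub>R u))"
    and acZ: "ac 2 (pts Z)"
begin

definition X0 where "X0 = pts X - {i 0}"
definition Z0 where "Z0 = pts Z - {j 0}"
text \<open>\<open>X\<close> without a concentric closed disc: of the chart disc, a collar of width
  \<open>d\<close> is kept. The neck turns this collar into the punctured disc of radius
  \<open>d\<close> around \<open>j 0\<close>.\<close>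

definition XA where "XA d = pts X - i ` (cball 0 (1 - d) \<inter> H)"

lemmas chart_i = punctured_chart[OF H U(1,2) oriented_chart_smooth[OF U(3)], folded X0_def]
lemmas chart_j = punctured_chart[OF H U', folded Z0_def]

lemma H_cone: "0 \<in> H" "x \<in> H \<Longrightarrow> 0 \<le> s \<Longrightarrow> s *\<^sub>R x \<in> H"
  using H by (auto simp: half_space_def)

lemma a_oemb: "oemb X W X0 a" and a_open: "openin (top_of_set (pts W)) (a ` X0)"
  using open_embedding_delete[OF oX oW _ a] chart_i(1) by (simp_all add: X0_def)

lemma b_oemb: "oemb Z W Z0 b" and b_open: "openin (top_of_set (pts W)) (b ` Z0)"
  using open_embedding_delete[OF oZ oW _ b] chart_j(1) by (simp_all add: Z0_def)

lemma i_diffeo: "diffeo U (i ` U) i" by (rule oriented_chart_diffeo[OF U(3)])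

lemma j_diffeo: "diffeo U' (j ` U') j" using U'(3) by (simp add: smooth_chart_def)

lemma i_pts: "x \<in> U \<Longrightarrow> i x \<in> pts X" using oriented_chart_pts[OF U(3)] by blast

lemma j_pts: "x \<in> U' \<Longrightarrow> j x \<in> pts Z"
  using U'(3) openin_imp_subset unfolding smooth_chart_def by blast

lemma disc_U: "x \<in> H \<Longrightarrow> norm x \<le> 1 \<Longrightarrow> x \<in> U" and disc_U': "x \<in> H \<Longrightarrow> norm x \<le> 1 \<Longrightarrow> x \<in> U'"
  using U(2) U'(2) by (auto simp: subset_iff)

lemma i_eq: "x \<in> H \<Longrightarrow> norm x \<le> 1 \<Longrightarrow> y \<in> H \<Longrightarrow> norm y \<le> 1 \<Longrightarrow> i x = i y \<longleftrightarrow> x = y"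
  using inj_on_eq_iff[OF diffeoD(1)[OF i_diffeo]] disc_U by blast

lemma j_eq: "x \<in> H \<Longrightarrow> norm x \<le> 1 \<Longrightarrow> y \<in> H \<Longrightarrow> norm y \<le> 1 \<Longrightarrow> j x = j y \<longleftrightarrow> x = y"
  using inj_on_eq_iff[OF diffeoD(1)[OF j_diffeo]] disc_U' by blast

lemma i_X0: "x \<in> H \<Longrightarrow> norm x \<le> 1 \<Longrightarrow> x \<noteq> 0 \<Longrightarrow> i x \<in> X0"
  unfolding X0_def using i_pts[OF disc_U] i_eq[of x 0] H_cone(1) by simp

lemma j_Z0: "x \<in> H \<Longrightarrow> norm x \<le> 1 \<Longrightarrow> x \<noteq> 0 \<Longrightarrow> j x \<in> Z0"
  unfolding Z0_def using j_pts[OF disc_U'] j_eq[of x 0] H_cone(1) by simp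

lemma neck_eq:
  assumes "u \<in> sphere 0 1 \<inter> H" "t \<in> {0<..<1}"
  shows "a (i (t *\<^sub>R u)) = b (j ((1 - t) *\<^sub>R u))"
proof -
  have "i (t *\<^sub>R u) \<in> X0" "j ((1 - t) *\<^sub>R u) \<in> Z0"
    using assms by (auto intro!: i_X0 j_Z0 H_cone(2))
  then show ?thesis using neck assms unfolding X0_def Z0_def by blast
qed

lemma neck_eq': "u \<in> sphere 0 1 \<inter> H \<Longrightarrow> t \<in> {0<..<1} \<Longrightarrow> b (j (t *\<^sub>R u)) = a (i ((1 - t) *\<^sub>R u))"
  using neck_eq[of u "1 - t"] by simp

lemma neckD:
  assumes "x \<in> X0" "z \<in> Z0" "a x = b z"
  obtains u t where "u \<in> sphere 0 1 \<inter> H" "t \<in> {0<..<1}" "x = i (t *\<^sub>R u)" "z = j ((1 - t) *\<^sub>R u)"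
  using neck assms unfolding X0_def Z0_def by blast

lemma XA_X0: "d \<le> 1 \<Longrightarrow> XA d \<subseteq> X0"
  using H_cone(1) by (auto simp: XA_def X0_def)

lemma XA_1: "XA 1 = X0"
  using H_cone(1) by (auto simp: XA_def X0_def)

lemma i_XA: "x \<in> H \<Longrightarrow> norm x \<le> 1 \<Longrightarrow> 0 \<le> d \<Longrightarrow> i x \<in> XA d \<longleftrightarrow> 1 - d < norm x"
proof -
  assume x: "x \<in> H" "norm x \<le> 1" "0 \<le> d"
  have "i x \<in> i ` (cball 0 (1 - d) \<inter> H) \<longleftrightarrow> norm x \<le> 1 - d"
  proof
    assume "i x \<in> i ` (cball 0 (1 - d) \<inter> H)"
    then obtain y where y: "y \<in> H" "norm y \<le> 1 - d" "i x = i y" by auto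
    then have "x = y" using i_eq[of x y] x by linarith
    then show "norm x \<le> 1 - d" using y by simp
  next
    assume "norm x \<le> 1 - d"
    then show "i x \<in> i ` (cball 0 (1 - d) \<inter> H)" using x by simp
  qed
  then show ?thesis using i_pts[OF disc_U[OF x(1,2)]] by (auto simp: XA_def)
qed

text \<open>The inversion exchanges radii above \<open>1 - d\<close> in \<open>X\<close> with radii
  below \<open>d\<close> in \<open>Z\<close>; for \<open>d = 1\<close> the whole neck is
  obtained.\<close>

lemma neck_Int:
  assumes d: "0 < d" "d \<le> 1"
  shows "a ` XA d \<inter> b ` Z0 = b ` j ` (ball 0 d \<inter> H - {0})"
proof
  show "a ` XA d \<inter> b ` Z0 \<subseteq> b ` j ` (ball 0 d \<inter> H - {0})"
  proof
    fix p assume "p \<in> a ` XA d \<inter> b ` Z0"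
    then obtain x z where xz: "x \<in> XA d" "z \<in> Z0" "p = b z" "a x = b z" by auto
    then have "x \<in> X0" using XA_X0[OF d(2)] by blast
    then obtain u t where ut: "u \<in> sphere 0 1 \<inter> H" "t \<in> {0<..<1}" "x = i (t *\<^sub>R u)" "z = j ((1 - t) *\<^sub>R u)"
      by (rule neckD[OF _ xz(2,4)])
    have "1 - d < norm (t *\<^sub>R u)" using xz(1) ut d i_XA[of "t *\<^sub>R u" d] by (auto simp: H_cone(2))
    then have "(1 - t) *\<^sub>R u \<in> ball 0 d \<inter> H - {0}" using ut by (auto simp: H_cone(2))
    then show "p \<in> b ` j ` (ball 0 d \<inter> H - {0})" unfolding xz(3) ut(4) by blast
  qed
  show "b ` j ` (ball 0 d \<inter> H - {0}) \<subseteq> a ` XA d \<inter> b ` Z0"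
  proof
    fix p assume "p \<in> b ` j ` (ball 0 d \<inter> H - {0})"
    then obtain w where "w \<in> ball 0 d \<inter> H - {0}" "p = b (j w)" by blast
    then have w: "w \<in> H" "norm w < d" "w \<noteq> 0" "p = b (j w)" by simp_all
    define s u where "s = norm w" and "u = (1 / norm w) *\<^sub>R w"
    have u: "u \<in> sphere 0 1 \<inter> H" "s \<in> {0<..<1}" "w = s *\<^sub>R u"
      using w d by (auto simp: u_def s_def H_cone(2))
    have "p = a (i ((1 - s) *\<^sub>R u))" unfolding w(4) u(3) by (rule neck_eq'[OF u(1,2)])
    moreover have "i ((1 - s) *\<^sub>R u) \<in> XA d"
    proof -
      have "norm ((1 - s) *\<^sub>R u) = 1 - s" "(1 - s) *\<^sub>R u \<in> H" using u(1,2) by (auto simp: H_cone(2))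
      moreover have "s < d" "0 < s" using w u(2) by (simp_all add: s_def)
      ultimately show ?thesis using d i_XA[of "(1 - s) *\<^sub>R u" d] by simp
    qed
    moreover have "j w \<in> Z0" using w d by (intro j_Z0) auto
    ultimately show "p \<in> a ` XA d \<inter> b ` Z0" using w(4) by blast
  qed
qed

lemma ac_neck:
  assumes "p = 1 \<or> p = 2" "0 < d" "d \<le> 1"
  shows "ac p (b ` j ` (ball 0 d \<inter> H - {0}))"
proof -
  have "j ` (ball 0 d \<inter> H - {0}) \<subseteq> Z0" using assms by (auto intro!: j_Z0)
  then show ?thesis by (rule ac_diffeo[OF diffeo_subset[OF oembD(3)[OF b_oemb]] chart_j(3)[OF assms]])
qed

text \<open>Second homology of the punctured \<open>Z\<close> injects into that of \<open>Z\<close>,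
  which vanishes.\<close>

lemma ac_b: "ac 2 (b ` Z0)"
proof (rule ac_diffeo[OF oembD(3)[OF b_oemb]])
  show "ac 2 Z0" unfolding ac_def
  proof (intro allI impI)
    fix z assume z: "cyc 2 Z0 z"
    have "cyc 2 (pts Z) z" by (rule cyc_mono[OF z]) (simp add: Z0_def)
    then show "bd 2 Z0 z" by (intro chart_j(6) z acD[OF acZ])
  qed
qed

text \<open>The isomorphism is the inverse of one inclusion-induced isomorphism followed by another.
  Its value is recorded on cycles in \<open>X0\<close>, and these represent every class.\<close>

lemma homology_iso:
  obtains h where "h \<in> iso (H2 X) (H2 W)" "\<forall>x. cyc 2 X0 x \<longrightarrow> h (cls X x) = cls W (chain_map 2 a x)"
proof -
  let ?G = "homology_group 2 (top_of_set X0)"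
  let ?p = "hom_induced 2 (top_of_set X0) {} (top_of_set (pts X)) {} (\<lambda>x. x)"
  let ?q = "hom_induced 2 (top_of_set X0) {} (top_of_set (pts W)) {} a"
  have X0: "X0 \<subseteq> pts X" by (auto simp: X0_def)
  have da: "diffeo X0 (a ` X0) a" by (rule oembD(3)[OF a_oemb])
  have idX: "chain_map 2 (\<lambda>x. x) x = x" if "cyc 2 X0 x" for x by (rule chain_map_id_on[OF that]) simp
  have p: "?p \<in> iso ?G (H2 X)"
  proof (rule hom_induced_iso)
    show "\<exists>x. cyc 2 X0 x \<and> hlg 2 (pts X) z (chain_map 2 (\<lambda>x. x) x)" if z: "cyc 2 (pts X) z" for z
      using chart_i(5)[OF z] idX by auto
    show "bd 2 X0 x" if "cyc 2 X0 x" "bd 2 (pts X) (chain_map 2 (\<lambda>x. x) x)" for x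
      using chart_i(6)[OF that(1)] that(2) idX[OF that(1)] by simp
  qed (use X0 in \<open>auto intro!: continuous_on_id\<close>)
  have un: "a ` X0 \<union> b ` Z0 = pts W" unfolding ptsW X0_def Z0_def ..
  have int: "a ` X0 \<inter> b ` Z0 = b ` j ` (ball 0 1 \<inter> H - {0})"
    using neck_Int[of 1] by (simp add: XA_1)
  have q: "?q \<in> iso ?G (H2 W)"
  proof (rule hom_induced_iso)
    show ca: "continuous_on X0 a" by (rule diffeoD(9)[OF da])
    show "a ` X0 \<subseteq> pts W" by (rule oembD(2)[OF a_oemb])
    have inv: "continuous_on (a ` X0) (inv_into X0 a)" "inv_into X0 a ` a ` X0 \<subseteq> X0"
      using diffeoD(10)[OF da] diffeoD(8)[OF da] by auto
    show "\<exists>x. cyc 2 X0 x \<and> hlg 2 (pts W) z (chain_map 2 a x)" if z: "cyc 2 (pts W) z" for z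
    proof -
      obtain y where y: "cyc 2 (a ` X0) y" "hlg 2 (a ` X0 \<union> b ` Z0) z y"
        by (rule mv_surject[of "a ` X0" "b ` Z0" z])
          (use z a_open b_open ac_b ac_neck[of 1 1] in \<open>simp_all only: un int, simp_all\<close>)
      let ?x = "chain_map 2 (inv_into X0 a) y"
      have "chain_map 2 a ?x = chain_map 2 (\<lambda>w. a (inv_into X0 a w)) y" by (rule chain_map_chain_map)
      also have "\<dots> = y" by (rule chain_map_id_on[OF y(1)]) (rule f_inv_into_f)
      finally have "hlg 2 (pts W) z (chain_map 2 a ?x)" using y(2) unfolding un by simp
      then show ?thesis using cyc_map[OF y(1) inv] by blast
    qed
    show "bd 2 X0 x" if x: "cyc 2 X0 x" and bx: "bd 2 (pts W) (chain_map 2 a x)" for x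
    proof -
      have cx: "cyc 2 (a ` X0) (chain_map 2 a x)" by (rule cyc_map[OF x ca]) simp
      have "bd 2 (a ` X0) (chain_map 2 a x)"
        by (rule mv_inject[of 2 "a ` X0" _ "b ` Z0"])
          (use cx bx a_open b_open ac_neck[of 2 1] in \<open>simp_all only: un int, simp_all\<close>)
      then have "bd 2 X0 (chain_map 2 (inv_into X0 a) (chain_map 2 a x))" by (rule bd_map[OF _ inv])
      moreover have "chain_map 2 (inv_into X0 a) (chain_map 2 a x) = chain_map 2 (\<lambda>w. inv_into X0 a (a w)) x"
        by (rule chain_map_chain_map)
      moreover have "\<dots> = x" by (rule chain_map_id_on[OF x]) (rule diffeoD(5)[OF da])
      ultimately show ?thesis by simp
    qed
  qed
  let ?h = "\<lambda>\<alpha>. ?q (inv_into (carrier ?G) ?p \<alpha>)"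
  have "inv_into (carrier ?G) ?p \<in> iso (H2 X) ?G"
    by (rule group.iso_set_sym[OF group_relative_homology_group p])
  from iso_set_trans[OF this q] have "?h \<in> iso (H2 X) (H2 W)" by (simp add: comp_def)
  moreover have "?h (cls X x) = cls W (chain_map 2 a x)" if x: "cyc 2 X0 x" for x
  proof -
    let ?c = "homologous_rel_set 2 (top_of_set X0) {} x"
    have c: "?c \<in> carrier ?G" using x carrier_relative_homology_group[of 2 "top_of_set X0" "{}"] by auto
    have "?p ?c = cls X (chain_map 2 (\<lambda>x. x) x)"
      by (rule hom_induced_chain_map[of "top_of_set X0" "top_of_set (pts X)" "\<lambda>x. x" "{}" "{}" 2 x, simplified])
        (use X0 x in \<open>auto intro!: continuous_on_id\<close>)
    then have "?p ?c = cls X x" by (simp add: idX[OF x])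
    moreover have "inj_on ?p (carrier ?G)" using p by (simp add: iso_def bij_betw_def)
    ultimately have "inv_into (carrier ?G) ?p (cls X x) = ?c" using c by (metis inv_into_f_f)
    moreover have "?q ?c = cls W (chain_map 2 a x)"
      by (rule hom_induced_chain_map[of "top_of_set X0" "top_of_set (pts W)" a "{}" "{}" 2 x, simplified])
        (use diffeoD(9)[OF da] oembD(2)[OF a_oemb] x in auto)
    ultimately show ?thesis by simp
  qed
  ultimately show ?thesis by (intro that[of ?h]) auto
qed

text \<open>The homotopy from the identity to \<open>\<psi>\<close> shows that a cycle in
  \<open>N\<close> is homologous in \<open>X\<close> to its image in \<open>X0\<close>, and on
  cycles in \<open>X0\<close> the map \<open>h\<close> is given by \<open>a\<close>.\<close>

lemma movable_to_sum:
  assumes h: "\<forall>x. cyc 2 X0 x \<longrightarrow> h (cls X x) = cls W (chain_map 2 a x)"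
  shows "movable X W (\<lambda>z w. h (cls X z) = cls W w)"
  unfolding movable_def
proof (intro allI impI)
  fix P assume P: "compact P" "thin P" "P \<subseteq> pts X"
  obtain \<psi> where \<psi>: "oemb X X (pts X) \<psi>" "i 0 \<notin> \<psi> ` P"
    "homotopic_with_canon (\<lambda>_. True) (pts X) (pts X) (\<lambda>x. x) \<psi>"
    by (rule chart_shift[OF oX H U(3,1,2) P(2,3)])
  define N where "N = {x \<in> pts X. \<psi> x \<noteq> i 0}"
  have NX: "N \<subseteq> pts X" by (auto simp: N_def)
  have im: "\<psi> ` N \<subseteq> X0" using oembD(2)[OF \<psi>(1)] by (auto simp: N_def X0_def)
  have c: "continuous_on N \<psi>"
    by (rule continuous_on_subset[OF diffeoD(9)[OF oembD(3)[OF \<psi>(1)]] NX])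
  show "\<exists>N f. P \<subseteq> N \<and> oemb X W N f \<and>
      (\<forall>z. cyc 2 N z \<longrightarrow> h (cls X z) = cls W (chain_map 2 f z))"
  proof (intro exI[of _ N] exI[of _ "\<lambda>x. a (\<psi> x)"] conjI allI impI)
    show "P \<subseteq> N"
    proof
      fix x assume x: "x \<in> P"
      then have "\<psi> x \<in> \<psi> ` P" by (rule imageI)
      then have "\<psi> x \<noteq> i 0" using \<psi>(2) by metis
      moreover have "x \<in> pts X" using x P(3) by (rule subsetD[rotated])
      ultimately show "x \<in> N" by (simp add: N_def)
    qed
    show "oemb X W N (\<lambda>x. a (\<psi> x))" by (rule oemb_compose[OF oemb_subset[OF \<psi>(1) NX] a_oemb im])
    fix z assume z: "cyc 2 N z"
    have z': "cyc 2 (pts X) z" by (rule cyc_mono[OF z NX])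
    have "chain_map 2 (\<lambda>x. x) z = z" by (rule chain_map_id_on[OF z]) simp
    then have "hlg 2 (pts X) z (chain_map 2 \<psi> z)" using homotopic_hlg[OF \<psi>(3) z'] by simp
    then have "cls X z = cls X (chain_map 2 \<psi> z)" by (simp add: homologous_rel_set_eq)
    moreover have "h (cls X (chain_map 2 \<psi> z)) = cls W (chain_map 2 a (chain_map 2 \<psi> z))"
      using h cyc_map[OF z c im] by blast
    ultimately show "h (cls X z) = cls W (chain_map 2 (\<lambda>x. a (\<psi> x)) z)" by (simp add: chain_map_chain_map)
  qed
qed

text \<open>The neighbourhood of \<open>P\<close> is \<open>N1 \<union> N2\<close>: the part of
  \<open>X\<close> outside a concentric disc, and a flat neighbourhood in \<open>Z\<close>. On
  \<open>N1\<close> the map \<open>\<Psi>\<close> undoes \<open>a\<close>; on \<open>N2\<close> it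
  flattens by \<open>\<kappa>\<close>, turns inside out by \<open>E\<close> and enters the disc of
  \<open>X\<close> by \<open>i\<close>. The two formulas agree on the neck, and the neck is the only
  place where the two images overlap.\<close>

lemma movable_from_sum:
  assumes h: "\<forall>x. cyc 2 X0 x \<longrightarrow> h (cls X x) = cls W (chain_map 2 a x)"
    and flat: "\<And>Q. thin Q \<Longrightarrow> Q \<subseteq> pts Z \<Longrightarrow>
      \<exists>Z' \<kappa>. openin (top_of_set (pts Z)) Z' \<and> Q \<subseteq> Z' \<and> oemb Z (std UNIV) Z' \<kappa>"
  shows "movable W X (\<lambda>w z. h (cls X z) = cls W w)"
  unfolding movable_def
proof (intro allI impI)
  fix P assume P: "compact P" "thin P" "P \<subseteq> pts W"
  have db: "diffeo Z0 (b ` Z0) b" by (rule oembD(3)[OF b_oemb])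
  have da: "diffeo X0 (a ` X0) a" by (rule oembD(3)[OF a_oemb])
  let ?b' = "inv_into Z0 b" and ?a' = "inv_into X0 a"
  \<comment> \<open>Adding \<open>j 0\<close> to \<open>Q\<close> makes the flattening defined on a
    small disc around the puncture, so that the neck can be compared with a disc in
    \<open>real^4\<close>.\<close>
  define Q where "Q = ?b' ` (P \<inter> b ` Z0) \<union> {j 0}"
  have "thin (?b' ` (P \<inter> b ` Z0))"
    by (rule thin_image[OF diffeoD(4)[OF db] thin_subset[OF P(2)]]) auto
  then have tQ: "thin Q" unfolding Q_def by (rule thin_Un[OF _ thin_sing])
  have j0: "j 0 \<in> pts Z" by (rule j_pts[OF disc_U']) (simp_all add: H_cone(1))
  have "?b' ` (P \<inter> b ` Z0) \<subseteq> Z0" by (rule image_subsetI) (auto simp: diffeoD(5)[OF db])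
  then have "Q \<subseteq> pts Z" using j0 unfolding Q_def Z0_def by blast
  then obtain Z' \<kappa> where Z': "openin (top_of_set (pts Z)) Z'" "Q \<subseteq> Z'" "oemb Z (std UNIV) Z' \<kappa>"
    using flat[OF tQ] by blast
  have Z'Z: "Z' \<subseteq> pts Z" by (rule openin_imp_subset[OF Z'(1)])
  have dk: "diffeo Z' (\<kappa> ` Z') \<kappa>" by (rule oembD(3)[OF Z'(3)])
  have j0': "j 0 \<in> Z'" using Z'(2) by (auto simp: Q_def)
  have opj: "openin (top_of_set (pts Z)) (j ` U')" using U'(3) by (simp add: smooth_chart_def)
  obtain r where r: "0 < r" "r \<le> 1" "j ` (ball 0 r \<inter> H) \<subseteq> Z'"
  proof -
    have "j ` U' \<subseteq> pts Z" by (rule openin_imp_subset[OF opj])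
    then have "openin (top_of_set (j ` U')) (j ` U' \<inter> Z')" by (rule openin_Int_subset[OF Z'(1)])
    then have "openin (top_of_set U') (U' \<inter> j -` (j ` U' \<inter> Z'))" by (rule diffeo_openin_vimage[OF j_diffeo])
    moreover have "0 \<in> U' \<inter> j -` (j ` U' \<inter> Z')" using disc_U'[OF H_cone(1)] j0' by simp
    ultimately obtain e where e: "e > 0" "ball 0 e \<inter> U' \<subseteq> U' \<inter> j -` (j ` U' \<inter> Z')"
      unfolding openin_contains_ball by blast
    show ?thesis
    proof (rule that[of "min e 1"])
      show "j ` (ball 0 (min e 1) \<inter> H) \<subseteq> Z'"
      proof (rule image_subsetI)
        fix x assume "x \<in> ball 0 (min e 1) \<inter> H"
        then have "x \<in> ball 0 e \<inter> U'" using disc_U'[of x] by simp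
        then show "j x \<in> Z'" using e(2) by blast
      qed
    qed (use e(1) in auto)
  qed
  define g where "g = (\<lambda>x. \<kappa> (j x))"
  define q where "q = \<kappa> (j 0)"
  have g0: "g 0 = q" by (simp add: g_def q_def)
  have rU: "ball 0 r \<inter> H \<subseteq> U'" using r(2) disc_U' by auto
  have dg: "diffeo (ball 0 r \<inter> H) (g ` (ball 0 r \<inter> H)) g"
    using diffeo_compose[OF diffeo_subset[OF j_diffeo rU] diffeo_subset[OF dk r(3)]]
    by (simp add: g_def image_image)
  have opg: "openin (top_of_set (\<kappa> ` Z')) (g ` (ball 0 r \<inter> H))"
  proof -
    have "openin (top_of_set Z') (j ` (ball 0 r \<inter> H))"
      by (rule openin_subset_trans[OF chart_j(2)[OF r(2)] r(3) Z'Z])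
    from diffeo_openin[OF dk this] show ?thesis by (simp add: g_def image_image)
  qed
  obtain E d where d: "0 < d" "d \<le> r" "d < 1" and smE: "smooth_on (-{g 0}) E"
    and dE: "diffeo (-{g 0}) (E ` (-{g 0})) E"
    and E1: "\<forall>u\<in>sphere 0 1 \<inter> H. \<forall>s\<in>{0<..<d}. E (g (s *\<^sub>R u)) = (1 - s) *\<^sub>R u"
    and E2: "E ` (\<kappa> ` Z' - {g 0}) \<subseteq> ball 0 1 \<inter> H"
    and E3: "\<forall>y\<in>\<kappa> ` Z' - {g 0}. 1 - d < norm (E y) \<longrightarrow> (\<exists>u\<in>sphere 0 1 \<inter> H. \<exists>s\<in>{0<..<d}. y = g (s *\<^sub>R u))"
    by (rule disc_extension[OF H r(1) dg opg])
  have d1: "d \<le> 1" using d by simp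
  define N1 where "N1 = a ` XA d"
  define N2 where "N2 = b ` (Z' - {j 0})"
  \<comment> \<open>\<open>N1\<close> takes precedence in the definition; \<open>\<Psi>2\<close>
    shows that the second formula is valid on all of \<open>N2\<close>.\<close>
  define \<Psi> where "\<Psi> = (\<lambda>p. if p \<in> N1 then ?a' p else i (E (\<kappa> (?b' p))))"
  have Z'0: "Z' - {j 0} \<subseteq> Z0" using Z'Z by (auto simp: Z0_def)
  have N1a: "N1 \<subseteq> a ` X0" unfolding N1_def by (rule image_mono[OF XA_X0[OF d1]])
  have N2b: "N2 \<subseteq> b ` Z0" unfolding N2_def by (rule image_mono[OF Z'0])
  have NW: "N1 \<union> N2 \<subseteq> pts W" using N1a N2b unfolding ptsW X0_def Z0_def by blast
  have jd: "j ` (ball 0 d \<inter> H - {0}) \<subseteq> Z' - {j 0}"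
  proof (rule image_subsetI)
    fix x assume x: "x \<in> ball 0 d \<inter> H - {0}"
    then have "j x \<noteq> j 0" using d by (subst j_eq) (auto simp: H_cone(1))
    moreover have "x \<in> ball 0 r \<inter> H" using x d by simp
    ultimately show "j x \<in> Z' - {j 0}" using r(3) by blast
  qed
  have int: "N1 \<inter> N2 = b ` j ` (ball 0 d \<inter> H - {0})"
  proof -
    have "N1 \<inter> b ` Z0 = b ` j ` (ball 0 d \<inter> H - {0})" unfolding N1_def by (rule neck_Int[OF d(1) d1])
    moreover have "b ` j ` (ball 0 d \<inter> H - {0}) \<subseteq> N2" unfolding N2_def by (rule image_mono[OF jd])
    moreover have "N1 \<inter> N2 = (N1 \<inter> b ` Z0) \<inter> N2" using N2b by (simp add: Int_assoc Int_absorb1)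
    ultimately show ?thesis by (simp add: Int_absorb2)
  qed
  have a'a: "?a' (a x) = x" if "x \<in> X0" for x by (rule diffeoD(5)[OF da that])
  have b'b: "?b' (b x) = x" if "x \<in> Z0" for x by (rule diffeoD(5)[OF db that])
  have \<Psi>1: "\<Psi> (a x) = x" if "x \<in> XA d" for x
    using that a'a XA_X0[OF d1] by (auto simp: \<Psi>_def N1_def)
  have nk: "\<exists>u\<in>sphere 0 1 \<inter> H. \<exists>s\<in>{0<..<d}. p = b (j (s *\<^sub>R u))" if p: "p \<in> N1 \<inter> N2" for p
  proof -
    obtain w where w: "w \<in> ball 0 d \<inter> H - {0}" "p = b (j w)" using p unfolding int by blast
    have "(1 / norm w) *\<^sub>R w \<in> sphere 0 1 \<inter> H" using w(1) by (auto simp: H_cone(2))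
    moreover have "norm w \<in> {0<..<d}" using w(1) by simp
    moreover have "p = b (j (norm w *\<^sub>R ((1 / norm w) *\<^sub>R w)))" using w by simp
    ultimately show ?thesis by blast
  qed
  \<comment> \<open>On the neck \<open>E\<close> acts as the exact inversion, and so does the
    passage from \<open>j\<close> to \<open>i\<close> in the sum.\<close>
  have \<Psi>2: "\<Psi> p = i (E (\<kappa> (?b' p)))" if p: "p \<in> N2" for p
  proof (cases "p \<in> N1")
    case True
    then obtain u s where us: "u \<in> sphere 0 1 \<inter> H" "s \<in> {0<..<d}" "p = b (j (s *\<^sub>R u))" using nk p by blast
    have su: "s *\<^sub>R u \<in> H" "norm (s *\<^sub>R u) \<le> 1" "s *\<^sub>R u \<noteq> 0" using us d by (auto simp: H_cone(2))
    have su': "(1 - s) *\<^sub>R u \<in> H" "norm ((1 - s) *\<^sub>R u) \<le> 1" "(1 - s) *\<^sub>R u \<noteq> 0" using us d by (auto simp: H_cone(2))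
    have "?b' p = j (s *\<^sub>R u)" unfolding us(3) by (rule b'b[OF j_Z0[OF su]])
    then have "E (\<kappa> (?b' p)) = (1 - s) *\<^sub>R u" using E1 us by (simp add: g_def)
    moreover have "p = a (i ((1 - s) *\<^sub>R u))" unfolding us(3) by (rule neck_eq'[OF us(1)]) (use us d in auto)
    then have "?a' p = i ((1 - s) *\<^sub>R u)" using a'a[OF i_X0[OF su']] by simp
    ultimately show ?thesis using True by (simp add: \<Psi>_def)
  qed (simp add: \<Psi>_def)
  have bN2: "?b' p \<in> Z' - {j 0}" if "p \<in> N2" for p
    using that b'b Z'0 unfolding N2_def by auto
  have kq: "\<kappa> z \<in> \<kappa> ` Z' - {g 0}" if "z \<in> Z' - {j 0}" for z
    using that inj_on_eq_iff[OF diffeoD(1)[OF dk], of z "j 0"] j0' by (simp add: g0 q_def)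
  have N2E: "E (\<kappa> (?b' p)) \<in> ball 0 1 \<inter> H" if "p \<in> N2" for p
    using E2 kq[OF bN2[OF that]] by blast
  \<comment> \<open>An image in \<open>XA d\<close> forces \<open>E\<close> to have norm above
    \<open>1 - d\<close>. By the last property of \<open>E\<close> the point then comes from the
    small punctured disc around \<open>j 0\<close>, which is the overlap. This yields injectivity of
    the glued map.\<close>
  have N2N1: "p \<in> N1" if p: "p \<in> N2" and big: "\<Psi> p \<in> XA d" for p
  proof -
    let ?y = "\<kappa> (?b' p)"
    have Ey: "E ?y \<in> H" "norm (E ?y) \<le> 1" using N2E[OF p] by simp_all
    have "i (E ?y) \<in> XA d" using big \<Psi>2[OF p] by simp
    then have "1 - d < norm (E ?y)" using i_XA[OF Ey] d(1) by simp
    then obtain u s where us: "u \<in> sphere 0 1 \<inter> H" "s \<in> {0<..<d}" "?y = g (s *\<^sub>R u)"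
      using E3 kq[OF bN2[OF p]] by blast
    have su: "s *\<^sub>R u \<in> ball 0 d \<inter> H - {0}" using us by (auto simp: H_cone(2))
    have jz: "j (s *\<^sub>R u) \<in> Z' - {j 0}" using jd su by blast
    have "?b' p = j (s *\<^sub>R u)"
      using inj_onD[OF diffeoD(1)[OF dk], of "?b' p" "j (s *\<^sub>R u)"] us(3) bN2[OF p] jz by (simp add: g_def)
    moreover have "b (?b' p) = p" by (rule f_inv_into_f) (use p N2b in blast)
    ultimately have "p = b (j (s *\<^sub>R u))" by simp
    then have "p \<in> N1 \<inter> N2" unfolding int using su by blast
    then show ?thesis by blast
  qed
  have PN: "P \<subseteq> N1 \<union> N2"
  proof
    fix p assume p: "p \<in> P"
    show "p \<in> N1 \<union> N2"
    proof (cases "p \<in> b ` Z0")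
      case True
      then have "?b' p \<in> Q" using p by (auto simp: Q_def)
      then have "?b' p \<in> Z'" using Z'(2) by blast
      moreover have "?b' p \<in> Z0" using True b'b by auto
      moreover have "b (?b' p) = p" using True by (rule f_inv_into_f)
      ultimately have "p \<in> N2" unfolding N2_def Z0_def by (metis Diff_iff image_eqI)
      then show ?thesis by simp
    next
      case False
      have "p \<in> pts W" using p P(3) by blast
      then obtain x where x: "x \<in> X0" "p = a x" using False unfolding ptsW X0_def Z0_def by blast
      \<comment> \<open>A point of the inner disc other than its centre belongs to the neck and
        hence to the image of \<open>b\<close>, which is the other case.\<close>
      have "x \<in> XA d"
      proof (rule ccontr)
        assume "x \<notin> XA d"
        then obtain w where w: "w \<in> H" "norm w \<le> 1 - d" "x = i w" using x(1) by (auto simp: XA_def X0_def)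
        have w0: "w \<noteq> 0" using x(1) w(3) by (auto simp: X0_def)
        have u: "(1 / norm w) *\<^sub>R w \<in> sphere 0 1 \<inter> H" using w w0 by (auto simp: H_cone(2))
        have t: "norm w \<in> {0<..<1}" using w0 w(2) d(1) by simp
        have "p = b (j ((1 - norm w) *\<^sub>R ((1 / norm w) *\<^sub>R w)))"
          using neck_eq[OF u t] x(2) w(3) w0 by simp
        moreover have "j ((1 - norm w) *\<^sub>R ((1 / norm w) *\<^sub>R w)) \<in> Z0"
          by (rule j_Z0) (use u t w0 w(1) in \<open>auto simp: H_cone(2)\<close>)
        ultimately show False using False by blast
      qed
      then show ?thesis using x(2) by (simp add: N1_def)
    qed
  qed
  \<comment> \<open>The complement of \<open>q\<close> is connected, so \<open>E\<close> preserves
    orientation everywhere or reverses it everywhere; one point of the neck decides.\<close>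
  have E_oemb: "oemb (std UNIV) (std UNIV) (-{q}) E"
  proof -
    have oneg: "open (-{q})" by (simp add: open_Compl)
    have smE': "smooth_on (-{q}) E" using smE by (simp only: g0)
    have dE': "diffeo (-{q}) (E ` (-{q})) E" using dE by (simp only: g0)
    have full: "full (-{q})" using oneg by (simp add: full_def)
    have injE: "inj (frechet_derivative E (at x))" if "x \<in> -{q}" for x
      by (rule diffeo_derivative_inj[OF dE' full that has_derivative_at_withinI[OF smooth_on_has_derivative[OF smE' that]]])
    have ostd: "oriented_manifold (std UNIV :: (real^4, 4) omanifold)" by (rule oriented_manifold_std) (simp add: full_def)
    have con: "connected (-{q})" by (rule connected_punctured_universe) simp
    have dich: "(\<forall>x\<in>-{q}. frechet_derivative E (at x) \<in> frames (std UNIV) (E x)) \<or>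
      (\<forall>x\<in>-{q}. frechet_derivative E (at x) \<notin> frames (std UNIV) (E x) \<and>
         (\<forall>B. det B < 0 \<longrightarrow> frechet_derivative E (at x) \<circ> (\<lambda>v. B *v v) \<in> frames (std UNIV) (E x)))"
      by (rule immersion_orientation[OF smE' con ostd _ injE]) simp_all
    \<comment> \<open>The part of the small disc with positive first coordinate is open in
      \<open>real^4\<close>, avoids the centre and lies in \<open>H\<close> for both choices of
      \<open>H\<close>, so ordinary derivatives are available on its image.\<close>
    define G where "G = ball 0 d \<inter> {x :: real^4. 0 < x $ 1}"
    have GH: "G \<subseteq> ball 0 d \<inter> H - {0}" using H by (auto simp: G_def half_space_def)
    have Gr: "G \<subseteq> ball 0 r \<inter> H" using GH d(2) by auto
    have oG: "open G" unfolding G_def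
      by (intro open_Int open_ball open_Collect_less continuous_intros)
    define x0 where "x0 = (d / 2) *\<^sub>R (axis 1 1 :: real^4)"
    have x0: "x0 \<in> G" using d(1) by (simp add: x0_def G_def)
    have dgG: "diffeo G (g ` G) g" by (rule diffeo_subset[OF dg Gr])
    have ogG: "open (g ` G)" by (rule invariance_of_domain[OF diffeoD(9)[OF dgG] oG diffeoD(1)[OF dgG]])
    have jG: "j ` G \<subseteq> Z' - {j 0}" using jd GH by blast
    have kj: "g ` G \<subseteq> \<kappa> ` Z'" using jG unfolding g_def by blast
    let ?k' = "inv_into Z' \<kappa>" and ?i' = "inv_into U i"
    have k'g: "?k' (g x) = j x" if "x \<in> G" for x
      unfolding g_def using that jG by (intro diffeoD(5)[OF dk]) blast
    have oU: "oriented_manifold (std U)" by (rule oriented_manifold_std[OF oriented_chart_full[OF U(3)]])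
    have c1: "oemb (std UNIV) Z (g ` G) ?k'"
      by (rule oemb_subset[OF oemb_inverse[OF Z'(3) oZ ostd Z'(1)] kj])
    have k'G: "?k' ` g ` G \<subseteq> Z0" using k'g jG Z'0 by fastforce
    have c2: "oemb (std UNIV) W (g ` G) (\<lambda>y. b (?k' y))"
      by (rule oemb_compose[OF c1 b_oemb k'G])
    have bj: "b (j x) \<in> N1" if "x \<in> G" for x using int that GH by blast
    have s2: "(\<lambda>y. b (?k' y)) ` g ` G \<subseteq> a ` X0" using k'g bj N1a by fastforce
    have X0open: "openin (top_of_set (pts X)) X0" by (rule chart_i(1))
    have c3: "oemb (std UNIV) X (g ` G) (\<lambda>y. ?a' (b (?k' y)))"
      by (rule oemb_compose[OF c2 oemb_inverse[OF a_oemb oX oW X0open] s2])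
    have Eg: "?a' (b (j x)) = i (E (g x)) \<and> E (g x) \<in> H \<and> norm (E (g x)) \<le> 1" if x: "x \<in> G" for x
    proof -
      have p: "b (j x) \<in> N2" using jG x by (auto simp: N2_def)
      have b': "?b' (b (j x)) = j x" using jG Z'0 x by (intro b'b) blast
      have "?a' (b (j x)) = \<Psi> (b (j x))" using bj[OF x] by (simp add: \<Psi>_def)
      then show ?thesis using \<Psi>2[OF p] N2E[OF p] by (simp add: b' g_def)
    qed
    have s3: "(\<lambda>y. ?a' (b (?k' y))) ` g ` G \<subseteq> i ` U"
    proof (rule image_subsetI)
      fix y assume "y \<in> g ` G"
      then obtain x where x: "x \<in> G" "y = g x" by blast
      then have "E (g x) \<in> U" using Eg disc_U by blast
      then show "?a' (b (?k' y)) \<in> i ` U" using Eg[OF x(1)] k'g[OF x(1)] x(2) by simp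
    qed
    have iU: "oemb (std U) X U i" by (rule oriented_chart_oemb[OF U(3)]) simp
    have c4: "oemb (std UNIV) (std U) (g ` G) (\<lambda>y. ?i' (?a' (b (?k' y))))"
      by (rule oemb_compose[OF c3 oemb_inverse[OF iU oU oX] s3]) simp
    \<comment> \<open>On the image of \<open>G\<close>, \<open>E\<close> is the passage from
      \<open>real^4\<close> back to \<open>Z\<close>, into \<open>W\<close>, back to
      \<open>X\<close> and into the chart \<open>i\<close>. Each of these steps preserves
      orientation.\<close>
    have c5: "oemb (std UNIV) (std U) (g ` G) E"
    proof (rule oemb_cong[OF c4])
      fix y assume "y \<in> g ` G"
      then obtain x where x: "x \<in> G" "y = g x" by blast
      then have "E (g x) \<in> U" using Eg disc_U by blast
      then show "?i' (?a' (b (?k' y))) = E y"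
        using Eg[OF x(1)] k'g[OF x(1)] x(2) diffeoD(5)[OF i_diffeo] by simp
    qed
    define y0 where "y0 = g x0"
    have y0: "y0 \<in> g ` G" using x0 by (simp add: y0_def)
    have y0q: "y0 \<in> -{q}" using kq jG x0 by (auto simp: y0_def g_def q_def)
    obtain O' F where F: "y0 \<in> O'" "smooth_on O' F" "\<forall>y\<in>O' \<inter> g ` G. F y = E y"
      "\<forall>A\<in>frames (std UNIV) y0. frechet_derivative F (at y0) \<circ> A \<in> frames (std U) (E y0)"
      by (rule oembE[OF c5 y0])
    have op: "open (O' \<inter> g ` G)" by (rule open_Int[OF smooth_on_open[OF F(2)] ogG])
    have "(E has_derivative frechet_derivative F (at y0)) (at y0)"
      by (rule has_derivative_transform_within_open[OF smooth_on_has_derivative[OF F(2,1)] op])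
        (use F(1,3) y0 in auto)
    then have FE: "frechet_derivative F (at y0) = frechet_derivative E (at y0)" by (rule frechet_derivative_at)
    have "(\<lambda>v. mat 1 *v v) \<in> frames (std UNIV) y0" unfolding std_simps
      by (intro CollectI exI[of _ "mat 1"] conjI refl) simp
    then have "frechet_derivative E (at y0) \<circ> (\<lambda>v. mat 1 *v v) \<in> frames (std U) (E y0)" using F(4) unfolding FE by blast
    then have "frechet_derivative E (at y0) \<in> frames (std UNIV) (E y0)" by (simp add: comp_def)
    then have pos: "\<forall>x\<in>-{q}. frechet_derivative E (at x) \<in> frames (std UNIV) (E x)" using dich y0q by blast
    show ?thesis unfolding oemb_def
    proof (intro conjI ballI)
      show "diffeo (-{q}) (E ` (-{q})) E" by (rule dE')
      fix p assume p: "p \<in> -{q}"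
      obtain B where B: "frechet_derivative E (at p) = (\<lambda>v. B *v v)" "0 < det B" using pos p by auto
      have "frechet_derivative E (at p) \<circ> A \<in> frames (std UNIV) (E p)" if "A \<in> frames (std UNIV) p" for A
      proof -
        obtain B' where B': "A = (\<lambda>v. B' *v v)" "0 < det B'" using \<open>A \<in> frames (std UNIV) p\<close> by auto
        have "frechet_derivative E (at p) \<circ> A = (\<lambda>v. (B ** B') *v v)"
          unfolding B B' by (simp add: comp_def matrix_vector_mul_assoc)
        moreover have "0 < det (B ** B')" using B B' by (simp add: det_mul)
        ultimately show ?thesis unfolding std_simps by blast
      qed
      then show "\<exists>O'' F. p \<in> O'' \<and> smooth_on O'' F \<and> (\<forall>y\<in>O'' \<inter> -{q}. F y = E y) \<and>
          (\<forall>A\<in>frames (std UNIV) p. frechet_derivative F (at p) \<circ> A \<in> frames (std UNIV) (E p))"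
        by (intro exI[of _ "-{q}"] exI[of _ E] conjI ballI smE' p) simp_all
    qed simp_all
  qed
  have A: "oemb W X N1 \<Psi>"
    by (rule oemb_cong[OF oemb_subset[OF oemb_inverse[OF a_oemb oX oW chart_i(1)] N1a]]) (simp add: \<Psi>_def)
  have B: "oemb W X N2 \<Psi>"
  proof (rule oemb_cong)
    have 1: "oemb W Z N2 ?b'" by (rule oemb_subset[OF oemb_inverse[OF b_oemb oZ oW chart_j(1)] N2b])
    have 2: "oemb W (std UNIV) N2 (\<lambda>p. \<kappa> (?b' p))"
      by (rule oemb_compose[OF 1 Z'(3)]) (use bN2 in blast)
    have 3: "oemb W (std UNIV) N2 (\<lambda>p. E (\<kappa> (?b' p)))"
      by (rule oemb_compose[OF 2 E_oemb]) (use kq bN2 g0 in fastforce)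
    have iU: "oemb (std UNIV) X U i" by (rule oriented_chart_oemb[OF U(3)]) simp
    show "oemb W X N2 (\<lambda>p. i (E (\<kappa> (?b' p))))"
      by (rule oemb_compose[OF 3 iU]) (use N2E disc_U in fastforce)
  qed (simp add: \<Psi>2)
  have im1: "\<Psi> ` N1 = XA d" using \<Psi>1 by (force simp: N1_def)
  have im2: "\<Psi> ` N2 \<subseteq> i ` (ball 0 1 \<inter> H)" using \<Psi>2 N2E by fastforce
  have inj: "inj_on \<Psi> (N1 \<union> N2)"
  proof -
    have 1: "inj_on \<Psi> N1" "inj_on \<Psi> N2" using diffeoD(1)[OF oembD(3)[OF A]] diffeoD(1)[OF oembD(3)[OF B]] .
    have 2: "p = p'" if "p \<in> N1" "p' \<in> N2" "\<Psi> p = \<Psi> p'" for p p'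
    proof -
      have "\<Psi> p' \<in> XA d" using im1 that by (metis imageI)
      then have "p' \<in> N1" by (rule N2N1[OF that(2)])
      then show ?thesis using inj_onD[OF 1(1)] that by blast
    qed
    show ?thesis
    proof (rule inj_onI)
      fix p p' assume "p \<in> N1 \<union> N2" "p' \<in> N1 \<union> N2" "\<Psi> p = \<Psi> p'"
      then show "p = p'" using inj_onD[OF 1(1)] inj_onD[OF 1(2)] 2[of p p'] 2[of p' p] by (metis Un_iff)
    qed
  qed
  have XAopen: "openin (top_of_set (pts X)) (XA d)"
  proof -
    have "compact (cball 0 (1 - d) \<inter> H)"
      using H by (auto simp: half_space_def intro!: compact_Int_closed closed_Collect_le continuous_intros)
    moreover have "continuous_on (cball 0 (1 - d) \<inter> H) i"
      by (rule continuous_on_subset[OF diffeoD(9)[OF i_diffeo]]) (use disc_U d(1) in auto)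
    ultimately have "compact (i ` (cball 0 (1 - d) \<inter> H))" by (intro compact_continuous_image)
    then have "open (- i ` (cball 0 (1 - d) \<inter> H))" by (simp add: compact_imp_closed open_Compl)
    moreover have "XA d = pts X \<inter> - i ` (cball 0 (1 - d) \<inter> H)" by (auto simp: XA_def)
    ultimately show ?thesis by (simp add: openin_open_Int)
  qed
  have N1W: "openin (top_of_set (pts W)) N1" unfolding N1_def
  proof (rule openin_trans[OF diffeo_openin[OF da] a_open])
    show "openin (top_of_set X0) (XA d)"
      by (rule openin_subset_trans[OF XAopen XA_X0[OF d1]]) (simp add: X0_def)
  qed
  have N2W: "openin (top_of_set (pts W)) N2" unfolding N2_def
  proof (rule openin_trans[OF diffeo_openin[OF db] b_open])
    have "openin (top_of_set (pts Z)) (Z' - {j 0})" by (rule openin_delete[OF Z'(1)])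
    then show "openin (top_of_set Z0) (Z' - {j 0})"
      by (rule openin_subset_trans[OF _ Z'0]) (simp add: Z0_def)
  qed
  have op1: "openin (top_of_set (N1 \<union> N2)) N1" and op2: "openin (top_of_set (N1 \<union> N2)) N2"
    by (rule openin_subset_trans[OF N1W _ NW], simp, rule openin_subset_trans[OF N2W _ NW], simp)
  have imX: "\<Psi> ` (N1 \<union> N2) \<subseteq> pts X" using oembD(2)[OF A] oembD(2)[OF B] by blast
  have of1: "openin (top_of_set (\<Psi> ` (N1 \<union> N2))) (\<Psi> ` N1)"
    by (rule openin_subset_trans[OF _ _ imX]) (use XAopen im1 in auto)
  \<comment> \<open>The image of \<open>N2\<close> is cut out of the whole image by the open unit
    disc of the chart \<open>i\<close>: a point of \<open>N1\<close> sent into that disc lies in the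
    collar, hence in the overlap.\<close>
  have of2: "openin (top_of_set (\<Psi> ` (N1 \<union> N2))) (\<Psi> ` N2)"
  proof -
    have "\<Psi> ` (N1 \<union> N2) \<inter> i ` (ball 0 1 \<inter> H) = \<Psi> ` N2"
    proof -
      have "\<Psi> p \<in> \<Psi> ` N2" if p: "p \<in> N1" "\<Psi> p \<in> i ` (ball 0 1 \<inter> H)" for p
      proof -
        obtain w where w: "w \<in> H" "norm w < 1" "\<Psi> p = i w" using p(2) by auto
        obtain x where x: "x \<in> XA d" "p = a x" using p(1) by (auto simp: N1_def)
        have xw: "x = i w" using \<Psi>1[OF x(1)] x(2) w(3) by simp
        then have big: "1 - d < norm w" using i_XA[of w d] w x(1) d(1) by simp
        define u where "u = (1 / norm w) *\<^sub>R w"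
        have w0: "w \<noteq> 0" using big d(3) by auto
        have u: "u \<in> sphere 0 1 \<inter> H" "norm w \<in> {0<..<1}" "w = norm w *\<^sub>R u" using w w0 by (auto simp: u_def H_cone(2))
        have "p = b (j ((1 - norm w) *\<^sub>R u))" using neck_eq[OF u(1,2)] u(3) x(2) xw by simp
        moreover have "(1 - norm w) *\<^sub>R u \<in> ball 0 d \<inter> H - {0}" using u w big by (auto simp: H_cone(2))
        ultimately have "p \<in> N1 \<inter> N2" unfolding int by blast
        then show ?thesis by blast
      qed
      then show ?thesis using im2 by blast
    qed
    then show ?thesis using openin_Int_subset[OF chart_i(2)[of 1] imX] by simp
  qed
  have \<Psi>: "oemb W X (N1 \<union> N2) \<Psi>" by (rule oemb_glue[OF A B inj op1 op2 of1 of2])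
  have c\<Psi>: "continuous_on (N1 \<union> N2) \<Psi>" by (rule diffeoD(9)[OF oembD(3)[OF \<Psi>]])
  show "\<exists>N f. P \<subseteq> N \<and> oemb W X N f \<and>
      (\<forall>z. cyc 2 N z \<longrightarrow> h (cls X (chain_map 2 f z)) = cls W z)"
  proof (intro exI[of _ "N1 \<union> N2"] exI[of _ \<Psi>] conjI allI impI PN \<Psi>)
    fix z assume z: "cyc 2 (N1 \<union> N2) z"
    \<comment> \<open>Acyclicity of the overlap splits a cycle into \<open>x\<close> in
      \<open>N1\<close> and \<open>y\<close> in \<open>N2\<close>. The summand \<open>y\<close>
      bounds in \<open>W\<close> because the punctured \<open>Z\<close> is acyclic in degree 2, and
      its image bounds in \<open>X\<close> because it lies in a disc. On \<open>N1\<close> the map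
      \<open>a\<close> undoes \<open>\<Psi>\<close>, so the two classes correspond under
      \<open>h\<close>.\<close>
    have "ac 1 (N1 \<inter> N2)" unfolding int by (rule ac_neck[OF _ d(1) d1]) simp
    then obtain x y where xy: "cyc 2 N1 x" "cyc 2 N2 y" "hlg 2 (N1 \<union> N2) z (x + y)"
      using mv_split[of 1 N1 N2 z] z op1 op2 by (auto simp: numeral_2_eq_2)
    have "bd 2 (b ` Z0) y" by (rule acD[OF ac_b cyc_mono[OF xy(2) N2b]])
    then have bdy: "bd 2 (pts W) y" by (rule bd_mono) (rule oembD(2)[OF b_oemb])
    have "hlg 2 (pts W) z (x + y)" by (rule hlg_mono[OF xy(3) NW])
    then have "bd 2 (pts W) (z - (x + y) + y)" unfolding hlg_iff by (rule singular_relboundary_add[OF _ bdy])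
    then have zx: "hlg 2 (pts W) z x" unfolding hlg_iff by (simp add: algebra_simps)
    let ?x = "chain_map 2 \<Psi> x" and ?y = "chain_map 2 \<Psi> y" and ?z = "chain_map 2 \<Psi> z"
    have cN1: "continuous_on N1 \<Psi>" and cN2: "continuous_on N2 \<Psi>"
      by (rule continuous_on_subset[OF c\<Psi>], simp)+
    have "cyc 2 (i ` (ball 0 1 \<inter> H)) ?y" by (rule cyc_map[OF xy(2) cN2 im2])
    then have "bd 2 (i ` (ball 0 1 \<inter> H)) ?y" by (rule acD[OF chart_i(4)])
    then have bdy': "bd 2 (pts X) ?y" by (rule bd_mono) (use i_pts disc_U in auto)
    have "hlg 2 (pts X) ?z (chain_map 2 \<Psi> (x + y))" by (rule hlg_map[OF xy(3) c\<Psi> imX])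
    then have "bd 2 (pts X) (?z - (?x + ?y))" unfolding hlg_iff by (simp add: chain_map_add)
    then have "bd 2 (pts X) (?z - (?x + ?y) + ?y)" by (rule singular_relboundary_add[OF _ bdy'])
    then have "hlg 2 (pts X) ?z ?x" unfolding hlg_iff by (simp add: algebra_simps)
    then have "cls X ?z = cls X ?x" by (simp add: homologous_rel_set_eq)
    moreover have "cyc 2 X0 ?x" by (rule cyc_map[OF xy(1) cN1]) (use im1 XA_X0[OF d1] in simp)
    then have "h (cls X ?x) = cls W (chain_map 2 a ?x)" using h by blast
    moreover have "chain_map 2 a ?x = chain_map 2 (\<lambda>p. a (\<Psi> p)) x" by (rule chain_map_chain_map)
    moreover have "\<dots> = x" by (rule chain_map_id_on[OF xy(1)]) (auto simp: N1_def \<Psi>1)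
    moreover have "cls W z = cls W x" using zx by (simp add: homologous_rel_set_eq)
    ultimately show "h (cls X ?z) = cls W z" by simp
  qed
qed

end

section \<open>Flat neighbourhoods of thin sets in \<open>Z\<close>\<close>

text \<open>The embedding carries the thin set into the surgered sphere; the neighbourhood found
  there and its flattening are pulled back.\<close>

lemma flat_codim0:
  assumes Z: "oriented_manifold Z" and L: "S2_link L" and S: "surgery L S" and c: "codim0_submanifold Z S"
    and Q: "thin Q" "Q \<subseteq> pts Z"
  shows "\<exists>Z' \<kappa>. openin (top_of_set (pts Z)) Z' \<and> Q \<subseteq> Z' \<and> oemb Z (std UNIV) Z' \<kappa>"
proof -
  have oS: "oriented_manifold S" using S by (simp add: surgery_def)
  obtain e where "oriented_embedding Z S e" using c unfolding codim0_submanifold_def by (elim exE)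
  then have e: "oemb Z S (pts Z) e" by (rule oriented_embedding_oemb[OF _ Z oS])
  have de: "diffeo (pts Z) (e ` pts Z) e" by (rule oembD(3)[OF e])
  have tQ: "thin (e ` Q)" by (rule thin_image[OF diffeoD(3)[OF de] Q])
  have sQ: "e ` Q \<subseteq> pts S" using oembD(2)[OF e] Q(2) by blast
  obtain S' \<kappa> where S': "openin (top_of_set (pts S)) S'" "e ` Q \<subseteq> S'" "oemb S (std UNIV) S' \<kappa>"
    by (rule surgery_flatten[OF L S tQ sQ])
  let ?Z' = "pts Z \<inter> e -` S'"
  have "openin (top_of_set (pts Z)) ?Z'"
    by (rule continuous_openin_preimage[OF diffeoD(9)[OF de] _ S'(1)]) (use oembD(2)[OF e] in blast)
  moreover have "Q \<subseteq> ?Z'" using Q(2) S'(2) by blast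
  moreover have "oemb Z (std UNIV) ?Z' (\<lambda>x. \<kappa> (e x))"
    by (rule oemb_compose[OF oemb_subset[OF e] S'(3)]) auto
  ultimately show ?thesis by blast
qed

text \<open>Only the punctured \<open>Z\<close> embeds in the surgered sphere, so the thin set is
  moved off the centre of the summing disc by \<open>chart_shift\<close> beforehand, and the
  neighbourhood is pulled back through the shift as well.\<close>

lemma flat_summand:
  assumes Z: "oriented_manifold Z" and L: "S2_link L" and S: "surgery L S" and c: "connected_summand Z S"
    and Q: "thin Q" "Q \<subseteq> pts Z"
  shows "\<exists>Z' \<kappa>. openin (top_of_set (pts Z)) Z' \<and> Q \<subseteq> Z' \<and> oemb Z (std UNIV) Z' \<kappa>"
proof -
  have oS: "oriented_manifold S" using S by (simp add: surgery_def)
  obtain M :: "(real^9, 4) omanifold" where M: "disc_sum UNIV Z M S"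
    using c unfolding connected_summand_def connected_sum_def by (elim exE conjE)
  obtain U k a where U: "openin (top_of_set UNIV) U" "cball 0 1 \<inter> UNIV \<subseteq> U" "oriented_chart Z U k"
    and a: "open_oriented_embedding (delete Z {k 0}) S a"
    using conjunct2[OF M[unfolded disc_sum_def]] by (elim exE conjE)
  let ?Z0 = "pts Z - {k 0}"
  have op: "openin (top_of_set (pts Z)) ?Z0" by (rule openin_delete) simp
  have a': "oemb Z S ?Z0 a" by (rule open_embedding_delete(1)[OF Z oS op a])
  have da: "diffeo ?Z0 (a ` ?Z0) a" by (rule oembD(3)[OF a'])
  have H: "UNIV = UNIV \<or> UNIV = (half_space :: (real^4) set)" by simp
  obtain \<psi> where \<psi>: "oemb Z Z (pts Z) \<psi>" "k 0 \<notin> \<psi> ` Q"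
    by (rule chart_shift[OF Z H U(3,1,2) Q])
  have d\<psi>: "diffeo (pts Z) (\<psi> ` pts Z) \<psi>" by (rule oembD(3)[OF \<psi>(1)])
  have im: "\<psi> ` pts Z \<subseteq> pts Z" by (rule oembD(2)[OF \<psi>(1)])
  have Q0: "\<psi> ` Q \<subseteq> ?Z0" using im Q(2) \<psi>(2) by blast
  have "thin (\<psi> ` Q)" by (rule thin_image[OF diffeoD(3)[OF d\<psi>] Q])
  then have tQ: "thin (a ` \<psi> ` Q)" by (rule thin_image[OF diffeoD(3)[OF da] _ Q0])
  have sQ: "a ` \<psi> ` Q \<subseteq> pts S" using oembD(2)[OF a'] Q0 by blast
  obtain S' \<kappa> where S': "openin (top_of_set (pts S)) S'" "a ` \<psi> ` Q \<subseteq> S'" "oemb S (std UNIV) S' \<kappa>"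
    by (rule surgery_flatten[OF L S tQ sQ])
  let ?Z1 = "?Z0 \<inter> a -` S'"
  let ?Z' = "pts Z \<inter> \<psi> -` ?Z1"
  have "openin (top_of_set ?Z0) ?Z1"
    by (rule continuous_openin_preimage[OF diffeoD(9)[OF da] _ S'(1)]) (use oembD(2)[OF a'] in blast)
  then have "openin (top_of_set (pts Z)) ?Z1" by (rule openin_trans[OF _ op])
  then have "openin (top_of_set (pts Z)) ?Z'"
    by (rule continuous_openin_preimage[OF diffeoD(9)[OF d\<psi>], rotated]) (use im in blast)
  moreover have "Q \<subseteq> ?Z'" using Q(2) Q0 S'(2) by blast
  moreover have "oemb Z (std UNIV) ?Z' (\<lambda>x. \<kappa> (a (\<psi> x)))"
  proof -
    have "oemb Z S ?Z' (\<lambda>x. a (\<psi> x))" by (rule oemb_compose[OF oemb_subset[OF \<psi>(1)] a']) auto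
    then show ?thesis by (rule oemb_compose[OF _ S'(3)]) auto
  qed
  ultimately show ?thesis by blast
qed

section \<open>Algebraic equivalence of a summand and its sum, and the conclusion\<close>

proposition alg_equiv_disc_sum:
  fixes X :: "('a::euclidean_space, 4) omanifold" and Z :: "('b::euclidean_space, 4) omanifold"
    and W :: "('c::euclidean_space, 4) omanifold" and S :: "('d::euclidean_space, 4) omanifold"
  assumes H: "H = UNIV \<or> H = half_space" and X: "oriented_manifold X" and Z: "oriented_manifold Z"
    and L: "S2_link L" and S: "surgery L S" and ZS: "connected_summand Z S \<or> codim0_submanifold Z S"
    and triv: "trivial_group (H2 Z)" and sum: "disc_sum H X Z W"
  shows "alg_equiv X W"
proof -
  have W: "oriented_manifold W" using sum by (simp add: disc_sum_def)
  obtain U i U' j a b where U: "openin (top_of_set H) U" "cball 0 1 \<inter> H \<subseteq> U" "oriented_chart X U i"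
    and U': "openin (top_of_set H) U'" "cball 0 1 \<inter> H \<subseteq> U'" "oriented_chart (opposite Z) U' j"
    and ab: "open_oriented_embedding (delete X {i 0}) W a" "open_oriented_embedding (delete Z {j 0}) W b"
      "pts W = a ` (pts X - {i 0}) \<union> b ` (pts Z - {j 0})"
      "\<forall>x \<in> pts X - {i 0}. \<forall>z \<in> pts Z - {j 0}. a x = b z \<longleftrightarrow>
             (\<exists>u \<in> sphere 0 1 \<inter> H. \<exists>t \<in> {0<..<1}. x = i (t *\<^sub>R u) \<and> z = j ((1 - t) *\<^sub>R u))"
    using conjunct2[OF sum[unfolded disc_sum_def]] by (elim exE conjE)
  have cj: "smooth_chart (pts Z) U' j" using oriented_chart_smooth[OF U'(3)] by (simp add: opposite_def)
  have acZ: "ac 2 (pts Z)" using triv by (simp add: ac_iff)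
  interpret disc_gluing H X Z W U i U' j a b
    by (rule disc_gluing.intro[OF H X Z W U U'(1,2) cj ab acZ])
  have flat: "\<exists>Z' \<kappa>. openin (top_of_set (pts Z)) Z' \<and> Q \<subseteq> Z' \<and> oemb Z (std UNIV) Z' \<kappa>"
    if "thin Q" "Q \<subseteq> pts Z" for Q
    using ZS flat_summand[OF Z L S _ that] flat_codim0[OF Z L S _ that] by (elim disjE)
  obtain h where h: "h \<in> iso (H2 X) (H2 W)" "\<forall>x. cyc 2 X0 x \<longrightarrow> h (cls X x) = cls W (chain_map 2 a x)"
    by (rule homology_iso)
  show ?thesis
    by (rule alg_equivI[OF X W h(1) movable_to_sum[OF h(2)] movable_from_sum[OF h(2) flat]])
qed

theorem theorem1p9:
  fixes X1 :: "('a::euclidean_space, 4) omanifold" and X2 :: "('b::euclidean_space, 4) omanifold"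
    and Z1 :: "('c::euclidean_space, 4) omanifold" and Z2 :: "('d::euclidean_space, 4) omanifold"
    and L1 L2 :: "(real^5) set"
    and S1 :: "('e::euclidean_space, 4) omanifold" and S2 :: "('f::euclidean_space, 4) omanifold"
  assumes "four_manifold X1" and "four_manifold X2"
    and "four_manifold Z1" and "four_manifold Z2"
    and "S2_link L1" and "S2_link L2"
    and "surgery L1 S1" and "surgery L2 S2"
    and "connected_summand Z1 S1 \<or> codim0_submanifold Z1 S1"
    and "connected_summand Z2 S2 \<or> codim0_submanifold Z2 S2"
    and "trivial_group (H2 Z1)" and "trivial_group (H2 Z2)"
  shows "(\<forall>(W1 :: ('g::euclidean_space, 4) omanifold) (W2 :: ('h::euclidean_space, 4) omanifold).
            connected_sum X1 Z1 W1 \<longrightarrow> connected_sum X2 Z2 W2 \<longrightarrow>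
            (alg_equiv W1 W2 \<longleftrightarrow> alg_equiv X1 X2)) \<and>
         (bdry X1 \<noteq> {} \<longrightarrow> bdry X2 \<noteq> {} \<longrightarrow> bdry Z1 \<noteq> {} \<longrightarrow> bdry Z2 \<noteq> {} \<longrightarrow>
          (\<forall>(W1 :: ('g, 4) omanifold) (W2 :: ('h, 4) omanifold).
            boundary_sum X1 Z1 W1 \<longrightarrow> boundary_sum X2 Z2 W2 \<longrightarrow>
            (alg_equiv W1 W2 \<longleftrightarrow> alg_equiv X1 X2)))"
proof -
  have or: "oriented_manifold X1" "oriented_manifold X2" "oriented_manifold Z1" "oriented_manifold Z2"
    using assms(1-4) by (simp_all add: four_manifold_def)
  have 1: "alg_equiv X1 W" if "disc_sum H X1 Z1 W" "H = UNIV \<or> H = half_space"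
    for H and W :: "('g, 4) omanifold"
    by (rule alg_equiv_disc_sum[OF that(2) or(1,3) assms(5,7,9,11) that(1)])
  have 2: "alg_equiv X2 W" if "disc_sum H X2 Z2 W" "H = UNIV \<or> H = half_space"
    for H and W :: "('h, 4) omanifold"
    by (rule alg_equiv_disc_sum[OF that(2) or(2,4) assms(6,8,10,12) that(1)])
  \<comment> \<open>Both implications are compositions of equivalences, so symmetry and transitivity
    of \<open>alg_equiv\<close> reduce the comparison of sums to that of summands.\<close>
  have eq: "alg_equiv W1 W2 \<longleftrightarrow> alg_equiv X1 X2" if "alg_equiv X1 W1" "alg_equiv X2 W2"
    for W1 :: "('g, 4) omanifold" and W2 :: "('h, 4) omanifold"
  proof
    assume "alg_equiv W1 W2"
    then show "alg_equiv X1 X2" by (rule alg_equiv_trans[OF that(1) alg_equiv_trans[OF _ alg_equiv_sym[OF that(2)]]])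
  next
    assume "alg_equiv X1 X2"
    then show "alg_equiv W1 W2" by (rule alg_equiv_trans[OF alg_equiv_sym[OF that(1)] alg_equiv_trans[OF _ that(2)]])
  qed
  show ?thesis unfolding connected_sum_def boundary_sum_def by (intro conjI allI impI eq 1 2) (assumption | simp)+
qed

end
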